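(* Let $\{X_t\}$ be a stationary AR(1) process $X_t=\theta_0X_{t-1}+Z_t$ with $|\theta_0|<1$, where the $Z_t$ are i.i.d. with median $0$, variance $\sigma^2$ and $EZ_t^4<\infty$, and let $f$ denote the probability density function of $Z_t$. Let $\{w_{nt}:1\le t\le n,\ n\ge 1\}$ be a triangular array of row-exchangeable random variables (the bootstrap weights), independent of $\{X_t\}$, and put $\sigma_n^2=\mathrm{Var}(w_{n1})$ and $W_{nt}=\sigma_n^{-1}(w_{nt}-1)$. Suppose the weights satisfy: (A1) $E(w_{n1})=1$; (A2) $0<k<\sigma_n^2=o(n)$ for some constant $k$; (A3) $\mathrm{Cov}(w_{n1},w_{n2})=O(n^{-1})$; (A4) $E(W_{nj})=0$ and $E(W_{nj}^2)=1$ for all $1\le j\le n$, $n\ge1$; $\frac1n\sum_{j=1}^n W_{nj}^2\to 1$ in probability; and $\lim_{K\to\infty}\limsup_{n\to\infty}\sqrt{E\big(W_{nj}^2 I_{\{|W_{nj}|>K\}}\big)}=0$. Assume also that $n^{-1/2}\sigma_n\max_{t}|X_t|\to 0$ in probability. Let $\hat\theta_2$ be the minimizer over $\theta$ of $\frac1n\sum_{t=2}^n|X_t-\theta X_{t-1}|$ (the least absolute deviations estimator of $\theta_0$) and let $\hat\theta_2^*$, the weighted bootstrap estimator of $\hat\theta_2$, be the minimizer over $\theta$ of $\sum_{t=2}^n w_{nt}|X_t-\theta X_{t-1}|$. Then $$\sup_{x\in\mathbb{R}}\Big|P\big[\sqrt n\,\sigma_n^{-1}(\hat\theta_2^*-\hat\theta_2)\le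 x\,\big|\,X_1,\dots,X_n\big]-P[Y\le x]\Big|=o_P(1),$$ where $Y\sim N\Big(0,\frac{1}{4f^2(0)\,EX_t^2}\Big)$.
   Context: $o_P(1)$ denotes a sequence converging to $0$ in probability as $n\to\infty$. A triangular array is row exchangeable if for each $n$ the vector $(w_{n1},\dots,w_{nn})$ has an exchangeable joint distribution. The model is parametrized so that the median of $Z_t$, instead of its mean, equals $0$, the variance $\sigma^2$ being unchanged.
   Formalization: It is additionally assumed that f(0)>0 and that the distribution function of Z_t is differentiable at 0 with derivative f(0) (as holds if f is continuous at 0); a density is fixed only almost everywhere, so f(0) and the limit variance are otherwise not well defined. *)

theory Defs
  imports "HOL-Probability.Probability" "HOL-Combinatorics.Permutations"
    "HOL-Library.Landau_Symbols"
begin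

definition conv_in_prob :: "'a measure \<Rightarrow> (nat \<Rightarrow> 'a \<Rightarrow> real) \<Rightarrow> real \<Rightarrow> bool" where
  "conv_in_prob M Y c \<longleftrightarrow>
     (\<forall>e>0. (\<lambda>n. measure M {\<omega> \<in> space M. \<bar>Y n \<omega> - c\<bar> > e}) \<longlonglongrightarrow> 0)"

definition is_median :: "'a measure \<Rightarrow> ('a \<Rightarrow> real) \<Rightarrow> real \<Rightarrow> bool" where
  "is_median M Y m \<longleftrightarrow>
     measure M {\<omega> \<in> space M. Y \<omega> \<le> m} \<ge> 1 / 2 \<and> measure M {\<omega> \<in> space M. Y \<omega> \<ge> m} \<ge> 1 / 2"

definition covariance :: "'a measure \<Rightarrow> ('a \<Rightarrow> real) \<Rightarrow> ('a \<Rightarrow> real) \<Rightarrow> real" where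
  "covariance M Y V =
     integral\<^sup>L M (\<lambda>\<omega>. (Y \<omega> - integral\<^sup>L M Y) * (V \<omega> - integral\<^sup>L M V))"

definition iid :: "'a measure \<Rightarrow> ('i \<Rightarrow> 'a \<Rightarrow> real) \<Rightarrow> bool" where
  "iid M Z \<longleftrightarrow> prob_space.indep_vars M (\<lambda>_. borel) Z UNIV \<and>
     (\<forall>s t. distr M borel (Z s) = distr M borel (Z t))"

definition strictly_stationary :: "'a measure \<Rightarrow> (int \<Rightarrow> 'a \<Rightarrow> real) \<Rightarrow> bool" where
  "strictly_stationary M X \<longleftrightarrow>
     (\<forall>J h. finite J \<longrightarrow>
        distr M (Pi\<^sub>M J (\<lambda>_. borel)) (\<lambda>\<omega>. \<lambda>t\<in>J. X (t + h) \<omega>) =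
        distr M (Pi\<^sub>M J (\<lambda>_. borel)) (\<lambda>\<omega>. \<lambda>t\<in>J. X t \<omega>))"

text \<open>In a triangular array \<open>w n t\<close> only the entries with \<open>1 \<le> t \<le> n\<close> are meaningful.\<close>

definition triangle :: "(nat \<times> nat) set" where
  "triangle = {(n, t). 1 \<le> t \<and> t \<le> n}"

definition row_exchangeable :: "'a measure \<Rightarrow> (nat \<Rightarrow> nat \<Rightarrow> 'a \<Rightarrow> real) \<Rightarrow> bool" where
  "row_exchangeable M w \<longleftrightarrow>
     (\<forall>n p. p permutes {1..n} \<longrightarrow>
        distr M (Pi\<^sub>M {1..n} (\<lambda>_. borel)) (\<lambda>\<omega>. \<lambda>t\<in>{1..n}. w n (p t) \<omega>) =
        distr M (Pi\<^sub>M {1..n} (\<lambda>_. borel)) (\<lambda>\<omega>. \<lambda>t\<in>{1..n}. w n t \<omega>))"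

definition array_indep_of_process ::
    "'a measure \<Rightarrow> (nat \<Rightarrow> nat \<Rightarrow> 'a \<Rightarrow> real) \<Rightarrow> (int \<Rightarrow> 'a \<Rightarrow> real) \<Rightarrow> bool" where
  "array_indep_of_process M w X \<longleftrightarrow>
     prob_space.indep_set M
       (sets (vimage_algebra (space M) (\<lambda>\<omega>. \<lambda>(n, t)\<in>triangle. w n t \<omega>)
          (Pi\<^sub>M triangle (\<lambda>_. borel))))
       (sets (vimage_algebra (space M) (\<lambda>\<omega> t. X t \<omega>) (Pi\<^sub>M UNIV (\<lambda>_. borel))))"

definition weight_sd :: "'a measure \<Rightarrow> (nat \<Rightarrow> nat \<Rightarrow> 'a \<Rightarrow> real) \<Rightarrow> nat \<Rightarrow> real" where
  "weight_sd M w n = sqrt (prob_space.variance M (w n 1))"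

text \<open>The centring is by the constant 1, the common mean of the weights.\<close>

definition std_weight ::
    "'a measure \<Rightarrow> (nat \<Rightarrow> nat \<Rightarrow> 'a \<Rightarrow> real) \<Rightarrow> nat \<Rightarrow> nat \<Rightarrow> 'a \<Rightarrow> real" where
  "std_weight M w n t \<omega> = (w n t \<omega> - 1) / weight_sd M w n"

text \<open>The \<open>\<sigma>\<close>-algebra generated by \<open>X\<^sub>1, \<dots>, X\<^sub>n\<close>.\<close>

definition obs_algebra :: "'a measure \<Rightarrow> (int \<Rightarrow> 'a \<Rightarrow> real) \<Rightarrow> nat \<Rightarrow> 'a measure" where
  "obs_algebra M X n =
     vimage_algebra (space M) (\<lambda>\<omega>. \<lambda>t\<in>{1..int n}. X t \<omega>) (Pi\<^sub>M {1..int n} (\<lambda>_. borel))"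

text \<open>
  A conditional probability \<open>P[T \<le> x | F]\<close> is determined only almost surely, separately for each
  \<open>x\<close>, so a supremum over all real \<open>x\<close> needs versions that are chosen jointly. They are taken from
  a regular conditional distribution of \<open>T\<close> given \<open>F\<close>, i.e. a Markov kernel \<open>\<kappa>\<close> for which
  \<open>\<kappa> \<omega> B\<close> is a version of \<open>P[T \<in> B | F]\<close> for every Borel set \<open>B\<close>. For a real random variable
  such a kernel always exists and is almost surely unique.
\<close>

definition regular_cond_distr ::
    "'a measure \<Rightarrow> 'a measure \<Rightarrow> ('a \<Rightarrow> real) \<Rightarrow> ('a \<Rightarrow> real measure) \<Rightarrow> bool" where
  "regular_cond_distr M F T \<kappa> \<longleftrightarrow>
     \<kappa> \<in> measurable F (prob_algebra borel) \<and>
     (\<forall>B\<in>sets borel. AE \<omega> in M.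
        measure (\<kappa> \<omega>) B = real_cond_exp M F (indicator (T -` B \<inter> space M)) \<omega>)"

end

theory Submission
  imports Defs
begin

text \<open>
  Write \<open>\<bar>z - y\<bar> - \<bar>z\<bar> = - y sgn z + r(z, y)\<close> with \<open>r \<ge> 0\<close>. Centred at \<open>\<theta>\<^sub>0\<close>, both objectives are a
  linear score plus a remainder sum, which at the scale \<open>\<delta> = u \<sigma>\<^sub>n n\<^sup>-\<^sup>1\<^sup>/\<^sup>2\<close> is
  approximately \<open>f(0) E X\<^sub>0\<^sup>2 n \<delta>\<^sup>2\<close>: martingale differences around the conditional means plus a law of
  large numbers for \<open>X\<^sub>t\<^sup>2\<close>. The part of the remainder that carries the weights \<open>W\<^sub>n\<^sub>t\<close> is
  negligible uniformly in \<open>u\<close>. So both minimizers are linear statistics up to \<open>o\<^sub>P\<close>, and their difference is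
  \<open>n\<^sup>-\<^sup>1\<^sup>/\<^sup>2 \<Sum>\<^sub>t W\<^sub>n\<^sub>t X\<^sub>t\<^sub>-\<^sub>1 sgn Z\<^sub>t / (2 f(0) E X\<^sub>0\<^sup>2)\<close>.

  Given the data this is a linear form in exchangeable weights. Swapping two of the weights shows that the
  characteristic function \<open>\<phi>\<close> of such a form nearly solves \<open>\<phi>'(t) = - v t \<phi>(t)\<close>, where \<open>v\<close>
  is the sum of the squared coefficients, so it is nearly Gaussian. Levy's continuity theorem gives
  convergence of the conditional distribution functions at every point, and monotonicity makes it uniform.
\<close>

section \<open>Moment inequalities\<close>

text \<open>The weights may be negative, so the bootstrap objective need not be convex, and
  pointwise convergence of objectives would not locate their minimizers. Two bounds on the weighted
  remainder take the place of convexity: one linear in the shift for all shifts, which the convex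
  unweighted remainder beats outside a large multiple of the scale, and a smaller one inside. The
  unweighted estimator is expanded at the coarser scale \<open>\<sigma>_n n^(-1/2)\<close> as well.
  Only its error relative to this scale matters in the difference, and one expansion for weights
  \<open>1 + b W\<close> then serves both estimators, with \<open>b = 0\<close> and
  \<open>b = \<sigma>_n\<close>. The weights are dependent and only second moments of them are
  controlled. Hence the truncation at a level \<open>K\<close> in the Gaussian approximation and the
  error bounds in L1. Given the data, the coefficients of the linear form are random; the limit
  theorem is therefore made uniform over coefficient vectors and applied on an event of high
  probability, where the coefficients are small, have a bounded sum and a sum of squares near the
  limiting variance.\<close>

lemma (in prob_space) integrable_mult_of_squares:
  fixes f g :: "'a \<Rightarrow> real"
  assumes [measurable]: "f \<in> borel_measurable M" "g \<in> borel_measurable M"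
    and "integrable M (\<lambda>x. (f x)\<^sup>2)" "integrable M (\<lambda>x. (g x)\<^sup>2)"
  shows "integrable M (\<lambda>x. f x * g x)"
proof (rule Bochner_Integration.integrable_bound)
  show "integrable M (\<lambda>x. (f x)\<^sup>2 + (g x)\<^sup>2)"
    using assms by simp
  show "AE x in M. norm (f x * g x) \<le> norm ((f x)\<^sup>2 + (g x)\<^sup>2)"
  proof (rule AE_I2)
    fix x
    have "2 * \<bar>f x * g x\<bar> \<le> (f x)\<^sup>2 + (g x)\<^sup>2"
      using sum_squares_bound[of "\<bar>f x\<bar>" "\<bar>g x\<bar>"] by (simp add: abs_mult)
    then show "norm (f x * g x) \<le> norm ((f x)\<^sup>2 + (g x)\<^sup>2)"
      by simp
  qed
qed measurable

lemma (in prob_space) integrable_of_square: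
  fixes f :: "'a \<Rightarrow> real"
  assumes "f \<in> borel_measurable M" "integrable M (\<lambda>x. (f x)\<^sup>2)"
  shows "integrable M f"
  using square_integrable_imp_integrable[OF assms] .

lemma (in prob_space) integrable_add_square:
  fixes f g :: "'a \<Rightarrow> real"
  assumes [measurable]: "f \<in> borel_measurable M" "g \<in> borel_measurable M"
    and "integrable M (\<lambda>x. (f x)\<^sup>2)" "integrable M (\<lambda>x. (g x)\<^sup>2)"
  shows "integrable M (\<lambda>x. (f x + g x)\<^sup>2)"
  using assms integrable_mult_of_squares[OF assms] by (simp add: power2_sum mult.assoc)

lemma (in prob_space) integrable_sum_square:
  fixes f :: "'i \<Rightarrow> 'a \<Rightarrow> real"
  assumes "finite I" "\<And>i. i \<in> I \<Longrightarrow> f i \<in> borel_measurable M"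
    and "\<And>i. i \<in> I \<Longrightarrow> integrable M (\<lambda>x. (f i x)\<^sup>2)"
  shows "integrable M (\<lambda>x. (\<Sum>i\<in>I. f i x)\<^sup>2)"
  using assms
proof (induction rule: finite_induct)
  case (insert i I)
  then show ?case
    using integrable_add_square[of "f i" "\<lambda>x. \<Sum>i\<in>I. f i x"] by simp
qed simp

lemma (in prob_space) expectation_abs_le_sqrt:
  fixes f :: "'a \<Rightarrow> real"
  assumes [measurable]: "f \<in> borel_measurable M" and sq: "integrable M (\<lambda>x. (f x)\<^sup>2)"
  shows "expectation (\<lambda>x. \<bar>f x\<bar>) \<le> sqrt (expectation (\<lambda>x. (f x)\<^sup>2))"
proof (rule real_le_rsqrt)
  have "integrable M f"
    using assms by (rule integrable_of_square)
  then have "0 \<le> variance (\<lambda>x. \<bar>f x\<bar>)" "integrable M (\<lambda>x. \<bar>f x\<bar>)"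
    by auto
  then show "(expectation (\<lambda>x. \<bar>f x\<bar>))\<^sup>2 \<le> expectation (\<lambda>x. (f x)\<^sup>2)"
    using sq by (subst (asm) variance_eq) auto
qed

lemma (in prob_space) expectation_abs_mult_le:
  fixes f g :: "'a \<Rightarrow> real"
  assumes [measurable]: "f \<in> borel_measurable M" "g \<in> borel_measurable M"
    and f: "integrable M (\<lambda>x. (f x)\<^sup>2)" and g: "integrable M (\<lambda>x. (g x)\<^sup>2)"
  shows "expectation (\<lambda>x. \<bar>f x * g x\<bar>) \<le>
    sqrt (expectation (\<lambda>x. (f x)\<^sup>2)) * sqrt (expectation (\<lambda>x. (g x)\<^sup>2))"
proof -
  define a b where "a = expectation (\<lambda>x. (f x)\<^sup>2)" and "b = expectation (\<lambda>x. (g x)\<^sup>2)"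
  define e where "e = expectation (\<lambda>x. \<bar>f x * g x\<bar>)"
  have ab: "a \<ge> 0" "b \<ge> 0" "e \<ge> 0"
    by (simp_all add: a_def b_def e_def)
  have "integrable M (\<lambda>x. \<bar>f x * g x\<bar>)"
    using integrable_mult_of_squares[OF assms] by simp
  \<comment> \<open>This is the expectation of \<open>(s |f| - |g|)^2 \<ge> 0\<close>.
    Cauchy-Schwarz is its discriminant condition; \<open>s \<ge> 0\<close> is enough because
    \<open>e \<ge> 0\<close>.\<close>
  then have le: "2 * s * e \<le> s\<^sup>2 * a + b" if "s \<ge> 0" for s
  proof -
    have "expectation (\<lambda>x. 2 * s * \<bar>f x * g x\<bar>) \<le> expectation (\<lambda>x. s\<^sup>2 * (f x)\<^sup>2 + (g x)\<^sup>2)"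
    proof (rule integral_mono)
      fix x
      show "2 * s * \<bar>f x * g x\<bar> \<le> s\<^sup>2 * (f x)\<^sup>2 + (g x)\<^sup>2"
        using sum_squares_bound[of "s * \<bar>f x\<bar>" "\<bar>g x\<bar>"] that
        by (simp add: abs_mult power_mult_distrib algebra_simps)
    qed (use f g \<open>integrable M (\<lambda>x. \<bar>f x * g x\<bar>)\<close> in auto)
    then show ?thesis
      using f g by (simp add: a_def b_def e_def)
  qed
  have "e\<^sup>2 \<le> a * b"
  proof (cases "a = 0")
    case True
    have "e = 0"
    proof (rule ccontr)
      assume "e \<noteq> 0"
      \<comment> \<open>For \<open>a = 0\<close> the inequality is linear in \<open>s\<close>, and
        \<open>s = (b + 1) / e\<close> turns it into \<open>2 * (b + 1) \<le> b\<close>.\<close>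
      then have "2 * ((b + 1) / e) * e = 2 * (b + 1)"
        by simp
      then show False
        using le[of "(b + 1) / e"] True ab by simp
    qed
    then show ?thesis
      using ab by simp
  next
    case False
    then have "a > 0"
      using ab by simp
    \<comment> \<open>The choice \<open>s = e / a\<close> is the vertex of the quadratic.\<close>
    then have "2 * (e / a) * e \<le> (e / a)\<^sup>2 * a + b"
      using ab by (intro le) simp
    then have "(2 * (e / a) * e) * a \<le> ((e / a)\<^sup>2 * a + b) * a"
      using \<open>a > 0\<close> by (intro mult_right_mono) auto
    then have "2 * e\<^sup>2 \<le> e\<^sup>2 + a * b"
      using \<open>a > 0\<close> by (simp add: field_simps power2_eq_square)
    then show ?thesis
      by simp
  qed
  then have "e \<le> sqrt (a * b)"
    by (rule real_le_rsqrt)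
  then show ?thesis
    by (simp add: real_sqrt_mult a_def b_def e_def)
qed

lemma norm_integral_le_integral:
  fixes f :: "'a \<Rightarrow> 'b::{banach, second_countable_topology}"
  assumes "integrable M f" "integrable M g" "\<And>x. norm (f x) \<le> g x"
  shows "norm (integral\<^sup>L M f) \<le> integral\<^sup>L M g"
  using assms by (intro order.trans[OF integral_norm_bound integral_mono]) auto

lemma
  fixes f :: "'i \<Rightarrow> 'j \<Rightarrow> 'a \<Rightarrow> 'b::{banach, second_countable_topology}"
  assumes "\<And>i j. i \<in> I \<Longrightarrow> j \<in> J \<Longrightarrow> integrable M (f i j)"
  shows integrable_double_sum: "integrable M (\<lambda>x. \<Sum>i\<in>I. \<Sum>j\<in>J. f i j x)"
    and integral_double_sum: "(LINT x|M. (\<Sum>i\<in>I. \<Sum>j\<in>J. f i j x)) = (\<Sum>i\<in>I. \<Sum>j\<in>J. integral\<^sup>L M (f i j))"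
proof -
  have 1: "integrable M (\<lambda>x. \<Sum>j\<in>J. f i j x)" if "i \<in> I" for i
    using assms that by (intro Bochner_Integration.integrable_sum)
  then show "integrable M (\<lambda>x. \<Sum>i\<in>I. \<Sum>j\<in>J. f i j x)"
    by (rule Bochner_Integration.integrable_sum)
  have "(LINT x|M. (\<Sum>i\<in>I. \<Sum>j\<in>J. f i j x)) = (\<Sum>i\<in>I. LINT x|M. (\<Sum>j\<in>J. f i j x))"
    using 1 by (rule Bochner_Integration.integral_sum)
  also have "\<dots> = (\<Sum>i\<in>I. \<Sum>j\<in>J. integral\<^sup>L M (f i j))"
    by (rule sum.cong[OF refl], rule Bochner_Integration.integral_sum) (rule assms)
  finally show "(LINT x|M. (\<Sum>i\<in>I. \<Sum>j\<in>J. f i j x)) = (\<Sum>i\<in>I. \<Sum>j\<in>J. integral\<^sup>L M (f i j))" .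
qed

lemma (in prob_space) prob_abs_ge_le:
  fixes f :: "'a \<Rightarrow> real"
  assumes "integrable M f" "c > 0"
  shows "prob {x \<in> space M. \<bar>f x\<bar> \<ge> c} \<le> expectation (\<lambda>x. \<bar>f x\<bar>) / c"
proof -
  have [measurable]: "f \<in> borel_measurable M"
    using assms by auto
  show ?thesis
    using assms by (intro integral_Markov_inequality_measure[where A = "space M"]) auto
qed

section \<open>Independence\<close>

text \<open>Unlike \<open>indep_var\<close>, this notion allows values in two different types.\<close>

definition (in prob_space) indep_pair ::
    "'b measure \<Rightarrow> ('a \<Rightarrow> 'b) \<Rightarrow> 'c measure \<Rightarrow> ('a \<Rightarrow> 'c) \<Rightarrow> bool" where
  "indep_pair S A T B \<longleftrightarrow> A \<in> M \<rightarrow>\<^sub>M S \<and> B \<in> M \<rightarrow>\<^sub>M T \<and>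
    (\<forall>U\<in>sets S. \<forall>V\<in>sets T. prob {\<omega> \<in> space M. A \<omega> \<in> U \<and> B \<omega> \<in> V} =
      prob {\<omega> \<in> space M. A \<omega> \<in> U} * prob {\<omega> \<in> space M. B \<omega> \<in> V})"

lemma (in prob_space) indep_var_imp_indep_pair:
  assumes "indep_var S A T B"
  shows "indep_pair S A T B"
  unfolding indep_pair_def
proof (intro conjI ballI)
  fix U V
  assume "U \<in> sets S" "V \<in> sets T"
  from indep_varD[OF assms this] show "prob {\<omega> \<in> space M. A \<omega> \<in> U \<and> B \<omega> \<in> V} =
      prob {\<omega> \<in> space M. A \<omega> \<in> U} * prob {\<omega> \<in> space M. B \<omega> \<in> V}"
    by (simp add: vimage_def Int_def conj_commute)
qed (use assms in \<open>auto dest: indep_var_rv1 indep_var_rv2\<close>)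

lemma (in prob_space) indep_pair_compose:
  assumes "indep_pair S A T B" "f \<in> S \<rightarrow>\<^sub>M S'" "g \<in> T \<rightarrow>\<^sub>M T'"
  shows "indep_pair S' (\<lambda>\<omega>. f (A \<omega>)) T' (\<lambda>\<omega>. g (B \<omega>))"
  unfolding indep_pair_def
proof (intro conjI ballI)
  have [measurable]: "A \<in> M \<rightarrow>\<^sub>M S" "B \<in> M \<rightarrow>\<^sub>M T"
    using assms by (auto simp: indep_pair_def)
  fix U V
  assume "U \<in> sets S'" "V \<in> sets T'"
  then have "f -` U \<inter> space S \<in> sets S" "g -` V \<inter> space T \<in> sets T"
    using assms by (auto intro: measurable_sets)
  then have "prob {\<omega> \<in> space M. A \<omega> \<in> f -` U \<inter> space S \<and> B \<omega> \<in> g -` V \<inter> space T} =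
      prob {\<omega> \<in> space M. A \<omega> \<in> f -` U \<inter> space S} * prob {\<omega> \<in> space M. B \<omega> \<in> g -` V \<inter> space T}"
    using assms(1) unfolding indep_pair_def by blast
  moreover have "A \<omega> \<in> space S" "B \<omega> \<in> space T" if "\<omega> \<in> space M" for \<omega>
    using that by (auto intro: measurable_space)
  ultimately show "prob {\<omega> \<in> space M. f (A \<omega>) \<in> U \<and> g (B \<omega>) \<in> V} =
      prob {\<omega> \<in> space M. f (A \<omega>) \<in> U} * prob {\<omega> \<in> space M. g (B \<omega>) \<in> V}"
    by (simp cong: conj_cong)
qed (use assms in \<open>auto simp: indep_pair_def intro: measurable_compose\<close>)

text \<open>Past values of the process agree with functions of past innovations only almost surely,
  so independence has to survive a change on a null set.\<close>

lemma (in prob_space) indep_pair_cong_AE: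
  assumes indep: "indep_pair S A T B" and AE: "AE \<omega> in M. A \<omega> = A' \<omega>" "AE \<omega> in M. B \<omega> = B' \<omega>"
    and [measurable]: "A' \<in> M \<rightarrow>\<^sub>M S" "B' \<in> M \<rightarrow>\<^sub>M T"
  shows "indep_pair S A' T B'"
  unfolding indep_pair_def
proof (intro conjI ballI)
  have [measurable]: "A \<in> M \<rightarrow>\<^sub>M S" "B \<in> M \<rightarrow>\<^sub>M T"
    using indep by (auto simp: indep_pair_def)
  fix U V
  assume [measurable]: "U \<in> sets S" "V \<in> sets T"
  have "prob {\<omega> \<in> space M. A' \<omega> \<in> U \<and> B' \<omega> \<in> V} = prob {\<omega> \<in> space M. A \<omega> \<in> U \<and> B \<omega> \<in> V}"
    using AE by (intro measure_eq_AE) auto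
  moreover have "prob {\<omega> \<in> space M. A' \<omega> \<in> U} = prob {\<omega> \<in> space M. A \<omega> \<in> U}"
    using AE by (intro measure_eq_AE) auto
  moreover have "prob {\<omega> \<in> space M. B' \<omega> \<in> V} = prob {\<omega> \<in> space M. B \<omega> \<in> V}"
    using AE by (intro measure_eq_AE) auto
  ultimately show "prob {\<omega> \<in> space M. A' \<omega> \<in> U \<and> B' \<omega> \<in> V} =
      prob {\<omega> \<in> space M. A' \<omega> \<in> U} * prob {\<omega> \<in> space M. B' \<omega> \<in> V}"
    using indep by (simp add: indep_pair_def)
qed auto

lemma (in prob_space) distr_indep_pair:
  assumes indep: "indep_pair S A T B"
  shows "distr M S A \<Otimes>\<^sub>M distr M T B = distr M (S \<Otimes>\<^sub>M T) (\<lambda>x. (A x, B x))"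
proof -
  have [measurable]: "A \<in> M \<rightarrow>\<^sub>M S" "B \<in> M \<rightarrow>\<^sub>M T"
    using indep by (auto simp: indep_pair_def)
  interpret A: prob_space "distr M S A"
    by (rule prob_space_distr) simp
  interpret B: prob_space "distr M T B"
    by (rule prob_space_distr) simp
  show ?thesis
  proof (rule pair_measure_eqI)
    fix U V
    assume "U \<in> sets (distr M S A)" "V \<in> sets (distr M T B)"
    then have UV [measurable]: "U \<in> sets S" "V \<in> sets T"
      by auto
    have "emeasure (distr M S A) U = prob {\<omega> \<in> space M. A \<omega> \<in> U}"
      by (simp add: emeasure_distr emeasure_eq_measure vimage_def Int_def conj_commute)
    moreover have "emeasure (distr M T B) V = prob {\<omega> \<in> space M. B \<omega> \<in> V}"
      by (simp add: emeasure_distr emeasure_eq_measure vimage_def Int_def conj_commute)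
    moreover have "emeasure (distr M (S \<Otimes>\<^sub>M T) (\<lambda>x. (A x, B x))) (U \<times> V) = prob {\<omega> \<in> space M. A \<omega> \<in> U \<and> B \<omega> \<in> V}"
      by (simp add: emeasure_distr emeasure_eq_measure vimage_def Int_def conj_ac)
    ultimately show "emeasure (distr M S A) U * emeasure (distr M T B) V =
        emeasure (distr M (S \<Otimes>\<^sub>M T) (\<lambda>x. (A x, B x))) (U \<times> V)"
      using indep UV by (simp add: indep_pair_def ennreal_mult)
  qed (simp_all add: A.sigma_finite_measure_axioms B.sigma_finite_measure_axioms cong: sets_pair_measure_cong)
qed

text \<open>Tonelli for the joint law. In this form it applies to second moments of weighted sums
  whose integrability is itself a consequence of the resulting bound.\<close>

lemma (in prob_space) nn_integral_indep_pair:
  assumes indep: "indep_pair S A T B" and [measurable]: "g \<in> borel_measurable (S \<Otimes>\<^sub>M T)"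
  shows "(\<integral>\<^sup>+\<omega>. g (A \<omega>, B \<omega>) \<partial>M) = (\<integral>\<^sup>+\<omega>. \<integral>\<^sup>+\<omega>'. g (A \<omega>, B \<omega>') \<partial>M \<partial>M)"
proof -
  have [measurable]: "A \<in> M \<rightarrow>\<^sub>M S" "B \<in> M \<rightarrow>\<^sub>M T"
    using indep by (auto simp: indep_pair_def)
  note sigma_finite = sigma_finite_measure_axioms
  interpret B: prob_space "distr M T B"
    by (rule prob_space_distr) simp
  have meas: "(\<lambda>a. \<integral>\<^sup>+\<omega>'. g (a, B \<omega>') \<partial>M) \<in> borel_measurable S"
    using sigma_finite_measure.borel_measurable_nn_integral[OF sigma_finite, where f = "\<lambda>a \<omega>'. g (a, B \<omega>')" and N = S]
    by simp
  have "(\<integral>\<^sup>+\<omega>. g (A \<omega>, B \<omega>) \<partial>M) = integral\<^sup>N (distr M S A \<Otimes>\<^sub>M distr M T B) g"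
    unfolding distr_indep_pair[OF indep] by (subst nn_integral_distr) auto
  also have "\<dots> = (\<integral>\<^sup>+a. \<integral>\<^sup>+b. g (a, b) \<partial>distr M T B \<partial>distr M S A)"
    by (rule B.nn_integral_fst[symmetric]) measurable
  also have "\<dots> = (\<integral>\<^sup>+a. \<integral>\<^sup>+\<omega>'. g (a, B \<omega>') \<partial>M \<partial>distr M S A)"
    by (intro nn_integral_cong nn_integral_distr) (auto simp: measurable_Pair2)
  also have "\<dots> = (\<integral>\<^sup>+\<omega>. \<integral>\<^sup>+\<omega>'. g (A \<omega>, B \<omega>') \<partial>M \<partial>M)"
    by (rule nn_integral_distr) (use meas in auto)
  finally show ?thesis .
qed

text \<open>Markov's inequality with values in \<open>ennreal\<close>: the kernel masses to which it
  is applied are integrals that might be infinite at some sample points.\<close>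

lemma (in prob_space) prob_gt_le_nn_integral:
  assumes [measurable]: "g \<in> borel_measurable M" and le: "(\<integral>\<^sup>+\<omega>. g \<omega> \<partial>M) \<le> ennreal K" and "K \<ge> 0" "a > 0"
  shows "prob {\<omega> \<in> space M. g \<omega> > ennreal a} \<le> K / a"
proof -
  have "ennreal a * emeasure M {\<omega> \<in> space M. g \<omega> > ennreal a} =
      (\<integral>\<^sup>+\<omega>. ennreal a * indicator {\<omega> \<in> space M. g \<omega> > ennreal a} \<omega> \<partial>M)"
    by (simp add: nn_integral_cmult_indicator)
  also have "\<dots> \<le> (\<integral>\<^sup>+\<omega>. g \<omega> \<partial>M)"
    by (intro nn_integral_mono) (auto simp: indicator_def)
  also have "\<dots> \<le> ennreal K"
    by (rule le)
  finally have "ennreal (a * prob {\<omega> \<in> space M. g \<omega> > ennreal a}) \<le> ennreal K"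
    using \<open>a > 0\<close> by (simp add: emeasure_eq_measure ennreal_mult)
  then show ?thesis
    using assms by (simp add: le_divide_eq mult.commute)
qed

lemma (in prob_space) nn_integral_abs_le_sqrt:
  fixes h :: "'a \<Rightarrow> real"
  assumes [measurable]: "h \<in> borel_measurable M" and le: "(\<integral>\<^sup>+\<omega>. ennreal ((h \<omega>)\<^sup>2) \<partial>M) \<le> ennreal B" and "B \<ge> 0"
  shows "integrable M (\<lambda>\<omega>. (h \<omega>)\<^sup>2)" "expectation (\<lambda>\<omega>. \<bar>h \<omega>\<bar>) \<le> sqrt B"
    "(\<integral>\<^sup>+\<omega>. ennreal \<bar>h \<omega>\<bar> \<partial>M) \<le> ennreal (sqrt B)"
proof -
  show sq: "integrable M (\<lambda>\<omega>. (h \<omega>)\<^sup>2)"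
    using le by (intro integrableI_bounded) (auto simp: le_less_trans)
  have "ennreal (expectation (\<lambda>\<omega>. (h \<omega>)\<^sup>2)) \<le> ennreal B"
    using le sq by (subst (asm) nn_integral_eq_integral) auto
  then have "expectation (\<lambda>\<omega>. (h \<omega>)\<^sup>2) \<le> B"
    using \<open>B \<ge> 0\<close> by simp
  then show abs: "expectation (\<lambda>\<omega>. \<bar>h \<omega>\<bar>) \<le> sqrt B"
    by (intro order.trans[OF expectation_abs_le_sqrt[OF _ sq]]) auto
  have "integrable M h"
    by (rule integrable_of_square[OF _ sq]) simp
  then have "(\<integral>\<^sup>+\<omega>. ennreal \<bar>h \<omega>\<bar> \<partial>M) = ennreal (expectation (\<lambda>\<omega>. \<bar>h \<omega>\<bar>))"
    by (intro nn_integral_eq_integral) auto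
  then show "(\<integral>\<^sup>+\<omega>. ennreal \<bar>h \<omega>\<bar> \<partial>M) \<le> ennreal (sqrt B)"
    using abs by (simp add: ennreal_leI)
qed

text \<open>Fubini for the joint law; the inner expectation freezes \<open>A\<close>. This is how
  conditioning enters, both for martingale differences and for the conditional distribution function
  given the data.\<close>

lemma (in prob_space) expectation_indep_pair:
  fixes g :: "'b \<times> 'c \<Rightarrow> real"
  assumes indep: "indep_pair S A T B" and [measurable]: "g \<in> borel_measurable (S \<Otimes>\<^sub>M T)"
    and int: "integrable M (\<lambda>\<omega>. g (A \<omega>, B \<omega>))"
  shows "expectation (\<lambda>\<omega>. g (A \<omega>, B \<omega>)) = expectation (\<lambda>\<omega>. expectation (\<lambda>\<omega>'. g (A \<omega>, B \<omega>')))"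
proof -
  have A: "A \<in> M \<rightarrow>\<^sub>M S" and B [measurable]: "B \<in> M \<rightarrow>\<^sub>M T"
    using indep by (auto simp: indep_pair_def)
  note [measurable] = A
  note sigma_finite = sigma_finite_measure_axioms
  interpret A: prob_space "distr M S A"
    by (rule prob_space_distr) simp
  interpret B: prob_space "distr M T B"
    by (rule prob_space_distr) simp
  interpret pair_sigma_finite "distr M S A" "distr M T B" ..
  note joint = distr_indep_pair[OF indep]
  have "integrable (distr M S A \<Otimes>\<^sub>M distr M T B) g"
    unfolding joint using int by (subst integrable_distr_eq) auto
  then have "integral\<^sup>L (distr M S A \<Otimes>\<^sub>M distr M T B) g =
      (LINT a|distr M S A. LINT b|distr M T B. g (a, b))"
    by (rule integral_fst'[symmetric])
  also have "\<dots> = (LINT a|distr M S A. expectation (\<lambda>\<omega>'. g (a, B \<omega>')))"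
    by (intro Bochner_Integration.integral_cong refl integral_distr) (auto simp: measurable_Pair2)
  also have "\<dots> = expectation (\<lambda>\<omega>. expectation (\<lambda>\<omega>'. g (A \<omega>, B \<omega>')))"
  proof (rule integral_distr)
    have "(\<lambda>(a, \<omega>'). g (a, B \<omega>')) \<in> borel_measurable (S \<Otimes>\<^sub>M M)"
      by measurable
    then show "(\<lambda>a. expectation (\<lambda>\<omega>'. g (a, B \<omega>'))) \<in> borel_measurable S"
      using sigma_finite_measure.borel_measurable_lebesgue_integral[OF sigma_finite, where f = "\<lambda>a \<omega>'. g (a, B \<omega>')" and N = S]
      by simp
  qed simp
  also have "integral\<^sup>L (distr M S A \<Otimes>\<^sub>M distr M T B) g = expectation (\<lambda>\<omega>. g (A \<omega>, B \<omega>))"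
    unfolding joint by (subst integral_distr) auto
  finally show ?thesis .
qed

section \<open>The remainder of the absolute value\<close>

text \<open>For \<open>z \<noteq> 0\<close> this is the remainder in Knight's identity: twice the
  integral of \<open>1(z \<le> s) - 1(z \<le> 0)\<close> over \<open>s\<close> from 0 to
  \<open>y\<close>.\<close>

definition lad_rem :: "real \<Rightarrow> real \<Rightarrow> real" where
  "lad_rem z y = \<bar>z - y\<bar> - \<bar>z\<bar> + y * sgn z"

lemma lad_rem_measurable [measurable]: "case_prod lad_rem \<in> borel_measurable (borel \<Otimes>\<^sub>M borel)"
  unfolding lad_rem_def by measurable

lemma lad_rem_zero [simp]: "lad_rem z 0 = 0"
  by (simp add: lad_rem_def)

lemma lad_rem_nonneg: "0 \<le> lad_rem z y"
  by (auto simp: lad_rem_def sgn_if)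

text \<open>Nothing happens until the shift \<open>y\<close> reaches \<open>z\<close>. The indicator
  is what later becomes the probability that an innovation falls into a short interval around
  0.\<close>

lemma lad_rem_le: "lad_rem z y \<le> 2 * \<bar>y\<bar> * of_bool (\<bar>z\<bar> \<le> \<bar>y\<bar>)"
  by (auto simp: lad_rem_def sgn_if)

text \<open>Convexity in \<open>y\<close> together with the value 0 at \<open>y = 0\<close>. Summed
  over the sample it makes the unweighted remainder grow at least linearly along rays, which is what
  confines the minimizer.\<close>

lemma lad_rem_scale_le:
  assumes "0 \<le> s" "s \<le> 1"
  shows "lad_rem z (s * y) \<le> s * lad_rem z y"
proof -
  have "\<bar>z - s * y\<bar> = \<bar>(1 - s) * z + s * (z - y)\<bar>"
    by (simp add: algebra_simps)
  also have "\<dots> \<le> (1 - s) * \<bar>z\<bar> + s * \<bar>z - y\<bar>"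
    using assms abs_triangle_ineq[of "(1 - s) * z" "s * (z - y)"] by (simp add: abs_mult)
  finally show ?thesis
    by (simp add: lad_rem_def algebra_simps)
qed

lemma lad_rem_mono:
  assumes "0 \<le> s" "s \<le> 1"
  shows "lad_rem z (s * y) \<le> lad_rem z y"
  using mult_right_mono[OF assms(2) lad_rem_nonneg[of z y]]
  by (intro order.trans[OF lad_rem_scale_le[OF assms]]) simp

text \<open>
  The weights may be negative, so the weighted objective need not be convex and its remainder has
  to be controlled uniformly. The kernel below is chosen such that the quotient of the remainder
  and \<open>\<delta>\<close> is an integral over \<open>s \<le> \<delta>\<close> of an integrand that does not depend on \<open>\<delta>\<close>.
\<close>

definition lad_kernel :: "real \<Rightarrow> real \<Rightarrow> real \<Rightarrow> real" where
  "lad_kernel z x s = \<bar>z\<bar> * of_bool (0 < z * x \<and> \<bar>z\<bar> \<le> s * \<bar>x\<bar>) / s\<^sup>2"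

lemma lad_kernel_measurable [measurable (raw)]:
  assumes "a \<in> borel_measurable N" "b \<in> borel_measurable N" "c \<in> borel_measurable N"
  shows "(\<lambda>x. lad_kernel (a x) (b x) (c x)) \<in> borel_measurable N"
  using assms unfolding lad_kernel_def by measurable

text \<open>An antiderivative of \<open>\<bar>z\<bar> / s\<^sup>2\<close> is
  \<open>- \<bar>z\<bar> / s\<close>, and the integration starts at
  \<open>s = \<bar>z\<bar> / \<bar>x\<bar>\<close>, where \<open>x * s\<close> reaches
  \<open>z\<close>. If \<open>x * \<delta>\<close> vanishes, points away from \<open>z\<close> or
  stops short of it, both sides are 0.\<close>

lemma has_integral_lad_kernel:
  assumes "z \<noteq> 0" "\<delta> > 0"
  shows "has_bochner_integral lborel (\<lambda>s. indicator {..\<delta>} s * lad_kernel z x s)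
    (lad_rem z (x * \<delta>) / (2 * \<delta>))"
proof (cases "0 < z * x \<and> \<bar>z\<bar> \<le> \<delta> * \<bar>x\<bar>")
  case True
  then have "x \<noteq> 0"
    by auto
  define r where "r = \<bar>z\<bar> / \<bar>x\<bar>"
  have r: "r > 0" "r \<le> \<delta>"
    using assms True \<open>x \<noteq> 0\<close> by (simp_all add: r_def divide_le_eq)
  have "has_bochner_integral lborel (\<lambda>s. indicator {r..\<delta>} s *\<^sub>R (\<bar>z\<bar> / s\<^sup>2)) (- \<bar>z\<bar> / \<delta> - (- \<bar>z\<bar> / r))"
  proof (rule has_bochner_integral_FTC_Icc)
    show "continuous_on {r..\<delta>} (\<lambda>s. \<bar>z\<bar> / s\<^sup>2)"
      using r by (intro continuous_intros) auto
    show "((\<lambda>s. - \<bar>z\<bar> / s) has_vector_derivative \<bar>z\<bar> / s\<^sup>2) (at s within {r..\<delta>})"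
      if "r \<le> s" "s \<le> \<delta>" for s
      unfolding has_real_derivative_iff_has_vector_derivative[symmetric] using r that
      by (auto intro!: derivative_eq_intros simp: power2_eq_square)
  qed (use r in auto)
  moreover have "indicator {r..\<delta>} s *\<^sub>R (\<bar>z\<bar> / s\<^sup>2) = indicator {..\<delta>} s * lad_kernel z x s" for s
  proof -
    have "\<bar>z\<bar> \<le> s * \<bar>x\<bar> \<longleftrightarrow> r \<le> s"
      using \<open>x \<noteq> 0\<close> by (simp add: r_def divide_le_eq)
    then show ?thesis
      using True by (auto simp: lad_kernel_def indicator_def)
  qed
  moreover have "- \<bar>z\<bar> / \<delta> - (- \<bar>z\<bar> / r) = lad_rem z (x * \<delta>) / (2 * \<delta>)"
  proof -
    have "lad_rem z (x * \<delta>) = 2 * (\<bar>x\<bar> * \<delta> - \<bar>z\<bar>)"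
    proof (cases "z > 0")
      case True
      then have "x > 0"
        using \<open>0 < z * x \<and> \<bar>z\<bar> \<le> \<delta> * \<bar>x\<bar>\<close> by (simp add: zero_less_mult_iff)
      then show ?thesis
        using True \<open>0 < z * x \<and> \<bar>z\<bar> \<le> \<delta> * \<bar>x\<bar>\<close> by (simp add: lad_rem_def mult.commute)
    next
      case False
      then have "z < 0"
        using assms by simp
      then have "x < 0"
        using True by (simp add: zero_less_mult_iff)
      then show ?thesis
        using \<open>z < 0\<close> True by (simp add: lad_rem_def mult.commute)
    qed
    then have "lad_rem z (x * \<delta>) / (2 * \<delta>) = (\<bar>x\<bar> * \<delta> - \<bar>z\<bar>) / \<delta>"
      by (simp only: mult_divide_mult_cancel_left_if) simp
    then show ?thesis
      using \<open>x \<noteq> 0\<close> assms by (simp add: r_def diff_divide_distrib)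
  qed
  ultimately show ?thesis
    by simp
next
  case False
  have "indicator {..\<delta>} s * lad_kernel z x s = 0" for s
  proof (cases "s \<le> \<delta>")
    case True
    then have "s * \<bar>x\<bar> \<le> \<delta> * \<bar>x\<bar>"
      by (intro mult_right_mono) auto
    then show ?thesis
      using False by (auto simp: lad_kernel_def)
  qed simp
  moreover have "lad_rem z (x * \<delta>) = 0"
  proof -
    consider "x * \<delta> = 0" | "0 < z" "x * \<delta> < 0" | "z < 0" "0 < x * \<delta>" | "\<bar>x * \<delta>\<bar> < \<bar>z\<bar>"
      using False assms by (fastforce simp: zero_less_mult_iff mult_less_0_iff abs_mult mult.commute)
    then show ?thesis
      by cases (use assms in \<open>auto simp: lad_rem_def sgn_if abs_if split: if_splits\<close>)
  qed
  ultimately show ?thesis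
    by (simp only: has_bochner_integral_zero div_0)
qed

text \<open>The absolute value is taken of the whole sum at a fixed \<open>s\<close>, so that
  cancellation between the weights is kept. The set \<open>A\<close> restricts the range of
  \<open>s\<close>: all of the line for arbitrary shifts, a half-line \<open>{..a}\<close> for small
  ones.\<close>

definition kernel_mass ::
    "'i set \<Rightarrow> ('i \<Rightarrow> real) \<Rightarrow> ('i \<Rightarrow> real) \<Rightarrow> ('i \<Rightarrow> real) \<Rightarrow> real set \<Rightarrow> ennreal" where
  "kernel_mass I W z x A = (\<integral>\<^sup>+s. ennreal \<bar>\<Sum>t\<in>I. W t * lad_kernel (z t) (x t) s\<bar> * indicator A s \<partial>lborel)"

text \<open>The integrand is independent of \<open>\<delta>\<close>; only the upper limit depends on
  it. A single number therefore bounds the weighted remainder for all \<open>\<delta>\<close> in the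
  range at once.\<close>

lemma weighted_lad_rem_le_kernel_mass:
  assumes "\<And>t. t \<in> I \<Longrightarrow> z t \<noteq> 0" "\<delta> > 0" "{..\<delta>} \<subseteq> A"
  shows "ennreal \<bar>\<Sum>t\<in>I. W t * lad_rem (z t) (x t * \<delta>)\<bar> \<le> ennreal (2 * \<delta>) * kernel_mass I W z x A"
proof -
  have "has_bochner_integral lborel (\<lambda>s. \<Sum>t\<in>I. W t * (indicator {..\<delta>} s * lad_kernel (z t) (x t) s))
      (\<Sum>t\<in>I. W t * (lad_rem (z t) (x t * \<delta>) / (2 * \<delta>)))"
    using assms by (intro has_bochner_integral_sum has_bochner_integral_mult_right has_integral_lad_kernel) auto
  then have int: "integrable lborel (\<lambda>s. \<Sum>t\<in>I. W t * (indicator {..\<delta>} s * lad_kernel (z t) (x t) s))"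
    and eq: "(\<Sum>t\<in>I. W t * (lad_rem (z t) (x t * \<delta>) / (2 * \<delta>))) =
      (LINT s|lborel. (\<Sum>t\<in>I. W t * (indicator {..\<delta>} s * lad_kernel (z t) (x t) s)))"
    by (auto simp: has_bochner_integral_iff)
  have "ennreal \<bar>\<Sum>t\<in>I. W t * lad_rem (z t) (x t * \<delta>)\<bar> =
      ennreal (2 * \<delta>) * ennreal \<bar>\<Sum>t\<in>I. W t * (lad_rem (z t) (x t * \<delta>) / (2 * \<delta>))\<bar>"
    using assms by (simp add: ennreal_mult[symmetric] sum_divide_distrib[symmetric])
  also have "\<dots> \<le> ennreal (2 * \<delta>) * (\<integral>\<^sup>+s. ennreal \<bar>\<Sum>t\<in>I. W t * (indicator {..\<delta>} s * lad_kernel (z t) (x t) s)\<bar> \<partial>lborel)"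
    unfolding eq using integral_norm_bound_ennreal[OF int] by (intro mult_left_mono) auto
  also have "\<dots> \<le> ennreal (2 * \<delta>) * kernel_mass I W z x A"
  proof -
    have "ennreal \<bar>\<Sum>t\<in>I. W t * (indicator {..\<delta>} s * lad_kernel (z t) (x t) s)\<bar> \<le>
        ennreal \<bar>\<Sum>t\<in>I. W t * lad_kernel (z t) (x t) s\<bar> * indicator A s" for s
      using assms(3) by (cases "s \<le> \<delta>") (auto simp: indicator_def)
    then show ?thesis
      unfolding kernel_mass_def by (intro mult_left_mono nn_integral_mono) auto
  qed
  finally show ?thesis .
qed

text \<open>A negative shift is a positive one after the sign of \<open>x\<close> is reversed; hence
  the two masses.\<close>

lemma weighted_lad_rem_le:
  assumes z: "\<And>t. t \<in> I \<Longrightarrow> z t \<noteq> 0" and A: "{..\<bar>\<delta>\<bar>} \<subseteq> A"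
    and K: "kernel_mass I W z x A + kernel_mass I W z (\<lambda>t. - x t) A \<le> ennreal K" "K \<ge> 0"
  shows "\<bar>\<Sum>t\<in>I. W t * lad_rem (z t) (x t * \<delta>)\<bar> \<le> 2 * \<bar>\<delta>\<bar> * K"
proof -
  have le: "\<bar>\<Sum>t\<in>I. W t * lad_rem (z t) (y t * d)\<bar> \<le> 2 * d * K"
    if "d > 0" "{..d} \<subseteq> A" "kernel_mass I W z y A \<le> ennreal K" for y d
  proof -
    have "ennreal \<bar>\<Sum>t\<in>I. W t * lad_rem (z t) (y t * d)\<bar> \<le> ennreal (2 * d) * ennreal K"
      using weighted_lad_rem_le_kernel_mass[where W = W and x = y, OF z that(1,2)] that(3)
      by (meson mult_left_mono order_trans zero_le)
    also have "\<dots> = ennreal (2 * d * K)"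
      using that K by (simp add: ennreal_mult)
    finally show ?thesis
      using that K by (subst (asm) ennreal_le_iff) auto
  qed
  have "kernel_mass I W z x A \<le> ennreal K" "kernel_mass I W z (\<lambda>t. - x t) A \<le> ennreal K"
    using K(1) by (auto intro: order.trans[rotated])
  then show ?thesis
    using le[of \<delta> x] le[of "- \<delta>" "\<lambda>t. - x t"] A
    by (cases \<delta> "0::real" rule: linorder_cases) auto
qed

section \<open>Minimizers of approximately quadratic objectives\<close>

text \<open>Monotonicity interpolates between grid points, as in Polya's theorem. The extra term
  bounds the increment of the parabola over one cell: \<open>\<mu>\<close> times width
  \<open>C / m\<close> times \<open>2 * C\<close>.\<close>

lemma mono_near_parabola:
  fixes \<phi> :: "real \<Rightarrow> real"
  assumes mono: "\<And>u v. 0 \<le> u \<Longrightarrow> u \<le> v \<Longrightarrow> \<phi> u \<le> \<phi> v" and "m > 0" "\<mu> \<ge> 0" "C > 0"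
    and grid: "\<And>i. i \<le> m \<Longrightarrow> \<bar>\<phi> (real i * C / real m) - \<mu> * (real i * C / real m)\<^sup>2\<bar> \<le> \<epsilon>"
    and u: "0 \<le> u" "u \<le> C"
  shows "\<bar>\<phi> u - \<mu> * u\<^sup>2\<bar> \<le> \<epsilon> + 2 * \<mu> * C\<^sup>2 / real m"
proof -
  define i where "i = nat \<lfloor>u * m / C\<rfloor>"
  have pos: "u * m / C \<ge> 0"
    using assms by simp
  then have i: "real i \<le> u * m / C" "u * m / C < real i + 1"
    unfolding i_def by (simp_all add: of_nat_nat)
  have diff: "a - b \<le> C / m \<Longrightarrow> 0 \<le> b \<Longrightarrow> b \<le> a \<Longrightarrow> a \<le> C \<Longrightarrow> \<mu> * a\<^sup>2 - \<mu> * b\<^sup>2 \<le> 2 * \<mu> * C\<^sup>2 / m" for a b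
  proof -
    assume *: "a - b \<le> C / m" "0 \<le> b" "b \<le> a" "a \<le> C"
    have "\<mu> * a\<^sup>2 - \<mu> * b\<^sup>2 = \<mu> * ((a + b) * (a - b))"
      by (simp add: power2_eq_square algebra_simps)
    also have "\<dots> \<le> \<mu> * ((2 * C) * (C / m))"
      using * assms by (intro mult_left_mono mult_mono) auto
    finally show "\<mu> * a\<^sup>2 - \<mu> * b\<^sup>2 \<le> 2 * \<mu> * C\<^sup>2 / m"
      by (simp add: power2_eq_square mult_ac)
  qed
  have m0: "real m > 0"
    using assms by simp
  have "u * m / C \<le> m"
    using u \<open>C > 0\<close> mult_right_mono[of u C "real m"] by (simp add: divide_le_eq mult.commute)
  then have "i \<le> m"
    using i by linarith
  show ?thesis
  \<comment> \<open>The point \<open>u = C\<close> has no cell to its right, but is itself on the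
    grid.\<close>
  proof (cases "i = m")
    case True
    then have "u = C"
      using i(1) u \<open>C > 0\<close> m0 by (simp add: le_divide_eq)
    moreover have "0 \<le> 2 * \<mu> * C\<^sup>2 / m"
      using assms by simp
    ultimately show ?thesis
      using grid[of m] m0 by simp
  next
    case False
    define a b where "a = real i * C / m" and "b = real (Suc i) * C / m"
    have "real (Suc i) * C \<le> real m * C"
      using False \<open>i \<le> m\<close> \<open>C > 0\<close> by (intro mult_right_mono) auto
    then have "b \<le> C"
      using m0 by (simp add: b_def divide_le_eq mult.commute)
    have ab: "0 \<le> a" "a \<le> u" "u \<le> b" "b - a = C / m" "b \<le> C"
      using i \<open>C > 0\<close> m0 u \<open>b \<le> C\<close> by (auto simp: a_def b_def field_simps)
    have "\<bar>\<phi> a - \<mu> * a\<^sup>2\<bar> \<le> \<epsilon>" "\<bar>\<phi> b - \<mu> * b\<^sup>2\<bar> \<le> \<epsilon>"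
      using grid[of i] grid[of "Suc i"] \<open>i \<le> m\<close> False by (auto simp: a_def b_def)
    moreover have "\<phi> a \<le> \<phi> u" "\<phi> u \<le> \<phi> b"
      using mono ab u by auto
    moreover have "\<mu> * u\<^sup>2 - \<mu> * a\<^sup>2 \<le> 2 * \<mu> * C\<^sup>2 / m" "\<mu> * b\<^sup>2 - \<mu> * u\<^sup>2 \<le> 2 * \<mu> * C\<^sup>2 / m"
      using ab u by (auto intro!: diff)
    ultimately show ?thesis
      by linarith
  qed
qed

text \<open>The sample point is fixed here; \<open>N\<close> is \<open>sqrt n\<close>,
  \<open>s\<close> the standard deviation of the weights. In the variable
  \<open>u = N / s * \<delta>\<close> the objective is \<open>E u = - u * A + P u + U u\<close>,
  where \<open>P\<close> is convex and close to \<open>\<mu> * u\<^sup>2\<close> for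
  \<open>\<bar>u\<bar> \<le> C\<close>. Since \<open>P\<close> exceeds \<open>2 * B * C\<close> at
  radius \<open>C\<close>, it exceeds \<open>2 * B * \<bar>u\<bar>\<close> beyond, and there beats
  both other terms; so no minimizer lies outside. Inside, \<open>E\<close> is close to a parabola
  with vertex \<open>A / (2 * \<mu>)\<close>, and the excess of the parabola over its minimum is
  \<open>\<mu>\<close> times the squared distance to the vertex.\<close>

lemma argmin_near_linear_statistic:
  fixes z x W :: "'i \<Rightarrow> real" and b s N \<mu> C B \<epsilon> \<delta>\<^sub>0 :: real and I :: "'i set"
  defines "w \<equiv> \<lambda>t. 1 + b * W t"
  defines "D \<equiv> \<lambda>\<delta>. \<Sum>t\<in>I. w t * (\<bar>z t - \<delta> * x t\<bar> - \<bar>z t\<bar>)"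
    and "R \<equiv> \<lambda>\<delta>. \<Sum>t\<in>I. lad_rem (z t) (x t * \<delta>)"
    and "V \<equiv> \<lambda>\<delta>. \<Sum>t\<in>I. W t * lad_rem (z t) (x t * \<delta>)"
    and "T \<equiv> \<Sum>t\<in>I. w t * (x t * sgn (z t))"
  assumes pos: "s > 0" "N > 0" "\<mu> > 0" "C > 0" "B \<ge> 0" and b: "0 \<le> b" "b \<le> s"
    and min: "\<And>\<delta>. D \<delta>\<^sub>0 \<le> D \<delta>"
    and T: "\<bar>T\<bar> \<le> B * (s * N)"
    and V_global: "\<And>\<delta>. \<bar>V \<delta>\<bar> \<le> \<bar>\<delta>\<bar> * (N * B)"
    and R_local: "\<And>u. \<bar>u\<bar> \<le> C \<Longrightarrow> \<bar>R (u * s / N) / s\<^sup>2 - \<mu> * u\<^sup>2\<bar> \<le> \<epsilon>"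
    and V_local: "\<And>\<delta>. \<bar>\<delta>\<bar> \<le> C * s / N \<Longrightarrow> \<bar>V \<delta>\<bar> \<le> \<bar>\<delta>\<bar> * (N * \<epsilon>)"
    and C: "\<mu> * C\<^sup>2 - \<epsilon> > 2 * B * C" "B / (2 * \<mu>) \<le> C"
  shows "\<mu> * (N / s * \<delta>\<^sub>0 - T / (2 * \<mu> * (s * N)))\<^sup>2 \<le> 2 * (\<epsilon> + C * \<epsilon>)"
proof -
  \<comment> \<open>Splitting \<open>w\<close> into \<open>1\<close> and \<open>b * W\<close> leaves
    the convex sum \<open>R\<close> apart from the sum \<open>V\<close>, whose weights may have
    either sign.\<close>
  have D_eq: "D \<delta> = - \<delta> * T + R \<delta> + b * V \<delta>" for \<delta>
  proof -
    have "w t * (\<bar>z t - \<delta> * x t\<bar> - \<bar>z t\<bar>) = - \<delta> * (w t * (x t * sgn (z t)))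
        + lad_rem (z t) (x t * \<delta>) + b * (W t * lad_rem (z t) (x t * \<delta>))" for t
      by (simp add: lad_rem_def w_def algebra_simps)
    then show ?thesis
      by (simp add: D_def R_def V_def T_def sum.distrib sum_subtractf sum_negf sum_distrib_left)
  qed
  define A where "A = T / (s * N)"
  have A: "\<bar>A\<bar> \<le> B"
    using T pos by (simp add: A_def abs_mult divide_le_eq mult.commute)
  define E where "E = (\<lambda>u. D (u * s / N) / s\<^sup>2)"
  define P where "P = (\<lambda>u. R (u * s / N) / s\<^sup>2)"
  define U where "U = (\<lambda>u. b * V (u * s / N) / s\<^sup>2)"
  have E_eq: "E u = - u * A + P u + U u" for u
    unfolding E_def D_eq P_def U_def A_def using pos
    by (simp add: add_divide_distrib diff_divide_distrib power2_eq_square)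
  have U_le: "\<bar>U u\<bar> \<le> \<bar>u\<bar> * \<epsilon>'" if "\<bar>V (u * s / N)\<bar> \<le> \<bar>u * s / N\<bar> * (N * \<epsilon>')" for u \<epsilon>'
  proof -
    have "b * \<bar>V (u * s / N)\<bar> \<le> s * (\<bar>u * s / N\<bar> * (N * \<epsilon>'))"
      using that b by (intro mult_mono) auto
    also have "\<dots> = \<bar>u\<bar> * \<epsilon>' * s\<^sup>2"
      using pos by (simp add: abs_mult power2_eq_square)
    finally have "b * \<bar>V (u * s / N)\<bar> / s\<^sup>2 \<le> \<bar>u\<bar> * \<epsilon>'"
      using pos by (simp add: divide_le_eq)
    then show ?thesis
      using b by (simp add: U_def abs_mult)
  qed
  define u where "u = N / s * \<delta>\<^sub>0"
  have u_\<delta>: "u * s / N = \<delta>\<^sub>0"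
    using pos by (simp add: u_def)
  have E_min: "E u \<le> E v" for v
    unfolding E_def u_\<delta> using pos by (intro divide_right_mono min) auto
  have "E 0 = 0"
    by (simp add: E_def D_def)
  have "\<epsilon> \<ge> 0"
    using order.trans[OF abs_ge_zero R_local[of 0]] pos by simp
  have u: "\<bar>u\<bar> \<le> C"
  proof (rule ccontr)
    assume "\<not> \<bar>u\<bar> \<le> C"
    then have u: "\<bar>u\<bar> > C"
      by simp
    then have "u \<noteq> 0"
      using pos by auto
    \<comment> \<open>\<open>k * u\<close> is the point at radius \<open>C\<close> on the ray
      through \<open>u\<close>; convexity along this ray carries the lower bound from radius
      \<open>C\<close> out to \<open>u\<close>.\<close>
    define k where "k = C / \<bar>u\<bar>"
    have k: "0 \<le> k" "k \<le> 1" "k > 0" "\<bar>k * u\<bar> = C"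
      using u pos by (auto simp: k_def abs_mult)
    have "lad_rem (z t) (x t * ((k * u) * s / N)) \<le> k * lad_rem (z t) (x t * (u * s / N))" for t
      using lad_rem_scale_le[OF k(1,2), of "z t" "x t * (u * s / N)"] by (simp add: mult_ac)
    then have "R ((k * u) * s / N) \<le> k * R (u * s / N)"
      unfolding R_def sum_distrib_left by (intro sum_mono)
    then have "P (k * u) \<le> k * P u"
      unfolding P_def using pos by (simp add: divide_right_mono)
    moreover have "\<mu> * C\<^sup>2 - \<epsilon> \<le> P (k * u)"
    proof -
      have "(k * u)\<^sup>2 = C\<^sup>2"
        using k(4) by (metis power2_abs)
      then show ?thesis
        using R_local[of "k * u"] k(4) unfolding P_def by (simp add: abs_le_iff)
    qed
    ultimately have "2 * B * C < k * P u"
      using C by linarith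
    then have "2 * B * C < C * P u / \<bar>u\<bar>"
      by (simp add: k_def)
    then have "C * (2 * B * \<bar>u\<bar>) < C * P u"
      using \<open>u \<noteq> 0\<close> by (simp add: less_divide_eq mult_ac)
    then have "2 * B * \<bar>u\<bar> < P u"
      using pos by simp
    moreover have "\<bar>U u\<bar> \<le> \<bar>u\<bar> * B"
      by (intro U_le V_global)
    moreover have "\<bar>u * A\<bar> \<le> \<bar>u\<bar> * B"
      unfolding abs_mult using A by (intro mult_left_mono) auto
    ultimately have "E u > 0"
    proof -
      have "0 < - r + p + q" if "2 * a < p" "\<bar>q\<bar> \<le> a" "\<bar>r\<bar> \<le> a" for a p q r :: real
        using that by linarith
      from this[of "\<bar>u\<bar> * B" "P u" "U u" "u * A"] show ?thesis
        unfolding E_eq using \<open>2 * B * \<bar>u\<bar> < P u\<close> \<open>\<bar>U u\<bar> \<le> \<bar>u\<bar> * B\<close> \<open>\<bar>u * A\<bar> \<le> \<bar>u\<bar> * B\<close>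
        by (simp add: mult_ac)
    qed
    then show False
      using E_min[of 0] \<open>E 0 = 0\<close> by simp
  qed
  define v where "v = A / (2 * \<mu>)"
  have v: "\<bar>v\<bar> \<le> C"
  proof -
    have "\<bar>v\<bar> \<le> B / (2 * \<mu>)"
      using A pos by (simp add: v_def abs_mult divide_right_mono)
    then show ?thesis
      using C by simp
  qed
  have U_local: "\<bar>U y\<bar> \<le> C * \<epsilon>" if "\<bar>y\<bar> \<le> C" for y
  proof -
    have "\<bar>y * s / N\<bar> \<le> C * s / N"
      using that pos by (simp add: abs_mult divide_right_mono mult_right_mono)
    from U_le[OF V_local[OF this]] show ?thesis
      using that \<open>\<epsilon> \<ge> 0\<close> by (meson mult_right_mono order_trans)
  qed
  \<comment> \<open>The minimizer is compared with the vertex \<open>v\<close>. Replacing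
    \<open>E\<close> by the parabola costs at most \<open>\<epsilon>\<close> for \<open>P\<close>
    and \<open>C * \<epsilon>\<close> for \<open>U\<close>, at each of the two points.\<close>
  have "- u * A + \<mu> * u\<^sup>2 \<le> - v * A + \<mu> * v\<^sup>2 + 2 * (\<epsilon> + C * \<epsilon>)"
  proof -
    have "a + q \<le> a' + q' + 2 * (e + f)"
      if "a + p + h \<le> a' + p' + h'" "\<bar>p - q\<bar> \<le> e" "\<bar>p' - q'\<bar> \<le> e" "\<bar>h\<bar> \<le> f" "\<bar>h'\<bar> \<le> f"
      for a a' p p' q q' h h' e f :: real
    proof -
      have "q \<le> p + e" "p' \<le> q' + e" "h' - h \<le> 2 * f"
        using that by linarith+
      then show ?thesis
        using that(1) by argo
    qed
    from this[OF E_min[of v, unfolded E_eq P_def] R_local[OF u] R_local[OF v] U_local[OF u] U_local[OF v]]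
    show ?thesis .
  qed
  moreover have "A = 2 * \<mu> * v"
    using pos by (simp add: v_def)
  ultimately have "\<mu> * (u - v)\<^sup>2 \<le> 2 * (\<epsilon> + C * \<epsilon>)"
    by (simp add: power2_eq_square algebra_simps)
  moreover have "v = T / (2 * \<mu> * (s * N))"
    by (simp add: v_def A_def)
  ultimately show ?thesis
    by (simp add: u_def)
qed

section \<open>Stationary autoregression\<close>

text \<open>The Cauchy-Schwarz inequality with weights \<open>a\<close>, used twice. With geometric
  weights it bounds the fourth moments of partial sums independently of their length.\<close>

lemma weighted_sum_power4_le:
  fixes a z :: "'i \<Rightarrow> real"
  assumes "\<And>i. i \<in> I \<Longrightarrow> 0 \<le> a i"
  shows "(\<Sum>i\<in>I. a i * z i) ^ 4 \<le> (\<Sum>i\<in>I. a i) ^ 3 * (\<Sum>i\<in>I. a i * z i ^ 4)"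
proof -
  have cs: "(\<Sum>i\<in>I. a i * y i)\<^sup>2 \<le> (\<Sum>i\<in>I. a i) * (\<Sum>i\<in>I. a i * (y i)\<^sup>2)" for y :: "'i \<Rightarrow> real"
  proof -
    have "(\<Sum>i\<in>I. sqrt (a i) * (sqrt (a i) * y i))\<^sup>2 \<le> (\<Sum>i\<in>I. (sqrt (a i))\<^sup>2) * (\<Sum>i\<in>I. (sqrt (a i) * y i)\<^sup>2)"
      by (rule Cauchy_Schwarz_ineq_sum)
    moreover have "(\<Sum>i\<in>I. sqrt (a i) * (sqrt (a i) * y i)) = (\<Sum>i\<in>I. a i * y i)"
      using assms by (intro sum.cong) (auto simp flip: mult.assoc)
    moreover have "(\<Sum>i\<in>I. (sqrt (a i))\<^sup>2) = (\<Sum>i\<in>I. a i)"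
      "(\<Sum>i\<in>I. (sqrt (a i) * y i)\<^sup>2) = (\<Sum>i\<in>I. a i * (y i)\<^sup>2)"
      using assms by (auto intro!: sum.cong simp: power_mult_distrib)
    ultimately show ?thesis
      by simp
  qed
  have nonneg: "0 \<le> (\<Sum>i\<in>I. a i)"
    using assms by (intro sum_nonneg)
  have "(\<Sum>i\<in>I. a i * z i) ^ 4 = ((\<Sum>i\<in>I. a i * z i)\<^sup>2)\<^sup>2"
    by simp
  also have "\<dots> \<le> ((\<Sum>i\<in>I. a i) * (\<Sum>i\<in>I. a i * (z i)\<^sup>2))\<^sup>2"
    by (intro power_mono cs) auto
  also have "\<dots> = (\<Sum>i\<in>I. a i)\<^sup>2 * (\<Sum>i\<in>I. a i * (z i)\<^sup>2)\<^sup>2"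
    by (simp add: power_mult_distrib)
  also have "\<dots> \<le> (\<Sum>i\<in>I. a i)\<^sup>2 * ((\<Sum>i\<in>I. a i) * (\<Sum>i\<in>I. a i * ((z i)\<^sup>2)\<^sup>2))"
    by (intro mult_left_mono cs) auto
  also have "\<dots> = (\<Sum>i\<in>I. a i) ^ 3 * (\<Sum>i\<in>I. a i * z i ^ 4)"
    by (simp add: power3_eq_cube power2_eq_square[of "sum a I"] mult.assoc)
  finally show ?thesis .
qed

locale ar1 = prob_space M for M :: "'a measure" +
  fixes X Z :: "int \<Rightarrow> 'a \<Rightarrow> real" and \<theta> :: real
  assumes X_measurable [measurable]: "\<And>t. X t \<in> borel_measurable M"
    and stationary: "strictly_stationary M X"
    and recursion: "\<And>t. AE \<omega> in M. X t \<omega> = \<theta> * X (t - 1) \<omega> + Z t \<omega>"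
    and \<theta>_less: "\<bar>\<theta>\<bar> < 1"
    and Z_iid: "iid M Z"
    and Z_moment4: "\<And>t. integrable M (\<lambda>\<omega>. (Z t \<omega>) ^ 4)"
begin

text \<open>Agrees with \<open>Z t\<close> almost surely, but is a function of the observations at
  every sample point. Stationarity of \<open>X\<close> and its independence from the weights thus
  apply to it directly.\<close>

definition innov :: "int \<Rightarrow> 'a \<Rightarrow> real" where
  "innov t \<omega> = X t \<omega> - \<theta> * X (t - 1) \<omega>"

lemma innov_measurable [measurable]: "innov t \<in> borel_measurable M"
  unfolding innov_def by measurable

lemma innov_eq_Z: "AE \<omega> in M. innov t \<omega> = Z t \<omega>"
  using recursion[of t] by eventually_elim (simp add: innov_def)

lemma Z_indep: "indep_vars (\<lambda>_. borel) Z UNIV"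
  using Z_iid unfolding iid_def by blast

lemma Z_measurable [measurable]: "Z t \<in> borel_measurable M"
  using Z_indep by (simp add: indep_vars_def)

lemma
  fixes F :: "(int \<Rightarrow> real) \<Rightarrow> real"
  assumes "finite J" and F: "F \<in> borel_measurable (Pi\<^sub>M J (\<lambda>_. borel))"
  shows expectation_shift: "expectation (\<lambda>\<omega>. F (\<lambda>t\<in>J. X (t + h) \<omega>)) = expectation (\<lambda>\<omega>. F (\<lambda>t\<in>J. X t \<omega>))"
    and integrable_shift: "integrable M (\<lambda>\<omega>. F (\<lambda>t\<in>J. X (t + h) \<omega>)) \<longleftrightarrow> integrable M (\<lambda>\<omega>. F (\<lambda>t\<in>J. X t \<omega>))"
proof -
  have eq: "distr M (Pi\<^sub>M J (\<lambda>_. borel)) (\<lambda>\<omega>. \<lambda>t\<in>J. X (t + h) \<omega>) =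
      distr M (Pi\<^sub>M J (\<lambda>_. borel)) (\<lambda>\<omega>. \<lambda>t\<in>J. X t \<omega>)"
    using stationary \<open>finite J\<close> by (simp add: strictly_stationary_def)
  have [measurable]: "(\<lambda>\<omega>. \<lambda>t\<in>J. X (t + h) \<omega>) \<in> M \<rightarrow>\<^sub>M Pi\<^sub>M J (\<lambda>_. borel)" for h
    by measurable
  have m0: "(\<lambda>\<omega>. \<lambda>t\<in>J. X t \<omega>) \<in> M \<rightarrow>\<^sub>M Pi\<^sub>M J (\<lambda>_. borel)"
    by measurable
  show "expectation (\<lambda>\<omega>. F (\<lambda>t\<in>J. X (t + h) \<omega>)) = expectation (\<lambda>\<omega>. F (\<lambda>t\<in>J. X t \<omega>))"
    using integral_distr[OF _ F, of "\<lambda>\<omega>. \<lambda>t\<in>J. X (t + h) \<omega>" M] integral_distr[OF m0 F] eq by simp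
  show "integrable M (\<lambda>\<omega>. F (\<lambda>t\<in>J. X (t + h) \<omega>)) \<longleftrightarrow> integrable M (\<lambda>\<omega>. F (\<lambda>t\<in>J. X t \<omega>))"
    using integrable_distr_eq[OF _ F, of "\<lambda>\<omega>. \<lambda>t\<in>J. X (t + h) \<omega>" M] integrable_distr_eq[OF m0 F] eq by simp
qed

text \<open>The pair \<open>(innov t, X (t - 1))\<close> is a fixed function of
  \<open>(X (t - 1), X t)\<close>, so its law inherits stationarity. All moments can then be
  computed at \<open>t = 1\<close>.\<close>

lemma
  fixes g :: "real \<Rightarrow> real \<Rightarrow> real"
  assumes [measurable]: "case_prod g \<in> borel_measurable (borel \<Otimes>\<^sub>M borel)"
  shows expectation_innov_lag: "expectation (\<lambda>\<omega>. g (innov t \<omega>) (X (t - 1) \<omega>)) = expectation (\<lambda>\<omega>. g (innov 1 \<omega>) (X 0 \<omega>))"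
    and integrable_innov_lag: "integrable M (\<lambda>\<omega>. g (innov t \<omega>) (X (t - 1) \<omega>)) \<longleftrightarrow> integrable M (\<lambda>\<omega>. g (innov 1 \<omega>) (X 0 \<omega>))"
proof -
  define F where "F = (\<lambda>x::int \<Rightarrow> real. g (x 1 - \<theta> * x 0) (x 0))"
  have F: "F \<in> borel_measurable (Pi\<^sub>M {0, 1} (\<lambda>_. borel))"
    unfolding F_def by measurable
  have fin: "finite {0, 1 :: int}"
    by simp
  have eq: "F (\<lambda>s\<in>{0, 1}. X (s + (t - 1)) \<omega>) = g (innov t \<omega>) (X (t - 1) \<omega>)"
    "F (\<lambda>s\<in>{0, 1}. X s \<omega>) = g (innov 1 \<omega>) (X 0 \<omega>)" for \<omega>
    by (simp_all add: F_def innov_def)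
  show "expectation (\<lambda>\<omega>. g (innov t \<omega>) (X (t - 1) \<omega>)) = expectation (\<lambda>\<omega>. g (innov 1 \<omega>) (X 0 \<omega>))"
    using expectation_shift[OF fin F, of "t - 1"] unfolding eq .
  show "integrable M (\<lambda>\<omega>. g (innov t \<omega>) (X (t - 1) \<omega>)) \<longleftrightarrow> integrable M (\<lambda>\<omega>. g (innov 1 \<omega>) (X 0 \<omega>))"
    using integrable_shift[OF fin F, of "t - 1"] unfolding eq .
qed

lemma
  fixes g :: "real \<Rightarrow> real"
  assumes [measurable]: "g \<in> borel_measurable borel"
  shows expectation_X: "expectation (\<lambda>\<omega>. g (X t \<omega>)) = expectation (\<lambda>\<omega>. g (X 0 \<omega>))"
    and expectation_innov: "expectation (\<lambda>\<omega>. g (innov t \<omega>)) = expectation (\<lambda>\<omega>. g (innov 1 \<omega>))"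
proof -
  have m: "(\<lambda>(z, x). g x) \<in> borel_measurable (borel \<Otimes>\<^sub>M borel)"
    "(\<lambda>(z, x). g z) \<in> borel_measurable (borel \<Otimes>\<^sub>M borel)"
    by measurable
  show "expectation (\<lambda>\<omega>. g (X t \<omega>)) = expectation (\<lambda>\<omega>. g (X 0 \<omega>))"
    using expectation_innov_lag[OF m(1), of "t + 1"] unfolding add_diff_cancel_right' .
  show "expectation (\<lambda>\<omega>. g (innov t \<omega>)) = expectation (\<lambda>\<omega>. g (innov 1 \<omega>))"
    by (rule expectation_innov_lag[OF m(2)])
qed

lemma integrable_Z: "integrable M (\<lambda>\<omega>. (Z t \<omega>)\<^sup>2)" "integrable M (Z t)"
proof -
  show sq: "integrable M (\<lambda>\<omega>. (Z t \<omega>)\<^sup>2)"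
    by (rule integrable_of_square) (use Z_moment4[of t] in simp_all)
  show "integrable M (Z t)"
    by (rule integrable_of_square) (use sq in simp_all)
qed

lemma expectation_Z:
  assumes [measurable]: "g \<in> borel_measurable borel"
  shows "expectation (\<lambda>\<omega>. g (Z t \<omega>)) = expectation (\<lambda>\<omega>. g (Z s \<omega>) :: real)"
proof -
  have "distr M borel (Z t) = distr M borel (Z s)"
    using Z_iid unfolding iid_def by blast
  then show ?thesis
    using integral_distr[of "Z t" M borel g] integral_distr[of "Z s" M borel g] by simp
qed

section \<open>The moving-average representation and fourth moments\<close>

definition moving_average :: "int \<Rightarrow> 'a \<Rightarrow> real" where
  "moving_average t \<omega> = (\<Sum>j. \<theta> ^ j * Z (t - int j) \<omega>)"

text \<open>The expected sum of the absolute values is a geometric series.\<close>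

lemma moving_average_summable: "AE \<omega> in M. summable (\<lambda>j. \<theta> ^ j * Z (t - int j) \<omega>)"
proof -
  define m where "m = expectation (\<lambda>\<omega>. \<bar>Z 0 \<omega>\<bar>)"
  have "(\<integral>\<^sup>+\<omega>. (\<Sum>j. ennreal (\<bar>\<theta>\<bar> ^ j * \<bar>Z (t - int j) \<omega>\<bar>)) \<partial>M) =
      (\<Sum>j. \<integral>\<^sup>+\<omega>. ennreal (\<bar>\<theta>\<bar> ^ j * \<bar>Z (t - int j) \<omega>\<bar>) \<partial>M)"
    by (rule nn_integral_suminf) measurable
  also have "\<dots> = (\<Sum>j. ennreal (\<bar>\<theta>\<bar> ^ j * m))"
  proof (intro suminf_cong)
    fix j
    have "(\<integral>\<^sup>+\<omega>. ennreal (\<bar>\<theta>\<bar> ^ j * \<bar>Z (t - int j) \<omega>\<bar>) \<partial>M) =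
        ennreal (expectation (\<lambda>\<omega>. \<bar>\<theta>\<bar> ^ j * \<bar>Z (t - int j) \<omega>\<bar>))"
      using integrable_Z by (intro nn_integral_eq_integral) auto
    also have "expectation (\<lambda>\<omega>. \<bar>\<theta>\<bar> ^ j * \<bar>Z (t - int j) \<omega>\<bar>) = \<bar>\<theta>\<bar> ^ j * m"
      using expectation_Z[of abs "t - int j" 0] by (simp add: m_def)
    finally show "(\<integral>\<^sup>+\<omega>. ennreal (\<bar>\<theta>\<bar> ^ j * \<bar>Z (t - int j) \<omega>\<bar>) \<partial>M) = ennreal (\<bar>\<theta>\<bar> ^ j * m)" .
  qed
  also have "\<dots> = ennreal (\<Sum>j. \<bar>\<theta>\<bar> ^ j * m)"
    using \<theta>_less by (intro suminf_ennreal2) (auto simp: m_def intro!: summable_mult2 summable_geometric)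
  finally have "(\<integral>\<^sup>+\<omega>. (\<Sum>j. ennreal (\<bar>\<theta>\<bar> ^ j * \<bar>Z (t - int j) \<omega>\<bar>)) \<partial>M) \<noteq> \<infinity>"
    by simp
  then have "AE \<omega> in M. (\<Sum>j. ennreal (\<bar>\<theta>\<bar> ^ j * \<bar>Z (t - int j) \<omega>\<bar>)) \<noteq> \<infinity>"
    by (intro nn_integral_noteq_infinite) auto
  then show ?thesis
  proof eventually_elim
    case (elim \<omega>)
    then have "summable (\<lambda>j. \<bar>\<theta>\<bar> ^ j * \<bar>Z (t - int j) \<omega>\<bar>)"
      by (intro summable_suminf_not_top) auto
    then have "summable (\<lambda>j. norm (\<theta> ^ j * Z (t - int j) \<omega>))"
      by (simp add: abs_mult power_abs)
    then show ?case
      by (rule summable_norm_cancel)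
  qed
qed

lemma X_iterate: "AE \<omega> in M. \<forall>t N. X t \<omega> = (\<Sum>j<N. \<theta> ^ j * Z (t - int j) \<omega>) + \<theta> ^ N * X (t - int N) \<omega>"
proof -
  have "AE \<omega> in M. \<forall>t. X t \<omega> = \<theta> * X (t - 1) \<omega> + Z t \<omega>"
    using recursion by (simp add: AE_all_countable)
  then show ?thesis
  proof eventually_elim
    case (elim \<omega>)
    have "X t \<omega> = (\<Sum>j<N. \<theta> ^ j * Z (t - int j) \<omega>) + \<theta> ^ N * X (t - int N) \<omega>" for t N
    proof (induction N)
      case (Suc N)
      have "X (t - int N) \<omega> = \<theta> * X (t - int (Suc N)) \<omega> + Z (t - int N) \<omega>"
        using elim[rule_format, of "t - int N"] by (simp add: algebra_simps)
      then show ?case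
        using Suc by (simp add: algebra_simps)
    qed simp
    then show ?case
      by blast
  qed
qed

text \<open>Iterating the recursion leaves the term \<open>\<theta> ^ N * X (t - int N)\<close>. It
  converges almost surely to \<open>X t - moving_average t\<close>, while by stationarity it has the
  law of \<open>\<theta> ^ N * X 0\<close>, which tends to 0. No moment of \<open>X\<close> is
  available yet, so both limits are taken inside \<open>min 1 \<bar>_\<bar>\<close>, where bounded
  convergence applies.\<close>

lemma X_eq_moving_average: "AE \<omega> in M. X t \<omega> = moving_average t \<omega>"
proof -
  have [measurable]: "moving_average t \<in> borel_measurable M"
    unfolding moving_average_def by measurable
  define D where "D = (\<lambda>N \<omega>. \<theta> ^ N * X (t - int N) \<omega>)"
  have lim: "AE \<omega> in M. (\<lambda>N. min 1 \<bar>D N \<omega>\<bar>) \<longlonglongrightarrow> min 1 \<bar>X t \<omega> - moving_average t \<omega>\<bar>"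
    using moving_average_summable[of t] X_iterate
  proof eventually_elim
    case (elim \<omega>)
    have "D N \<omega> = X t \<omega> - (\<Sum>j<N. \<theta> ^ j * Z (t - int j) \<omega>)" for N
      using elim(2)[rule_format, of t N] by (simp add: D_def)
    moreover have "(\<lambda>N. \<Sum>j<N. \<theta> ^ j * Z (t - int j) \<omega>) \<longlonglongrightarrow> moving_average t \<omega>"
      using summable_LIMSEQ[OF elim(1)] by (simp add: moving_average_def)
    ultimately have "(\<lambda>N. D N \<omega>) \<longlonglongrightarrow> X t \<omega> - moving_average t \<omega>"
      by (simp add: tendsto_diff)
    then show ?case
      by (intro tendsto_min tendsto_const tendsto_rabs)
  qed
  have 1: "(\<lambda>N. expectation (\<lambda>\<omega>. min 1 \<bar>D N \<omega>\<bar>)) \<longlonglongrightarrow> expectation (\<lambda>\<omega>. min 1 \<bar>X t \<omega> - moving_average t \<omega>\<bar>)"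
    by (rule integral_dominated_convergence[where w = "\<lambda>_. 1", OF _ _ _ lim]) (auto simp: D_def)
  have "(\<lambda>N. expectation (\<lambda>\<omega>. min 1 \<bar>\<theta> ^ N * X 0 \<omega>\<bar>)) \<longlonglongrightarrow> expectation (\<lambda>\<omega>. min 1 \<bar>0 * X 0 \<omega>\<bar>)"
  proof (rule integral_dominated_convergence[where w = "\<lambda>_. 1"])
    have "(\<lambda>N. \<theta> ^ N) \<longlonglongrightarrow> 0"
      using \<theta>_less by (intro LIMSEQ_power_zero) simp
    then show "AE \<omega> in M. (\<lambda>N. min 1 \<bar>\<theta> ^ N * X 0 \<omega>\<bar>) \<longlonglongrightarrow> min 1 \<bar>0 * X 0 \<omega>\<bar>"
      by (intro AE_I2 tendsto_min tendsto_const tendsto_rabs tendsto_mult)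
  qed auto
  moreover have "expectation (\<lambda>\<omega>. min 1 \<bar>D N \<omega>\<bar>) = expectation (\<lambda>\<omega>. min 1 \<bar>\<theta> ^ N * X 0 \<omega>\<bar>)" for N
    unfolding D_def by (rule expectation_X[of "\<lambda>x. min 1 \<bar>\<theta> ^ N * x\<bar>"]) simp
  ultimately have "expectation (\<lambda>\<omega>. min 1 \<bar>X t \<omega> - moving_average t \<omega>\<bar>) = 0"
    using 1 LIMSEQ_unique by fastforce
  moreover have "integrable M (\<lambda>\<omega>. min 1 \<bar>X t \<omega> - moving_average t \<omega>\<bar>)"
    by (rule integrable_const_bound[where B = 1]) auto
  ultimately have "AE \<omega> in M. min 1 \<bar>X t \<omega> - moving_average t \<omega>\<bar> = 0"
    by (subst (asm) integral_nonneg_eq_0_iff_AE) auto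
  then show ?thesis
    by eventually_elim (auto simp: min_def split: if_splits)
qed

text \<open>Fatou's lemma along the partial sums of the moving average, whose fourth moments are
  bounded by means of the total geometric weight \<open>A\<close>.\<close>

lemma X_moment4: "integrable M (\<lambda>\<omega>. (X t \<omega>) ^ 4)"
proof -
  define S where "S = (\<lambda>N \<omega>. \<Sum>j<N. \<theta> ^ j * Z (t - int j) \<omega>)"
  define A where "A = 1 / (1 - \<bar>\<theta>\<bar>)"
  define m where "m = expectation (\<lambda>\<omega>. (Z 0 \<omega>) ^ 4)"
  have [measurable]: "S N \<in> borel_measurable M" for N
    unfolding S_def by measurable
  have geo: "(\<Sum>j<N. \<bar>\<theta>\<bar> ^ j) \<le> A" for N
  proof -
    have "(\<Sum>j<N. \<bar>\<theta>\<bar> ^ j) \<le> (\<Sum>j. \<bar>\<theta>\<bar> ^ j)"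
      using \<theta>_less by (intro sum_le_suminf summable_geometric) auto
    then show ?thesis
      using \<theta>_less by (simp add: A_def suminf_geometric)
  qed
  have "A \<ge> 0"
    using \<theta>_less by (simp add: A_def)
  have S4: "(\<integral>\<^sup>+\<omega>. ennreal ((S N \<omega>) ^ 4) \<partial>M) \<le> ennreal (A ^ 3 * (A * m))" for N
  proof -
    have le: "(S N \<omega>) ^ 4 \<le> A ^ 3 * (\<Sum>j<N. \<bar>\<theta>\<bar> ^ j * (Z (t - int j) \<omega>) ^ 4)" for \<omega>
    proof -
      have "\<bar>S N \<omega>\<bar> \<le> (\<Sum>j<N. \<bar>\<theta>\<bar> ^ j * \<bar>Z (t - int j) \<omega>\<bar>)"
        unfolding S_def by (rule order.trans[OF sum_abs]) (simp add: abs_mult power_abs)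
      then have "\<bar>S N \<omega>\<bar> ^ 4 \<le> (\<Sum>j<N. \<bar>\<theta>\<bar> ^ j * \<bar>Z (t - int j) \<omega>\<bar>) ^ 4"
        by (intro power_mono) auto
      also have "\<dots> \<le> (\<Sum>j<N. \<bar>\<theta>\<bar> ^ j) ^ 3 * (\<Sum>j<N. \<bar>\<theta>\<bar> ^ j * \<bar>Z (t - int j) \<omega>\<bar> ^ 4)"
        by (rule weighted_sum_power4_le) simp
      also have "\<dots> \<le> A ^ 3 * (\<Sum>j<N. \<bar>\<theta>\<bar> ^ j * \<bar>Z (t - int j) \<omega>\<bar> ^ 4)"
        using geo by (intro mult_right_mono power_mono sum_nonneg) auto
      finally show ?thesis
        by simp
    qed
    have int: "integrable M (\<lambda>\<omega>. A ^ 3 * (\<Sum>j<N. \<bar>\<theta>\<bar> ^ j * (Z (t - int j) \<omega>) ^ 4))"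
      using Z_moment4 by (intro integrable_mult_right Bochner_Integration.integrable_sum)
    have "(\<integral>\<^sup>+\<omega>. ennreal ((S N \<omega>) ^ 4) \<partial>M) \<le>
        (\<integral>\<^sup>+\<omega>. ennreal (A ^ 3 * (\<Sum>j<N. \<bar>\<theta>\<bar> ^ j * (Z (t - int j) \<omega>) ^ 4)) \<partial>M)"
      by (intro nn_integral_mono ennreal_leI le)
    also have "\<dots> = ennreal (expectation (\<lambda>\<omega>. A ^ 3 * (\<Sum>j<N. \<bar>\<theta>\<bar> ^ j * (Z (t - int j) \<omega>) ^ 4)))"
      using int \<open>A \<ge> 0\<close> by (intro nn_integral_eq_integral AE_I2 mult_nonneg_nonneg sum_nonneg) auto
    also have "expectation (\<lambda>\<omega>. A ^ 3 * (\<Sum>j<N. \<bar>\<theta>\<bar> ^ j * (Z (t - int j) \<omega>) ^ 4)) = A ^ 3 * ((\<Sum>j<N. \<bar>\<theta>\<bar> ^ j) * m)"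
    proof -
      have m: "expectation (\<lambda>\<omega>. (Z s \<omega>) ^ 4) = m" for s
        unfolding m_def by (rule expectation_Z) measurable
      have "expectation (\<lambda>\<omega>. \<Sum>j<N. \<bar>\<theta>\<bar> ^ j * (Z (t - int j) \<omega>) ^ 4) = (\<Sum>j<N. \<bar>\<theta>\<bar> ^ j * m)"
        using Z_moment4 m by (subst Bochner_Integration.integral_sum) auto
      then show ?thesis
        by (simp add: sum_distrib_right)
    qed
    also have "\<dots> \<le> A ^ 3 * (A * m)"
      using geo \<open>A \<ge> 0\<close> by (intro mult_left_mono mult_right_mono) (auto simp: m_def)
    finally show ?thesis
      by (simp add: ennreal_leI)
  qed
  have "(\<integral>\<^sup>+\<omega>. ennreal ((X t \<omega>) ^ 4) \<partial>M) = (\<integral>\<^sup>+\<omega>. liminf (\<lambda>N. ennreal ((S N \<omega>) ^ 4)) \<partial>M)"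
  proof (rule nn_integral_cong_AE)
    show "AE \<omega> in M. ennreal ((X t \<omega>) ^ 4) = liminf (\<lambda>N. ennreal ((S N \<omega>) ^ 4))"
      using moving_average_summable[of t] X_eq_moving_average[of t]
    proof eventually_elim
      case (elim \<omega>)
      have "(\<lambda>N. S N \<omega>) \<longlonglongrightarrow> X t \<omega>"
        using summable_LIMSEQ[OF elim(1)] elim(2) by (simp add: moving_average_def S_def)
      then have "(\<lambda>N. ennreal ((S N \<omega>) ^ 4)) \<longlonglongrightarrow> ennreal ((X t \<omega>) ^ 4)"
        by (intro tendsto_ennrealI tendsto_power)
      then show ?case
        by (rule lim_imp_Liminf[OF trivial_limit_sequentially, symmetric])
    qed
  qed
  also have "\<dots> \<le> liminf (\<lambda>N. \<integral>\<^sup>+\<omega>. ennreal ((S N \<omega>) ^ 4) \<partial>M)"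
    by (rule nn_integral_liminf) measurable
  also have "\<dots> \<le> liminf (\<lambda>N. ennreal (A ^ 3 * (A * m)))"
    by (intro Liminf_mono always_eventually allI S4)
  also have "\<dots> < \<infinity>"
    by (simp add: Liminf_const)
  finally have "(\<integral>\<^sup>+\<omega>. ennreal ((X t \<omega>) ^ 4) \<partial>M) < \<infinity>" .
  then show ?thesis
    by (intro integrableI_bounded) auto
qed

lemma X_moments: "integrable M (\<lambda>\<omega>. (X t \<omega>)\<^sup>2)" "integrable M (X t)" "integrable M (\<lambda>\<omega>. \<bar>X t \<omega>\<bar> ^ 3)"
proof -
  show sq: "integrable M (\<lambda>\<omega>. (X t \<omega>)\<^sup>2)"
    by (rule integrable_of_square) (use X_moment4[of t] in simp_all)
  show "integrable M (X t)"
    by (rule integrable_of_square) (use sq in simp_all)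
  have eq: "\<bar>x\<bar> * x\<^sup>2 = \<bar>x\<bar> ^ 3" for x :: real
    unfolding power2_abs[of x, symmetric] by (simp only: power3_eq_cube power2_eq_square mult.assoc)
  have "integrable M (\<lambda>\<omega>. \<bar>X t \<omega>\<bar> * (X t \<omega>)\<^sup>2)"
    by (rule integrable_mult_of_squares) (use sq X_moment4[of t] in simp_all)
  then show "integrable M (\<lambda>\<omega>. \<bar>X t \<omega>\<bar> ^ 3)"
    unfolding eq .
qed

lemma innov_moments: "integrable M (\<lambda>\<omega>. (innov t \<omega>) ^ 4)" "integrable M (\<lambda>\<omega>. (innov t \<omega>)\<^sup>2)" "integrable M (innov t)"
proof -
  have AE: "AE \<omega> in M. Z t \<omega> = innov t \<omega>"
    using innov_eq_Z[of t] by eventually_elim simp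
  show "integrable M (\<lambda>\<omega>. (innov t \<omega>) ^ 4)"
    using Z_moment4[of t] by (rule integrable_cong_AE_imp) (use AE in auto)
  show "integrable M (\<lambda>\<omega>. (innov t \<omega>)\<^sup>2)"
    using integrable_Z(1)[of t] by (rule integrable_cong_AE_imp) (use AE in auto)
  show "integrable M (innov t)"
    using integrable_Z(2)[of t] by (rule integrable_cong_AE_imp) (use AE in auto)
qed

section \<open>Innovations and the past; martingale sums\<close>

lemma innov_indep_past:
  "indep_pair (Pi\<^sub>M {..<t} (\<lambda>_. borel)) (\<lambda>\<omega>. \<lambda>s\<in>{..<t}. X s \<omega>) borel (innov t)"
proof -
  \<comment> \<open>The moving average as a measurable map of the innovations before
    \<open>t\<close>. Independence of \<open>Z\<close> transfers through it to the past of
    \<open>X\<close>, up to null sets.\<close>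
  define Y where "Y = (\<lambda>f :: int \<Rightarrow> real. \<lambda>s\<in>{..<t}. \<Sum>j. \<theta> ^ j * f (s - int j))"
  have Y: "Y \<in> Pi\<^sub>M {..<t} (\<lambda>_. borel) \<rightarrow>\<^sub>M Pi\<^sub>M {..<t} (\<lambda>_. borel)"
    unfolding Y_def
  proof (rule measurable_restrict)
    fix s
    assume "s \<in> {..<t}"
    then have "s - int j \<in> {..<t}" for j
      by auto
    then have [measurable]: "(\<lambda>f. f (s - int j)) \<in> borel_measurable (Pi\<^sub>M {..<t} (\<lambda>_. borel))" for j
      by (rule measurable_component_singleton)
    show "(\<lambda>f. \<Sum>j. \<theta> ^ j * f (s - int j)) \<in> borel_measurable (Pi\<^sub>M {..<t} (\<lambda>_. borel))"
      by measurable
  qed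
  have "indep_var (Pi\<^sub>M {..<t} (\<lambda>_. borel)) (\<lambda>\<omega>. \<lambda>s\<in>{..<t}. Z s \<omega>) (Pi\<^sub>M {t} (\<lambda>_. borel)) (\<lambda>\<omega>. \<lambda>s\<in>{t}. Z s \<omega>)"
    by (rule indep_var_restrict[OF Z_indep]) auto
  then have "indep_pair (Pi\<^sub>M {..<t} (\<lambda>_. borel)) (\<lambda>\<omega>. Y (\<lambda>s\<in>{..<t}. Z s \<omega>)) borel (\<lambda>\<omega>. (\<lambda>s\<in>{t}. Z s \<omega>) t)"
    by (rule indep_pair_compose[OF indep_var_imp_indep_pair Y]) simp
  then show ?thesis
  proof (rule indep_pair_cong_AE)
    have "AE \<omega> in M. \<forall>s. X s \<omega> = moving_average s \<omega>"
      using X_eq_moving_average by (simp add: AE_all_countable)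
    then show "AE \<omega> in M. Y (\<lambda>s\<in>{..<t}. Z s \<omega>) = (\<lambda>s\<in>{..<t}. X s \<omega>)"
      by eventually_elim (auto simp: Y_def moving_average_def intro!: restrict_ext)
    show "AE \<omega> in M. (\<lambda>s\<in>{t}. Z s \<omega>) t = innov t \<omega>"
      using innov_eq_Z[of t] by eventually_elim simp
  qed measurable
qed

lemma innov_indep_lag: "indep_pair borel (X (t - 1)) borel (innov t)"
proof -
  have "indep_pair borel (\<lambda>\<omega>. (\<lambda>s\<in>{..<t}. X s \<omega>) (t - 1)) borel (\<lambda>\<omega>. innov t \<omega>)"
    by (rule indep_pair_compose[OF innov_indep_past]) auto
  then show ?thesis
    by simp
qed

text \<open>Centring holds for every frozen value of the lag. Given the past of time
  \<open>t\<close>, the later factor of a mixed product therefore has mean 0, the summands are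
  orthogonal, and only \<open>n - 1\<close> equal squares remain.\<close>

lemma martingale_difference_square:
  fixes \<phi> :: "real \<Rightarrow> real \<Rightarrow> real"
  assumes \<phi> [measurable]: "case_prod \<phi> \<in> borel_measurable (borel \<Otimes>\<^sub>M borel)"
    and centred: "\<And>x. expectation (\<lambda>\<omega>. \<phi> (innov 1 \<omega>) x) = 0"
    and sq: "integrable M (\<lambda>\<omega>. (\<phi> (innov 1 \<omega>) (X 0 \<omega>))\<^sup>2)"
  shows "integrable M (\<lambda>\<omega>. (\<Sum>t=2..n. \<phi> (innov (int t) \<omega>) (X (int t - 1) \<omega>))\<^sup>2)"
    and "expectation (\<lambda>\<omega>. (\<Sum>t=2..n. \<phi> (innov (int t) \<omega>) (X (int t - 1) \<omega>))\<^sup>2) \<le>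
      real n * expectation (\<lambda>\<omega>. (\<phi> (innov 1 \<omega>) (X 0 \<omega>))\<^sup>2)"
proof -
  define \<xi> where "\<xi> = (\<lambda>t \<omega>. \<phi> (innov t \<omega>) (X (t - 1) \<omega>))"
  have [measurable]: "\<xi> t \<in> borel_measurable M" for t
    unfolding \<xi>_def by measurable
  have \<xi>_sq: "integrable M (\<lambda>\<omega>. (\<xi> t \<omega>)\<^sup>2)"
    "expectation (\<lambda>\<omega>. (\<xi> t \<omega>)\<^sup>2) = expectation (\<lambda>\<omega>. (\<phi> (innov 1 \<omega>) (X 0 \<omega>))\<^sup>2)" for t
    using integrable_innov_lag[of "\<lambda>z x. (\<phi> z x)\<^sup>2" t] expectation_innov_lag[of "\<lambda>z x. (\<phi> z x)\<^sup>2" t] sq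
    by (simp_all add: \<xi>_def)
  have \<xi>_int: "integrable M (\<lambda>\<omega>. \<xi> s \<omega> * \<xi> t \<omega>)" for s t
    by (intro integrable_mult_of_squares \<xi>_sq) measurable
  have orth: "expectation (\<lambda>\<omega>. \<xi> s \<omega> * \<xi> t \<omega>) = 0" if "s < t" for s t
  proof -
    \<comment> \<open>The earlier summand and the lag \<open>X (t - 1)\<close> are functions of the
      path before \<open>t\<close>; only \<open>innov t\<close> is left to be integrated
      out.\<close>
    define g where "g = (\<lambda>(f :: int \<Rightarrow> real, z). \<phi> (f s - \<theta> * f (s - 1)) (f (s - 1)) * \<phi> z (f (t - 1)))"
    have in_past: "s \<in> {..<t}" "s - 1 \<in> {..<t}" "t - 1 \<in> {..<t}"
      using that by auto
    have g: "g \<in> borel_measurable (Pi\<^sub>M {..<t} (\<lambda>_. borel) \<Otimes>\<^sub>M borel)"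
      unfolding g_def using in_past by measurable
    have eq: "g (\<lambda>s\<in>{..<t}. X s \<omega>, innov t \<omega>') = \<xi> s \<omega> * \<phi> (innov t \<omega>') (X (t - 1) \<omega>)" for \<omega> \<omega>'
      using in_past by (simp add: g_def \<xi>_def innov_def)
    have \<xi>_t: "\<xi> t \<omega> = \<phi> (innov t \<omega>) (X (t - 1) \<omega>)" for \<omega>
      by (simp add: \<xi>_def)
    have int: "integrable M (\<lambda>\<omega>. g (\<lambda>s\<in>{..<t}. X s \<omega>, innov t \<omega>))"
      unfolding eq using \<xi>_int[of s t] unfolding \<xi>_t .
    have "expectation (\<lambda>\<omega>. \<xi> s \<omega> * \<xi> t \<omega>) =
        expectation (\<lambda>\<omega>. expectation (\<lambda>\<omega>'. \<xi> s \<omega> * \<phi> (innov t \<omega>') (X (t - 1) \<omega>)))"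
      using expectation_indep_pair[OF innov_indep_past g int] unfolding eq \<xi>_t .
    also have "\<dots> = expectation (\<lambda>\<omega>. \<xi> s \<omega> * expectation (\<lambda>\<omega>'. \<phi> (innov t \<omega>') (X (t - 1) \<omega>)))"
      by simp
    also have "\<dots> = 0"
    proof -
      have "expectation (\<lambda>\<omega>'. \<phi> (innov t \<omega>') x) = 0" for x
        using expectation_innov[of "\<lambda>z. \<phi> z x" t] centred by simp
      then show ?thesis
        by simp
    qed
    finally show ?thesis .
  qed
  have "expectation (\<lambda>\<omega>. \<xi> (int s) \<omega> * \<xi> (int t) \<omega>) =
      (if s = t then expectation (\<lambda>\<omega>. (\<phi> (innov 1 \<omega>) (X 0 \<omega>))\<^sup>2) else 0)" for s t :: nat
    using orth[of "int s" "int t"] orth[of "int t" "int s"] \<xi>_sq(2)[of "int t"]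
    by (cases s t rule: linorder_cases) (auto simp: power2_eq_square mult.commute)
  moreover have "expectation (\<lambda>\<omega>. (\<Sum>t=2..n. \<xi> (int t) \<omega>)\<^sup>2) =
      (\<Sum>s=2..n. \<Sum>t=2..n. expectation (\<lambda>\<omega>. \<xi> (int s) \<omega> * \<xi> (int t) \<omega>))"
    unfolding power2_eq_square sum_product by (rule integral_double_sum) (rule \<xi>_int)
  ultimately have "expectation (\<lambda>\<omega>. (\<Sum>t=2..n. \<xi> (int t) \<omega>)\<^sup>2) =
      real (n - 1) * expectation (\<lambda>\<omega>. (\<phi> (innov 1 \<omega>) (X 0 \<omega>))\<^sup>2)"
    by (simp add: sum.delta)
  also have "\<dots> \<le> real n * expectation (\<lambda>\<omega>. (\<phi> (innov 1 \<omega>) (X 0 \<omega>))\<^sup>2)"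
    by (intro mult_right_mono) auto
  finally show "expectation (\<lambda>\<omega>. (\<Sum>t=2..n. \<phi> (innov (int t) \<omega>) (X (int t - 1) \<omega>))\<^sup>2) \<le>
      real n * expectation (\<lambda>\<omega>. (\<phi> (innov 1 \<omega>) (X 0 \<omega>))\<^sup>2)"
    by (simp add: \<xi>_def)
  have "integrable M (\<lambda>\<omega>. (\<Sum>t=2..n. \<xi> (int t) \<omega>)\<^sup>2)"
    by (intro integrable_sum_square \<xi>_sq) auto
  then show "integrable M (\<lambda>\<omega>. (\<Sum>t=2..n. \<phi> (innov (int t) \<omega>) (X (int t - 1) \<omega>))\<^sup>2)"
    by (simp add: \<xi>_def)
qed

lemma martingale_difference_abs:
  fixes \<phi> :: "real \<Rightarrow> real \<Rightarrow> real"
  assumes \<phi> [measurable]: "case_prod \<phi> \<in> borel_measurable (borel \<Otimes>\<^sub>M borel)"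
    and centred: "\<And>x. expectation (\<lambda>\<omega>. \<phi> (innov 1 \<omega>) x) = 0"
    and sq: "integrable M (\<lambda>\<omega>. (\<phi> (innov 1 \<omega>) (X 0 \<omega>))\<^sup>2)"
  shows "integrable M (\<lambda>\<omega>. \<Sum>t=2..n. \<phi> (innov (int t) \<omega>) (X (int t - 1) \<omega>))"
    and "expectation (\<lambda>\<omega>. \<bar>\<Sum>t=2..n. \<phi> (innov (int t) \<omega>) (X (int t - 1) \<omega>)\<bar>) \<le>
      sqrt (real n) * sqrt (expectation (\<lambda>\<omega>. (\<phi> (innov 1 \<omega>) (X 0 \<omega>))\<^sup>2))"
proof -
  note * = martingale_difference_square[OF assms, of n]
  show "integrable M (\<lambda>\<omega>. \<Sum>t=2..n. \<phi> (innov (int t) \<omega>) (X (int t - 1) \<omega>))"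
    by (rule integrable_of_square[OF _ *(1)]) measurable
  show "expectation (\<lambda>\<omega>. \<bar>\<Sum>t=2..n. \<phi> (innov (int t) \<omega>) (X (int t - 1) \<omega>)\<bar>) \<le>
      sqrt (real n) * sqrt (expectation (\<lambda>\<omega>. (\<phi> (innov 1 \<omega>) (X 0 \<omega>))\<^sup>2))"
    unfolding real_sqrt_mult[symmetric]
    by (rule order.trans[OF expectation_abs_le_sqrt[OF _ *(1)]]) (use *(2) in auto)
qed

section \<open>Law of large numbers in mean for the squares\<close>

lemma sum_lag:
  fixes x :: "int \<Rightarrow> real"
  assumes "1 \<le> n"
  shows "(\<Sum>t=2..n. x (int t)) = (\<Sum>t=2..n. x (int t - 1)) + x (int n) - x 1"
  using assms
proof (induction n rule: dec_induct)
  case (step n)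
  then show ?case
    by (simp add: sum.atLeast_Suc_atMost)
qed simp

text \<open>No ergodic theorem is involved. Squaring and summing the recursion expresses
  \<open>1 - \<theta>\<^sup>2\<close> times the centred sum of squares through martingale sums,
  which are of order \<open>sqrt n\<close> in mean because fourth moments exist, and boundary terms,
  which are bounded in mean and absorbed by \<open>sqrt n \<ge> 1\<close>.\<close>

lemma X_square_average:
  obtains C where "C \<ge> 0" "\<And>n. 1 \<le> n \<Longrightarrow>
    expectation (\<lambda>\<omega>. \<bar>(\<Sum>t=2..n. (X (int t - 1) \<omega>)\<^sup>2) - (real n - 1) * expectation (\<lambda>\<omega>. (X 0 \<omega>)\<^sup>2)\<bar>) \<le> C * sqrt n"
proof -
  define m where "m = expectation (X 0)"
  define v where "v = expectation (\<lambda>\<omega>. (X 0 \<omega>)\<^sup>2)"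
  define \<mu> where "\<mu> = expectation (innov 1)"
  define q where "q = expectation (\<lambda>\<omega>. (innov 1 \<omega>)\<^sup>2)"
  have X_eq: "X t \<omega> = \<theta> * X (t - 1) \<omega> + innov t \<omega>" for t \<omega>
    by (simp add: innov_def)
  have prod: "integrable M (\<lambda>\<omega>. X 0 \<omega> * innov 1 \<omega>)"
    using X_moments innov_moments by (intro integrable_mult_of_squares) auto
  have m_eq: "(1 - \<theta>) * m = \<mu>"
  proof -
    have "m = expectation (\<lambda>\<omega>. \<theta> * X 0 \<omega> + innov 1 \<omega>)"
      using expectation_X[of "\<lambda>x. x" 1] X_eq[of 1] by (simp add: m_def)
    also have "\<dots> = \<theta> * m + \<mu>"
      using X_moments innov_moments by (simp add: m_def \<mu>_def)
    finally show ?thesis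
      by (simp add: algebra_simps)
  qed
  have cross: "expectation (\<lambda>\<omega>. X 0 \<omega> * innov 1 \<omega>) = m * \<mu>"
  proof -
    have "expectation (\<lambda>\<omega>. X 0 \<omega> * innov 1 \<omega>) = expectation (\<lambda>\<omega>. X 0 \<omega> * expectation (innov 1))"
      using expectation_indep_pair[OF innov_indep_lag[of 1], of "\<lambda>(x, z). x * z"] prod by simp
    then show ?thesis
      by (simp add: m_def \<mu>_def)
  qed
  have v_eq: "(1 - \<theta>\<^sup>2) * v = 2 * \<theta> * \<mu> * m + q"
  proof -
    have "v = expectation (\<lambda>\<omega>. \<theta>\<^sup>2 * (X 0 \<omega>)\<^sup>2 + 2 * \<theta> * (X 0 \<omega> * innov 1 \<omega>) + (innov 1 \<omega>)\<^sup>2)"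
      using expectation_X[of "\<lambda>x. x\<^sup>2" 1] X_eq[of 1]
      by (simp add: v_def power2_sum power_mult_distrib mult_ac add_ac)
    also have "\<dots> = \<theta>\<^sup>2 * v + 2 * \<theta> * (m * \<mu>) + q"
      using X_moments innov_moments prod cross by (simp add: v_def q_def)
    finally show ?thesis
      by (simp add: algebra_simps)
  qed

  \<comment> \<open>The mean \<open>\<mu>\<close> of the innovations may differ from 0, so the sum
    of the \<open>X\<close>'s enters the identity for the squares and needs its own centring,
    through \<open>\<phi>1\<close>. The cross term and the squared innovation give
    \<open>\<phi>2\<close> and \<open>\<phi>3\<close>.\<close>
  define \<phi>1 \<phi>2 \<phi>3 :: "real \<Rightarrow> real \<Rightarrow> real"
    where "\<phi>1 = (\<lambda>z x. z - \<mu>)" and "\<phi>2 = (\<lambda>z x. x * (z - \<mu>))" and "\<phi>3 = (\<lambda>z x. z\<^sup>2 - q)"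
  have \<phi>_meas: "case_prod \<phi>1 \<in> borel_measurable (borel \<Otimes>\<^sub>M borel)"
    "case_prod \<phi>2 \<in> borel_measurable (borel \<Otimes>\<^sub>M borel)"
    "case_prod \<phi>3 \<in> borel_measurable (borel \<Otimes>\<^sub>M borel)"
    unfolding \<phi>1_def \<phi>2_def \<phi>3_def by measurable
  have \<phi>_centred: "expectation (\<lambda>\<omega>. \<phi>1 (innov 1 \<omega>) x) = 0" "expectation (\<lambda>\<omega>. \<phi>2 (innov 1 \<omega>) x) = 0"
    "expectation (\<lambda>\<omega>. \<phi>3 (innov 1 \<omega>) x) = 0" for x
    using innov_moments[of 1] by (simp_all add: \<phi>1_def \<phi>2_def \<phi>3_def \<mu>_def q_def prob_space)
  have \<phi>1_sq: "integrable M (\<lambda>\<omega>. (\<phi>1 (innov 1 \<omega>) (X 0 \<omega>))\<^sup>2)"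
    unfolding \<phi>1_def using innov_moments integrable_add_square[of "innov 1" "\<lambda>_. - \<mu>"] by simp
  have innov4: "integrable M (\<lambda>\<omega>. ((innov 1 \<omega> - \<mu>)\<^sup>2)\<^sup>2)"
  proof (rule Bochner_Integration.integrable_bound)
    show "integrable M (\<lambda>\<omega>. 8 * (innov 1 \<omega>) ^ 4 + 8 * \<mu> ^ 4)"
      using innov_moments by simp
    show "AE \<omega> in M. norm (((innov 1 \<omega> - \<mu>)\<^sup>2)\<^sup>2) \<le> norm (8 * (innov 1 \<omega>) ^ 4 + 8 * \<mu> ^ 4)"
    proof (rule AE_I2)
      fix \<omega>
      define a where "a = innov 1 \<omega>"
      have sq: "(c - d)\<^sup>2 \<le> 2 * c\<^sup>2 + 2 * d\<^sup>2" "(c + d)\<^sup>2 \<le> 2 * c\<^sup>2 + 2 * d\<^sup>2" for c d :: real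
        using zero_le_power2[of "c + d"] zero_le_power2[of "c - d"]
        by (simp_all add: power2_sum power2_diff)
      have "((a - \<mu>)\<^sup>2)\<^sup>2 \<le> (2 * a\<^sup>2 + 2 * \<mu>\<^sup>2)\<^sup>2"
        by (intro power_mono sq) auto
      also have "\<dots> \<le> 2 * (2 * a\<^sup>2)\<^sup>2 + 2 * (2 * \<mu>\<^sup>2)\<^sup>2"
        by (rule sq)
      also have "\<dots> = 8 * a ^ 4 + 8 * \<mu> ^ 4"
        by (simp add: power_mult_distrib)
      finally show "norm (((innov 1 \<omega> - \<mu>)\<^sup>2)\<^sup>2) \<le> norm (8 * (innov 1 \<omega>) ^ 4 + 8 * \<mu> ^ 4)"
        by (simp add: a_def)
    qed
  qed measurable
  have \<phi>2_sq: "integrable M (\<lambda>\<omega>. (\<phi>2 (innov 1 \<omega>) (X 0 \<omega>))\<^sup>2)"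
    unfolding \<phi>2_def power_mult_distrib using X_moment4[of 0] innov4
    by (intro integrable_mult_of_squares) auto
  have \<phi>3_sq: "integrable M (\<lambda>\<omega>. (\<phi>3 (innov 1 \<omega>) (X 0 \<omega>))\<^sup>2)"
    unfolding \<phi>3_def using innov_moments(1)[of 1]
      integrable_add_square[of "\<lambda>\<omega>. (innov 1 \<omega>)\<^sup>2" "\<lambda>_. - q"] by simp
  define c where "c = (\<lambda>\<phi>. sqrt (expectation (\<lambda>\<omega>. (\<phi> (innov 1 \<omega>) (X 0 \<omega>))\<^sup>2)))"
  define \<Sigma> where "\<Sigma> = (\<lambda>\<phi> n \<omega>. \<Sum>t=2..n. \<phi> (innov (int t) \<omega>) (X (int t - 1) \<omega>) :: real)"
  have \<Sigma>: "integrable M (\<Sigma> \<phi>1 n)" "integrable M (\<Sigma> \<phi>2 n)" "integrable M (\<Sigma> \<phi>3 n)"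
    "expectation (\<lambda>\<omega>. \<bar>\<Sigma> \<phi>1 n \<omega>\<bar>) \<le> sqrt n * c \<phi>1" "expectation (\<lambda>\<omega>. \<bar>\<Sigma> \<phi>2 n \<omega>\<bar>) \<le> sqrt n * c \<phi>2"
    "expectation (\<lambda>\<omega>. \<bar>\<Sigma> \<phi>3 n \<omega>\<bar>) \<le> sqrt n * c \<phi>3" for n
    using martingale_difference_abs[OF \<phi>_meas(1) \<phi>_centred(1) \<phi>1_sq, of n]
      martingale_difference_abs[OF \<phi>_meas(2) \<phi>_centred(2) \<phi>2_sq, of n]
      martingale_difference_abs[OF \<phi>_meas(3) \<phi>_centred(3) \<phi>3_sq, of n]
    by (simp_all add: \<Sigma>_def c_def)
  define A where "A = (\<lambda>n \<omega>. (\<Sum>t=2..n. X (int t - 1) \<omega>) - (real n - 1) * m)"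
  define B where "B = (\<lambda>n \<omega>. (\<Sum>t=2..n. (X (int t - 1) \<omega>)\<^sup>2) - (real n - 1) * v)"
  have card: "(\<Sum>t=2..n. r) = (real n - 1) * r" if "1 \<le> n" for n and r :: real
    using that by (simp add: of_nat_diff)
  have A_eq: "(1 - \<theta>) * A n \<omega> = \<Sigma> \<phi>1 n \<omega> + X 1 \<omega> - X (int n) \<omega>" if n: "1 \<le> n" for n \<omega>
  proof -
    have "(\<Sum>t=2..n. X (int t) \<omega>) = (\<Sum>t=2..n. \<theta> * X (int t - 1) \<omega> + \<phi>1 (innov (int t) \<omega>) (X (int t - 1) \<omega>) + \<mu>)"
      by (intro sum.cong refl) (simp add: innov_def \<phi>1_def)
    also have "\<dots> = \<theta> * (\<Sum>t=2..n. X (int t - 1) \<omega>) + \<Sigma> \<phi>1 n \<omega> + (real n - 1) * \<mu>"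
      unfolding sum.distrib card[OF n] \<Sigma>_def sum_distrib_left ..
    finally show ?thesis
      unfolding sum_lag[OF n, of "\<lambda>t. X t \<omega>"] A_def m_eq[symmetric] by (simp add: algebra_simps)
  qed
  \<comment> \<open>The squared recursion, summed. Shifting the index of the left-hand sum yields
    the factor \<open>1 - \<theta>\<^sup>2\<close> and the two boundary squares; \<open>v_eq\<close>
    removes the constants.\<close>
  have B_eq: "(1 - \<theta>\<^sup>2) * B n \<omega> = 2 * \<theta> * \<Sigma> \<phi>2 n \<omega> + 2 * \<theta> * \<mu> * A n \<omega> + \<Sigma> \<phi>3 n \<omega> + (X 1 \<omega>)\<^sup>2 - (X (int n) \<omega>)\<^sup>2"
    if n: "1 \<le> n" for n \<omega>
  proof -
    have "(\<Sum>t=2..n. (X (int t) \<omega>)\<^sup>2) = (\<Sum>t=2..n. \<theta>\<^sup>2 * (X (int t - 1) \<omega>)\<^sup>2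
        + 2 * \<theta> * \<phi>2 (innov (int t) \<omega>) (X (int t - 1) \<omega>) + 2 * \<theta> * \<mu> * X (int t - 1) \<omega>
        + \<phi>3 (innov (int t) \<omega>) (X (int t - 1) \<omega>) + q)"
    proof (intro sum.cong refl)
      fix t
      show "(X (int t) \<omega>)\<^sup>2 = \<theta>\<^sup>2 * (X (int t - 1) \<omega>)\<^sup>2
        + 2 * \<theta> * \<phi>2 (innov (int t) \<omega>) (X (int t - 1) \<omega>) + 2 * \<theta> * \<mu> * X (int t - 1) \<omega>
        + \<phi>3 (innov (int t) \<omega>) (X (int t - 1) \<omega>) + q"
        unfolding X_eq[of "int t"] \<phi>2_def \<phi>3_def by (simp add: power2_eq_square algebra_simps)
    qed
    also have "\<dots> = \<theta>\<^sup>2 * (\<Sum>t=2..n. (X (int t - 1) \<omega>)\<^sup>2) + 2 * \<theta> * \<Sigma> \<phi>2 n \<omega>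
        + 2 * \<theta> * \<mu> * (\<Sum>t=2..n. X (int t - 1) \<omega>) + \<Sigma> \<phi>3 n \<omega> + (real n - 1) * q"
      unfolding sum.distrib card[OF n] \<Sigma>_def sum_distrib_left ..
    finally have "(1 - \<theta>\<^sup>2) * (\<Sum>t=2..n. (X (int t - 1) \<omega>)\<^sup>2) = 2 * \<theta> * \<Sigma> \<phi>2 n \<omega>
        + 2 * \<theta> * \<mu> * (\<Sum>t=2..n. X (int t - 1) \<omega>) + \<Sigma> \<phi>3 n \<omega> + (real n - 1) * q + (X 1 \<omega>)\<^sup>2 - (X (int n) \<omega>)\<^sup>2"
      unfolding sum_lag[OF n, of "\<lambda>t. (X t \<omega>)\<^sup>2"] by (simp add: algebra_simps)
    moreover have "(1 - \<theta>\<^sup>2) * ((real n - 1) * v) = (real n - 1) * (2 * \<theta> * \<mu> * m + q)"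
      unfolding v_eq[symmetric] by simp
    ultimately show ?thesis
      unfolding B_def A_def right_diff_distrib by (simp add: algebra_simps)
  qed
  have A_int: "integrable M (A n)" and B_int: "integrable M (B n)" for n
    unfolding A_def B_def using X_moments by (auto intro!: Bochner_Integration.integrable_sum)
  have \<theta>: "1 - \<theta> > 0" "1 - \<theta>\<^sup>2 > 0"
    using \<theta>_less by (auto simp: abs_square_less_1)
  define a where "a = expectation (\<lambda>\<omega>. \<bar>X 0 \<omega>\<bar>)"
  have aX: "expectation (\<lambda>\<omega>. \<bar>X t \<omega>\<bar>) = a" and vX: "expectation (\<lambda>\<omega>. (X t \<omega>)\<^sup>2) = v" for t
    using expectation_X[of abs t] expectation_X[of "\<lambda>x. x\<^sup>2" t] by (simp_all add: a_def v_def)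
  have av: "a \<ge> 0" "v \<ge> 0" and c_nonneg: "c \<phi> \<ge> 0" for \<phi>
    by (simp_all add: a_def v_def c_def)
  define CA where "CA = (c \<phi>1 + 2 * a) / (1 - \<theta>)"
  define CB where "CB = (2 * \<bar>\<theta>\<bar> * c \<phi>2 + 2 * \<bar>\<theta> * \<mu>\<bar> * CA + c \<phi>3 + 2 * v) / (1 - \<theta>\<^sup>2)"
  have EA: "expectation (\<lambda>\<omega>. \<bar>A n \<omega>\<bar>) \<le> CA * sqrt n" if n: "1 \<le> n" for n
  proof -
    have "(1 - \<theta>) * expectation (\<lambda>\<omega>. \<bar>A n \<omega>\<bar>) = expectation (\<lambda>\<omega>. \<bar>(1 - \<theta>) * A n \<omega>\<bar>)"
      using \<theta> by (simp add: abs_mult)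
    also have "\<dots> \<le> expectation (\<lambda>\<omega>. \<bar>\<Sigma> \<phi>1 n \<omega>\<bar> + \<bar>X 1 \<omega>\<bar> + \<bar>X (int n) \<omega>\<bar>)"
      unfolding A_eq[OF n] using \<Sigma> X_moments by (intro integral_mono) auto
    also have "\<dots> = expectation (\<lambda>\<omega>. \<bar>\<Sigma> \<phi>1 n \<omega>\<bar>) + a + a"
      using \<Sigma> X_moments aX by simp
    also have "\<dots> \<le> sqrt n * c \<phi>1 + sqrt n * (2 * a)"
      using \<Sigma>(4)[of n] n mult_right_mono[of 1 "sqrt n" "2 * a"] av by simp
    finally have "(1 - \<theta>) * expectation (\<lambda>\<omega>. \<bar>A n \<omega>\<bar>) \<le> (c \<phi>1 + 2 * a) * sqrt n"
      by (simp add: algebra_simps)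
    then show ?thesis
      using \<theta> by (simp add: CA_def le_divide_eq mult.commute)
  qed
  have EB: "expectation (\<lambda>\<omega>. \<bar>B n \<omega>\<bar>) \<le> CB * sqrt n" if n: "1 \<le> n" for n
  proof -
    have "(1 - \<theta>\<^sup>2) * expectation (\<lambda>\<omega>. \<bar>B n \<omega>\<bar>) = expectation (\<lambda>\<omega>. \<bar>(1 - \<theta>\<^sup>2) * B n \<omega>\<bar>)"
      using \<theta> by (simp add: abs_mult)
    also have "\<dots> \<le> expectation (\<lambda>\<omega>. 2 * \<bar>\<theta>\<bar> * \<bar>\<Sigma> \<phi>2 n \<omega>\<bar> + 2 * \<bar>\<theta> * \<mu>\<bar> * \<bar>A n \<omega>\<bar> + \<bar>\<Sigma> \<phi>3 n \<omega>\<bar> + (X 1 \<omega>)\<^sup>2 + (X (int n) \<omega>)\<^sup>2)"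
    proof (rule integral_mono)
      fix \<omega>
      have "\<bar>x + y + z + s - r\<bar> \<le> \<bar>x\<bar> + \<bar>y\<bar> + \<bar>z\<bar> + s + r" if "s \<ge> 0" "r \<ge> 0" for x y z s r :: real
        using that by linarith
      from this[of "(X 1 \<omega>)\<^sup>2" "(X (int n) \<omega>)\<^sup>2" "2 * \<theta> * \<Sigma> \<phi>2 n \<omega>" "2 * \<theta> * \<mu> * A n \<omega>" "\<Sigma> \<phi>3 n \<omega>"]
      show "\<bar>(1 - \<theta>\<^sup>2) * B n \<omega>\<bar> \<le> 2 * \<bar>\<theta>\<bar> * \<bar>\<Sigma> \<phi>2 n \<omega>\<bar> + 2 * \<bar>\<theta> * \<mu>\<bar> * \<bar>A n \<omega>\<bar> + \<bar>\<Sigma> \<phi>3 n \<omega>\<bar> + (X 1 \<omega>)\<^sup>2 + (X (int n) \<omega>)\<^sup>2"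
        unfolding B_eq[OF n] by (simp add: abs_mult mult.assoc)
    qed (use \<Sigma> A_int B_int X_moments in auto)
    also have "\<dots> = 2 * \<bar>\<theta>\<bar> * expectation (\<lambda>\<omega>. \<bar>\<Sigma> \<phi>2 n \<omega>\<bar>) + 2 * \<bar>\<theta> * \<mu>\<bar> * expectation (\<lambda>\<omega>. \<bar>A n \<omega>\<bar>)
        + expectation (\<lambda>\<omega>. \<bar>\<Sigma> \<phi>3 n \<omega>\<bar>) + v + v"
      using \<Sigma> A_int X_moments vX by simp
    also have "\<dots> \<le> 2 * \<bar>\<theta>\<bar> * (sqrt n * c \<phi>2) + 2 * \<bar>\<theta> * \<mu>\<bar> * (CA * sqrt n) + sqrt n * c \<phi>3 + sqrt n * v + sqrt n * v"
      using \<Sigma>(5,6)[of n] EA[OF n] n mult_right_mono[of 1 "sqrt n" v] av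
      by (intro add_mono mult_left_mono) auto
    finally have "(1 - \<theta>\<^sup>2) * expectation (\<lambda>\<omega>. \<bar>B n \<omega>\<bar>) \<le>
        (2 * \<bar>\<theta>\<bar> * c \<phi>2 + 2 * \<bar>\<theta> * \<mu>\<bar> * CA + c \<phi>3 + 2 * v) * sqrt n"
      by (simp add: algebra_simps)
    then show ?thesis
      using \<theta> by (simp add: CB_def le_divide_eq mult.commute)
  qed
  have "CB \<ge> 0"
    using \<theta> av c_nonneg by (auto simp: CB_def CA_def)
  then show ?thesis
    using that EB by (simp add: B_def v_def)
qed

end

section \<open>Characteristic functions\<close>

lemma has_vector_derivative_of_quadratic_remainder:
  fixes g :: "real \<Rightarrow> complex"
  assumes "\<And>h. cmod (g (t + h) - g t - h *\<^sub>R L) \<le> C * h\<^sup>2"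
  shows "(g has_vector_derivative L) (at t)"
proof -
  have "((\<lambda>h. norm (g (t + h) - g t - h *\<^sub>R L) / norm h) \<longlongrightarrow> 0) (at 0)"
  proof (rule tendsto_sandwich[of "\<lambda>_. 0" _ _ "\<lambda>h. C * \<bar>h\<bar>"])
    show "\<forall>\<^sub>F h in at 0. norm (g (t + h) - g t - h *\<^sub>R L) / norm h \<le> C * \<bar>h\<bar>"
    proof (rule always_eventually, rule allI)
      fix h
      have "norm (g (t + h) - g t - h *\<^sub>R L) / norm h \<le> C * h\<^sup>2 / \<bar>h\<bar>"
        using assms[of h] by (simp add: divide_right_mono)
      also have "\<dots> = C * \<bar>h\<bar>"
        by (cases "h = 0") (auto simp: power2_eq_square abs_if)
      finally show "norm (g (t + h) - g t - h *\<^sub>R L) / norm h \<le> C * \<bar>h\<bar>" .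
    qed
  qed (auto intro!: tendsto_eq_intros)
  then show ?thesis
    unfolding has_vector_derivative_def has_derivative_at
    by (auto intro: bounded_linear_intros)
qed

text \<open>Second moments suffice: the first-order remainder of \<open>iexp\<close> is at most half
  the square of its argument, which gives an error quadratic in \<open>h\<close>.\<close>

lemma (in prob_space) char_has_vector_derivative:
  fixes S :: "'a \<Rightarrow> real"
  assumes [measurable]: "S \<in> borel_measurable M" and sq: "integrable M (\<lambda>\<omega>. (S \<omega>)\<^sup>2)"
  shows "((\<lambda>t. CLINT \<omega>|M. iexp (t * S \<omega>)) has_vector_derivative
    (CLINT \<omega>|M. \<i> * S \<omega> * iexp (t * S \<omega>))) (at t)"
proof (rule has_vector_derivative_of_quadratic_remainder)
  fix h :: real
  have int1: "integrable M (\<lambda>\<omega>. iexp (s * S \<omega>))" for s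
    by (rule integrable_const_bound[where B = 1]) auto
  have "integrable M (\<lambda>\<omega>. complex_of_real (S \<omega>))"
    using integrable_of_square[OF _ sq] by simp
  then have int2: "integrable M (\<lambda>\<omega>. \<i> * S \<omega> * iexp (t * S \<omega>))"
    by (rule Bochner_Integration.integrable_bound) (auto simp: norm_mult)
  have "(CLINT \<omega>|M. iexp ((t + h) * S \<omega>)) - (CLINT \<omega>|M. iexp (t * S \<omega>)) -
      h *\<^sub>R (CLINT \<omega>|M. \<i> * S \<omega> * iexp (t * S \<omega>)) =
      (CLINT \<omega>|M. iexp ((t + h) * S \<omega>) - iexp (t * S \<omega>) - h *\<^sub>R (\<i> * S \<omega> * iexp (t * S \<omega>)))"
    by (subst Bochner_Integration.integral_diff Bochner_Integration.integral_scaleR_right[symmetric]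
          integral_scaleR_right[symmetric];
        (intro Bochner_Integration.integrable_diff integrable_scaleR_right int1 int2)?)+ simp
  also have "cmod \<dots> \<le> (LINT \<omega>|M. h\<^sup>2 / 2 * (S \<omega>)\<^sup>2)"
  proof (rule norm_integral_le_integral)
    fix \<omega>
    have "iexp ((t + h) * S \<omega>) - iexp (t * S \<omega>) - h *\<^sub>R (\<i> * S \<omega> * iexp (t * S \<omega>)) =
        iexp (t * S \<omega>) * (iexp (h * S \<omega>) - (\<Sum>k\<le>1. (\<i> * (h * S \<omega>)) ^ k / fact k))"
      by (simp add: algebra_simps exp_add scaleR_conv_of_real)
    also have "cmod \<dots> \<le> \<bar>h * S \<omega>\<bar> ^ Suc 1 / fact (Suc 1)"
      unfolding norm_mult using iexp_approx1[of "h * S \<omega>" 1] by simp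
    finally show "cmod (iexp ((t + h) * S \<omega>) - iexp (t * S \<omega>) -
        h *\<^sub>R (\<i> * S \<omega> * iexp (t * S \<omega>))) \<le> h\<^sup>2 / 2 * (S \<omega>)\<^sup>2"
      by (simp add: power2_eq_square mult_ac)
    show "integrable M (\<lambda>\<omega>. iexp ((t + h) * S \<omega>) - iexp (t * S \<omega>) - h *\<^sub>R (\<i> * S \<omega> * iexp (t * S \<omega>)))"
      by (intro Bochner_Integration.integrable_diff integrable_scaleR_right int1 int2)
  qed (use sq in auto)
  finally show "cmod ((CLINT \<omega>|M. iexp ((t + h) * S \<omega>)) - (CLINT \<omega>|M. iexp (t * S \<omega>)) -
      h *\<^sub>R (CLINT \<omega>|M. \<i> * S \<omega> * iexp (t * S \<omega>))) \<le>
      (1 / 2 * expectation (\<lambda>\<omega>. (S \<omega>)\<^sup>2)) * h\<^sup>2"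
    using sq by (simp add: mult.commute)
qed

text \<open>With the integrating factor \<open>exp (v * s\<^sup>2 / 2)\<close> the defect
  \<open>\<phi>' s + s * v * \<phi> s\<close> becomes a derivative. On the segment from 0 to
  \<open>t\<close> the factor is at most its value at \<open>t\<close>, which cancels when the
  product is divided by it.\<close>

lemma gaussian_ode_bound:
  fixes \<phi> :: "real \<Rightarrow> complex" and v t E :: real
  assumes deriv: "\<And>s. (\<phi> has_vector_derivative \<phi>' s) (at s)"
    and init: "\<phi> 0 = 1" and "v \<ge> 0"
    and bound: "\<And>s. \<bar>s\<bar> \<le> \<bar>t\<bar> \<Longrightarrow> cmod (\<phi>' s + s * v * \<phi> s) \<le> E"
  shows "cmod (\<phi> t - of_real (exp (- v * t\<^sup>2 / 2))) \<le> \<bar>t\<bar> * E"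
proof -
  define u where "u = (\<lambda>s. complex_of_real (exp (v * s\<^sup>2 / 2)))"
  have "E \<ge> 0"
    using bound[of 0] order.trans[OF norm_ge_zero] by fastforce
  have u: "(u has_vector_derivative of_real (exp (v * s\<^sup>2 / 2) * (v * s))) (at s within A)" for s A
    unfolding u_def
    by (intro has_vector_derivative_of_real)
       (auto intro!: derivative_eq_intros simp flip: has_real_derivative_iff_has_vector_derivative)
  have prod: "((\<lambda>s. u s * \<phi> s) has_vector_derivative u s * (\<phi>' s + s * v * \<phi> s)) (at s within A)"
    for s A
  proof -
    have "((\<lambda>s. u s * \<phi> s) has_vector_derivative
        u s * \<phi>' s + of_real (exp (v * s\<^sup>2 / 2) * (v * s)) * \<phi> s) (at s within A)"
      using has_vector_derivative_mult[OF u has_vector_derivative_at_within[OF deriv]] .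
    then show ?thesis
      by (simp add: u_def algebra_simps)
  qed
  have "norm ((\<lambda>s. u s * \<phi> s) t - (\<lambda>s. u s * \<phi> s) 0) \<le> exp (v * t\<^sup>2 / 2) * E * norm (t - 0)"
  proof (rule differentiable_bound[where f' = "\<lambda>s h. h *\<^sub>R (u s * (\<phi>' s + s * v * \<phi> s))"
        and S = "closed_segment 0 t"])
    fix s
    assume "s \<in> closed_segment 0 t"
    then have s: "\<bar>s\<bar> \<le> \<bar>t\<bar>"
      by (auto simp: closed_segment_eq_real_ivl split: if_splits)
    then have "s\<^sup>2 \<le> t\<^sup>2"
      by (simp add: abs_le_square_iff)
    then have "v * s\<^sup>2 / 2 \<le> v * t\<^sup>2 / 2"
      using \<open>v \<ge> 0\<close> by (simp add: mult_left_mono)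
    then have "cmod (u s * (\<phi>' s + s * v * \<phi> s)) \<le> exp (v * t\<^sup>2 / 2) * E"
      unfolding norm_mult using bound[OF s] \<open>E \<ge> 0\<close> by (intro mult_mono) (auto simp: u_def)
    then show "onorm (\<lambda>h. h *\<^sub>R (u s * (\<phi>' s + s * v * \<phi> s))) \<le> exp (v * t\<^sup>2 / 2) * E"
      by (simp add: onorm_scaleR_left[OF bounded_linear_ident] onorm_id)
    show "((\<lambda>s. u s * \<phi> s) has_derivative (\<lambda>h. h *\<^sub>R (u s * (\<phi>' s + s * v * \<phi> s))))
        (at s within closed_segment 0 t)"
      using prod by (simp add: has_vector_derivative_def)
  qed auto
  then have "cmod (u t * \<phi> t - 1) \<le> exp (v * t\<^sup>2 / 2) * E * \<bar>t\<bar>"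
    by (simp add: init u_def)
  then have "exp (- v * t\<^sup>2 / 2) * cmod (u t * \<phi> t - 1) \<le>
      exp (- v * t\<^sup>2 / 2) * (exp (v * t\<^sup>2 / 2) * E * \<bar>t\<bar>)"
    by (intro mult_left_mono) auto
  also have "\<dots> = \<bar>t\<bar> * E"
    by (simp add: mult.assoc[symmetric] exp_add[symmetric])
  also have "exp (- v * t\<^sup>2 / 2) * cmod (u t * \<phi> t - 1) =
      cmod (of_real (exp (- v * t\<^sup>2 / 2)) * (u t * \<phi> t - 1))"
    by (simp add: norm_mult)
  also have "of_real (exp (- v * t\<^sup>2 / 2)) * (u t * \<phi> t - 1) = \<phi> t - of_real (exp (- v * t\<^sup>2 / 2))"
  proof -
    have "complex_of_real (exp (- v * t\<^sup>2 / 2)) * u t = 1"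
      unfolding u_def of_real_mult[symmetric] exp_add[symmetric] by simp
    then show ?thesis
      by (simp add: algebra_simps)
  qed
  finally show ?thesis .
qed

section \<open>Exchangeable rows\<close>

locale exchangeable_row = prob_space M for M :: "'a measure" +
  fixes n :: nat and W :: "nat \<Rightarrow> 'a \<Rightarrow> real"
  assumes two_le: "2 \<le> n"
    and W_measurable: "\<And>j. j \<in> {1..n} \<Longrightarrow> W j \<in> borel_measurable M"
    and exchangeable: "\<And>p. p permutes {1..n} \<Longrightarrow>
        distr M (Pi\<^sub>M {1..n} (\<lambda>_. borel)) (\<lambda>\<omega>. \<lambda>t\<in>{1..n}. W (p t) \<omega>) =
        distr M (Pi\<^sub>M {1..n} (\<lambda>_. borel)) (\<lambda>\<omega>. \<lambda>t\<in>{1..n}. W t \<omega>)"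
begin

lemma row_measurable:
  assumes "p permutes {1..n}"
  shows "(\<lambda>\<omega>. \<lambda>t\<in>{1..n}. W (p t) \<omega>) \<in> M \<rightarrow>\<^sub>M Pi\<^sub>M {1..n} (\<lambda>_. borel)"
  using assms by (intro measurable_restrict W_measurable) (simp only: permutes_in_image)

lemma expectation_permute:
  fixes F :: "(nat \<Rightarrow> real) \<Rightarrow> 'b::{banach, second_countable_topology}"
  assumes p: "p permutes {1..n}" and F: "F \<in> borel_measurable (Pi\<^sub>M {1..n} (\<lambda>_. borel))"
  shows "(LINT \<omega>|M. F (\<lambda>t\<in>{1..n}. W (p t) \<omega>)) = (LINT \<omega>|M. F (\<lambda>t\<in>{1..n}. W t \<omega>))"
  using integral_distr[OF row_measurable[OF p] F]
    integral_distr[OF row_measurable[OF permutes_id] F] exchangeable[OF p]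
  by simp

lemma integrable_permute:
  fixes F :: "(nat \<Rightarrow> real) \<Rightarrow> 'b::{banach, second_countable_topology}"
  assumes p: "p permutes {1..n}" and F: "F \<in> borel_measurable (Pi\<^sub>M {1..n} (\<lambda>_. borel))"
  shows "integrable M (\<lambda>\<omega>. F (\<lambda>t\<in>{1..n}. W (p t) \<omega>)) \<longleftrightarrow>
    integrable M (\<lambda>\<omega>. F (\<lambda>t\<in>{1..n}. W t \<omega>))"
  using integrable_distr_eq[OF row_measurable[OF p] F]
    integrable_distr_eq[OF row_measurable[OF permutes_id] F] exchangeable[OF p]
  by simp

lemma
  fixes g :: "real \<Rightarrow> real"
  assumes j: "j \<in> {1..n}" and [measurable]: "g \<in> borel_measurable borel"
  shows expectation_single: "expectation (\<lambda>\<omega>. g (W j \<omega>)) = expectation (\<lambda>\<omega>. g (W 1 \<omega>))"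
    and integrable_single: "integrable M (\<lambda>\<omega>. g (W j \<omega>)) \<longleftrightarrow> integrable M (\<lambda>\<omega>. g (W 1 \<omega>))"
proof -
  have 1: "1 \<in> {1..n}"
    using two_le by simp
  then have p: "Transposition.transpose 1 j permutes {1..n}"
    using j by (rule permutes_swap_id)
  have F: "(\<lambda>x. g (x 1)) \<in> borel_measurable (Pi\<^sub>M {1..n} (\<lambda>_. borel))"
    using 1 by measurable
  show "expectation (\<lambda>\<omega>. g (W j \<omega>)) = expectation (\<lambda>\<omega>. g (W 1 \<omega>))"
    using expectation_permute[OF p F] 1 by simp
  show "integrable M (\<lambda>\<omega>. g (W j \<omega>)) \<longleftrightarrow> integrable M (\<lambda>\<omega>. g (W 1 \<omega>))"
    using integrable_permute[OF p F] 1 by simp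
qed

lemma expectation_pair:
  fixes g :: "real \<Rightarrow> real"
  assumes jk: "j \<in> {1..n}" "k \<in> {1..n}" "j \<noteq> k" and [measurable]: "g \<in> borel_measurable borel"
  shows "expectation (\<lambda>\<omega>. g (W j \<omega>) * g (W k \<omega>)) = expectation (\<lambda>\<omega>. g (W 1 \<omega>) * g (W 2 \<omega>))"
proof -
  have 12: "1 \<in> {1..n}" "2 \<in> {1..n}"
    using two_le by simp_all
  \<comment> \<open>\<open>k'\<close> is sent to \<open>k\<close> by the swap of 1 and
    \<open>j\<close>, and \<open>k' \<noteq> 1\<close> because \<open>j \<noteq> k\<close>. Swapping
    2 with \<open>k'\<close> first therefore produces a permutation that sends 1 to \<open>j\<close>
    and 2 to \<open>k\<close>.\<close>
  define k' where "k' = Transposition.transpose 1 j k"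
  have k': "k' \<in> {1..n}" "k' \<noteq> 1"
    using jk 12 by (auto simp: k'_def Transposition.transpose_def)
  define p where "p = Transposition.transpose 1 j \<circ> Transposition.transpose 2 k'"
  have p: "p permutes {1..n}"
    unfolding p_def using 12 jk k' by (intro permutes_compose permutes_swap_id)
  have p12: "p 1 = j" "p 2 = k"
    using k' jk by (auto simp: p_def k'_def Transposition.transpose_def)
  have F: "(\<lambda>x. g (x 1) * g (x 2)) \<in> borel_measurable (Pi\<^sub>M {1..n} (\<lambda>_. borel))"
    using 12 by measurable
  show ?thesis
    using expectation_permute[OF p F] 12 p12 by simp
qed

text \<open>Exchangeability leaves just two second moments, \<open>\<beta>\<close> on the diagonal
  and \<open>\<gamma>\<close> off it. For coefficients with sum 0 the term with
  \<open>\<gamma>\<close> alone drops out, however large the correlation.\<close>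

lemma expectation_linear_square:
  fixes g :: "real \<Rightarrow> real" and e :: "nat \<Rightarrow> real"
  assumes [measurable]: "g \<in> borel_measurable borel"
    and int: "integrable M (\<lambda>\<omega>. (g (W 1 \<omega>))\<^sup>2)"
  defines "\<beta> \<equiv> expectation (\<lambda>\<omega>. (g (W 1 \<omega>))\<^sup>2)"
    and "\<gamma> \<equiv> expectation (\<lambda>\<omega>. g (W 1 \<omega>) * g (W 2 \<omega>))"
  shows "expectation (\<lambda>\<omega>. (\<Sum>j=1..n. e j * g (W j \<omega>))\<^sup>2) =
    (\<beta> - \<gamma>) * (\<Sum>j=1..n. (e j)\<^sup>2) + \<gamma> * (\<Sum>j=1..n. e j)\<^sup>2"
proof -
  note [measurable] = W_measurable
  have int_sq: "integrable M (\<lambda>\<omega>. (g (W j \<omega>))\<^sup>2)" if "j \<in> {1..n}" for j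
    using integrable_single[OF that, of "\<lambda>x. (g x)\<^sup>2"] int by simp
  have int_pair: "integrable M (\<lambda>\<omega>. g (W j \<omega>) * g (W k \<omega>))" if "j \<in> {1..n}" "k \<in> {1..n}" for j k
    using that by (intro integrable_mult_of_squares int_sq) measurable
  have e: "expectation (\<lambda>\<omega>. g (W j \<omega>) * g (W k \<omega>)) = \<gamma> + (if j = k then \<beta> - \<gamma> else 0)"
    if "j \<in> {1..n}" "k \<in> {1..n}" for j k
    using expectation_single[OF that(1), of "\<lambda>x. (g x)\<^sup>2"] expectation_pair[OF that]
    by (auto simp: \<beta>_def \<gamma>_def power2_eq_square)
  have "expectation (\<lambda>\<omega>. (\<Sum>j=1..n. e j * g (W j \<omega>))\<^sup>2) =
      expectation (\<lambda>\<omega>. \<Sum>j=1..n. \<Sum>k=1..n. e j * e k * (g (W j \<omega>) * g (W k \<omega>)))"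
    by (simp add: power2_eq_square sum_product mult.assoc mult.left_commute)
  also have "\<dots> = (\<Sum>j=1..n. \<Sum>k=1..n. e j * e k * expectation (\<lambda>\<omega>. g (W j \<omega>) * g (W k \<omega>)))"
    using int_pair by (subst integral_double_sum) auto
  also have "\<dots> = (\<Sum>j=1..n. \<Sum>k=1..n. e j * e k * (\<gamma> + (if j = k then \<beta> - \<gamma> else 0)))"
    using e by (intro sum.cong) auto
  also have "\<dots> = (\<Sum>j=1..n. \<Sum>k=1..n. e j * e k * \<gamma> + (if j = k then e j * e k * (\<beta> - \<gamma>) else 0))"
    by (intro sum.cong) (auto simp: algebra_simps)
  also have "\<dots> = (\<beta> - \<gamma>) * (\<Sum>j=1..n. (e j)\<^sup>2) + \<gamma> * (\<Sum>j=1..n. e j)\<^sup>2"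
    by (simp add: sum.distrib sum.delta power2_eq_square sum_product sum_distrib_left mult_ac)
  finally show ?thesis .
qed

text \<open>
  Summed over all pairs, this antisymmetrized form of \<open>\<phi>'\<close> no longer sees a common shift of the
  weights, and \<open>iexp (s S) - iexp (s (S - D))\<close> supplies the factor \<open>s D\<close>.
\<close>

lemma permuted_characteristic:
  fixes c :: "nat \<Rightarrow> real"
  assumes jk: "j \<in> {1..n}" "k \<in> {1..n}"
  defines "S \<equiv> \<lambda>\<omega>. \<Sum>i=1..n. c i * W i \<omega>"
    and "D \<equiv> \<lambda>\<omega>. (c j - c k) * (W j \<omega> - W k \<omega>)"
  shows "(CLINT \<omega>|M. D \<omega> * iexp (s * S \<omega>)) = - (CLINT \<omega>|M. D \<omega> * iexp (s * (S \<omega> - D \<omega>)))"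
proof (cases "j = k")
  case False
  define p where "p = Transposition.transpose j k"
  have p: "p permutes {1..n}"
    unfolding p_def using jk by (intro permutes_swap_id)
  have p_jk: "p j = k" "p k = j"
    by (simp_all add: p_def)
  \<comment> \<open>A swap affects two terms of the linear form only, and changes it by exactly the
    product that defines \<open>D\<close>.\<close>
  have S_p: "(\<Sum>i=1..n. c i * x (p i)) = (\<Sum>i=1..n. c i * x i) - (c j - c k) * (x j - x k)"
    for x :: "nat \<Rightarrow> real"
  proof -
    have "(\<Sum>i=1..n. c i * x (p i)) - (\<Sum>i=1..n. c i * x i) = (\<Sum>i=1..n. c i * (x (p i) - x i))"
      by (simp add: sum_subtractf algebra_simps)
    also have "\<dots> = (\<Sum>i\<in>{j, k}. c i * (x (p i) - x i))"
      using jk by (intro sum.mono_neutral_right) (auto simp: p_def Transposition.transpose_def)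
    also have "\<dots> = - ((c j - c k) * (x j - x k))"
      using False p_jk by (simp add: algebra_simps)
    finally show ?thesis
      by simp
  qed
  define F where "F = (\<lambda>x. complex_of_real ((c j - c k) * (x j - x k)) * iexp (s * (\<Sum>i=1..n. c i * x i)))"
  have F: "F \<in> borel_measurable (Pi\<^sub>M {1..n} (\<lambda>_. borel))"
    unfolding F_def using jk by measurable
  have F_restrict: "F (\<lambda>t\<in>{1..n}. x t) = complex_of_real ((c j - c k) * (x j - x k)) * iexp (s * (\<Sum>i=1..n. c i * x i))"
    for x
  proof -
    have "(\<Sum>i=1..n. c i * (\<lambda>t\<in>{1..n}. x t) i) = (\<Sum>i=1..n. c i * x i)"
      by (intro sum.cong) auto
    then show ?thesis
      using jk by (simp only: F_def restrict_apply' if_True)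
  qed
  have "F (\<lambda>t\<in>{1..n}. W t \<omega>) = D \<omega> * iexp (s * S \<omega>)" for \<omega>
    by (simp only: F_restrict D_def S_def)
  moreover have "F (\<lambda>t\<in>{1..n}. W (p t) \<omega>) = - (D \<omega> * iexp (s * (S \<omega> - D \<omega>)))" for \<omega>
    unfolding F_restrict S_p[of "\<lambda>i. W i \<omega>"] p_jk D_def S_def by (simp add: algebra_simps)
  ultimately show ?thesis
    using expectation_permute[OF p F] by simp
qed (simp add: D_def)

end

text \<open>These identities translate between single sums and sums over all pairs. The first writes
  the linear form as an average of swap differences, the third evaluates the sum of their
  squares.\<close>

lemma sum_pair_products:
  fixes c a :: "'i \<Rightarrow> real"
  assumes "sum c I = 0"
  shows "(\<Sum>j\<in>I. \<Sum>k\<in>I. (c j - c k) * (a j - a k)) = 2 * real (card I) * (\<Sum>j\<in>I. c j * a j)"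
    and "(\<Sum>j\<in>I. \<Sum>k\<in>I. (c j - c k)\<^sup>2) = 2 * real (card I) * (\<Sum>j\<in>I. (c j)\<^sup>2)"
    and "(\<Sum>j\<in>I. \<Sum>k\<in>I. ((c j - c k) * (a j - a k))\<^sup>2) =
      2 * real (card I) * (\<Sum>j\<in>I. (c j)\<^sup>2 * (a j)\<^sup>2) + 2 * (\<Sum>j\<in>I. (c j)\<^sup>2) * (\<Sum>j\<in>I. (a j)\<^sup>2)
      - 4 * (\<Sum>j\<in>I. (c j)\<^sup>2 * a j) * sum a I + 4 * (\<Sum>j\<in>I. c j * a j)\<^sup>2"
proof -
  have prod: "(\<Sum>j\<in>I. \<Sum>k\<in>I. f j * g k) = sum f I * sum g I" for f g :: "'i \<Rightarrow> real"
    by (simp add: sum_product)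
  \<comment> \<open>Each summand is arranged as a sum of products of a function of \<open>j\<close>
    and a function of \<open>k\<close>, so that the double sums factor and every factor
    \<open>sum c I\<close> vanishes.\<close>
  have 1: "(c j - c k) * (a j - a k) = (c j * a j) * 1 + 1 * (c k * a k) + (- c j) * a k + (- a j) * c k"
    for j k
    by (simp add: algebra_simps)
  show one: "(\<Sum>j\<in>I. \<Sum>k\<in>I. (c j - c k) * (a j - a k)) = 2 * real (card I) * (\<Sum>j\<in>I. c j * a j)"
    unfolding 1 sum.distrib prod using assms by (simp add: sum_negf)
  have 2: "(c j - c k)\<^sup>2 = (c j)\<^sup>2 * 1 + 1 * (c k)\<^sup>2 + (- 2 * c j) * c k" for j k
    by (simp add: algebra_simps power2_eq_square)
  show "(\<Sum>j\<in>I. \<Sum>k\<in>I. (c j - c k)\<^sup>2) = 2 * real (card I) * (\<Sum>j\<in>I. (c j)\<^sup>2)"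
    unfolding 2 sum.distrib prod using assms by simp
  have 3: "((c j - c k) * (a j - a k))\<^sup>2 = ((c j)\<^sup>2 * (a j)\<^sup>2) * 1 + 1 * ((c k)\<^sup>2 * (a k)\<^sup>2)
      + (c j)\<^sup>2 * (a k)\<^sup>2 + (a j)\<^sup>2 * (c k)\<^sup>2
      + (-2 * ((c j)\<^sup>2 * a j)) * a k + (-2 * a j) * ((c k)\<^sup>2 * a k)
      + (-2 * (c j * (a j)\<^sup>2)) * c k + (-2 * c j) * (c k * (a k)\<^sup>2)
      + (4 * (c j * a j)) * (c k * a k)" for j k
    by (simp add: algebra_simps power2_eq_square)
  show "(\<Sum>j\<in>I. \<Sum>k\<in>I. ((c j - c k) * (a j - a k))\<^sup>2) =
      2 * real (card I) * (\<Sum>j\<in>I. (c j)\<^sup>2 * (a j)\<^sup>2) + 2 * (\<Sum>j\<in>I. (c j)\<^sup>2) * (\<Sum>j\<in>I. (a j)\<^sup>2)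
      - 4 * (\<Sum>j\<in>I. (c j)\<^sup>2 * a j) * sum a I + 4 * (\<Sum>j\<in>I. c j * a j)\<^sup>2"
    unfolding 3 sum.distrib prod
    using assms by (simp add: sum_distrib_left[symmetric] sum_negf)
      (simp add: power2_eq_square algebra_simps)
qed

text \<open>If one of the values exceeds \<open>K\<close> in modulus, so does the larger one, and
  the squared difference is at most 4 times its square.\<close>

lemma diff_square_indicator_le:
  fixes a b K :: real
  shows "(if \<bar>a\<bar> \<le> K \<and> \<bar>b\<bar> \<le> K then 0 else (a - b)\<^sup>2) \<le>
    4 * (a\<^sup>2 * of_bool (\<bar>a\<bar> > K)) + 4 * (b\<^sup>2 * of_bool (\<bar>b\<bar> > K))"
proof -
  have le: "(a - b)\<^sup>2 \<le> 4 * x\<^sup>2" if "\<bar>a\<bar> \<le> \<bar>x\<bar>" "\<bar>b\<bar> \<le> \<bar>x\<bar>" for x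
  proof -
    have "\<bar>a - b\<bar> \<le> 2 * \<bar>x\<bar>"
      using that by linarith
    then have "\<bar>a - b\<bar>\<^sup>2 \<le> (2 * \<bar>x\<bar>)\<^sup>2"
      by (intro power_mono) auto
    then show ?thesis
      by (simp add: power_mult_distrib)
  qed
  consider "\<bar>a\<bar> \<le> K" "\<bar>b\<bar> \<le> K" | "\<bar>a\<bar> > K" "\<bar>b\<bar> \<le> \<bar>a\<bar>" | "\<bar>b\<bar> > K" "\<bar>a\<bar> \<le> \<bar>b\<bar>"
    by linarith
  then show ?thesis
  proof cases
    case 2
    then show ?thesis
      using le[of a] by (auto intro: add_increasing2)
  next
    case 3
    then show ?thesis
      using le[of b] by (auto intro: add_increasing)
  qed simp
qed

text \<open>The quadratic bound is for pairs of bounded weights, the linear one for the tails: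
  multiplied by \<open>\<bar>x\<bar>\<close> it stays of second order, so that second moments
  suffice.\<close>

lemma iexp_remainder_le:
  fixes x :: real
  shows "cmod (1 - iexp (- x) - \<i> * x) \<le> x\<^sup>2 / 2" "cmod (1 - iexp (- x) - \<i> * x) \<le> 2 * \<bar>x\<bar>"
proof -
  have eq: "cmod (1 - iexp (- x) - \<i> * x) = cmod (iexp (- x) - (\<Sum>k\<le>1. (\<i> * of_real (- x)) ^ k / fact k))"
    by (subst norm_minus_cancel[symmetric]) (simp add: algebra_simps)
  show "cmod (1 - iexp (- x) - \<i> * x) \<le> x\<^sup>2 / 2"
    unfolding eq using iexp_approx1[of "- x" 1] by (simp add: numeral_2_eq_2)
  show "cmod (1 - iexp (- x) - \<i> * x) \<le> 2 * \<bar>x\<bar>"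
    unfolding eq using iexp_approx2[of "- x" 1] by simp
qed

context exchangeable_row
begin

text \<open>An exchangeable-pair argument in the manner of Stein. Averaging over swaps,
  \<open>\<phi>' s\<close> is \<open>\<i> / (4 * n)\<close> times the sum over pairs of the mean of
  \<open>D * iexp (s * S) * (1 - iexp (- (s * D)))\<close>. To first order in \<open>D\<close> this
  is \<open>- s\<close> times the mean of \<open>Q * iexp (s * S)\<close>, and \<open>Q\<close> is
  close to \<open>v\<close> in L1. In the bound, \<open>\<tau>\<close> measures the tails,
  \<open>\<eta>\<close> the average of the squares, the terms with \<open>G\<close> the mean of the
  weights and the square of the linear form, and the last term the second-order error in
  \<open>D\<close>.\<close>

lemma characteristic_near_gaussian:
  assumes m: "\<And>j. j \<in> {1..n} \<Longrightarrow> \<bar>c j\<bar> \<le> m" and sq1: "expectation (\<lambda>\<omega>. (W 1 \<omega>)\<^sup>2) = 1"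
    and G: "\<And>e. expectation (\<lambda>\<omega>. (\<Sum>j=1..n. e j * W j \<omega>)\<^sup>2) \<le> G * (\<Sum>j=1..n. (e j)\<^sup>2)"
    and c0: "(\<Sum>j=1..n. c j) = 0" and K: "K \<ge> 0"
  defines "v \<equiv> \<Sum>j=1..n. (c j)\<^sup>2"
    and "\<tau> \<equiv> expectation (\<lambda>\<omega>. (W 1 \<omega>)\<^sup>2 * of_bool (\<bar>W 1 \<omega>\<bar> > K))"
    and "\<eta> \<equiv> expectation (\<lambda>\<omega>. \<bar>(1 / real n) * (\<Sum>j=1..n. (W j \<omega>)\<^sup>2) - 1\<bar>)"
  shows "cmod ((CLINT \<omega>|M. iexp (t * (\<Sum>j=1..n. c j * W j \<omega>))) - of_real (exp (- v * t\<^sup>2 / 2)))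
    \<le> \<bar>t\<bar> * (\<bar>t\<bar> * (9 * v * \<tau> + K\<^sup>2 * m * sqrt v + v * \<eta> + v * sqrt (G / n) + G * v / n
      + 4 * m * K * \<bar>t\<bar> * v))"
proof -
  note [measurable] = W_measurable
  define S where "S = (\<lambda>\<omega>. \<Sum>j=1..n. c j * W j \<omega>)"
  define D where "D = (\<lambda>j k \<omega>. (c j - c k) * (W j \<omega> - W k \<omega>))"
  \<comment> \<open>By the second pair identity the sum of \<open>(c j - c k)\<^sup>2\<close> is
    \<open>2 * n * v\<close>, and \<open>(W j - W k)\<^sup>2\<close> has mean about 2; the factor
    \<open>1 / (4 * n)\<close> brings the mean of \<open>Q\<close> near \<open>v\<close>.\<close>
  define Q where "Q = (\<lambda>\<omega>. (1 / (4 * n)) * (\<Sum>j=1..n. \<Sum>k=1..n. (D j k \<omega>)\<^sup>2))"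
  have n0: "real n > 0"
    using two_le by simp
  have "m \<ge> 0"
    using m[of 1] two_le by force
  have "v \<ge> 0"
    by (simp add: v_def sum_nonneg)
  have "G \<ge> 0"
  proof -
    have "0 \<le> G * (\<Sum>j=1..n. (1::real)\<^sup>2)"
      by (rule order.trans[OF _ G]) simp
    then show ?thesis
      using n0 by (simp add: zero_le_mult_iff)
  qed
  have one: "1 \<in> {1..n}" and two: "2 \<in> {1..n}"
    using two_le by simp_all
  have S_meas [measurable]: "S \<in> borel_measurable M"
    unfolding S_def by measurable
  have D_meas [measurable]: "D j k \<in> borel_measurable M" if "j \<in> {1..n}" "k \<in> {1..n}" for j k
    using that unfolding D_def by measurable
  \<comment> \<open>The integral of a non-integrable function is 0 by convention, so the value 1
    implies integrability.\<close>
  have sq1_int: "integrable M (\<lambda>\<omega>. (W 1 \<omega>)\<^sup>2)"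
    using sq1 not_integrable_integral_eq by fastforce
  have W_sq: "integrable M (\<lambda>\<omega>. (W j \<omega>)\<^sup>2)" "expectation (\<lambda>\<omega>. (W j \<omega>)\<^sup>2) = 1" if "j \<in> {1..n}" for j
    using integrable_single[OF that, of "\<lambda>x. x\<^sup>2"] expectation_single[OF that, of "\<lambda>x. x\<^sup>2"] sq1 sq1_int
    by simp_all
  have lin_sq: "integrable M (\<lambda>\<omega>. (\<Sum>j=1..n. e j * W j \<omega>)\<^sup>2)" for e
    by (rule integrable_sum_square) (auto simp: power_mult_distrib W_sq)
  define tail where "tail = (\<lambda>x::real. x\<^sup>2 * of_bool (\<bar>x\<bar> > K))"
  have tail_meas [measurable]: "tail \<in> borel_measurable borel"
    unfolding tail_def by measurable
  have tail_nonneg: "tail x \<ge> 0" for x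
    by (simp add: tail_def)
  have tail_int: "integrable M (\<lambda>\<omega>. tail (W j \<omega>))" "expectation (\<lambda>\<omega>. tail (W j \<omega>)) = \<tau>"
    if j: "j \<in> {1..n}" for j
  proof -
    show "integrable M (\<lambda>\<omega>. tail (W j \<omega>))"
      using W_sq(1)[OF j] by (rule Bochner_Integration.integrable_bound) (use j in \<open>auto simp: tail_def\<close>)
    show "expectation (\<lambda>\<omega>. tail (W j \<omega>)) = \<tau>"
      using expectation_single[OF j, of tail] by (simp add: \<tau>_def tail_def)
  qed
  have "\<tau> \<ge> 0"
    unfolding \<tau>_def by simp
  have sum_c2: "(\<Sum>j=1..n. \<Sum>k=1..n. (c j - c k)\<^sup>2) = 2 * n * v"
    using sum_pair_products(2)[OF c0] by (simp add: v_def)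

  have D_sq: "integrable M (\<lambda>\<omega>. (D j k \<omega>)\<^sup>2)" if "j \<in> {1..n}" "k \<in> {1..n}" for j k
    unfolding D_def power_mult_distrib using that W_sq
      integrable_add_square[of "W j" "\<lambda>\<omega>. - W k \<omega>"] by simp
  have D_int: "integrable M (D j k)" if "j \<in> {1..n}" "k \<in> {1..n}" for j k
    using integrable_of_square[OF D_meas D_sq] that by blast
  have D_sq_le: "expectation (\<lambda>\<omega>. (D j k \<omega>)\<^sup>2) \<le> 4 * (c j - c k)\<^sup>2"
    if "j \<in> {1..n}" "k \<in> {1..n}" for j k
  proof -
    have "expectation (\<lambda>\<omega>. (D j k \<omega>)\<^sup>2) \<le>
        expectation (\<lambda>\<omega>. (c j - c k)\<^sup>2 * (2 * (W j \<omega>)\<^sup>2 + 2 * (W k \<omega>)\<^sup>2))"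
    proof (rule integral_mono)
      fix \<omega>
      have "(W j \<omega> - W k \<omega>)\<^sup>2 \<le> 2 * (W j \<omega>)\<^sup>2 + 2 * (W k \<omega>)\<^sup>2"
        using zero_le_power2[of "W j \<omega> + W k \<omega>"] by (simp add: power2_eq_square algebra_simps)
      then show "(D j k \<omega>)\<^sup>2 \<le> (c j - c k)\<^sup>2 * (2 * (W j \<omega>)\<^sup>2 + 2 * (W k \<omega>)\<^sup>2)"
        by (simp add: D_def power_mult_distrib mult_left_mono)
    qed (use that D_sq W_sq in auto)
    also have "\<dots> = 4 * (c j - c k)\<^sup>2"
      using that W_sq by simp
    finally show ?thesis .
  qed

  have Q_eq: "Q \<omega> - v = (1 / 2) * (\<Sum>j=1..n. (c j)\<^sup>2 * (W j \<omega>)\<^sup>2)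
      + (1 / 2) * v * ((1 / n) * (\<Sum>j=1..n. (W j \<omega>)\<^sup>2))
      - (\<Sum>j=1..n. (c j)\<^sup>2 * W j \<omega>) * ((1 / n) * (\<Sum>j=1..n. W j \<omega>)) + (S \<omega>)\<^sup>2 / n - v" for \<omega>
    unfolding Q_def D_def sum_pair_products(3)[OF c0] using n0 by (simp add: v_def S_def field_simps)
  have Q_meas [measurable]: "Q \<in> borel_measurable M"
    unfolding Q_def by measurable
  have Q_int: "integrable M Q"
    unfolding Q_def by (intro integrable_mult_right integrable_double_sum D_sq)

  \<comment> \<open>Only the truncated square has a second moment that can be bounded; the remaining
    part \<open>tail\<close> is handled in mean.\<close>
  define b where "b = (\<lambda>x::real. x\<^sup>2 * of_bool (\<bar>x\<bar> \<le> K))"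
  have b_meas [measurable]: "b \<in> borel_measurable borel"
    unfolding b_def by measurable
  have b_abs: "\<bar>b x\<bar> \<le> K\<^sup>2" for x
    using K by (auto simp: b_def abs_le_square_iff[symmetric])
  \<comment> \<open>Subtracting the average \<open>v / n\<close> makes these coefficients sum to 0.
    The common correlation of the \<open>b (W j)\<close>, which need not be small, then drops out of
    the variance.\<close>
  define e where "e = (\<lambda>j. (c j)\<^sup>2 - v / n)"
  have e_sum: "(\<Sum>j=1..n. e j) = 0"
    using n0 by (simp add: e_def sum_subtractf v_def)
  have e_sq: "(\<Sum>j=1..n. (e j)\<^sup>2) \<le> m\<^sup>2 * v"
  proof -
    have "(\<Sum>j=1..n. (e j)\<^sup>2) = (\<Sum>j=1..n. ((c j)\<^sup>2)\<^sup>2) - v\<^sup>2 / n"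
    proof -
      have "(\<Sum>j=1..n. (e j)\<^sup>2) = (\<Sum>j=1..n. ((c j)\<^sup>2)\<^sup>2 - 2 * (v / n) * (c j)\<^sup>2 + (v / n)\<^sup>2)"
        by (intro sum.cong) (simp_all add: e_def power2_diff)
      also have "\<dots> = (\<Sum>j=1..n. ((c j)\<^sup>2)\<^sup>2) - 2 * (v / n) * v + n * (v / n)\<^sup>2"
        unfolding sum.distrib sum_subtractf sum_distrib_left[symmetric] by (simp add: v_def)
      finally show ?thesis
        using n0 by (simp add: power2_eq_square)
    qed
    also have "\<dots> \<le> (\<Sum>j=1..n. m\<^sup>2 * (c j)\<^sup>2)"
    proof -
      have "((c j)\<^sup>2)\<^sup>2 \<le> m\<^sup>2 * (c j)\<^sup>2" if "j \<in> {1..n}" for j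
        using power_mono[OF m[OF that], of 2] unfolding power2_eq_square[of "(c j)\<^sup>2"]
        by (intro mult_right_mono) auto
      then show ?thesis
        using sum_mono[of "{1..n}" "\<lambda>j. ((c j)\<^sup>2)\<^sup>2" "\<lambda>j. m\<^sup>2 * (c j)\<^sup>2"] n0 by (smt (verit) divide_nonneg_pos zero_le_power2)
    qed
    also have "\<dots> = m\<^sup>2 * v"
      by (simp add: v_def sum_distrib_left)
    finally show ?thesis .
  qed
  have b_int: "integrable M (\<lambda>\<omega>. (b (W j \<omega>))\<^sup>2)" if "j \<in> {1..n}" for j
    using that power_mono[OF b_abs abs_ge_zero, of _ 2]
    by (intro integrable_const_bound[where B = "(K\<^sup>2)\<^sup>2"]) auto
  have sum_eb_int: "integrable M (\<lambda>\<omega>. (\<Sum>j=1..n. e j * b (W j \<omega>))\<^sup>2)"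
    using b_int by (intro integrable_sum_square) (auto simp: power_mult_distrib)
  have sum_eb: "expectation (\<lambda>\<omega>. \<bar>\<Sum>j=1..n. e j * b (W j \<omega>)\<bar>) \<le> 2 * K\<^sup>2 * m * sqrt v"
  proof -
    have le: "\<bar>expectation (\<lambda>\<omega>. b (W i \<omega>) * b (W j \<omega>))\<bar> \<le> (K\<^sup>2)\<^sup>2" if "i \<in> {1..n}" "j \<in> {1..n}" for i j
    proof -
      have "norm (expectation (\<lambda>\<omega>. b (W i \<omega>) * b (W j \<omega>))) \<le> expectation (\<lambda>\<omega>. (K\<^sup>2)\<^sup>2)"
      proof (rule norm_integral_le_integral)
        show "integrable M (\<lambda>\<omega>. b (W i \<omega>) * b (W j \<omega>))"
          using that by (intro integrable_mult_of_squares b_int) measurable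
        show "norm (b (W i \<omega>) * b (W j \<omega>)) \<le> (K\<^sup>2)\<^sup>2" for \<omega>
          unfolding power2_eq_square[of "K\<^sup>2"] real_norm_def abs_mult
          by (intro mult_mono b_abs) auto
      qed simp
      then show ?thesis
        by (simp add: prob_space)
    qed
    have "expectation (\<lambda>\<omega>. (\<Sum>j=1..n. e j * b (W j \<omega>))\<^sup>2) =
        (expectation (\<lambda>\<omega>. (b (W 1 \<omega>))\<^sup>2) - expectation (\<lambda>\<omega>. b (W 1 \<omega>) * b (W 2 \<omega>))) * (\<Sum>j=1..n. (e j)\<^sup>2)"
      using expectation_linear_square[of b e] b_int[OF one] e_sum by simp
    \<comment> \<open>Bounding both moments by \<open>(K\<^sup>2)\<^sup>2\<close> would give the
      factor 2; the factor 4 makes the bound a perfect square.\<close>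
    also have "\<dots> \<le> (4 * (K\<^sup>2)\<^sup>2) * (m\<^sup>2 * v)"
    proof (intro mult_mono e_sq)
      show "expectation (\<lambda>\<omega>. (b (W 1 \<omega>))\<^sup>2) - expectation (\<lambda>\<omega>. b (W 1 \<omega>) * b (W 2 \<omega>)) \<le> 4 * (K\<^sup>2)\<^sup>2"
        using le[OF one one] le[OF one two] zero_le_power2[of "K\<^sup>2"]
        unfolding power2_eq_square[of "b _"] by linarith
    qed (auto simp: sum_nonneg)
    finally have "expectation (\<lambda>\<omega>. (\<Sum>j=1..n. e j * b (W j \<omega>))\<^sup>2) \<le> (2 * K\<^sup>2 * m * sqrt v)\<^sup>2"
      using \<open>v \<ge> 0\<close> by (simp add: power_mult_distrib)
    then show ?thesis
      using \<open>v \<ge> 0\<close> \<open>m \<ge> 0\<close> expectation_abs_le_sqrt[OF _ sum_eb_int]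
      by (intro order.trans[OF expectation_abs_le_sqrt[OF _ sum_eb_int]] real_le_lsqrt) auto
  qed

  have Q_le: "expectation (\<lambda>\<omega>. \<bar>Q \<omega> - v\<bar>) \<le> v * \<tau> + K\<^sup>2 * m * sqrt v + v * \<eta> + v * sqrt (G / n) + G * v / n"
  proof -
    define mean where "mean = (\<lambda>\<omega>. \<Sum>j=1..n. (1 / n) * W j \<omega>)"
    have mean_meas [measurable]: "mean \<in> borel_measurable M"
      unfolding mean_def by measurable
    have mean_sq: "integrable M (\<lambda>\<omega>. (mean \<omega>)\<^sup>2)" "expectation (\<lambda>\<omega>. (mean \<omega>)\<^sup>2) \<le> G / n"
      using lin_sq[of "\<lambda>_. 1 / n"] G[of "\<lambda>_. 1 / n"] n0 by (simp_all add: mean_def power2_eq_square)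
    have mean_prod: "expectation (\<lambda>\<omega>. \<bar>W j \<omega> * mean \<omega>\<bar>) \<le> sqrt (G / n)" if "j \<in> {1..n}" for j
      using expectation_abs_mult_le[OF W_measurable[OF that] mean_meas W_sq(1)[OF that] mean_sq(1)]
        W_sq(2)[OF that] real_sqrt_le_mono[OF mean_sq(2)] by (auto intro: order.trans)
    have mean_prod_int: "integrable M (\<lambda>\<omega>. W j \<omega> * mean \<omega>)" if "j \<in> {1..n}" for j
      using that by (intro integrable_mult_of_squares mean_sq W_sq) measurable
    define V where "V = (\<lambda>\<omega>. (1 / n) * (\<Sum>j=1..n. (W j \<omega>)\<^sup>2))"
    have V_int: "integrable M V"
      unfolding V_def using W_sq by (auto intro!: Bochner_Integration.integrable_sum)
    define R where "R = (\<lambda>\<omega>. (1 / 2) * \<bar>\<Sum>j=1..n. e j * b (W j \<omega>)\<bar>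
      + (1 / 2) * (\<Sum>j=1..n. (c j)\<^sup>2 * tail (W j \<omega>)) + (1 / 2) * (v / n) * (\<Sum>j=1..n. tail (W j \<omega>))
      + v * \<bar>V \<omega> - 1\<bar> + (\<Sum>j=1..n. (c j)\<^sup>2 * \<bar>W j \<omega> * mean \<omega>\<bar>) + (S \<omega>)\<^sup>2 / n)"
    have le_generic: "\<bar>x + (1 / 2) * y + (1 / 2) * a - (1 / 2) * b - p + q\<bar> \<le>
        (1 / 2) * \<bar>y\<bar> + (1 / 2) * a + (1 / 2) * b + \<bar>x\<bar> + P + q"
      if "\<bar>p\<bar> \<le> P" "0 \<le> a" "0 \<le> b" "0 \<le> q" for x y a b p q P :: real
      using that by linarith
    have le: "\<bar>Q \<omega> - v\<bar> \<le> R \<omega>" for \<omega>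
    proof -
      have sq: "(W j \<omega>)\<^sup>2 = b (W j \<omega>) + tail (W j \<omega>)" for j
        by (auto simp: b_def tail_def)
      \<comment> \<open>The average part \<open>v / n\<close> of the squared coefficients reproduces
        \<open>v * V \<omega>\<close>, whose distance from \<open>v\<close> is measured by
        \<open>\<eta>\<close>. What is left is the centred bounded part and the tails.\<close>
      have 1: "(\<Sum>j=1..n. (c j)\<^sup>2 * (W j \<omega>)\<^sup>2) = v * V \<omega> + (\<Sum>j=1..n. e j * b (W j \<omega>))
          + (\<Sum>j=1..n. (c j)\<^sup>2 * tail (W j \<omega>)) - (v / n) * (\<Sum>j=1..n. tail (W j \<omega>))"
        unfolding V_def sq e_def
        by (simp add: sum.distrib sum_subtractf sum_distrib_left distrib_left left_diff_distrib)
      have 2: "\<bar>(\<Sum>j=1..n. (c j)\<^sup>2 * W j \<omega>) * mean \<omega>\<bar> \<le> (\<Sum>j=1..n. (c j)\<^sup>2 * \<bar>W j \<omega> * mean \<omega>\<bar>)"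
        unfolding sum_distrib_right by (rule order.trans[OF sum_abs]) (simp add: abs_mult mult.assoc)
      have 3: "(\<Sum>j=1..n. (c j)\<^sup>2 * tail (W j \<omega>)) \<ge> 0" "(v / n) * (\<Sum>j=1..n. tail (W j \<omega>)) \<ge> 0"
        "(S \<omega>)\<^sup>2 / n \<ge> 0"
        using tail_nonneg \<open>v \<ge> 0\<close> by (auto intro!: sum_nonneg mult_nonneg_nonneg divide_nonneg_nonneg)
      have 4: "Q \<omega> - v = (1 / 2) * (\<Sum>j=1..n. (c j)\<^sup>2 * (W j \<omega>)\<^sup>2) + (1 / 2) * v * V \<omega>
          - (\<Sum>j=1..n. (c j)\<^sup>2 * W j \<omega>) * mean \<omega> + (S \<omega>)\<^sup>2 / n - v"
        unfolding Q_eq V_def mean_def by (simp add: sum_distrib_left)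
      have 5: "\<bar>v * (V \<omega> - 1)\<bar> = v * \<bar>V \<omega> - 1\<bar>"
        using \<open>v \<ge> 0\<close> by (simp add: abs_mult)
      have 6: "Q \<omega> - v = v * (V \<omega> - 1) + (1 / 2) * (\<Sum>j=1..n. e j * b (W j \<omega>))
          + (1 / 2) * (\<Sum>j=1..n. (c j)\<^sup>2 * tail (W j \<omega>)) - (1 / 2) * ((v / n) * (\<Sum>j=1..n. tail (W j \<omega>)))
          - (\<Sum>j=1..n. (c j)\<^sup>2 * W j \<omega>) * mean \<omega> + (S \<omega>)\<^sup>2 / n"
        unfolding 4 1 by (simp add: algebra_simps)
      have R': "R \<omega> = (1 / 2) * \<bar>\<Sum>j=1..n. e j * b (W j \<omega>)\<bar>
          + (1 / 2) * (\<Sum>j=1..n. (c j)\<^sup>2 * tail (W j \<omega>)) + (1 / 2) * ((v / n) * (\<Sum>j=1..n. tail (W j \<omega>)))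
          + \<bar>v * (V \<omega> - 1)\<bar> + (\<Sum>j=1..n. (c j)\<^sup>2 * \<bar>W j \<omega> * mean \<omega>\<bar>) + (S \<omega>)\<^sup>2 / n"
        unfolding R_def 5 by simp
      show ?thesis
        unfolding 6 R' by (rule le_generic[OF 2 3])
    qed
    have S_sq: "integrable M (\<lambda>\<omega>. (S \<omega>)\<^sup>2)" "expectation (\<lambda>\<omega>. (S \<omega>)\<^sup>2) \<le> G * v"
      using lin_sq[of c] G[of c] by (simp_all add: S_def v_def)
    have eb_int: "integrable M (\<lambda>\<omega>. \<bar>\<Sum>j=1..n. e j * b (W j \<omega>)\<bar>)"
      using integrable_of_square[OF _ sum_eb_int] by simp
    have ints: "integrable M (\<lambda>\<omega>. \<Sum>j=1..n. (c j)\<^sup>2 * tail (W j \<omega>))"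
      "integrable M (\<lambda>\<omega>. \<Sum>j=1..n. tail (W j \<omega>))"
      "integrable M (\<lambda>\<omega>. \<Sum>j=1..n. (c j)\<^sup>2 * \<bar>W j \<omega> * mean \<omega>\<bar>)"
      "integrable M (\<lambda>\<omega>. \<bar>V \<omega> - 1\<bar>)"
      using tail_int mean_prod_int V_int by (auto intro!: Bochner_Integration.integrable_sum)
    have "expectation (\<lambda>\<omega>. \<bar>Q \<omega> - v\<bar>) \<le> expectation R"
    proof (rule integral_mono)
      show "integrable M R"
        unfolding R_def
        by (intro Bochner_Integration.integrable_add integrable_mult_right integrable_divide eb_int ints S_sq(1))
    qed (use Q_int le in auto)
    also have "\<dots> = (1 / 2) * expectation (\<lambda>\<omega>. \<bar>\<Sum>j=1..n. e j * b (W j \<omega>)\<bar>)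
      + (1 / 2) * expectation (\<lambda>\<omega>. \<Sum>j=1..n. (c j)\<^sup>2 * tail (W j \<omega>))
      + (1 / 2) * (v / n) * expectation (\<lambda>\<omega>. \<Sum>j=1..n. tail (W j \<omega>))
      + v * expectation (\<lambda>\<omega>. \<bar>V \<omega> - 1\<bar>) + expectation (\<lambda>\<omega>. \<Sum>j=1..n. (c j)\<^sup>2 * \<bar>W j \<omega> * mean \<omega>\<bar>)
      + expectation (\<lambda>\<omega>. (S \<omega>)\<^sup>2) / n"
      unfolding R_def using eb_int ints S_sq(1)
      by (simp only: Bochner_Integration.integral_add Bochner_Integration.integrable_add integrable_mult_right
          integrable_divide integral_mult_right_zero integral_divide_zero)
    also have "expectation (\<lambda>\<omega>. \<Sum>j=1..n. (c j)\<^sup>2 * tail (W j \<omega>)) = v * \<tau>"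
      using tail_int by (subst Bochner_Integration.integral_sum) (auto simp: v_def sum_distrib_right)
    also have "expectation (\<lambda>\<omega>. \<Sum>j=1..n. tail (W j \<omega>)) = n * \<tau>"
      using tail_int by (subst Bochner_Integration.integral_sum) auto
    also have "expectation (\<lambda>\<omega>. \<Sum>j=1..n. (c j)\<^sup>2 * \<bar>W j \<omega> * mean \<omega>\<bar>) =
        (\<Sum>j=1..n. (c j)\<^sup>2 * expectation (\<lambda>\<omega>. \<bar>W j \<omega> * mean \<omega>\<bar>))"
      using mean_prod_int by (subst Bochner_Integration.integral_sum) auto
    also have "expectation (\<lambda>\<omega>. \<bar>V \<omega> - 1\<bar>) = \<eta>"
      by (simp add: \<eta>_def V_def)
    finally have "expectation (\<lambda>\<omega>. \<bar>Q \<omega> - v\<bar>) \<le> (1 / 2) * expectation (\<lambda>\<omega>. \<bar>\<Sum>j=1..n. e j * b (W j \<omega>)\<bar>)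
      + v * \<tau> + v * \<eta> + (\<Sum>j=1..n. (c j)\<^sup>2 * expectation (\<lambda>\<omega>. \<bar>W j \<omega> * mean \<omega>\<bar>))
      + expectation (\<lambda>\<omega>. (S \<omega>)\<^sup>2) / n"
      using n0 by (simp add: mult.commute[of v \<tau>])
    moreover have "(\<Sum>j=1..n. (c j)\<^sup>2 * expectation (\<lambda>\<omega>. \<bar>W j \<omega> * mean \<omega>\<bar>)) \<le> (\<Sum>j=1..n. (c j)\<^sup>2 * sqrt (G / n))"
      using mean_prod by (intro sum_mono mult_left_mono) auto
    moreover have "(\<Sum>j=1..n. (c j)\<^sup>2 * sqrt (G / n)) = v * sqrt (G / n)"
      by (simp add: v_def sum_distrib_right)
    moreover have "expectation (\<lambda>\<omega>. (S \<omega>)\<^sup>2) / n \<le> G * v / n"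
      using S_sq n0 by (simp add: divide_right_mono)
    ultimately show ?thesis
      using sum_eb by linarith
  qed

  define \<phi> where "\<phi> = (\<lambda>s. CLINT \<omega>|M. iexp (s * S \<omega>))"
  define \<phi>' where "\<phi>' = (\<lambda>s. CLINT \<omega>|M. \<i> * S \<omega> * iexp (s * S \<omega>))"
  have deriv: "(\<phi> has_vector_derivative \<phi>' s) (at s)" for s
    unfolding \<phi>_def \<phi>'_def by (rule char_has_vector_derivative) (use lin_sq[of c] in \<open>auto simp: S_def\<close>)
  have mult_iexp_int: "integrable M (\<lambda>\<omega>. complex_of_real (f \<omega>) * iexp (g \<omega>))"
    if "integrable M f" "g \<in> borel_measurable M" for f g :: "'a \<Rightarrow> real"
  proof -
    have [measurable]: "f \<in> borel_measurable M" "g \<in> borel_measurable M"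
      using that by auto
    show ?thesis
      using that(1) by (rule Bochner_Integration.integrable_bound) (auto simp: norm_mult)
  qed
  have S_int: "integrable M S"
    using integrable_of_square[OF S_meas] lin_sq[of c] by (simp add: S_def)

  have main: "cmod (\<phi>' s + s * v * \<phi> s) \<le> \<bar>t\<bar> * (9 * v * \<tau> + K\<^sup>2 * m * sqrt v + v * \<eta> + v * sqrt (G / n)
      + G * v / n + 4 * m * K * \<bar>t\<bar> * v)" if s: "\<bar>s\<bar> \<le> \<bar>t\<bar>" for s
  proof -
    \<comment> \<open>\<open>P\<close> is the integrand antisymmetrized by the swap,
      \<open>L\<close> its first-order part in \<open>D\<close>. The sum of the \<open>L\<close>
      over all pairs is a multiple of \<open>Q * iexp (s * S)\<close>.\<close>
    define P where "P = (\<lambda>j k \<omega>. D j k \<omega> * iexp (s * S \<omega>) * (1 - iexp (- (s * D j k \<omega>))))"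
    define L where "L = (\<lambda>j k \<omega>. D j k \<omega> * iexp (s * S \<omega>) * (\<i> * (s * D j k \<omega>)))"
    have P_alt: "P j k \<omega> = D j k \<omega> * iexp (s * S \<omega>) - D j k \<omega> * iexp (s * (S \<omega> - D j k \<omega>))" for j k \<omega>
      by (simp add: P_def algebra_simps exp_add[symmetric] exp_diff exp_minus divide_inverse)
    have P_int: "integrable M (P j k)" if "j \<in> {1..n}" "k \<in> {1..n}" for j k
      unfolding P_alt using that by (intro Bochner_Integration.integrable_diff mult_iexp_int D_int) measurable
    have P_eq: "(CLINT \<omega>|M. P j k \<omega>) = 2 * (CLINT \<omega>|M. D j k \<omega> * iexp (s * S \<omega>))"
      if jk: "j \<in> {1..n}" "k \<in> {1..n}" for j k
    proof -
      have "(CLINT \<omega>|M. P j k \<omega>) = (CLINT \<omega>|M. D j k \<omega> * iexp (s * S \<omega>)) -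
          (CLINT \<omega>|M. D j k \<omega> * iexp (s * (S \<omega> - D j k \<omega>)))"
        unfolding P_alt using jk by (intro Bochner_Integration.integral_diff mult_iexp_int D_int) measurable
      then show ?thesis
        using permuted_characteristic[OF jk, of c s] by (simp add: D_def S_def)
    qed
    have "\<phi>' s = (CLINT \<omega>|M. \<i> * (1 / (2 * n)) * (\<Sum>j=1..n. \<Sum>k=1..n. D j k \<omega> * iexp (s * S \<omega>)))"
    proof -
      have "\<i> * S \<omega> * iexp (s * S \<omega>) = \<i> * (1 / (2 * n)) * (\<Sum>j=1..n. \<Sum>k=1..n. D j k \<omega> * iexp (s * S \<omega>))" for \<omega>
      proof -
        have "S \<omega> = (1 / (2 * n)) * (\<Sum>j=1..n. \<Sum>k=1..n. D j k \<omega>)"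
          unfolding D_def sum_pair_products(1)[OF c0] using n0 by (simp add: S_def)
        then have "\<i> * complex_of_real (S \<omega>) * iexp (s * S \<omega>) =
            \<i> * complex_of_real ((1 / (2 * n)) * (\<Sum>j=1..n. \<Sum>k=1..n. D j k \<omega>)) * iexp (s * S \<omega>)"
          by simp
        then show ?thesis
          by (simp add: sum_distrib_right sum_distrib_left mult.assoc)
      qed
      then show ?thesis
        unfolding \<phi>'_def by simp
    qed
    also have "\<dots> = \<i> * (1 / (2 * n)) * (\<Sum>j=1..n. \<Sum>k=1..n. (CLINT \<omega>|M. D j k \<omega> * iexp (s * S \<omega>)))"
    proof -
      have "integrable M (\<lambda>\<omega>. D j k \<omega> * iexp (s * S \<omega>))" if "j \<in> {1..n}" "k \<in> {1..n}" for j k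
        using that by (intro mult_iexp_int D_int) measurable
      then show ?thesis
        by (subst integral_mult_right_zero, subst integral_double_sum) auto
    qed
    also have "\<dots> = \<i> * (1 / (4 * n)) * (\<Sum>j=1..n. \<Sum>k=1..n. (CLINT \<omega>|M. P j k \<omega>))"
      using P_eq by (simp add: sum_distrib_left[symmetric])
    finally have \<phi>'_eq: "\<phi>' s = \<i> * (1 / (4 * n)) * (\<Sum>j=1..n. \<Sum>k=1..n. (CLINT \<omega>|M. P j k \<omega>))" .

    have L_alt: "L j k \<omega> = \<i> * s * ((D j k \<omega>)\<^sup>2 * iexp (s * S \<omega>))" for j k \<omega>
      by (simp add: L_def power2_eq_square mult_ac)
    have L_int: "integrable M (L j k)" if "j \<in> {1..n}" "k \<in> {1..n}" for j k
      unfolding L_alt using that by (intro integrable_mult_right mult_iexp_int D_sq) measurable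
    have Qe_int: "integrable M (\<lambda>\<omega>. Q \<omega> * iexp (s * S \<omega>))"
      by (intro mult_iexp_int Q_int) measurable
    have Qe: "- (s * (CLINT \<omega>|M. Q \<omega> * iexp (s * S \<omega>))) =
        \<i> * (1 / (4 * n)) * (\<Sum>j=1..n. \<Sum>k=1..n. (CLINT \<omega>|M. L j k \<omega>))"
    proof -
      have "- (s * (Q \<omega> * iexp (s * S \<omega>))) = \<i> * (1 / (4 * n)) * (\<Sum>j=1..n. \<Sum>k=1..n. L j k \<omega>)" for \<omega>
      proof -
        have "(\<Sum>j=1..n. \<Sum>k=1..n. L j k \<omega>) =
            \<i> * s * (of_real (\<Sum>j=1..n. \<Sum>k=1..n. (D j k \<omega>)\<^sup>2) * iexp (s * S \<omega>))"
          by (simp add: L_alt sum_distrib_left sum_distrib_right)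
        then show ?thesis
          by (simp add: Q_def mult.assoc del: of_real_sum)
      qed
      then have "(CLINT \<omega>|M. - (s * (Q \<omega> * iexp (s * S \<omega>)))) =
          (CLINT \<omega>|M. \<i> * (1 / (4 * n)) * (\<Sum>j=1..n. \<Sum>k=1..n. L j k \<omega>))"
        by simp
      then show ?thesis
        by (simp only: integral_minus integral_mult_right_zero integral_double_sum[OF L_int])
    qed
    have rem: "cmod ((CLINT \<omega>|M. P j k \<omega>) - (CLINT \<omega>|M. L j k \<omega>)) \<le>
        (8 * m * K * s\<^sup>2 + 16 * \<bar>s\<bar> * \<tau>) * (c j - c k)\<^sup>2" if jk: "j \<in> {1..n}" "k \<in> {1..n}" for j k
    proof -
      define R where "R = (\<lambda>\<omega>. 2 * m * K * s\<^sup>2 * (D j k \<omega>)\<^sup>2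
        + 2 * \<bar>s\<bar> * (c j - c k)\<^sup>2 * (4 * tail (W j \<omega>) + 4 * tail (W k \<omega>)))"
      have "(CLINT \<omega>|M. P j k \<omega>) - (CLINT \<omega>|M. L j k \<omega>) = (CLINT \<omega>|M. P j k \<omega> - L j k \<omega>)"
        using P_int[OF jk] L_int[OF jk] by simp
      also have "cmod \<dots> \<le> expectation R"
      proof (rule norm_integral_le_integral)
        show "integrable M (\<lambda>\<omega>. P j k \<omega> - L j k \<omega>)"
          using P_int[OF jk] L_int[OF jk] by simp
        show "integrable M R"
          unfolding R_def using D_sq[OF jk] tail_int(1)[OF jk(1)] tail_int(1)[OF jk(2)] by simp
        fix \<omega>
        define d where "d = D j k \<omega>"
        define r where "r = cmod (1 - iexp (- (s * d)) - \<i> * of_real (s * d))"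
        have r1: "r \<le> (s * d)\<^sup>2 / 2" and r2: "r \<le> 2 * \<bar>s * d\<bar>"
          unfolding r_def using iexp_remainder_le[of "s * d"] by simp_all
        have "P j k \<omega> - L j k \<omega> = d * iexp (s * S \<omega>) * (1 - iexp (- (s * d)) - \<i> * of_real (s * d))"
          by (simp add: P_def L_def d_def algebra_simps)
        then have eq: "cmod (P j k \<omega> - L j k \<omega>) = \<bar>d\<bar> * r"
          by (simp add: norm_mult r_def)
        have tails: "0 \<le> 2 * \<bar>s\<bar> * (c j - c k)\<^sup>2 * (4 * tail (W j \<omega>) + 4 * tail (W k \<omega>))"
          using tail_nonneg by (simp add: add_nonneg_nonneg)
        show "cmod (P j k \<omega> - L j k \<omega>) \<le> R \<omega>"
        \<comment> \<open>Two weights bounded by \<open>K\<close> give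
          \<open>\<bar>d\<bar> \<le> 4 * m * K\<close>, which is small with \<open>m\<close>, next
          to a quadratic remainder. Otherwise the linear remainder gives \<open>d\<^sup>2\<close>,
          which the tails dominate.\<close>
        proof (cases "\<bar>W j \<omega>\<bar> \<le> K \<and> \<bar>W k \<omega>\<bar> \<le> K")
          case True
          have "\<bar>c j - c k\<bar> \<le> 2 * m" "\<bar>W j \<omega> - W k \<omega>\<bar> \<le> 2 * K"
            using m[OF jk(1)] m[OF jk(2)] True by linarith+
          then have "\<bar>d\<bar> \<le> (2 * m) * (2 * K)"
            unfolding d_def D_def abs_mult using \<open>m \<ge> 0\<close> by (intro mult_mono) auto
          then have "\<bar>d\<bar> * r \<le> (4 * m * K) * ((s * d)\<^sup>2 / 2)"
            using r1 \<open>m \<ge> 0\<close> K by (intro mult_mono) (auto simp: r_def)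
          also have "\<dots> = 2 * m * K * s\<^sup>2 * (D j k \<omega>)\<^sup>2"
            by (simp add: power_mult_distrib d_def)
          finally show ?thesis
            using tails by (simp add: eq R_def)
        next
          case False
          have "\<bar>d\<bar> * r \<le> \<bar>d\<bar> * (2 * \<bar>s * d\<bar>)"
            using r2 by (intro mult_left_mono) auto
          also have "\<dots> = 2 * \<bar>s\<bar> * d\<^sup>2"
            by (simp add: abs_mult power2_eq_square)
          also have "\<dots> = 2 * \<bar>s\<bar> * (c j - c k)\<^sup>2 * (W j \<omega> - W k \<omega>)\<^sup>2"
            by (simp add: d_def D_def power_mult_distrib)
          also have "\<dots> \<le> 2 * \<bar>s\<bar> * (c j - c k)\<^sup>2 * (4 * tail (W j \<omega>) + 4 * tail (W k \<omega>))"
            using diff_square_indicator_le[of "W j \<omega>" K "W k \<omega>"] False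
            by (intro mult_left_mono) (auto simp: tail_def)
          also have "\<dots> \<le> R \<omega>"
            using K \<open>m \<ge> 0\<close> by (simp add: R_def)
          finally show ?thesis
            by (simp add: eq)
        qed
      qed
      also have "expectation R = 2 * m * K * s\<^sup>2 * expectation (\<lambda>\<omega>. (D j k \<omega>)\<^sup>2)
          + 2 * \<bar>s\<bar> * (c j - c k)\<^sup>2 * (4 * \<tau> + 4 * \<tau>)"
        unfolding R_def using D_sq[OF jk] tail_int[OF jk(1)] tail_int[OF jk(2)] by simp
      also have "\<dots> \<le> 2 * m * K * s\<^sup>2 * (4 * (c j - c k)\<^sup>2) + 2 * \<bar>s\<bar> * (c j - c k)\<^sup>2 * (4 * \<tau> + 4 * \<tau>)"
        using D_sq_le[OF jk] \<open>m \<ge> 0\<close> K by (intro add_right_mono mult_left_mono) auto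
      finally show ?thesis
        by (simp add: algebra_simps)
    qed
    have sv: "s * v * \<phi> s = s * (CLINT \<omega>|M. v * iexp (s * S \<omega>))"
      by (simp add: \<phi>_def)
    have v_int: "integrable M (\<lambda>\<omega>. v * iexp (s * S \<omega>))"
      using mult_iexp_int[of "\<lambda>_. v" "\<lambda>\<omega>. s * S \<omega>"] by simp
    have "\<phi>' s + s * v * \<phi> s = (\<phi>' s + s * (CLINT \<omega>|M. Q \<omega> * iexp (s * S \<omega>)))
        - s * (CLINT \<omega>|M. (Q \<omega> - v) * iexp (s * S \<omega>))"
    proof -
      have "(CLINT \<omega>|M. (Q \<omega> - v) * iexp (s * S \<omega>)) =
          (CLINT \<omega>|M. Q \<omega> * iexp (s * S \<omega>)) - (CLINT \<omega>|M. v * iexp (s * S \<omega>))"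
        using Qe_int v_int by (simp add: left_diff_distrib)
      moreover have "p + s * z = (p + s * y) - s * x" if "x = y - z" for p x y z :: complex
        unfolding that by (simp add: algebra_simps)
      ultimately show ?thesis
        unfolding sv by blast
    qed
    also have "\<phi>' s + s * (CLINT \<omega>|M. Q \<omega> * iexp (s * S \<omega>)) =
        \<i> * (1 / (4 * n)) * (\<Sum>j=1..n. \<Sum>k=1..n. (CLINT \<omega>|M. P j k \<omega>) - (CLINT \<omega>|M. L j k \<omega>))"
    proof -
      have "a * x + z = a * (x - y)" if "- z = a * y" for a x y z :: complex
        unfolding right_diff_distrib that[symmetric] by simp
      from this[OF Qe] show ?thesis
        unfolding \<phi>'_eq sum_subtractf .
    qed
    finally have "cmod (\<phi>' s + s * v * \<phi> s) \<le>
        cmod (\<i> * (1 / (4 * n)) * (\<Sum>j=1..n. \<Sum>k=1..n. (CLINT \<omega>|M. P j k \<omega>) - (CLINT \<omega>|M. L j k \<omega>)))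
        + cmod (s * (CLINT \<omega>|M. (Q \<omega> - v) * iexp (s * S \<omega>)))"
      by (simp only: norm_triangle_ineq4)
    moreover have "cmod (\<i> * (1 / (4 * n)) * (\<Sum>j=1..n. \<Sum>k=1..n. (CLINT \<omega>|M. P j k \<omega>) - (CLINT \<omega>|M. L j k \<omega>)))
        \<le> 1 / (4 * n) * (\<Sum>j=1..n. \<Sum>k=1..n. (8 * m * K * s\<^sup>2 + 16 * \<bar>s\<bar> * \<tau>) * (c j - c k)\<^sup>2)"
      unfolding norm_mult using n0 rem
      by (intro mult_mono) (auto simp: norm_divide intro!: sum_norm_le)
    moreover have "1 / (4 * n) * (\<Sum>j=1..n. \<Sum>k=1..n. (8 * m * K * s\<^sup>2 + 16 * \<bar>s\<bar> * \<tau>) * (c j - c k)\<^sup>2)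
        = v * (4 * m * K * s\<^sup>2 + 8 * \<bar>s\<bar> * \<tau>)"
      unfolding sum_distrib_left[symmetric] sum_c2 using n0 by (simp add: algebra_simps)
    moreover have "cmod (s * (CLINT \<omega>|M. (Q \<omega> - v) * iexp (s * S \<omega>))) \<le>
        \<bar>s\<bar> * expectation (\<lambda>\<omega>. \<bar>Q \<omega> - v\<bar>)"
    proof -
      have "cmod (CLINT \<omega>|M. (Q \<omega> - v) * iexp (s * S \<omega>)) \<le> expectation (\<lambda>\<omega>. \<bar>Q \<omega> - v\<bar>)"
        using Q_int mult_iexp_int[of "\<lambda>\<omega>. Q \<omega> - v" "\<lambda>\<omega>. s * S \<omega>"]
        by (intro norm_integral_le_integral) (auto simp: norm_mult simp flip: of_real_diff)
      then show ?thesis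
        by (simp add: norm_mult mult_left_mono)
    qed
    ultimately have "cmod (\<phi>' s + s * v * \<phi> s) \<le>
        v * (4 * m * K * s\<^sup>2 + 8 * \<bar>s\<bar> * \<tau>) + \<bar>s\<bar> * expectation (\<lambda>\<omega>. \<bar>Q \<omega> - v\<bar>)"
      by linarith
    \<comment> \<open>The remainder contributes \<open>8 * \<tau>\<close> and the distance of
      \<open>Q\<close> from \<open>v\<close> one further \<open>\<tau>\<close>; together they form
      the 9 in the statement.\<close>
    also have "\<dots> \<le> v * (4 * m * K * t\<^sup>2 + 8 * \<bar>t\<bar> * \<tau>) + \<bar>t\<bar> * (v * \<tau> + K\<^sup>2 * m * sqrt v + v * \<eta>
        + v * sqrt (G / n) + G * v / n)"
      using s Q_le \<open>v \<ge> 0\<close> \<open>m \<ge> 0\<close> \<open>\<tau> \<ge> 0\<close> K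
      by (intro add_mono mult_mono mult_left_mono mult_right_mono) (auto simp: abs_le_square_iff)
    also have "\<dots> = \<bar>t\<bar> * (9 * v * \<tau> + K\<^sup>2 * m * sqrt v + v * \<eta> + v * sqrt (G / n)
      + G * v / n + 4 * m * K * \<bar>t\<bar> * v)"
      by (simp add: algebra_simps power2_eq_square)
    finally show ?thesis .
  qed
  have "\<phi> 0 = 1"
    by (simp add: \<phi>_def prob_space)
  then show ?thesis
    using gaussian_ode_bound[OF deriv _ \<open>v \<ge> 0\<close> main] unfolding \<phi>_def S_def by (simp only:)
qed

end

section \<open>Limit theorem for exchangeable arrays\<close>

lemma char_normal_density_zero_mean:
  assumes "\<sigma> > 0"
  shows "char (density lborel (normal_density 0 \<sigma>)) t = of_real (exp (- \<sigma>\<^sup>2 * t\<^sup>2 / 2))"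
proof -
  interpret std: prob_space std_normal_distribution
    by (rule prob_space_normal_density) simp
  have "distributed std_normal_distribution lborel (\<lambda>x. x) (normal_density 0 1)"
    by (auto simp: distributed_def distr_id2)
  then have "distributed std_normal_distribution lborel (\<lambda>x. 0 + \<sigma> * x) (normal_density (0 + \<sigma> * 0) (\<bar>\<sigma>\<bar> * 1))"
    using assms by (intro std.normal_density_affine) auto
  then have "density lborel (normal_density 0 \<sigma>) = distr std_normal_distribution borel (\<lambda>x. \<sigma> * x)"
    using assms by (auto simp: distributed_def cong: distr_cong)
  then have "char (density lborel (normal_density 0 \<sigma>)) t = (CLINT x|std_normal_distribution. iexp ((t * \<sigma>) * x))"
    unfolding char_def by (simp add: integral_distr mult_ac)
  also have "\<dots> = char std_normal_distribution (t * \<sigma>)"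
    by (simp add: char_def)
  also have "\<dots> = of_real (exp (- \<sigma>\<^sup>2 * t\<^sup>2 / 2))"
    by (simp add: char_std_normal_distribution power_mult_distrib mult.commute exp_of_real[symmetric])
  finally show ?thesis .
qed

lemma cdf_normal_density_isCont:
  assumes "\<sigma> > 0"
  shows "isCont (cdf (density lborel (normal_density \<mu> \<sigma>))) x"
proof -
  interpret prob_space "density lborel (normal_density \<mu> \<sigma>)"
    using assms by (rule prob_space_normal_density)
  interpret real_distribution "density lborel (normal_density \<mu> \<sigma>)"
    by standard auto
  have AE: "AE y in lborel. ennreal (normal_density \<mu> \<sigma> y) * indicator {x} y = 0"
    using AE_lborel_singleton[of x] by eventually_elim auto
  have "emeasure (density lborel (normal_density \<mu> \<sigma>)) {x} =
      (\<integral>\<^sup>+y. ennreal (normal_density \<mu> \<sigma> y) * indicator {x} y \<partial>lborel)"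
    by (simp add: emeasure_density)
  also have "\<dots> = 0"
    by (rule nn_integral_0_iff_AE[THEN iffD2, OF _ AE]) measurable
  finally have "emeasure (density lborel (normal_density \<mu> \<sigma>)) {x} = 0" .
  then show ?thesis
    by (simp add: isCont_cdf measure_def)
qed

text \<open>The form in which the conditions on the weights are used. \<open>row_tail\<close> is
  asymptotic uniform integrability of the squares, \<open>row_average\<close> is convergence in
  mean, and \<open>row_linear\<close> says that the second-moment matrices of the rows have bounded
  norm, which is the effect of covariances of order \<open>1 / n\<close>.\<close>

locale exchangeable_array = prob_space M for M :: "'a measure" +
  fixes W :: "nat \<Rightarrow> nat \<Rightarrow> 'a \<Rightarrow> real" and G :: real
  assumes row: "\<And>n. 2 \<le> n \<Longrightarrow> exchangeable_row M n (W n)"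
    and entry_measurable: "\<And>n j. j \<in> {1..n} \<Longrightarrow> W n j \<in> borel_measurable M"
    and row_square: "\<And>n. 2 \<le> n \<Longrightarrow> expectation (\<lambda>\<omega>. (W n 1 \<omega>)\<^sup>2) = 1"
    and row_average: "(\<lambda>n. expectation (\<lambda>\<omega>. \<bar>(1 / real n) * (\<Sum>j=1..n. (W n j \<omega>)\<^sup>2) - 1\<bar>)) \<longlonglongrightarrow> 0"
    and row_tail: "\<And>\<epsilon>. \<epsilon> > 0 \<Longrightarrow> \<exists>K\<ge>0. \<forall>\<^sub>F n in sequentially.
      expectation (\<lambda>\<omega>. (W n 1 \<omega>)\<^sup>2 * of_bool (\<bar>W n 1 \<omega>\<bar> > K)) \<le> \<epsilon>"
    and row_linear: "\<forall>\<^sub>F n in sequentially. \<forall>e. expectation (\<lambda>\<omega>. (\<Sum>j=1..n. e j * W n j \<omega>)\<^sup>2) \<le> G * (\<Sum>j=1..n. (e j)\<^sup>2)"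
begin

lemma row_linear_integrable:
  assumes "2 \<le> n"
  shows "integrable M (\<lambda>\<omega>. (\<Sum>j=1..n. e j * W n j \<omega>)\<^sup>2)"
proof -
  interpret exchangeable_row M n "W n"
    using assms by (rule row)
  have "integrable M (\<lambda>\<omega>. (W n 1 \<omega>)\<^sup>2)"
    using row_square[OF assms] not_integrable_integral_eq by fastforce
  then have "integrable M (\<lambda>\<omega>. (W n j \<omega>)\<^sup>2)" if "j \<in> {1..n}" for j
    using integrable_single[OF that, of "\<lambda>x. x\<^sup>2"] by simp
  then show ?thesis
    using entry_measurable by (intro integrable_sum_square) (auto simp: power_mult_distrib)
qed

text \<open>The error bound needs coefficients with sum 0. Centring them changes the form by their
  bounded sum times the mean of the weights, which vanishes in L1, and the sum of squares by a term
  of order \<open>1 / N k\<close>. The row numbers \<open>N k\<close> are kept general for the sake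
  of a later argument along sequences of counterexamples.\<close>

lemma characteristic_limit:
  assumes N: "filterlim N at_top sequentially"
    and m: "m \<longlonglongrightarrow> 0" "\<And>k j. j \<in> {1..N k} \<Longrightarrow> \<bar>c k j\<bar> \<le> m k"
    and v: "(\<lambda>k. \<Sum>j=1..N k. (c k j)\<^sup>2) \<longlonglongrightarrow> v"
    and C: "\<And>k. \<bar>\<Sum>j=1..N k. c k j\<bar> \<le> C"
  shows "(\<lambda>k. CLINT \<omega>|M. iexp (t * (\<Sum>j=1..N k. c k j * W (N k) j \<omega>))) \<longlonglongrightarrow> of_real (exp (- v * t\<^sup>2 / 2))"
proof -
  have N2: "\<forall>\<^sub>F k in sequentially. 2 \<le> N k"
    using N by (simp add: filterlim_at_top)
  have GN: "\<forall>\<^sub>F k in sequentially. \<forall>e. expectation (\<lambda>\<omega>. (\<Sum>j=1..N k. e j * W (N k) j \<omega>)\<^sup>2) \<le> G * (\<Sum>j=1..N k. (e j)\<^sup>2)"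
    using row_linear N by (rule eventually_compose_filterlim)
  have inv: "(\<lambda>k. 1 / real (N k)) \<longlonglongrightarrow> 0"
    using filterlim_compose[OF filterlim_real_sequentially N]
    by (intro tendsto_divide_0[OF tendsto_const] filterlim_at_top_imp_at_infinity)
  have "C \<ge> 0"
    using C[of 0] by linarith
  define s where "s = (\<lambda>k. \<Sum>j=1..N k. c k j)"
  define d where "d = (\<lambda>k j. c k j - s k / N k)"
  define u where "u = (\<lambda>k. \<Sum>j=1..N k. (d k j)\<^sup>2)"
  define \<eta> where "\<eta> = (\<lambda>n. expectation (\<lambda>\<omega>. \<bar>(1 / real n) * (\<Sum>j=1..n. (W n j \<omega>)\<^sup>2) - 1\<bar>))"
  define \<tau> where "\<tau> = (\<lambda>n K. expectation (\<lambda>\<omega>. (W n 1 \<omega>)\<^sup>2 * of_bool (\<bar>W n 1 \<omega>\<bar> > K)))"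
  have d0: "(\<Sum>j=1..N k. d k j) = 0" for k
    by (cases "N k = 0") (simp_all add: d_def sum_subtractf s_def)
  have u_eq: "u k = (\<Sum>j=1..N k. (c k j)\<^sup>2) - (s k)\<^sup>2 * (1 / N k)" for k
  proof (cases "N k = 0")
    case False
    have "u k = (\<Sum>j=1..N k. (c k j)\<^sup>2 - 2 * (s k / N k) * c k j + (s k / N k)\<^sup>2)"
      unfolding u_def by (intro sum.cong) (simp_all add: d_def power2_diff)
    also have "\<dots> = (\<Sum>j=1..N k. (c k j)\<^sup>2) - 2 * (s k / N k) * s k + N k * (s k / N k)\<^sup>2"
      unfolding sum.distrib sum_subtractf sum_distrib_left[symmetric] by (simp add: s_def)
    finally show ?thesis
      using False by (simp add: power2_eq_square)
  qed (simp add: u_def)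
  have s_sq: "(\<lambda>k. (s k)\<^sup>2 * (1 / N k)) \<longlonglongrightarrow> 0"
  proof (rule tendsto_sandwich[of "\<lambda>_. 0" _ _ "\<lambda>k. C\<^sup>2 * (1 / N k)"])
    have "(s k)\<^sup>2 \<le> C\<^sup>2" for k
      using C[of k] \<open>C \<ge> 0\<close> by (simp add: s_def abs_le_square_iff[symmetric])
    then show "\<forall>\<^sub>F k in sequentially. (s k)\<^sup>2 * (1 / N k) \<le> C\<^sup>2 * (1 / N k)"
      by (intro always_eventually allI mult_right_mono) auto
  qed (use tendsto_mult_right_zero[OF inv] in auto)
  then have u: "u \<longlonglongrightarrow> v"
    unfolding u_eq using tendsto_diff[OF v] by fastforce
  have u_nonneg: "u k \<ge> 0" for k
    by (simp add: u_def sum_nonneg)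
  define \<phi> where "\<phi> = (\<lambda>k. CLINT \<omega>|M. iexp (t * (\<Sum>j=1..N k. c k j * W (N k) j \<omega>)))"
  define \<psi> where "\<psi> = (\<lambda>k. CLINT \<omega>|M. iexp (t * (\<Sum>j=1..N k. d k j * W (N k) j \<omega>)))"
  \<comment> \<open>\<open>row_linear\<close> with all coefficients equal to \<open>1 / N k\<close>
    bounds the second moment of the mean weight by \<open>G / N k\<close>.\<close>
  have \<phi>\<psi>: "(\<lambda>k. \<phi> k - \<psi> k) \<longlonglongrightarrow> 0"
  proof (rule Lim_null_comparison[of _ "\<lambda>k. \<bar>t\<bar> * (C * sqrt (G * (1 / N k)))"])
    show "\<forall>\<^sub>F k in sequentially. norm (\<phi> k - \<psi> k) \<le> \<bar>t\<bar> * (C * sqrt (G * (1 / N k)))"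
      using N2 GN
    proof eventually_elim
      case (elim k)
      define A where "A = (\<lambda>\<omega>. \<Sum>j=1..N k. (1 / N k) * W (N k) j \<omega>)"
      define S where "S = (\<lambda>\<omega>. \<Sum>j=1..N k. d k j * W (N k) j \<omega>)"
      note [measurable] = entry_measurable
      have [measurable]: "A \<in> borel_measurable M" "S \<in> borel_measurable M"
        unfolding A_def S_def by measurable
      have A_sq: "integrable M (\<lambda>\<omega>. (A \<omega>)\<^sup>2)" "expectation (\<lambda>\<omega>. (A \<omega>)\<^sup>2) \<le> G * (1 / N k)"
        using elim row_linear_integrable[of "N k" "\<lambda>_. 1 / N k"] elim(2)[rule_format, of "\<lambda>_. 1 / N k"]
        by (auto simp: A_def power2_eq_square)
      have A: "expectation (\<lambda>\<omega>. \<bar>A \<omega>\<bar>) \<le> sqrt (G * (1 / N k))"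
        by (rule order.trans[OF expectation_abs_le_sqrt[OF _ A_sq(1)]]) (use A_sq in auto)
      have A_int: "integrable M A"
        using integrable_of_square[OF _ A_sq(1)] by simp
      have eq: "(\<Sum>j=1..N k. c k j * W (N k) j \<omega>) = S \<omega> + s k * A \<omega>" for \<omega>
        using elim by (simp add: S_def A_def d_def left_diff_distrib sum_subtractf sum_distrib_left)
      have int: "integrable M (\<lambda>\<omega>. iexp (t * f \<omega>))" if "f \<in> borel_measurable M" for f :: "'a \<Rightarrow> real"
        using that by (intro integrable_const_bound[where B = 1]) auto
      have \<psi>_eq: "\<psi> k = (CLINT \<omega>|M. iexp (t * S \<omega>))"
        by (simp only: \<psi>_def S_def)
      have "\<phi> k - \<psi> k = (CLINT \<omega>|M. iexp (t * (S \<omega> + s k * A \<omega>)) - iexp (t * S \<omega>))"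
        unfolding \<phi>_def \<psi>_eq eq
        by (intro Bochner_Integration.integral_diff[symmetric] int) measurable
      also have "norm \<dots> \<le> expectation (\<lambda>\<omega>. \<bar>t\<bar> * \<bar>s k\<bar> * \<bar>A \<omega>\<bar>)"
      proof (rule norm_integral_le_integral)
        show "integrable M (\<lambda>\<omega>. iexp (t * (S \<omega> + s k * A \<omega>)) - iexp (t * S \<omega>))"
          by (intro Bochner_Integration.integrable_diff int) measurable
        fix \<omega>
        have "iexp (t * (S \<omega> + s k * A \<omega>)) - iexp (t * S \<omega>) = iexp (t * S \<omega>) * (iexp (t * s k * A \<omega>) - 1)"
          by (simp add: algebra_simps exp_add)
        also have "norm \<dots> \<le> \<bar>t * s k * A \<omega>\<bar>"
          unfolding norm_mult using iexp_approx1[of "t * s k * A \<omega>" 0] by simp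
        finally show "norm (iexp (t * (S \<omega> + s k * A \<omega>)) - iexp (t * S \<omega>)) \<le> \<bar>t\<bar> * \<bar>s k\<bar> * \<bar>A \<omega>\<bar>"
          by (simp add: abs_mult)
      qed (use A_int in simp)
      also have "\<dots> = \<bar>t\<bar> * (\<bar>s k\<bar> * expectation (\<lambda>\<omega>. \<bar>A \<omega>\<bar>))"
        by simp
      also have "\<dots> \<le> \<bar>t\<bar> * (C * sqrt (G * (1 / N k)))"
        using C[of k] A \<open>C \<ge> 0\<close> by (intro mult_left_mono mult_mono) (auto simp: s_def)
      finally show ?case .
    qed
    show "(\<lambda>k. \<bar>t\<bar> * (C * sqrt (G * (1 / N k)))) \<longlonglongrightarrow> 0"
      using tendsto_real_sqrt[OF tendsto_mult_right_zero[OF inv, of G]]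
      by (auto intro!: tendsto_mult_right_zero)
  qed
  have m0: "m k \<ge> 0" if "2 \<le> N k" for k
    using m(2)[of 1 k] that by force
  have \<psi>_bound: "\<forall>\<^sub>F k in sequentially. cmod (\<psi> k - of_real (exp (- u k * t\<^sup>2 / 2))) \<le>
      \<bar>t\<bar> * (\<bar>t\<bar> * (9 * u k * \<tau> (N k) K + K\<^sup>2 * (2 * m k) * sqrt (u k) + u k * \<eta> (N k) + u k * sqrt (G * (1 / N k))
        + G * u k * (1 / N k) + 4 * (2 * m k) * K * \<bar>t\<bar> * u k))" if "K \<ge> 0" for K
    using N2 GN
  proof eventually_elim
    case (elim k)
    interpret exchangeable_row M "N k" "W (N k)"
      using elim(1) by (rule row)
    have "\<bar>s k\<bar> \<le> N k * m k"
    proof -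
      have "\<bar>s k\<bar> \<le> (\<Sum>j=1..N k. \<bar>c k j\<bar>)"
        unfolding s_def by (rule sum_abs)
      also have "\<dots> \<le> (\<Sum>j=1..N k. m k)"
        by (intro sum_mono m)
      finally show ?thesis
        by simp
    qed
    then have "\<bar>s k / N k\<bar> \<le> m k"
      using elim(1) by (simp add: field_simps)
    then have "\<bar>d k j\<bar> \<le> 2 * m k" if "j \<in> {1..N k}" for j
      unfolding d_def using m(2)[OF that] by linarith
    from characteristic_near_gaussian[OF this row_square[OF elim(1)] _ d0 that, of G t] elim
    show ?case
      by (simp add: \<psi>_def u_def \<tau>_def \<eta>_def)
  qed
  have rest: "(\<lambda>k. K\<^sup>2 * (2 * m k) * sqrt (u k) + u k * \<eta> (N k) + u k * sqrt (G * (1 / N k))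
        + G * u k * (1 / N k) + 4 * (2 * m k) * K * \<bar>t\<bar> * u k) \<longlonglongrightarrow> 0" for K
  proof -
    have \<eta>: "(\<lambda>k. \<eta> (N k)) \<longlonglongrightarrow> 0"
      using filterlim_compose[OF row_average N] by (simp add: \<eta>_def)
    have "(\<lambda>k. K\<^sup>2 * (2 * m k) * sqrt (u k) + u k * \<eta> (N k) + u k * sqrt (G * (1 / N k))
        + G * u k * (1 / N k) + 4 * (2 * m k) * K * \<bar>t\<bar> * u k) \<longlonglongrightarrow>
        K\<^sup>2 * (2 * 0) * sqrt v + v * 0 + v * sqrt (G * 0) + G * v * 0 + 4 * (2 * 0) * K * \<bar>t\<bar> * v"
      by (intro tendsto_intros \<eta> u m inv)
    then show ?thesis
      by simp
  qed
  have "v \<ge> 0"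
    using u_nonneg by (intro LIMSEQ_le_const[OF u]) auto
  have \<psi>: "(\<lambda>k. \<psi> k - of_real (exp (- u k * t\<^sup>2 / 2))) \<longlonglongrightarrow> 0"
  proof (rule tendstoI)
    fix \<epsilon> :: real
    assume "\<epsilon> > 0"
    \<comment> \<open>\<open>\<delta>\<close> makes \<open>9 * (v + 1) * \<delta>\<close> equal to
      \<open>\<epsilon> / (2 * (t\<^sup>2 + 1))\<close>. The level \<open>K\<close> is fixed through
      \<open>\<delta>\<close> first, and the other terms tend to 0 for this \<open>K\<close>. The
      denominator \<open>t\<^sup>2 + 1\<close> absorbs the prefactor and also covers
      \<open>t = 0\<close>.\<close>
    define \<delta> where "\<delta> = \<epsilon> / (2 * (t\<^sup>2 + 1) * (9 * (v + 1)))"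
    have pos: "t\<^sup>2 + 1 > 0"
      by (simp add: add_nonneg_pos)
    have "\<delta> > 0"
      using \<open>\<epsilon> > 0\<close> \<open>v \<ge> 0\<close> pos by (simp add: \<delta>_def)
    then obtain K where K: "K \<ge> 0" "\<forall>\<^sub>F n in sequentially. \<tau> n K \<le> \<delta>"
      using row_tail unfolding \<tau>_def by blast
    have \<tau>: "\<forall>\<^sub>F k in sequentially. \<tau> (N k) K \<le> \<delta>"
      using K(2) N by (rule eventually_compose_filterlim)
    have "\<forall>\<^sub>F k in sequentially. K\<^sup>2 * (2 * m k) * sqrt (u k) + u k * \<eta> (N k) + u k * sqrt (G * (1 / N k))
        + G * u k * (1 / N k) + 4 * (2 * m k) * K * \<bar>t\<bar> * u k < \<epsilon> / (2 * (t\<^sup>2 + 1))"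
      using \<open>\<epsilon> > 0\<close> pos by (intro order_tendstoD(2)[OF rest]) simp
    moreover have "\<forall>\<^sub>F k in sequentially. u k < v + 1"
      by (rule order_tendstoD(2)[OF u]) simp
    ultimately show "\<forall>\<^sub>F k in sequentially. dist (\<psi> k - of_real (exp (- u k * t\<^sup>2 / 2))) 0 < \<epsilon>"
      using \<psi>_bound[OF K(1)] \<tau>
    proof eventually_elim
      case (elim k)
      have "9 * u k * \<tau> (N k) K \<le> 9 * (v + 1) * \<delta>"
        using elim u_nonneg[of k] \<open>\<delta> > 0\<close> \<open>v \<ge> 0\<close> by (intro mult_mono) (auto simp: \<tau>_def)
      also have "\<dots> = \<epsilon> / (2 * (t\<^sup>2 + 1))"
        using \<open>v \<ge> 0\<close> by (simp add: \<delta>_def)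
      finally have "9 * u k * \<tau> (N k) K \<le> \<epsilon> / (2 * (t\<^sup>2 + 1))" .
      then have "9 * u k * \<tau> (N k) K + K\<^sup>2 * (2 * m k) * sqrt (u k) + u k * \<eta> (N k) + u k * sqrt (G * (1 / N k))
        + G * u k * (1 / N k) + 4 * (2 * m k) * K * \<bar>t\<bar> * u k \<le> \<epsilon> / (t\<^sup>2 + 1)"
      proof -
        have "\<epsilon> / (2 * (t\<^sup>2 + 1)) + \<epsilon> / (2 * (t\<^sup>2 + 1)) = \<epsilon> / (t\<^sup>2 + 1)"
          unfolding add_divide_distrib[symmetric] using pos by (simp add: divide_simps)
        moreover have "a + b1 + b2 + b3 + b4 + b5 \<le> q"
          if "a \<le> h" "b1 + b2 + b3 + b4 + b5 < h" "h + h = q" for a b1 b2 b3 b4 b5 h q :: real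
          using that by linarith
        ultimately show ?thesis
          using elim(1) \<open>9 * u k * \<tau> (N k) K \<le> \<epsilon> / (2 * (t\<^sup>2 + 1))\<close> by blast
      qed
      then have "\<bar>t\<bar> * (\<bar>t\<bar> * (9 * u k * \<tau> (N k) K + K\<^sup>2 * (2 * m k) * sqrt (u k) + u k * \<eta> (N k)
        + u k * sqrt (G * (1 / N k)) + G * u k * (1 / N k) + 4 * (2 * m k) * K * \<bar>t\<bar> * u k))
        \<le> \<bar>t\<bar> * (\<bar>t\<bar> * (\<epsilon> / (t\<^sup>2 + 1)))"
        by (intro mult_left_mono) auto
      also have "\<dots> = \<epsilon> * (t\<^sup>2 / (t\<^sup>2 + 1))"
        by (simp add: power2_eq_square)
      also have "\<dots> < \<epsilon> * 1"
        using \<open>\<epsilon> > 0\<close> pos by (intro mult_strict_left_mono) auto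
      finally show ?case
        using elim(3) by (simp add: dist_norm)
    qed
  qed
  have "(\<lambda>k. of_real (exp (- u k * t\<^sup>2 / 2))) \<longlonglongrightarrow> complex_of_real (exp (- v * t\<^sup>2 / 2))"
    by (intro tendsto_intros u) auto
  from tendsto_add[OF tendsto_add[OF \<phi>\<psi> \<psi>] this] show ?thesis
    by (simp add: \<phi>_def)
qed

lemma cdf_limit:
  assumes "v > 0" and N: "filterlim N at_top sequentially"
    and m: "m \<longlonglongrightarrow> 0" "\<And>k j. j \<in> {1..N k} \<Longrightarrow> \<bar>c k j\<bar> \<le> m k"
    and v: "(\<lambda>k. \<Sum>j=1..N k. (c k j)\<^sup>2) \<longlonglongrightarrow> v"
    and C: "\<And>k. \<bar>\<Sum>j=1..N k. c k j\<bar> \<le> C"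
  shows "(\<lambda>k. prob {\<omega> \<in> space M. (\<Sum>j=1..N k. c k j * W (N k) j \<omega>) \<le> x}) \<longlonglongrightarrow>
    cdf (density lborel (normal_density 0 (sqrt v))) x"
proof -
  define S where "S = (\<lambda>k \<omega>. \<Sum>j=1..N k. c k j * W (N k) j \<omega>)"
  define \<mu> where "\<mu> = density lborel (normal_density 0 (sqrt v))"
  note [measurable] = entry_measurable
  have [measurable]: "S k \<in> borel_measurable M" for k
    unfolding S_def by measurable
  have "prob_space \<mu>"
    unfolding \<mu>_def using \<open>v > 0\<close> by (intro prob_space_normal_density) simp
  then have \<mu>: "real_distribution \<mu>"
    unfolding real_distribution_def real_distribution_axioms_def by (simp add: \<mu>_def)
  have "weak_conv_m (\<lambda>k. distr M borel (S k)) \<mu>"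
  proof (rule levy_continuity[OF _ \<mu>])
    show "real_distribution (distr M borel (S k))" for k
      by simp
    show "(\<lambda>k. char (distr M borel (S k)) t) \<longlonglongrightarrow> char \<mu> t" for t
      using characteristic_limit[OF N m v C, of t] \<open>v > 0\<close>
      by (simp add: char_def[of "distr _ _ _"] integral_distr \<mu>_def char_normal_density_zero_mean S_def)
  qed
  moreover have "isCont (cdf \<mu>) x"
    unfolding \<mu>_def using \<open>v > 0\<close> by (intro cdf_normal_density_isCont) simp
  ultimately have "(\<lambda>k. cdf (distr M borel (S k)) x) \<longlonglongrightarrow> cdf \<mu> x"
    by (simp add: weak_conv_m_def weak_conv_def)
  moreover have "cdf (distr M borel (S k)) x = prob {\<omega> \<in> space M. S k \<omega> \<le> x}" for k
    unfolding cdf_def by (subst measure_distr) (auto intro!: arg_cong[where f = prob])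
  ultimately show ?thesis
    by (simp add: S_def \<mu>_def)
qed

text \<open>Uniformity over coefficient vectors is what allows random coefficients later, with one
  tolerance for the whole good event. It follows by contradiction: counterexamples with tolerances
  tending to 0 and growing row numbers would violate \<open>cdf_limit\<close>.\<close>

lemma cdf_uniform_limit:
  assumes "v > 0" "\<epsilon> > 0"
  shows "\<exists>\<eta>>0. \<exists>N. \<forall>n\<ge>N. \<forall>c. (\<forall>j\<in>{1..n}. \<bar>c j\<bar> \<le> \<eta>) \<longrightarrow> \<bar>(\<Sum>j=1..n. (c j)\<^sup>2) - v\<bar> \<le> \<eta> \<longrightarrow>
    \<bar>\<Sum>j=1..n. c j\<bar> \<le> C \<longrightarrow>
    \<bar>prob {\<omega> \<in> space M. (\<Sum>j=1..n. c j * W n j \<omega>) \<le> x} - cdf (density lborel (normal_density 0 (sqrt v))) x\<bar> < \<epsilon>"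
proof (rule ccontr)
  assume neg: "\<not> ?thesis"
  \<comment> \<open>A counterexample at tolerance \<open>1 / (k + 1)\<close> in a row with number at
    least \<open>k\<close>.\<close>
  define P where "P = (\<lambda>k n c. k \<le> n \<and> (\<forall>j\<in>{1..n}. \<bar>c j\<bar> \<le> 1 / real (Suc k)) \<and> \<bar>(\<Sum>j=1..n. (c j)\<^sup>2) - v\<bar> \<le> 1 / real (Suc k) \<and>
    \<bar>\<Sum>j=1..n. c j\<bar> \<le> C \<and>
    \<bar>prob {\<omega> \<in> space M. (\<Sum>j=1..n. c j * W n j \<omega>) \<le> x} - cdf (density lborel (normal_density 0 (sqrt v))) x\<bar> \<ge> \<epsilon>)"
  have "\<exists>n c. P k n c" for k
  proof -
    define A1 where "A1 = (\<lambda>\<eta> n (c :: nat \<Rightarrow> real). \<forall>j\<in>{1..n::nat}. \<bar>c j\<bar> \<le> (\<eta>::real))"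
    define A2 where "A2 = (\<lambda>\<eta> n (c :: nat \<Rightarrow> real). \<bar>(\<Sum>j=1..n::nat. (c j)\<^sup>2) - v\<bar> \<le> \<eta>)"
    define A3 where "A3 = (\<lambda>n (c :: nat \<Rightarrow> real). \<bar>\<Sum>j=1..n::nat. c j\<bar> \<le> C)"
    define A4 where "A4 = (\<lambda>n c. \<bar>prob {\<omega> \<in> space M. (\<Sum>j=1..n. c j * W n j \<omega>) \<le> x} -
      cdf (density lborel (normal_density 0 (sqrt v))) x\<bar>)"
    have "\<not> (\<exists>\<eta>>0. \<exists>N. \<forall>n\<ge>N. \<forall>c. A1 \<eta> n c \<longrightarrow> A2 \<eta> n c \<longrightarrow> A3 n c \<longrightarrow> A4 n c < \<epsilon>)"
      using neg unfolding A1_def A2_def A3_def A4_def .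
    moreover have "1 / real (Suc k) > 0"
      by simp
    ultimately have "\<exists>n\<ge>k. \<exists>c. \<not> (A1 (1 / real (Suc k)) n c \<longrightarrow> A2 (1 / real (Suc k)) n c \<longrightarrow> A3 n c \<longrightarrow> A4 n c < \<epsilon>)"
      by blast
    then have "\<exists>n c. k \<le> n \<and> A1 (1 / real (Suc k)) n c \<and> A2 (1 / real (Suc k)) n c \<and> A3 n c \<and> A4 n c \<ge> \<epsilon>"
      by (auto simp: not_less)
    then show ?thesis
      unfolding P_def A1_def A2_def A3_def A4_def .
  qed
  then obtain N c where P: "\<And>k. P k (N k) (c k)"
    by metis
  have Nc: "\<And>k. k \<le> N k" "\<And>k j. j \<in> {1..N k} \<Longrightarrow> \<bar>c k j\<bar> \<le> 1 / real (Suc k)"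
    "\<And>k. \<bar>(\<Sum>j=1..N k. (c k j)\<^sup>2) - v\<bar> \<le> 1 / real (Suc k)" "\<And>k. \<bar>\<Sum>j=1..N k. c k j\<bar> \<le> C"
    "\<And>k. \<bar>prob {\<omega> \<in> space M. (\<Sum>j=1..N k. c k j * W (N k) j \<omega>) \<le> x} - cdf (density lborel (normal_density 0 (sqrt v))) x\<bar> \<ge> \<epsilon>"
    using P unfolding P_def by blast+
  have N: "filterlim N at_top sequentially"
    using Nc(1) by (intro filterlim_at_top_mono[OF filterlim_ident]) auto
  have m: "(\<lambda>k. 1 / real (Suc k)) \<longlonglongrightarrow> 0"
    using LIMSEQ_inverse_real_of_nat by (simp add: inverse_eq_divide)
  have "(\<lambda>k. (\<Sum>j=1..N k. (c k j)\<^sup>2) - v) \<longlonglongrightarrow> 0"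
    using Nc(3) by (intro Lim_null_comparison[OF _ m]) auto
  then have v: "(\<lambda>k. \<Sum>j=1..N k. (c k j)\<^sup>2) \<longlonglongrightarrow> v"
    by (simp add: LIM_zero_iff)
  have "\<forall>\<^sub>F k in sequentially. dist (prob {\<omega> \<in> space M. (\<Sum>j=1..N k. c k j * W (N k) j \<omega>) \<le> x})
      (cdf (density lborel (normal_density 0 (sqrt v))) x) < \<epsilon>"
    using cdf_limit[OF \<open>v > 0\<close> N m Nc(2) v Nc(4)] \<open>\<epsilon> > 0\<close> by (rule tendstoD)
  then obtain k where "dist (prob {\<omega> \<in> space M. (\<Sum>j=1..N k. c k j * W (N k) j \<omega>) \<le> x})
      (cdf (density lborel (normal_density 0 (sqrt v))) x) < \<epsilon>"
    using eventually_happens trivial_limit_sequentially by blast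
  then show False
    using Nc(5)[of k] by (simp add: dist_real_def)
qed

end

section \<open>Innovations with median zero and a density at zero\<close>

text \<open>A density is determined only up to null sets. \<open>f_at_0\<close> ties
  \<open>f 0\<close> to the distribution function, and the local estimates at 0 go through this
  derivative.\<close>

locale lad_ar1 = ar1 M X Z \<theta> for M :: "'a measure" and X Z :: "int \<Rightarrow> 'a \<Rightarrow> real" and \<theta> :: real +
  fixes f :: "real \<Rightarrow> real"
  assumes Z_median: "\<And>t. is_median M (Z t) 0"
    and Z_density: "\<And>t. distributed M lborel (Z t) (\<lambda>x. ennreal (f x))"
    and f_at_0: "\<And>t. (cdf (distr M borel (Z t)) has_real_derivative f 0) (at 0)"
    and f_pos: "f 0 > 0"
begin

text \<open>A law with a density has no atoms. At \<open>a = 0\<close> this makes every sign of an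
  innovation \<open>1\<close> or \<open>- 1\<close>.\<close>

lemma innov_neq: "AE \<omega> in M. innov t \<omega> \<noteq> a"
proof -
  have AE: "AE y in lborel. ennreal (f y) * indicator {a} y = 0"
    using AE_lborel_singleton[of a] by eventually_elim auto
  have [measurable]: "(\<lambda>x. ennreal (f x)) \<in> borel_measurable lborel"
    using Z_density by (rule distributed_borel_measurable)
  have "emeasure M (Z t -` {a} \<inter> space M) = (\<integral>\<^sup>+y. ennreal (f y) * indicator {a} y \<partial>lborel)"
    by (rule distributed_emeasure[OF Z_density]) simp
  also have "\<dots> = 0"
    by (rule nn_integral_0_iff_AE[THEN iffD2, OF _ AE]) measurable
  finally have "AE \<omega> in M. \<omega> \<notin> Z t -` {a} \<inter> space M"
    by (intro AE_not_in) auto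
  then show ?thesis
    using innov_eq_Z[of t] AE_space by eventually_elim auto
qed

section \<open>The distribution function of the innovations near 0\<close>

definition F where "F x = prob {\<omega> \<in> space M. innov 1 \<omega> \<le> x}"

lemma F_eq_cdf: "F = cdf (distr M borel (Z 1))"
proof
  fix x
  have "cdf (distr M borel (Z 1)) x = prob {\<omega> \<in> space M. Z 1 \<omega> \<le> x}"
    unfolding cdf_def by (subst measure_distr) (auto intro!: arg_cong[where f = prob])
  also have "\<dots> = F x"
    unfolding F_def using innov_eq_Z[of 1] by (intro measure_eq_AE) auto
  finally show "F x = cdf (distr M borel (Z 1)) x"
    by simp
qed

lemma F_0: "F 0 = 1 / 2"
proof -
  have "F 0 = prob {\<omega> \<in> space M. Z 1 \<omega> \<le> 0}"
    unfolding F_def using innov_eq_Z[of 1] by (intro measure_eq_AE) auto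
  then have "F 0 \<ge> 1 / 2"
    using Z_median[of 1] by (simp add: is_median_def)
  moreover have "prob {\<omega> \<in> space M. Z 1 \<omega> \<ge> 0} = prob {\<omega> \<in> space M. \<not> innov 1 \<omega> \<le> 0}"
    using innov_eq_Z[of 1] innov_neq[of 1 0] by (intro measure_eq_AE) auto
  moreover have "prob {\<omega> \<in> space M. \<not> innov 1 \<omega> \<le> 0} = 1 - F 0"
    unfolding F_def by (rule prob_neg) measurable
  ultimately show ?thesis
    using Z_median[of 1] by (simp add: is_median_def)
qed

lemma prob_innov_pos: "0 \<le> s \<Longrightarrow> prob {\<omega> \<in> space M. 0 < innov 1 \<omega> \<and> innov 1 \<omega> \<le> s} = F s - F 0"
proof -
  assume "0 \<le> s"
  then have "F s - F 0 = prob ({\<omega> \<in> space M. innov 1 \<omega> \<le> s} - {\<omega> \<in> space M. innov 1 \<omega> \<le> 0})"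
    unfolding F_def by (intro finite_measure_Diff[symmetric]) auto
  then show ?thesis
    by (simp add: set_diff_eq not_le conj_ac cong: conj_cong)
qed

lemma prob_innov_neg: "0 \<le> s \<Longrightarrow> prob {\<omega> \<in> space M. 0 < - innov 1 \<omega> \<and> - innov 1 \<omega> \<le> s} = F 0 - F (- s)"
proof -
  assume "0 \<le> s"
  then have "F 0 - F (- s) = prob ({\<omega> \<in> space M. innov 1 \<omega> \<le> 0} - {\<omega> \<in> space M. innov 1 \<omega> \<le> - s})"
    unfolding F_def by (intro finite_measure_Diff[symmetric]) auto
  \<comment> \<open>The half-open interval changes its closed end here; the two endpoints
    \<open>0\<close> and \<open>- s\<close> carry no mass.\<close>
  also have "\<dots> = prob {\<omega> \<in> space M. 0 < - innov 1 \<omega> \<and> - innov 1 \<omega> \<le> s}"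
    using innov_neq[of 1 0] innov_neq[of 1 "- s"] by (intro measure_eq_AE) auto
  finally show ?thesis
    by simp
qed

lemma F_near_0:
  assumes "\<epsilon> > 0"
  obtains \<eta> where "\<eta> > 0" "\<And>h. \<bar>h\<bar> \<le> \<eta> \<Longrightarrow> \<bar>F h - F 0 - f 0 * h\<bar> \<le> \<epsilon> * \<bar>h\<bar>"
proof -
  have "((\<lambda>h. (F (0 + h) - F 0) / h) \<longlongrightarrow> f 0) (at 0)"
    using f_at_0[of 1] unfolding F_eq_cdf by (simp only: DERIV_def)
  then have "\<forall>\<^sub>F h in at 0. dist ((F (0 + h) - F 0) / h) (f 0) < \<epsilon>"
    using assms by (rule tendstoD)
  then obtain d where d: "d > 0" "\<And>h. h \<noteq> 0 \<Longrightarrow> dist h 0 < d \<Longrightarrow> dist ((F (0 + h) - F 0) / h) (f 0) < \<epsilon>"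
    unfolding eventually_at by auto
  show thesis
  proof (rule that[of "d / 2"])
    fix h :: real
    assume h: "\<bar>h\<bar> \<le> d / 2"
    show "\<bar>F h - F 0 - f 0 * h\<bar> \<le> \<epsilon> * \<bar>h\<bar>"
    proof (cases "h = 0")
      case False
      then have "\<bar>(F h - F 0) / h - f 0\<bar> * \<bar>h\<bar> \<le> \<epsilon> * \<bar>h\<bar>"
        using d(2)[of h] h d(1) by (intro mult_right_mono) (auto simp: dist_real_def)
      moreover have "F h - F 0 - f 0 * h = ((F h - F 0) / h - f 0) * h"
        using False by (simp add: field_simps)
      ultimately show ?thesis
        by (simp only: abs_mult)
    qed simp
  qed (use d in auto)
qed

lemma prob_innov_abs_le:
  obtains C where "C \<ge> 0" "\<And>s. 0 \<le> s \<Longrightarrow> prob {\<omega> \<in> space M. \<bar>innov 1 \<omega>\<bar> \<le> s} \<le> C * s"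
proof -
  obtain \<eta> where \<eta>: "\<eta> > 0" "\<And>h. \<bar>h\<bar> \<le> \<eta> \<Longrightarrow> \<bar>F h - F 0 - f 0 * h\<bar> \<le> 1 * \<bar>h\<bar>"
    using F_near_0[of 1] by auto
  \<comment> \<open>Up to \<open>\<eta>\<close> differentiability at 0 gives at most
    \<open>(f 0 + 1) * s\<close> on each side; beyond \<open>\<eta>\<close> the summand
    \<open>1 / \<eta>\<close> makes \<open>C * s\<close> at least 1.\<close>
  define C where "C = 2 * (f 0 + 1) + 1 / \<eta>"
  have "C \<ge> 0"
    using f_pos \<eta> by (simp add: C_def)
  moreover have "prob {\<omega> \<in> space M. \<bar>innov 1 \<omega>\<bar> \<le> s} \<le> C * s" if s: "0 \<le> s" for s
  proof (cases "s \<le> \<eta>")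
    case True
    have "prob {\<omega> \<in> space M. \<bar>innov 1 \<omega>\<bar> \<le> s} = prob ({\<omega> \<in> space M. 0 < innov 1 \<omega> \<and> innov 1 \<omega> \<le> s} \<union>
        {\<omega> \<in> space M. 0 < - innov 1 \<omega> \<and> - innov 1 \<omega> \<le> s})"
      using innov_neq[of 1 0] by (intro measure_eq_AE) auto
    also have "\<dots> \<le> (F s - F 0) + (F 0 - F (- s))"
      unfolding prob_innov_pos[OF s, symmetric] prob_innov_neg[OF s, symmetric]
      by (intro measure_Un_le) measurable
    also have "\<dots> \<le> 2 * (f 0 + 1) * s"
      using \<eta>(2)[of s] \<eta>(2)[of "- s"] True s by (simp add: abs_le_iff algebra_simps)
    also have "\<dots> \<le> C * s"
      using s \<eta> by (intro mult_right_mono) (auto simp: C_def)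
    finally show ?thesis .
  next
    case False
    then have "1 \<le> 1 / \<eta> * s"
      using \<eta> by (simp add: le_divide_eq)
    also have "\<dots> \<le> C * s"
      using s f_pos by (intro mult_right_mono) (auto simp: C_def)
    finally show ?thesis
      using prob_le_1 order_trans by blast
  qed
  ultimately show thesis
    by (rule that)
qed

lemma expectation_sgn_innov: "expectation (\<lambda>\<omega>. sgn (innov 1 \<omega>)) = 0"
proof -
  have "expectation (\<lambda>\<omega>. sgn (innov 1 \<omega>)) = expectation (\<lambda>\<omega>. 1 - 2 * indicator {\<omega> \<in> space M. innov 1 \<omega> \<le> 0} \<omega>)"
  proof (rule integral_cong_AE)
    show "AE \<omega> in M. sgn (innov 1 \<omega>) = 1 - 2 * indicator {\<omega> \<in> space M. innov 1 \<omega> \<le> 0} \<omega>"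
      using innov_neq[of 1 0] AE_space by eventually_elim (auto simp: sgn_if indicator_def)
  qed measurable
  also have "\<dots> = 1 - 2 * F 0"
  proof -
    have "integrable M (indicat_real {\<omega> \<in> space M. innov 1 \<omega> \<le> 0})"
      by (rule integrable_real_indicator) (auto simp: emeasure_eq_measure)
    then show ?thesis
      by (simp add: F_def prob_space)
  qed
  finally show ?thesis
    by (simp add: F_0)
qed

text \<open>If \<open>X 0\<close> vanished almost surely, so would every \<open>X t\<close> and with
  it \<open>innov 1\<close>, which has no atom at 0.\<close>

lemma variance_X_pos: "expectation (\<lambda>\<omega>. (X 0 \<omega>)\<^sup>2) > 0"
proof (rule ccontr)
  assume "\<not> ?thesis"
  moreover have "expectation (\<lambda>\<omega>. (X 0 \<omega>)\<^sup>2) \<ge> 0"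
    by simp
  ultimately have zero: "expectation (\<lambda>\<omega>. (X 0 \<omega>)\<^sup>2) = 0"
    by linarith
  have X_0: "AE \<omega> in M. X t \<omega> = 0" for t
  proof -
    have "expectation (\<lambda>\<omega>. (X t \<omega>)\<^sup>2) = 0"
      using expectation_X[of "\<lambda>x. x\<^sup>2" t] zero by simp
    then have "AE \<omega> in M. (X t \<omega>)\<^sup>2 = 0"
      using X_moments(1)[of t] by (subst (asm) integral_nonneg_eq_0_iff_AE) auto
    then show ?thesis
      by simp
  qed
  have "AE \<omega> in M. False"
    using X_0[of 1] X_0[of 0] innov_neq[of 1 0] by eventually_elim (simp add: innov_def)
  then show False
    by simp
qed

subsection \<open>The mean of the remainder\<close>

definition mean_rem :: "real \<Rightarrow> real" where
  "mean_rem y = expectation (\<lambda>\<omega>. lad_rem (innov 1 \<omega>) y)"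

lemma lad_rem_abs_le: "\<bar>lad_rem z y\<bar> \<le> 2 * \<bar>y\<bar>"
  using lad_rem_nonneg[of z y] lad_rem_le[of z y] by (auto simp: of_bool_def split: if_splits)

lemma integrable_lad_rem_innov: "integrable M (\<lambda>\<omega>. lad_rem (innov 1 \<omega>) y)"
  by (rule integrable_const_bound[where B = "2 * \<bar>y\<bar>"]) (auto simp: lad_rem_abs_le)

lemma mean_rem_measurable [measurable]: "mean_rem \<in> borel_measurable borel"
  unfolding mean_rem_def by measurable

lemma mean_rem_nonneg: "0 \<le> mean_rem y"
  unfolding mean_rem_def by (intro integral_nonneg_AE AE_I2 lad_rem_nonneg)

text \<open>A size of order \<open>\<bar>y\<bar>\<close> on an event with probability of order
  \<open>\<bar>y\<bar>\<close>. This quadratic bound is global in \<open>y\<close> and serves as the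
  dominating function when the shift tends to 0.\<close>

lemma mean_rem_le:
  assumes C: "\<And>s. 0 \<le> s \<Longrightarrow> prob {\<omega> \<in> space M. \<bar>innov 1 \<omega>\<bar> \<le> s} \<le> C * s"
  shows "mean_rem y \<le> 2 * C * y\<^sup>2"
proof -
  have "mean_rem y \<le> expectation (\<lambda>\<omega>. 2 * \<bar>y\<bar> * indicator {\<omega> \<in> space M. \<bar>innov 1 \<omega>\<bar> \<le> \<bar>y\<bar>} \<omega>)"
    unfolding mean_rem_def
  proof (rule integral_mono)
    fix \<omega>
    assume "\<omega> \<in> space M"
    then show "lad_rem (innov 1 \<omega>) y \<le> 2 * \<bar>y\<bar> * indicator {\<omega> \<in> space M. \<bar>innov 1 \<omega>\<bar> \<le> \<bar>y\<bar>} \<omega>"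
      using lad_rem_le[of "innov 1 \<omega>" y] by (simp add: indicator_def)
  next
    show "integrable M (\<lambda>\<omega>. 2 * \<bar>y\<bar> * indicator {\<omega> \<in> space M. \<bar>innov 1 \<omega>\<bar> \<le> \<bar>y\<bar>} \<omega>)"
      by (intro integrable_mult_right integrable_real_indicator) (auto simp: emeasure_eq_measure)
  qed (auto simp: integrable_lad_rem_innov)
  also have "\<dots> = 2 * \<bar>y\<bar> * prob {\<omega> \<in> space M. \<bar>innov 1 \<omega>\<bar> \<le> \<bar>y\<bar>}"
    by simp
  also have "\<dots> \<le> 2 * \<bar>y\<bar> * (C * \<bar>y\<bar>)"
    by (intro mult_left_mono C) auto
  also have "\<dots> = 2 * C * (\<bar>y\<bar> * \<bar>y\<bar>)"
    by (simp only: mult_ac)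
  finally show ?thesis
    by (simp add: power2_eq_square)
qed

text \<open>Knight's integral for the remainder, with the expectation taken inside by Tonelli. The
  sign \<open>e\<close> treats both directions of the shift. One integration is what lifts
  first-order information on \<open>F\<close> at 0 to a second-order expansion of the mean
  remainder.\<close>

lemma mean_rem_eq_integral:
  assumes e: "e = 1 \<or> e = - 1" and "0 \<le> y"
  shows "ennreal (mean_rem (e * y)) =
    (\<integral>\<^sup>+s. ennreal (2 * prob {\<omega> \<in> space M. 0 < e * innov 1 \<omega> \<and> e * innov 1 \<omega> \<le> s}) * indicator {0..y} s \<partial>lborel)"
proof -
  define k where "k = (\<lambda>u s. 2 * of_bool (0 < u \<and> u \<le> s) * indicator {0..y} s :: real)"
  have k_meas [measurable]: "case_prod k \<in> borel_measurable (borel \<Otimes>\<^sub>M borel)"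
    unfolding k_def by measurable
  have rem: "ennreal (lad_rem z (e * y)) = (\<integral>\<^sup>+s. ennreal (k (e * z) s) \<partial>lborel)" if "z \<noteq> 0" for z
  proof -
    define u where "u = e * z"
    have u: "u \<noteq> 0" "\<bar>z\<bar> = \<bar>u\<bar>" "\<bar>z - e * y\<bar> = \<bar>u - y\<bar>" "e * y * sgn z = y * sgn u"
      using e that by (auto simp: u_def sgn_if)
    have "lad_rem z (e * y) = \<bar>u - y\<bar> - \<bar>u\<bar> + y * sgn u"
      unfolding lad_rem_def u ..
    also have "\<dots> = (if 0 < u \<and> u \<le> y then 2 * (y - u) else 0)"
      using \<open>u \<noteq> 0\<close> \<open>0 \<le> y\<close> by (auto simp: sgn_if)
    finally have 1: "lad_rem z (e * y) = (if 0 < u \<and> u \<le> y then 2 * (y - u) else 0)" .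
    have "(\<integral>\<^sup>+s. ennreal (k u s) \<partial>lborel) = ennreal (if 0 < u \<and> u \<le> y then 2 * (y - u) else 0)"
    proof (cases "0 < u \<and> u \<le> y")
      case True
      then have "k u s = 2 * indicator {u..y} s" for s
        by (auto simp: k_def indicator_def)
      then have "(\<integral>\<^sup>+s. ennreal (k u s) \<partial>lborel) = (\<integral>\<^sup>+s. 2 * indicator {u..y} s \<partial>lborel)"
        by (simp add: ennreal_mult ennreal_indicator)
      also have "\<dots> = 2 * ennreal (y - u)"
        using True by (subst nn_integral_cmult_indicator) auto
      also have "\<dots> = ennreal (2 * (y - u))"
        using True by (subst ennreal_mult) auto
      finally show ?thesis
        unfolding if_P[OF True] .
    next
      case False
      then have "k u s = 0" for s
        by (auto simp: k_def indicator_def)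
      then show ?thesis
        unfolding if_not_P[OF False] by simp
    qed
    then show ?thesis
      unfolding 1 u_def by simp
  qed
  have "ennreal (mean_rem (e * y)) = (\<integral>\<^sup>+\<omega>. ennreal (lad_rem (innov 1 \<omega>) (e * y)) \<partial>M)"
    unfolding mean_rem_def using integrable_lad_rem_innov
    by (intro nn_integral_eq_integral[symmetric]) (auto simp: lad_rem_nonneg)
  also have "\<dots> = (\<integral>\<^sup>+\<omega>. \<integral>\<^sup>+s. ennreal (k (e * innov 1 \<omega>) s) \<partial>lborel \<partial>M)"
    using innov_neq[of 1 0] rem by (intro nn_integral_cong_AE) auto
  also have "\<dots> = (\<integral>\<^sup>+s. \<integral>\<^sup>+\<omega>. ennreal (k (e * innov 1 \<omega>) s) \<partial>M \<partial>lborel)"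
  proof -
    interpret P: pair_sigma_finite lborel M
      by standard
    show ?thesis
      by (rule P.Fubini') measurable
  qed
  also have "\<dots> = (\<integral>\<^sup>+s. ennreal (2 * prob {\<omega> \<in> space M. 0 < e * innov 1 \<omega> \<and> e * innov 1 \<omega> \<le> s}) * indicator {0..y} s \<partial>lborel)"
  proof (rule nn_integral_cong)
    fix s
    have "(\<integral>\<^sup>+\<omega>. ennreal (k (e * innov 1 \<omega>) s) \<partial>M) =
        (\<integral>\<^sup>+\<omega>. ennreal (2 * indicator {0..y} s) * indicator {\<omega> \<in> space M. 0 < e * innov 1 \<omega> \<and> e * innov 1 \<omega> \<le> s} \<omega> \<partial>M)"
      by (intro nn_integral_cong) (auto simp: k_def indicator_def)
    also have "\<dots> = ennreal (2 * indicator {0..y} s) * ennreal (prob {\<omega> \<in> space M. 0 < e * innov 1 \<omega> \<and> e * innov 1 \<omega> \<le> s})"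
      by (subst nn_integral_cmult_indicator) (auto simp: emeasure_eq_measure)
    finally show "(\<integral>\<^sup>+\<omega>. ennreal (k (e * innov 1 \<omega>) s) \<partial>M) =
        ennreal (2 * prob {\<omega> \<in> space M. 0 < e * innov 1 \<omega> \<and> e * innov 1 \<omega> \<le> s}) * indicator {0..y} s"
      by (simp add: indicator_def ennreal_mult)
  qed
  finally show ?thesis .
qed

lemma nn_integral_linear_Icc:
  assumes "0 \<le> c" "0 \<le> y"
  shows "(\<integral>\<^sup>+s. ennreal (2 * (c * s)) * indicator {0..y} s \<partial>lborel) = ennreal (c * y\<^sup>2)"
proof -
  have "(\<integral>\<^sup>+s. ennreal (2 * (c * s)) * indicator {0..y} s \<partial>lborel) = ennreal (c * y\<^sup>2 - c * 0\<^sup>2)"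
    by (rule nn_integral_FTC_Icc) (use assms in \<open>auto intro!: derivative_eq_intros\<close>)
  then show ?thesis
    by simp
qed

text \<open>The increments of \<open>F\<close> on either side of 0 are \<open>f 0 * s\<close> up to
  \<open>\<epsilon> * s\<close>, and twice the integral of \<open>f 0 * s\<close> over
  \<open>{0..y}\<close> is \<open>f 0 * y\<^sup>2\<close>.\<close>

lemma mean_rem_near_0:
  assumes "\<epsilon> > 0"
  obtains \<eta> where "\<eta> > 0" "\<And>y. \<bar>y\<bar> \<le> \<eta> \<Longrightarrow> \<bar>mean_rem y - f 0 * y\<^sup>2\<bar> \<le> \<epsilon> * y\<^sup>2"
proof -
  obtain \<eta> where \<eta>: "\<eta> > 0" "\<And>h. \<bar>h\<bar> \<le> \<eta> \<Longrightarrow> \<bar>F h - F 0 - f 0 * h\<bar> \<le> \<epsilon> * \<bar>h\<bar>"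
    using F_near_0[OF assms] by blast
  have main: "\<bar>mean_rem (e * y) - f 0 * y\<^sup>2\<bar> \<le> \<epsilon> * y\<^sup>2" if e: "e = 1 \<or> e = - 1" and y: "0 \<le> y" "y \<le> \<eta>" for e y
  proof -
    define g where "g = (\<lambda>s. prob {\<omega> \<in> space M. 0 < e * innov 1 \<omega> \<and> e * innov 1 \<omega> \<le> s})"
    have g: "\<bar>g s - f 0 * s\<bar> \<le> \<epsilon> * s" if "0 \<le> s" "s \<le> y" for s
    proof -
      have "g s = F s - F 0 \<or> g s = F 0 - F (- s)"
        using e that prob_innov_pos[of s] prob_innov_neg[of s] by (auto simp: g_def)
      then show ?thesis
        using \<eta>(2)[of s] \<eta>(2)[of "- s"] that y by (auto simp: abs_le_iff algebra_simps)
    qed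
    have eq: "ennreal (mean_rem (e * y)) = (\<integral>\<^sup>+s. ennreal (2 * g s) * indicator {0..y} s \<partial>lborel)"
      unfolding g_def by (rule mean_rem_eq_integral[OF e y(1)])
    have "ennreal (mean_rem (e * y)) \<le> (\<integral>\<^sup>+s. ennreal (2 * ((f 0 + \<epsilon>) * s)) * indicator {0..y} s \<partial>lborel)"
      unfolding eq
    proof (rule nn_integral_mono)
      fix s
      have "2 * g s \<le> 2 * ((f 0 + \<epsilon>) * s)" if "0 \<le> s" "s \<le> y"
        using g[OF that] by (simp add: abs_le_iff algebra_simps)
      then show "ennreal (2 * g s) * indicator {0..y} s \<le> ennreal (2 * ((f 0 + \<epsilon>) * s)) * indicator {0..y} s"
        by (auto simp: indicator_def intro!: ennreal_leI)
    qed
    also have "\<dots> = ennreal ((f 0 + \<epsilon>) * y\<^sup>2)"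
      using f_pos assms y by (intro nn_integral_linear_Icc) auto
    finally have upper: "mean_rem (e * y) \<le> (f 0 + \<epsilon>) * y\<^sup>2"
      using f_pos assms by (simp add: ennreal_le_iff)
    have lower: "(f 0 - \<epsilon>) * y\<^sup>2 \<le> mean_rem (e * y)"
    \<comment> \<open>For \<open>\<epsilon> > f 0\<close> the lower bound is not positive and
      follows from \<open>mean_rem_nonneg\<close>; as an integral in \<open>ennreal\<close> it would
      be truncated at 0.\<close>
    proof (cases "\<epsilon> \<le> f 0")
      case True
      have "ennreal ((f 0 - \<epsilon>) * y\<^sup>2) = (\<integral>\<^sup>+s. ennreal (2 * ((f 0 - \<epsilon>) * s)) * indicator {0..y} s \<partial>lborel)"
        using True y by (intro nn_integral_linear_Icc[symmetric]) auto
      also have "\<dots> \<le> ennreal (mean_rem (e * y))"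
        unfolding eq
      proof (rule nn_integral_mono)
        fix s
        have "2 * ((f 0 - \<epsilon>) * s) \<le> 2 * g s" if "0 \<le> s" "s \<le> y"
          using g[OF that] by (simp add: abs_le_iff algebra_simps)
        then show "ennreal (2 * ((f 0 - \<epsilon>) * s)) * indicator {0..y} s \<le> ennreal (2 * g s) * indicator {0..y} s"
          by (auto simp: indicator_def intro!: ennreal_leI)
      qed
      finally show ?thesis
        by (simp add: ennreal_le_iff mean_rem_nonneg)
    next
      case False
      then have "(f 0 - \<epsilon>) * y\<^sup>2 \<le> 0"
        by (simp add: mult_nonpos_nonneg)
      then show ?thesis
        using mean_rem_nonneg[of "e * y"] by linarith
    qed
    show ?thesis
      using upper lower by (simp add: abs_le_iff algebra_simps)
  qed
  show thesis
  proof (rule that[OF \<eta>(1)])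
    fix y :: real
    assume "\<bar>y\<bar> \<le> \<eta>"
    then show "\<bar>mean_rem y - f 0 * y\<^sup>2\<bar> \<le> \<epsilon> * y\<^sup>2"
      using main[of 1 y] main[of "- 1" "- y"] by (cases "0 \<le> y") auto
  qed
qed

end

section \<open>Weighted sums of lagged innovations\<close>

lemma (in exchangeable_array) G_nonneg: "0 \<le> G"
proof -
  have "\<forall>\<^sub>F n in sequentially. 0 < n"
    by (rule eventually_gt_at_top)
  with row_linear have "\<forall>\<^sub>F n in sequentially. 0 \<le> G"
  proof eventually_elim
    case (elim n)
    have "0 \<le> G * (\<Sum>j=1..n. (1::real)\<^sup>2)"
      by (rule order.trans[OF _ elim(1)[rule_format]]) simp
    then show ?case
      using elim(2) by (simp add: zero_le_mult_iff)
  qed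
  then show ?thesis
    by simp
qed

locale bootstrap_lad = lad_ar1 M X Z \<theta> f + exchangeable_array M W G
  for M :: "'a measure" and X Z :: "int \<Rightarrow> 'a \<Rightarrow> real" and \<theta> :: real and f :: "real \<Rightarrow> real"
    and W :: "nat \<Rightarrow> nat \<Rightarrow> 'a \<Rightarrow> real" and G :: real +
  assumes indep: "\<And>n. indep_pair (Pi\<^sub>M {1..int n} (\<lambda>_. borel)) (\<lambda>\<omega>. \<lambda>t\<in>{1..int n}. X t \<omega>)
      (Pi\<^sub>M {1..n} (\<lambda>_. borel)) (\<lambda>\<omega>. \<lambda>j\<in>{1..n}. W n j \<omega>)"
begin

definition linear_bound :: "nat \<Rightarrow> bool" where
  "linear_bound n \<longleftrightarrow> 2 \<le> n \<and>
    (\<forall>e. expectation (\<lambda>\<omega>. (\<Sum>j=1..n. e j * W n j \<omega>)\<^sup>2) \<le> G * (\<Sum>j=1..n. (e j)\<^sup>2))"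

lemma eventually_linear_bound: "\<forall>\<^sub>F n in sequentially. linear_bound n"
  using row_linear eventually_ge_at_top[of 2] by eventually_elim (simp add: linear_bound_def)

lemma sum_from_2:
  fixes c :: "nat \<Rightarrow> real"
  assumes "2 \<le> n"
  shows "(\<Sum>j=1..n. (if j = 1 then 0 else c j) * y j) = (\<Sum>j=2..n. y j * c j)"
proof -
  have "(\<Sum>j=1..n. (if j = 1 then 0 else c j) * y j) = (\<Sum>j=2..n. (if j = 1 then 0 else c j) * y j)"
    using assms by (subst sum.atLeast_Suc_atMost) (auto simp: numeral_2_eq_2)
  also have "\<dots> = (\<Sum>j=2..n. y j * c j)"
    by (intro sum.cong) auto
  finally show ?thesis .
qed

text \<open>With the data frozen, the sum is a linear form in the weights, and
  \<open>row_linear\<close> bounds its second moment by \<open>G\<close> times the sum of squared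
  coefficients. Averaging over the data leaves \<open>n\<close> equal moments. The order
  \<open>sqrt n\<close> of the sum thus comes from the weights and not from centring of
  \<open>\<phi>\<close>.\<close>

lemma weighted_sum_square:
  fixes \<phi> :: "real \<Rightarrow> real \<Rightarrow> real"
  assumes n: "linear_bound n" and \<phi> [measurable]: "case_prod \<phi> \<in> borel_measurable (borel \<Otimes>\<^sub>M borel)"
    and sq: "integrable M (\<lambda>\<omega>. (\<phi> (innov 1 \<omega>) (X 0 \<omega>))\<^sup>2)"
    and b: "expectation (\<lambda>\<omega>. (\<phi> (innov 1 \<omega>) (X 0 \<omega>))\<^sup>2) \<le> b"
  shows "(\<integral>\<^sup>+\<omega>. ennreal ((\<Sum>t=2..n. W n t \<omega> * \<phi> (innov (int t) \<omega>) (X (int t - 1) \<omega>))\<^sup>2) \<partial>M) \<le> ennreal (G * n * b)"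
proof -
  have n2: "2 \<le> n"
    using n by (simp add: linear_bound_def)
  have "b \<ge> 0"
    by (rule order.trans[OF _ b]) simp
  \<comment> \<open>The observations provide no lag for \<open>j = 1\<close>; coefficient 0 there
    lets the sum run over the whole row.\<close>
  define c where "c = (\<lambda>(x :: int \<Rightarrow> real) j. if j = 1 then 0 else \<phi> (x (int j) - \<theta> * x (int j - 1)) (x (int j - 1)))"
  have c_meas [measurable]: "(\<lambda>x. c x j) \<in> borel_measurable (Pi\<^sub>M {1..int n} (\<lambda>_. borel))" if "j \<in> {1..n}" for j
  proof (cases "j = 1")
    case False
    then have [measurable]: "(\<lambda>x. x (int j)) \<in> borel_measurable (Pi\<^sub>M {1..int n} (\<lambda>_. borel))"
      "(\<lambda>x. x (int j - 1)) \<in> borel_measurable (Pi\<^sub>M {1..int n} (\<lambda>_. borel))"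
      using that by (auto intro!: measurable_component_singleton)
    show ?thesis
      unfolding c_def using False by simp
  qed (simp add: c_def)
  define g where "g = (\<lambda>(x, w). ennreal ((\<Sum>j=1..n. c x j * w j)\<^sup>2))"
  have g: "g \<in> borel_measurable (Pi\<^sub>M {1..int n} (\<lambda>_. borel) \<Otimes>\<^sub>M Pi\<^sub>M {1..n} (\<lambda>_. borel))"
    unfolding g_def by measurable
  define x where "x = (\<lambda>\<omega>. \<lambda>t\<in>{1..int n}. X t \<omega>)"
  have c_x: "c (x \<omega>) j = (if j = 1 then 0 else \<phi> (innov (int j) \<omega>) (X (int j - 1) \<omega>))" if "j \<in> {1..n}" for \<omega> j
    using that by (auto simp: c_def x_def innov_def)
  have g_eq: "g (x \<omega>, \<lambda>j\<in>{1..n}. W n j \<omega>') = ennreal ((\<Sum>j=1..n. c (x \<omega>) j * W n j \<omega>')\<^sup>2)" for \<omega> \<omega>'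
  proof -
    have "(\<Sum>j=1..n. c (x \<omega>) j * (\<lambda>j\<in>{1..n}. W n j \<omega>') j) = (\<Sum>j=1..n. c (x \<omega>) j * W n j \<omega>')"
      by (intro sum.cong) auto
    then show ?thesis
      by (simp add: g_def)
  qed
  have mean: "(\<integral>\<^sup>+\<omega>. ennreal (G * (\<Sum>j=1..n. (c (x \<omega>) j)\<^sup>2)) \<partial>M) = ennreal (expectation (\<lambda>\<omega>. G * (\<Sum>j=1..n. (c (x \<omega>) j)\<^sup>2)))"
    and mean_le: "expectation (\<lambda>\<omega>. G * (\<Sum>j=1..n. (c (x \<omega>) j)\<^sup>2)) \<le> G * n * b"
  proof -
    have c_sq: "integrable M (\<lambda>\<omega>. (c (x \<omega>) j)\<^sup>2)" "expectation (\<lambda>\<omega>. (c (x \<omega>) j)\<^sup>2) \<le> b" if "j \<in> {1..n}" for j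
      unfolding c_x[OF that]
      using integrable_innov_lag[of "\<lambda>z x. (\<phi> z x)\<^sup>2" "int j"] expectation_innov_lag[of "\<lambda>z x. (\<phi> z x)\<^sup>2" "int j"] sq b
        \<open>b \<ge> 0\<close> by (cases "j = 1"; simp)+
    then have int: "integrable M (\<lambda>\<omega>. G * (\<Sum>j=1..n. (c (x \<omega>) j)\<^sup>2))"
      by (intro integrable_mult_right Bochner_Integration.integrable_sum)
    then show "(\<integral>\<^sup>+\<omega>. ennreal (G * (\<Sum>j=1..n. (c (x \<omega>) j)\<^sup>2)) \<partial>M) = ennreal (expectation (\<lambda>\<omega>. G * (\<Sum>j=1..n. (c (x \<omega>) j)\<^sup>2)))"
      using G_nonneg by (intro nn_integral_eq_integral AE_I2 mult_nonneg_nonneg sum_nonneg) auto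
    have "expectation (\<lambda>\<omega>. G * (\<Sum>j=1..n. (c (x \<omega>) j)\<^sup>2)) = G * (\<Sum>j=1..n. expectation (\<lambda>\<omega>. (c (x \<omega>) j)\<^sup>2))"
      using c_sq by (subst integral_mult_right_zero, subst Bochner_Integration.integral_sum) auto
    also have "\<dots> \<le> G * (\<Sum>j=1..n. b)"
      using c_sq G_nonneg by (intro mult_left_mono sum_mono)
    finally show "expectation (\<lambda>\<omega>. G * (\<Sum>j=1..n. (c (x \<omega>) j)\<^sup>2)) \<le> G * n * b"
      by simp
  qed
  have "(\<Sum>t=2..n. W n t \<omega> * \<phi> (innov (int t) \<omega>) (X (int t - 1) \<omega>)) = (\<Sum>j=1..n. c (x \<omega>) j * W n j \<omega>)" for \<omega>
    unfolding sum_from_2[OF n2, symmetric] using c_x by (intro sum.cong) auto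
  then have "(\<integral>\<^sup>+\<omega>. ennreal ((\<Sum>t=2..n. W n t \<omega> * \<phi> (innov (int t) \<omega>) (X (int t - 1) \<omega>))\<^sup>2) \<partial>M) =
      (\<integral>\<^sup>+\<omega>. g (x \<omega>, \<lambda>j\<in>{1..n}. W n j \<omega>) \<partial>M)"
    unfolding g_eq by simp
  also have "\<dots> = (\<integral>\<^sup>+\<omega>. \<integral>\<^sup>+\<omega>'. g (x \<omega>, \<lambda>j\<in>{1..n}. W n j \<omega>') \<partial>M \<partial>M)"
    unfolding x_def by (rule nn_integral_indep_pair[OF indep g])
  also have "\<dots> \<le> (\<integral>\<^sup>+\<omega>. ennreal (G * (\<Sum>j=1..n. (c (x \<omega>) j)\<^sup>2)) \<partial>M)"
  proof (rule nn_integral_mono)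
    fix \<omega>
    have "(\<integral>\<^sup>+\<omega>'. g (x \<omega>, \<lambda>j\<in>{1..n}. W n j \<omega>') \<partial>M) = ennreal (expectation (\<lambda>\<omega>'. (\<Sum>j=1..n. c (x \<omega>) j * W n j \<omega>')\<^sup>2))"
      unfolding g_eq using row_linear_integrable[OF n2] by (intro nn_integral_eq_integral) auto
    also have "\<dots> \<le> ennreal (G * (\<Sum>j=1..n. (c (x \<omega>) j)\<^sup>2))"
      using n unfolding linear_bound_def by (intro ennreal_leI) blast
    finally show "(\<integral>\<^sup>+\<omega>'. g (x \<omega>, \<lambda>j\<in>{1..n}. W n j \<omega>') \<partial>M) \<le> ennreal (G * (\<Sum>j=1..n. (c (x \<omega>) j)\<^sup>2))" .
  qed
  also have "\<dots> \<le> ennreal (G * n * b)"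
    unfolding mean by (intro ennreal_leI mean_le)
  finally show ?thesis .
qed

lemma weighted_sum_abs:
  fixes \<phi> :: "real \<Rightarrow> real \<Rightarrow> real"
  assumes n: "linear_bound n" and \<phi> [measurable]: "case_prod \<phi> \<in> borel_measurable (borel \<Otimes>\<^sub>M borel)"
    and sq: "integrable M (\<lambda>\<omega>. (\<phi> (innov 1 \<omega>) (X 0 \<omega>))\<^sup>2)"
    and b: "expectation (\<lambda>\<omega>. (\<phi> (innov 1 \<omega>) (X 0 \<omega>))\<^sup>2) \<le> b"
  shows "(\<integral>\<^sup>+\<omega>. ennreal \<bar>\<Sum>t=2..n. W n t \<omega> * \<phi> (innov (int t) \<omega>) (X (int t - 1) \<omega>)\<bar> \<partial>M) \<le> ennreal (sqrt n * sqrt (G * b))"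
    and "integrable M (\<lambda>\<omega>. \<Sum>t=2..n. W n t \<omega> * \<phi> (innov (int t) \<omega>) (X (int t - 1) \<omega>))"
    and "expectation (\<lambda>\<omega>. \<bar>\<Sum>t=2..n. W n t \<omega> * \<phi> (innov (int t) \<omega>) (X (int t - 1) \<omega>)\<bar>) \<le> sqrt n * sqrt (G * b)"
proof -
  have "b \<ge> 0"
    by (rule order.trans[OF _ b]) simp
  have eq: "sqrt n * sqrt (G * b) = sqrt (G * n * b)"
    by (simp add: real_sqrt_mult mult_ac)
  note [measurable] = entry_measurable
  have meas [measurable]: "(\<lambda>\<omega>. \<Sum>t=2..n. W n t \<omega> * \<phi> (innov (int t) \<omega>) (X (int t - 1) \<omega>)) \<in> borel_measurable M"
    by (intro borel_measurable_sum borel_measurable_times) (auto simp: entry_measurable)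
  note le = weighted_sum_square[OF assms]
  have nonneg: "0 \<le> G * n * b"
    using G_nonneg \<open>b \<ge> 0\<close> by simp
  show "(\<integral>\<^sup>+\<omega>. ennreal \<bar>\<Sum>t=2..n. W n t \<omega> * \<phi> (innov (int t) \<omega>) (X (int t - 1) \<omega>)\<bar> \<partial>M) \<le> ennreal (sqrt n * sqrt (G * b))"
    "expectation (\<lambda>\<omega>. \<bar>\<Sum>t=2..n. W n t \<omega> * \<phi> (innov (int t) \<omega>) (X (int t - 1) \<omega>)\<bar>) \<le> sqrt n * sqrt (G * b)"
    unfolding eq using nn_integral_abs_le_sqrt(2,3)[OF meas le nonneg] by blast+
  show "integrable M (\<lambda>\<omega>. \<Sum>t=2..n. W n t \<omega> * \<phi> (innov (int t) \<omega>) (X (int t - 1) \<omega>))"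
    by (rule integrable_of_square[OF meas nn_integral_abs_le_sqrt(1)[OF meas le nonneg]])
qed

end

subsection \<open>The kernel mass\<close>

lemma lad_kernel_nonpos: "z \<noteq> 0 \<Longrightarrow> s \<le> 0 \<Longrightarrow> lad_kernel z x s = 0"
  using mult_nonpos_nonneg[of s "\<bar>x\<bar>"] by (auto simp: lad_kernel_def of_bool_def)

lemma nn_integral_inverse_sqrt:
  assumes "0 \<le> a"
  shows "(\<integral>\<^sup>+s. ennreal (s powr (- 1 / 2)) * indicator {0..a} s \<partial>lborel) = ennreal (2 * sqrt a)"
proof -
  have "((\<lambda>s. s powr (- 1 / 2)) has_integral (a powr (- 1 / 2 + 1) / (- 1 / 2 + 1))) {0..a}"
    using assms by (intro has_integral_powr_from_0) auto
  then have "((\<lambda>s. s powr (- 1 / 2)) has_integral (2 * sqrt a)) {0..a}"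
    using assms by (simp add: powr_half_sqrt mult.commute)
  then have "((\<lambda>s. if s \<in> {0..a} then s powr (- 1 / 2) else 0) has_integral (2 * sqrt a)) UNIV"
    unfolding has_integral_restrict_UNIV .
  moreover have "(if s \<in> {0..a} then s powr (- 1 / 2) else 0) = indicator {0..a} s * s powr (- 1 / 2)" for s
    by (simp add: indicator_def)
  ultimately have "((\<lambda>s. indicator {0..a} s * s powr (- 1 / 2)) has_integral (2 * sqrt a)) UNIV"
    by (simp only:)
  then have "(\<integral>\<^sup>+s. ennreal (indicator {0..a} s * s powr (- 1 / 2)) \<partial>lborel) = ennreal (2 * sqrt a)"
    by (intro nn_integral_has_integral_lborel) auto
  moreover have "ennreal (indicator {0..a} s * s powr (- 1 / 2)) = ennreal (s powr (- 1 / 2)) * indicator {0..a} s" for s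
    by (simp add: indicator_def)
  ultimately show ?thesis
    by (simp only:)
qed

lemma nn_integral_inverse_square:
  "(\<integral>\<^sup>+s. ennreal (1 / s\<^sup>2) * indicator {1..} s \<partial>lborel) = ennreal 1"
proof -
  have "((\<lambda>s::real. - 1 / s) \<longlongrightarrow> 0) at_top"
    by (intro tendsto_divide_0[OF tendsto_const] filterlim_at_top_imp_at_infinity filterlim_ident)
  then have "(\<integral>\<^sup>+s. ennreal (1 / s\<^sup>2) * indicator {1..} s \<partial>lborel) = ennreal (0 - (- 1 / 1))"
    by (intro nn_integral_FTC_atLeast) (auto intro!: derivative_eq_intros simp: power2_eq_square)
  then show ?thesis
    by simp
qed

context lad_ar1
begin

text \<open>Given \<open>X 0\<close>, the event has probability at most
  \<open>C * s * \<bar>X 0\<bar>\<close> by independence; the additional factor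
  \<open>\<bar>X 0\<bar>\<close> raises the square to a third moment.\<close>

lemma lag_square_small_innov:
  assumes C: "\<And>s. 0 \<le> s \<Longrightarrow> prob {\<omega> \<in> space M. \<bar>innov 1 \<omega>\<bar> \<le> s} \<le> C * s" and "0 \<le> s"
  shows "expectation (\<lambda>\<omega>. (X 0 \<omega>)\<^sup>2 * of_bool (\<bar>innov 1 \<omega>\<bar> \<le> s * \<bar>X 0 \<omega>\<bar>)) \<le>
    C * s * expectation (\<lambda>\<omega>. \<bar>X 0 \<omega>\<bar> ^ 3)"
proof -
  define g where "g = (\<lambda>(x::real, z::real). x\<^sup>2 * of_bool (\<bar>z\<bar> \<le> s * \<bar>x\<bar>))"
  have g: "g \<in> borel_measurable (borel \<Otimes>\<^sub>M borel)"
    unfolding g_def by measurable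
  have indep: "indep_pair borel (X 0) borel (innov 1)"
    using innov_indep_lag[of 1] by simp
  have int: "integrable M (\<lambda>\<omega>. g (X 0 \<omega>, innov 1 \<omega>))"
    using X_moments(1)[of 0] by (rule Bochner_Integration.integrable_bound) (auto simp: g_def)
  have "expectation (\<lambda>\<omega>. (X 0 \<omega>)\<^sup>2 * of_bool (\<bar>innov 1 \<omega>\<bar> \<le> s * \<bar>X 0 \<omega>\<bar>)) =
      expectation (\<lambda>\<omega>. expectation (\<lambda>\<omega>'. (X 0 \<omega>)\<^sup>2 * of_bool (\<bar>innov 1 \<omega>'\<bar> \<le> s * \<bar>X 0 \<omega>\<bar>)))"
    using expectation_indep_pair[OF indep g int] by (simp add: g_def)
  also have "\<dots> = expectation (\<lambda>\<omega>. (X 0 \<omega>)\<^sup>2 * prob {\<omega>' \<in> space M. \<bar>innov 1 \<omega>'\<bar> \<le> s * \<bar>X 0 \<omega>\<bar>})"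
  proof (rule Bochner_Integration.integral_cong[OF refl])
    fix \<omega>
    have "expectation (\<lambda>\<omega>'. of_bool (\<bar>innov 1 \<omega>'\<bar> \<le> a) :: real) = prob {\<omega>' \<in> space M. \<bar>innov 1 \<omega>'\<bar> \<le> a}" for a
    proof -
      have "expectation (\<lambda>\<omega>'. of_bool (\<bar>innov 1 \<omega>'\<bar> \<le> a) :: real) =
          expectation (indicator {\<omega>' \<in> space M. \<bar>innov 1 \<omega>'\<bar> \<le> a})"
        by (intro Bochner_Integration.integral_cong) (auto simp: indicator_def)
      then show ?thesis
        by simp
    qed
    then show "expectation (\<lambda>\<omega>'. (X 0 \<omega>)\<^sup>2 * of_bool (\<bar>innov 1 \<omega>'\<bar> \<le> s * \<bar>X 0 \<omega>\<bar>)) =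
        (X 0 \<omega>)\<^sup>2 * prob {\<omega>' \<in> space M. \<bar>innov 1 \<omega>'\<bar> \<le> s * \<bar>X 0 \<omega>\<bar>}"
      by simp
  qed
  also have "\<dots> \<le> expectation (\<lambda>\<omega>. C * s * \<bar>X 0 \<omega>\<bar> ^ 3)"
  proof (rule integral_mono')
    fix \<omega>
    have "(X 0 \<omega>)\<^sup>2 * prob {\<omega>' \<in> space M. \<bar>innov 1 \<omega>'\<bar> \<le> s * \<bar>X 0 \<omega>\<bar>} \<le> (X 0 \<omega>)\<^sup>2 * (C * (s * \<bar>X 0 \<omega>\<bar>))"
      using \<open>0 \<le> s\<close> by (intro mult_left_mono C) auto
    also have "\<dots> = C * s * (\<bar>X 0 \<omega>\<bar>\<^sup>2 * \<bar>X 0 \<omega>\<bar>)"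
      by simp
    also have "\<dots> = C * s * \<bar>X 0 \<omega>\<bar> ^ 3"
      unfolding power2_eq_square power3_eq_cube ..
    finally show "(X 0 \<omega>)\<^sup>2 * prob {\<omega>' \<in> space M. \<bar>innov 1 \<omega>'\<bar> \<le> s * \<bar>X 0 \<omega>\<bar>} \<le> C * s * \<bar>X 0 \<omega>\<bar> ^ 3" .
    then show "0 \<le> C * s * \<bar>X 0 \<omega>\<bar> ^ 3"
      by (rule order.trans[rotated]) simp
  qed (use X_moments(3)[of 0] in simp)
  finally show ?thesis
    by simp
qed

text \<open>Square roots of these moments must be integrable in \<open>s\<close> at both ends. Near
  0 the kernel is at most \<open>\<bar>x\<bar> / s\<close> and lives on an event with probability of
  order \<open>s\<close>, so its norm is of order \<open>s\<close> to the power
  \<open>- 1 / 2\<close>. For large \<open>s\<close> the bound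
  \<open>\<bar>z\<bar> / s\<^sup>2\<close> gives a norm of order
  \<open>1 / s\<^sup>2\<close>.\<close>

lemma lad_kernel_moments:
  obtains C where "C \<ge> 0"
    and "\<And>e s. e = 1 \<or> e = - 1 \<Longrightarrow> 0 < s \<Longrightarrow> integrable M (\<lambda>\<omega>. (lad_kernel (innov 1 \<omega>) (e * X 0 \<omega>) s)\<^sup>2)"
    and "\<And>e s. e = 1 \<or> e = - 1 \<Longrightarrow> 0 < s \<Longrightarrow> expectation (\<lambda>\<omega>. (lad_kernel (innov 1 \<omega>) (e * X 0 \<omega>) s)\<^sup>2) \<le> C / s"
    and "\<And>e s. e = 1 \<or> e = - 1 \<Longrightarrow> 0 < s \<Longrightarrow> expectation (\<lambda>\<omega>. (lad_kernel (innov 1 \<omega>) (e * X 0 \<omega>) s)\<^sup>2) \<le> C / s ^ 4"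
proof -
  obtain C0 where C0: "C0 \<ge> 0" "\<And>s. 0 \<le> s \<Longrightarrow> prob {\<omega> \<in> space M. \<bar>innov 1 \<omega>\<bar> \<le> s} \<le> C0 * s"
    by (rule prob_innov_abs_le) (rule that)
  define q3 q2 where "q3 = expectation (\<lambda>\<omega>. \<bar>X 0 \<omega>\<bar> ^ 3)" and "q2 = expectation (\<lambda>\<omega>. (innov 1 \<omega>)\<^sup>2)"
  have q: "q3 \<ge> 0" "q2 \<ge> 0"
    by (simp_all add: q3_def q2_def)
  have le: "(lad_kernel z (e * x) s)\<^sup>2 \<le> z\<^sup>2 / s ^ 4" "(lad_kernel z (e * x) s)\<^sup>2 \<le> x\<^sup>2 * of_bool (\<bar>z\<bar> \<le> s * \<bar>x\<bar>) / s\<^sup>2"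
    if "e = 1 \<or> e = - 1" "0 < s" for e z x s :: real
  proof -
    have ex: "\<bar>e * x\<bar> = \<bar>x\<bar>"
      using that by auto
    have s4: "(s\<^sup>2)\<^sup>2 = s ^ 4"
      by simp
    have eq: "(lad_kernel z (e * x) s)\<^sup>2 = z\<^sup>2 * of_bool (0 < z * (e * x) \<and> \<bar>z\<bar> \<le> s * \<bar>x\<bar>) / s ^ 4"
      unfolding lad_kernel_def ex power_divide s4 by (simp add: power_mult_distrib)
    show "(lad_kernel z (e * x) s)\<^sup>2 \<le> z\<^sup>2 / s ^ 4"
      unfolding eq using \<open>0 < s\<close> by (intro divide_right_mono) auto
    show "(lad_kernel z (e * x) s)\<^sup>2 \<le> x\<^sup>2 * of_bool (\<bar>z\<bar> \<le> s * \<bar>x\<bar>) / s\<^sup>2"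
    proof (cases "\<bar>z\<bar> \<le> s * \<bar>x\<bar>")
      case True
      then have "\<bar>z\<bar>\<^sup>2 \<le> (s * \<bar>x\<bar>)\<^sup>2"
        by (intro power_mono) auto
      then have "z\<^sup>2 \<le> s\<^sup>2 * x\<^sup>2"
        by (simp add: power_mult_distrib)
      then have "z\<^sup>2 / s ^ 4 \<le> s\<^sup>2 * x\<^sup>2 / s ^ 4"
        using \<open>0 < s\<close> by (intro divide_right_mono) auto
      also have "\<dots> = x\<^sup>2 / s\<^sup>2"
      proof -
        have "s ^ 4 = s\<^sup>2 * s\<^sup>2"
          by (simp flip: power_add)
        then show ?thesis
          using mult_divide_mult_cancel_left[of "s\<^sup>2" "x\<^sup>2" "s\<^sup>2"] \<open>0 < s\<close> by (simp only:) simp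
      qed
      finally have "z\<^sup>2 / s ^ 4 \<le> x\<^sup>2 / s\<^sup>2" .
      moreover have "z\<^sup>2 * of_bool (0 < z * (e * x) \<and> \<bar>z\<bar> \<le> s * \<bar>x\<bar>) / s ^ 4 \<le> z\<^sup>2 / s ^ 4"
        using \<open>0 < s\<close> by (intro divide_right_mono) auto
      ultimately show ?thesis
        unfolding eq using True by simp
    qed (simp add: eq)
  qed
  define C where "C = C0 * q3 + q2"
  show thesis
  proof (rule that[of C])
    show "C \<ge> 0"
      using C0 q by (simp add: C_def)
    fix e s :: real
    assume e: "e = 1 \<or> e = - 1" and s: "0 < s"
    show int: "integrable M (\<lambda>\<omega>. (lad_kernel (innov 1 \<omega>) (e * X 0 \<omega>) s)\<^sup>2)"
    proof (rule Bochner_Integration.integrable_bound)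
      show "integrable M (\<lambda>\<omega>. (innov 1 \<omega>)\<^sup>2 / s ^ 4)"
        using innov_moments by simp
    qed (use le(1)[OF e s] in auto)
    have "expectation (\<lambda>\<omega>. (lad_kernel (innov 1 \<omega>) (e * X 0 \<omega>) s)\<^sup>2) \<le> expectation (\<lambda>\<omega>. (innov 1 \<omega>)\<^sup>2 / s ^ 4)"
      using innov_moments by (intro integral_mono int le(1)[OF e s]) auto
    also have "\<dots> = q2 / s ^ 4"
      by (simp add: q2_def)
    also have "\<dots> \<le> C / s ^ 4"
      using s C0 q by (intro divide_right_mono) (auto simp: C_def)
    finally show "expectation (\<lambda>\<omega>. (lad_kernel (innov 1 \<omega>) (e * X 0 \<omega>) s)\<^sup>2) \<le> C / s ^ 4" .
    have "integrable M (\<lambda>\<omega>. (X 0 \<omega>)\<^sup>2 * of_bool (\<bar>innov 1 \<omega>\<bar> \<le> s * \<bar>X 0 \<omega>\<bar>))"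
      using X_moments(1)[of 0] by (rule Bochner_Integration.integrable_bound) auto
    then have "expectation (\<lambda>\<omega>. (lad_kernel (innov 1 \<omega>) (e * X 0 \<omega>) s)\<^sup>2) \<le>
        expectation (\<lambda>\<omega>. (X 0 \<omega>)\<^sup>2 * of_bool (\<bar>innov 1 \<omega>\<bar> \<le> s * \<bar>X 0 \<omega>\<bar>) / s\<^sup>2)"
      by (intro integral_mono int le(2)[OF e s]) auto
    also have "\<dots> = expectation (\<lambda>\<omega>. (X 0 \<omega>)\<^sup>2 * of_bool (\<bar>innov 1 \<omega>\<bar> \<le> s * \<bar>X 0 \<omega>\<bar>)) / s\<^sup>2"
      by simp
    also have "\<dots> \<le> C0 * s * q3 / s\<^sup>2"
      unfolding q3_def using lag_square_small_innov[OF C0(2), of s] s by (intro divide_right_mono) auto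
    also have "\<dots> = C0 * q3 / s"
      using s by (simp add: power2_eq_square)
    also have "\<dots> \<le> C / s"
      using s q by (intro divide_right_mono) (auto simp: C_def)
    finally show "expectation (\<lambda>\<omega>. (lad_kernel (innov 1 \<omega>) (e * X 0 \<omega>) s)\<^sup>2) \<le> C / s" .
  qed
qed

end

context bootstrap_lad
begin

text \<open>The two terms serve positive and negative shifts of the parameter.\<close>

definition mass :: "nat \<Rightarrow> real set \<Rightarrow> 'a \<Rightarrow> ennreal" where
  "mass n A \<omega> = kernel_mass {2..n} (\<lambda>t. W n t \<omega>) (\<lambda>t. innov (int t) \<omega>) (\<lambda>t. X (int t - 1) \<omega>) A
    + kernel_mass {2..n} (\<lambda>t. W n t \<omega>) (\<lambda>t. innov (int t) \<omega>) (\<lambda>t. - X (int t - 1) \<omega>) A"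

lemma kernel_mass_measurable:
  assumes [measurable]: "A \<in> sets borel" and e: "e = 1 \<or> e = - (1 :: real)"
  shows "(\<lambda>\<omega>. kernel_mass {2..n} (\<lambda>t. W n t \<omega>) (\<lambda>t. innov (int t) \<omega>) (\<lambda>t. e * X (int t - 1) \<omega>) A) \<in> borel_measurable M"
proof -
  have [measurable]: "A \<in> sets lborel"
    by simp
  have [measurable]: "W n t \<in> borel_measurable M" if "t \<in> {2..n}" for t
    using that by (intro entry_measurable) auto
  show ?thesis
    unfolding kernel_mass_def by measurable
qed

lemma mass_measurable [measurable]: "A \<in> sets borel \<Longrightarrow> mass n A \<in> borel_measurable M"
  using kernel_mass_measurable[of A 1 n] kernel_mass_measurable[of A "- 1" n] unfolding mass_def by simp

text \<open>Tonelli moves the expectation inside the integral over \<open>s\<close>, where for each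
  fixed \<open>s\<close> the sum is a weighted sum of order \<open>sqrt n\<close> times the norm of
  the kernel. Over \<open>{..a}\<close> only the part near 0 contributes, whence the factor
  \<open>sqrt a\<close>, which makes the local remainder negligible when \<open>a\<close> shrinks
  with the scale.\<close>

lemma mass_bound:
  obtains K where "K \<ge> 0"
    and "\<And>n. linear_bound n \<Longrightarrow> (\<integral>\<^sup>+\<omega>. mass n UNIV \<omega> \<partial>M) \<le> ennreal (sqrt n * K)"
    and "\<And>n a. linear_bound n \<Longrightarrow> 0 \<le> a \<Longrightarrow> a \<le> 1 \<Longrightarrow> (\<integral>\<^sup>+\<omega>. mass n {..a} \<omega> \<partial>M) \<le> ennreal (sqrt n * K * sqrt a)"
proof -
  obtain C where C: "C \<ge> 0"
    "\<And>e s. e = 1 \<or> e = - 1 \<Longrightarrow> 0 < s \<Longrightarrow> integrable M (\<lambda>\<omega>. (lad_kernel (innov 1 \<omega>) (e * X 0 \<omega>) s)\<^sup>2)"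
    "\<And>e s. e = 1 \<or> e = - 1 \<Longrightarrow> 0 < s \<Longrightarrow> expectation (\<lambda>\<omega>. (lad_kernel (innov 1 \<omega>) (e * X 0 \<omega>) s)\<^sup>2) \<le> C / s"
    "\<And>e s. e = 1 \<or> e = - 1 \<Longrightarrow> 0 < s \<Longrightarrow> expectation (\<lambda>\<omega>. (lad_kernel (innov 1 \<omega>) (e * X 0 \<omega>) s)\<^sup>2) \<le> C / s ^ 4"
    by (rule lad_kernel_moments) (rule that)
  define c where "c = sqrt (G * C)"
  have "c \<ge> 0"
    using G_nonneg C(1) by (simp add: c_def)
  define h where "h = (\<lambda>n s. ennreal (sqrt (real n) * c) * (ennreal (s powr (- 1 / 2)) * indicator {0..1} s + ennreal (1 / s\<^sup>2) * indicator {1..} s))"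
  have fixed_s: "(\<integral>\<^sup>+\<omega>. ennreal \<bar>\<Sum>t=2..n. W n t \<omega> * lad_kernel (innov (int t) \<omega>) (e * X (int t - 1) \<omega>) s\<bar> \<partial>M) \<le> h n s"
    if n: "linear_bound n" and e: "e = 1 \<or> e = - 1" for n e s
  proof -
    consider "s \<le> 0" | "0 < s" "s \<le> 1" | "1 < s"
      by linarith
    then show ?thesis
    proof cases
      case 1
      have "AE \<omega> in M. \<forall>t. innov (int t) \<omega> \<noteq> 0"
        using innov_neq by (simp add: AE_all_countable)
      then have "(\<integral>\<^sup>+\<omega>. ennreal \<bar>\<Sum>t=2..n. W n t \<omega> * lad_kernel (innov (int t) \<omega>) (e * X (int t - 1) \<omega>) s\<bar> \<partial>M) = (\<integral>\<^sup>+\<omega>. 0 \<partial>M)"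
        by (intro nn_integral_cong_AE) (auto simp: lad_kernel_nonpos[OF _ 1])
      then show ?thesis
        by simp
    next
      case 2
      have "(\<integral>\<^sup>+\<omega>. ennreal \<bar>\<Sum>t=2..n. W n t \<omega> * lad_kernel (innov (int t) \<omega>) (e * X (int t - 1) \<omega>) s\<bar> \<partial>M) \<le>
          ennreal (sqrt n * sqrt (G * (C / s)))"
        using weighted_sum_abs(1)[OF n _ C(2)[OF e 2(1)] C(3)[OF e 2(1)]] by simp
      also have "sqrt n * sqrt (G * (C / s)) = sqrt n * c * s powr (- 1 / 2)"
      proof -
        have "s powr (- 1 / 2) = 1 / sqrt s"
          using 2 powr_minus_divide[of s "1 / 2"] powr_half_sqrt[of s] by simp
        then show ?thesis
          by (simp only: c_def real_sqrt_mult real_sqrt_divide) simp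
      qed
      also have "ennreal (sqrt n * c * s powr (- 1 / 2)) \<le> h n s"
        using 2 \<open>c \<ge> 0\<close> unfolding h_def by (subst ennreal_mult) (auto intro!: mult_left_mono)
      finally show ?thesis .
    next
      case 3
      then have s: "0 < s"
        by simp
      have "(\<integral>\<^sup>+\<omega>. ennreal \<bar>\<Sum>t=2..n. W n t \<omega> * lad_kernel (innov (int t) \<omega>) (e * X (int t - 1) \<omega>) s\<bar> \<partial>M) \<le>
          ennreal (sqrt n * sqrt (G * (C / s ^ 4)))"
        using weighted_sum_abs(1)[OF n _ C(2)[OF e s] C(4)[OF e s]] by simp
      also have "sqrt n * sqrt (G * (C / s ^ 4)) = sqrt n * c * (1 / s\<^sup>2)"
      proof -
        have "sqrt (s ^ 4) = s\<^sup>2"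
          by (rule real_sqrt_unique) auto
        then show ?thesis
          by (simp add: c_def real_sqrt_mult real_sqrt_divide)
      qed
      also have "ennreal (sqrt n * c * (1 / s\<^sup>2)) \<le> h n s"
        using 3 \<open>c \<ge> 0\<close> unfolding h_def by (subst ennreal_mult) (auto intro!: mult_left_mono)
      finally show ?thesis .
    qed
  qed
  have one: "(\<integral>\<^sup>+\<omega>. kernel_mass {2..n} (\<lambda>t. W n t \<omega>) (\<lambda>t. innov (int t) \<omega>) (\<lambda>t. e * X (int t - 1) \<omega>) A \<partial>M) \<le>
      (\<integral>\<^sup>+s. h n s * indicator A s \<partial>lborel)"
    if n: "linear_bound n" and e: "e = 1 \<or> e = - 1" and A [measurable]: "A \<in> sets borel" for n e A
  proof -
    have [measurable]: "A \<in> sets lborel"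
      by simp
    have [measurable]: "W n t \<in> borel_measurable M" if "t \<in> {2..n}" for t
      using that by (intro entry_measurable) auto
    interpret P: pair_sigma_finite lborel M
      by standard
    have "(\<integral>\<^sup>+\<omega>. kernel_mass {2..n} (\<lambda>t. W n t \<omega>) (\<lambda>t. innov (int t) \<omega>) (\<lambda>t. e * X (int t - 1) \<omega>) A \<partial>M) =
        (\<integral>\<^sup>+s. \<integral>\<^sup>+\<omega>. ennreal \<bar>\<Sum>t=2..n. W n t \<omega> * lad_kernel (innov (int t) \<omega>) (e * X (int t - 1) \<omega>) s\<bar> * indicator A s \<partial>M \<partial>lborel)"
      unfolding kernel_mass_def by (rule P.Fubini') measurable
    also have "\<dots> \<le> (\<integral>\<^sup>+s. h n s * indicator A s \<partial>lborel)"
      using fixed_s[OF n e] by (intro nn_integral_mono) (auto simp: nn_integral_multc intro!: mult_right_mono)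
    finally show ?thesis .
  qed
  have mass: "(\<integral>\<^sup>+\<omega>. mass n A \<omega> \<partial>M) \<le> 2 * (\<integral>\<^sup>+s. h n s * indicator A s \<partial>lborel)"
    if n: "linear_bound n" and A [measurable]: "A \<in> sets borel" for n A
  proof -
    have "(\<integral>\<^sup>+\<omega>. mass n A \<omega> \<partial>M) =
      (\<integral>\<^sup>+\<omega>. kernel_mass {2..n} (\<lambda>t. W n t \<omega>) (\<lambda>t. innov (int t) \<omega>) (\<lambda>t. 1 * X (int t - 1) \<omega>) A \<partial>M) +
      (\<integral>\<^sup>+\<omega>. kernel_mass {2..n} (\<lambda>t. W n t \<omega>) (\<lambda>t. innov (int t) \<omega>) (\<lambda>t. - 1 * X (int t - 1) \<omega>) A \<partial>M)"
      unfolding mass_def using kernel_mass_measurable[OF A, of 1 n] kernel_mass_measurable[OF A, of "- 1" n]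
      by (subst nn_integral_add) auto
    also have "\<dots> \<le> (\<integral>\<^sup>+s. h n s * indicator A s \<partial>lborel) + (\<integral>\<^sup>+s. h n s * indicator A s \<partial>lborel)"
      by (intro add_mono one n A) auto
    finally show ?thesis
      by (simp add: mult_2)
  qed
  have whole: "(\<integral>\<^sup>+s. h n s * indicator UNIV s \<partial>lborel) = ennreal (sqrt n * c * 3)" for n
  proof -
    have "(\<integral>\<^sup>+s. h n s * indicator UNIV s \<partial>lborel) = ennreal (sqrt n * c) *
        ((\<integral>\<^sup>+s. ennreal (s powr (- 1 / 2)) * indicator {0..1} s \<partial>lborel) + (\<integral>\<^sup>+s. ennreal (1 / s\<^sup>2) * indicator {1..} s \<partial>lborel))"
      unfolding h_def by (simp add: nn_integral_cmult nn_integral_add)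
    also have "\<dots> = ennreal (sqrt n * c) * (ennreal 2 + ennreal 1)"
      by (subst nn_integral_inverse_sqrt, simp, subst nn_integral_inverse_square) simp
    also have "\<dots> = ennreal (sqrt n * c * 3)"
      using \<open>c \<ge> 0\<close> by (simp add: ennreal_mult flip: ennreal_plus)
    finally show ?thesis .
  qed
  have part: "(\<integral>\<^sup>+s. h n s * indicator {..a} s \<partial>lborel) = ennreal (sqrt n * c * (2 * sqrt a))" if "0 \<le> a" "a \<le> 1" for n a
  proof -
    have "(\<integral>\<^sup>+s. h n s * indicator {..a} s \<partial>lborel) = (\<integral>\<^sup>+s. ennreal (sqrt n * c) * (ennreal (s powr (- 1 / 2)) * indicator {0..a} s) \<partial>lborel)"
    proof (rule nn_integral_cong_AE)
      show "AE s in lborel. h n s * indicator {..a} s = ennreal (sqrt n * c) * (ennreal (s powr (- 1 / 2)) * indicator {0..a} s)"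
        using AE_lborel_singleton[of 1] by eventually_elim (use that in \<open>auto simp: h_def indicator_def\<close>)
    qed
    also have "\<dots> = ennreal (sqrt n * c) * ennreal (2 * sqrt a)"
      by (subst nn_integral_cmult, measurable) (simp only: nn_integral_inverse_sqrt[OF that(1)])
    finally show ?thesis
      using \<open>c \<ge> 0\<close> that by (simp add: ennreal_mult)
  qed
  show thesis
  \<comment> \<open>6 is 2 for the two signs of the lag times 3, the sum of the integral 2 over
    \<open>{0..1}\<close> and the integral 1 over \<open>{1..}\<close>. The local bound needs 4
    only.\<close>
  proof (rule that[of "6 * c"])
    show "0 \<le> 6 * c"
      using \<open>c \<ge> 0\<close> by simp
    have 2: "2 * ennreal r = ennreal (2 * r)" for r
      by (cases "r \<ge> 0") (simp_all add: ennreal_mult ennreal_neg)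
    fix n
    assume n: "linear_bound n"
    show "(\<integral>\<^sup>+\<omega>. mass n UNIV \<omega> \<partial>M) \<le> ennreal (sqrt n * (6 * c))"
      using mass[OF n, of UNIV] unfolding whole 2 by (simp add: mult_ac)
    fix a :: real
    assume a: "0 \<le> a" "a \<le> 1"
    have "(\<integral>\<^sup>+\<omega>. mass n {..a} \<omega> \<partial>M) \<le> ennreal (2 * (sqrt n * c * (2 * sqrt a)))"
      using mass[OF n, of "{..a}"] unfolding part[OF a] 2 by simp
    also have "\<dots> \<le> ennreal (sqrt n * (6 * c) * sqrt a)"
      using \<open>c \<ge> 0\<close> a by (intro ennreal_leI) (simp add: mult_ac mult_left_mono)
    finally show "(\<integral>\<^sup>+\<omega>. mass n {..a} \<omega> \<partial>M) \<le> ennreal (sqrt n * (6 * c) * sqrt a)" .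
  qed
qed

end

section \<open>Expansion of the minimizers\<close>

context lad_ar1
begin

section \<open>The unweighted remainder\<close>

definition rem_sum :: "nat \<Rightarrow> real \<Rightarrow> 'a \<Rightarrow> real" where
  "rem_sum n \<delta> \<omega> = (\<Sum>t=2..n. lad_rem (innov (int t) \<omega>) (X (int t - 1) \<omega> * \<delta>))"

lemma rem_sum_measurable [measurable]: "rem_sum n \<delta> \<in> borel_measurable M"
  unfolding rem_sum_def by measurable

text \<open>The L1 error of the quadratic approximation to the conditional mean of one summand at
  shift \<open>\<delta>\<close>. By stationarity \<open>X 0\<close> stands for every lag.\<close>

definition osc :: "real \<Rightarrow> real" where
  "osc \<delta> = expectation (\<lambda>\<omega>. \<bar>mean_rem (X 0 \<omega> * \<delta>) / \<delta>\<^sup>2 - f 0 * (X 0 \<omega>)\<^sup>2\<bar>)"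

text \<open>Dominated convergence: \<open>mean_rem_near_0\<close> gives the pointwise limit for each
  value of the lag, \<open>mean_rem_le\<close> a dominating multiple of
  \<open>(X 0)\<^sup>2\<close>.\<close>

lemma osc_tendsto_0:
  assumes \<delta>: "\<delta> \<longlonglongrightarrow> 0" "\<forall>\<^sub>F n in sequentially. \<delta> n \<noteq> 0"
  shows "(\<lambda>n. osc (\<delta> n)) \<longlonglongrightarrow> 0"
proof -
  obtain C where C: "C \<ge> 0" "\<And>s. 0 \<le> s \<Longrightarrow> prob {\<omega> \<in> space M. \<bar>innov 1 \<omega>\<bar> \<le> s} \<le> C * s"
    by (rule prob_innov_abs_le) (rule that)
  define g where "g = (\<lambda>n \<omega>. \<bar>mean_rem (X 0 \<omega> * \<delta> n) / (\<delta> n)\<^sup>2 - f 0 * (X 0 \<omega>)\<^sup>2\<bar>)"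
  have "(\<lambda>n. expectation (g n)) \<longlonglongrightarrow> expectation (\<lambda>\<omega>. 0)"
  proof (rule integral_dominated_convergence[where w = "\<lambda>\<omega>. (2 * C + f 0) * (X 0 \<omega>)\<^sup>2"])
    show "integrable M (\<lambda>\<omega>. (2 * C + f 0) * (X 0 \<omega>)\<^sup>2)"
      using X_moments by simp
    show "AE \<omega> in M. norm (g n \<omega>) \<le> (2 * C + f 0) * (X 0 \<omega>)\<^sup>2" for n
    proof (rule AE_I2)
      fix \<omega>
      have 1: "mean_rem (X 0 \<omega> * \<delta> n) / (\<delta> n)\<^sup>2 \<le> 2 * C * (X 0 \<omega>)\<^sup>2"
      proof (cases "\<delta> n = 0")
        case False
        then show ?thesis
          using mean_rem_le[OF C(2), of "X 0 \<omega> * \<delta> n"] by (simp add: divide_le_eq power_mult_distrib mult_ac)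
      qed (use C in simp)
      have 2: "0 \<le> mean_rem (X 0 \<omega> * \<delta> n) / (\<delta> n)\<^sup>2" "0 \<le> f 0 * (X 0 \<omega>)\<^sup>2"
        using mean_rem_nonneg f_pos by simp_all
      show "norm (g n \<omega>) \<le> (2 * C + f 0) * (X 0 \<omega>)\<^sup>2"
        using 1 2 C by (simp add: g_def abs_le_iff distrib_right)
    qed
    show "AE \<omega> in M. (\<lambda>n. g n \<omega>) \<longlonglongrightarrow> 0"
    proof (rule AE_I2, rule tendstoI)
      fix \<omega> and \<epsilon> :: real
      assume "\<epsilon> > 0"
      define x where "x = X 0 \<omega>"
      define \<epsilon>' where "\<epsilon>' = \<epsilon> / (2 * (x\<^sup>2 + 1))"
      have x1: "x\<^sup>2 + 1 > 0"
        by (simp add: add_nonneg_pos)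
      have "\<epsilon>' > 0"
        using \<open>\<epsilon> > 0\<close> x1 by (simp add: \<epsilon>'_def)
      obtain \<eta> where \<eta>: "\<eta> > 0" "\<And>y. \<bar>y\<bar> \<le> \<eta> \<Longrightarrow> \<bar>mean_rem y - f 0 * y\<^sup>2\<bar> \<le> \<epsilon>' * y\<^sup>2"
        using mean_rem_near_0[OF \<open>\<epsilon>' > 0\<close>] by blast
      have "(\<lambda>n. \<bar>x * \<delta> n\<bar>) \<longlonglongrightarrow> 0"
        using tendsto_mult_right_zero[OF \<delta>(1), of x] by (simp add: tendsto_rabs_zero)
      then have "\<forall>\<^sub>F n in sequentially. \<bar>x * \<delta> n\<bar> < \<eta>"
        using \<eta>(1) by (rule order_tendstoD(2))
      with \<delta>(2) show "\<forall>\<^sub>F n in sequentially. dist (g n \<omega>) 0 < \<epsilon>"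
      proof eventually_elim
        case (elim n)
        have "g n \<omega> = \<bar>mean_rem (x * \<delta> n) - f 0 * (x * \<delta> n)\<^sup>2\<bar> / (\<delta> n)\<^sup>2"
        proof -
          have "mean_rem (x * \<delta> n) / (\<delta> n)\<^sup>2 - f 0 * x\<^sup>2 = (mean_rem (x * \<delta> n) - f 0 * (x * \<delta> n)\<^sup>2) / (\<delta> n)\<^sup>2"
            using elim(1) by (simp add: diff_divide_distrib power_mult_distrib)
          then show ?thesis
            unfolding g_def x_def[symmetric] by (simp add: abs_divide)
        qed
        also have "\<dots> \<le> \<epsilon>' * (x * \<delta> n)\<^sup>2 / (\<delta> n)\<^sup>2"
          using elim(2) by (intro divide_right_mono \<eta>) auto
        also have "\<dots> = \<epsilon>' * x\<^sup>2"
          using elim(1) by (simp add: power_mult_distrib)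
        also have "\<dots> < \<epsilon>"
        proof -
          have "\<epsilon>' * x\<^sup>2 \<le> \<epsilon>' * (x\<^sup>2 + 1)"
            using \<open>\<epsilon>' > 0\<close> by simp
          also have "\<dots> = \<epsilon> / 2"
          proof -
            have "a / (2 * b) * b = a / 2" if "b > 0" for a b :: real
              using that by simp
            from this[OF x1] show ?thesis
              unfolding \<epsilon>'_def .
          qed
          finally show ?thesis
            using \<open>\<epsilon> > 0\<close> by simp
        qed
        finally show ?case
          by (simp add: g_def)
      qed
    qed
  qed (simp_all add: g_def)
  then show ?thesis
    by (simp add: osc_def g_def)
qed

text \<open>Four errors add up: the martingale part around the conditional means, the approximation
  of these means by a parabola, the law of large numbers for the squares, and the one summand by
  which the sum from 2 to \<open>n\<close> falls short of \<open>n\<close> terms.\<close>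

lemma rem_sum_bound:
  obtains A where "A \<ge> 0" and "\<And>n (\<delta> :: real). 1 \<le> n \<Longrightarrow> \<delta> \<noteq> 0 \<Longrightarrow>
    expectation (\<lambda>\<omega>. \<bar>rem_sum n \<delta> \<omega> - f 0 * expectation (\<lambda>\<omega>. (X 0 \<omega>)\<^sup>2) * n * \<delta>\<^sup>2\<bar>) \<le>
      sqrt n * sqrt (A * (\<bar>\<delta>\<bar> ^ 3 + \<delta> ^ 4)) + n * \<delta>\<^sup>2 * osc \<delta> + A * sqrt n * \<delta>\<^sup>2"
    and "\<And>n \<delta>. integrable M (rem_sum n \<delta>)"
proof -
  obtain C0 where C0: "C0 \<ge> 0" "\<And>s. 0 \<le> s \<Longrightarrow> prob {\<omega> \<in> space M. \<bar>innov 1 \<omega>\<bar> \<le> s} \<le> C0 * s"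
    by (rule prob_innov_abs_le) (rule that)
  obtain C1 where C1: "C1 \<ge> 0" "\<And>n. 1 \<le> n \<Longrightarrow>
    expectation (\<lambda>\<omega>. \<bar>(\<Sum>t=2..n. (X (int t - 1) \<omega>)\<^sup>2) - (real n - 1) * expectation (\<lambda>\<omega>. (X 0 \<omega>)\<^sup>2)\<bar>) \<le> C1 * sqrt n"
    by (rule X_square_average) (rule that)
  define q3 q4 v where "q3 = expectation (\<lambda>\<omega>. \<bar>X 0 \<omega>\<bar> ^ 3)" and "q4 = expectation (\<lambda>\<omega>. (X 0 \<omega>) ^ 4)"
    and "v = expectation (\<lambda>\<omega>. (X 0 \<omega>)\<^sup>2)"
  have q: "q3 \<ge> 0" "q4 \<ge> 0" "v \<ge> 0"
    by (simp_all add: q3_def q4_def v_def)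
  define A where "A = (8 * C0 * q3 + 8 * C0\<^sup>2 * q4) + f 0 * (C1 + v)"
  have A: "8 * C0 * q3 \<le> A" "8 * C0\<^sup>2 * q4 \<le> A" "f 0 * (C1 + v) \<le> A" "A \<ge> 0"
    using C0 C1 q f_pos by (simp_all add: A_def)
  have rem_int: "integrable M (\<lambda>\<omega>. lad_rem (innov (int t) \<omega>) (X (int t - 1) \<omega> * \<delta>))" for t \<delta>
  proof (rule Bochner_Integration.integrable_bound)
    show "integrable M (\<lambda>\<omega>. 2 * \<bar>X (int t - 1) \<omega> * \<delta>\<bar>)"
      using X_moments by simp
    show "AE \<omega> in M. norm (lad_rem (innov (int t) \<omega>) (X (int t - 1) \<omega> * \<delta>)) \<le> norm (2 * \<bar>X (int t - 1) \<omega> * \<delta>\<bar>)"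
      using lad_rem_abs_le by (intro AE_I2) (simp add: mult.assoc)
  qed measurable
  have rem_sum_int: "integrable M (rem_sum n \<delta>)" for n \<delta>
    unfolding rem_sum_def by (intro Bochner_Integration.integrable_sum rem_int)
  have main: "expectation (\<lambda>\<omega>. \<bar>rem_sum n \<delta> \<omega> - f 0 * v * n * \<delta>\<^sup>2\<bar>) \<le>
      sqrt n * sqrt (A * (\<bar>\<delta>\<bar> ^ 3 + \<delta> ^ 4)) + n * \<delta>\<^sup>2 * osc \<delta> + A * sqrt n * \<delta>\<^sup>2"
    if n: "1 \<le> n" and "\<delta> \<noteq> 0" for n :: nat and \<delta> :: real
  proof -
    define \<phi> where "\<phi> = (\<lambda>z x. lad_rem z (x * \<delta>) - mean_rem (x * \<delta>))"
    have \<phi>_meas [measurable]: "case_prod \<phi> \<in> borel_measurable (borel \<Otimes>\<^sub>M borel)"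
      unfolding \<phi>_def by measurable
    have centred: "expectation (\<lambda>\<omega>. \<phi> (innov 1 \<omega>) x) = 0" for x
      using integrable_lad_rem_innov[of "x * \<delta>"] by (simp add: \<phi>_def mean_rem_def prob_space)
    \<comment> \<open>A pointwise bound of the squared centred remainder. The first part has mean of
      order \<open>\<bar>\<delta>\<bar> ^ 3\<close> because the innovation must be small, the
      second, from the squared conditional mean, of order \<open>\<delta> ^ 4\<close>.\<close>
    define P where "P = (\<lambda>\<omega>. 8 * \<delta>\<^sup>2 * ((X 0 \<omega>)\<^sup>2 * of_bool (\<bar>innov 1 \<omega>\<bar> \<le> \<bar>\<delta>\<bar> * \<bar>X 0 \<omega>\<bar>)) + 8 * C0\<^sup>2 * \<delta> ^ 4 * (X 0 \<omega>) ^ 4)"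
    have P_int0: "integrable M (\<lambda>\<omega>. (X 0 \<omega>)\<^sup>2 * of_bool (\<bar>innov 1 \<omega>\<bar> \<le> \<bar>\<delta>\<bar> * \<bar>X 0 \<omega>\<bar>))"
      using X_moments(1)[of 0] by (rule Bochner_Integration.integrable_bound) auto
    then have P_int: "integrable M P"
      unfolding P_def using X_moment4 by simp
    have \<phi>_le: "(\<phi> (innov 1 \<omega>) (X 0 \<omega>))\<^sup>2 \<le> P \<omega>" for \<omega>
    proof -
      define y where "y = X 0 \<omega> * \<delta>"
      have "(lad_rem (innov 1 \<omega>) y)\<^sup>2 \<le> (2 * \<bar>y\<bar> * of_bool (\<bar>innov 1 \<omega>\<bar> \<le> \<bar>y\<bar>))\<^sup>2"
        by (intro power_mono lad_rem_le lad_rem_nonneg)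
      then have 1: "(lad_rem (innov 1 \<omega>) y)\<^sup>2 \<le> 4 * y\<^sup>2 * of_bool (\<bar>innov 1 \<omega>\<bar> \<le> \<bar>y\<bar>)"
        by (cases "\<bar>innov 1 \<omega>\<bar> \<le> \<bar>y\<bar>") (simp_all add: power_mult_distrib)
      have "(mean_rem y)\<^sup>2 \<le> (2 * C0 * y\<^sup>2)\<^sup>2"
        by (intro power_mono mean_rem_le C0 mean_rem_nonneg)
      then have 2: "(mean_rem y)\<^sup>2 \<le> 4 * C0\<^sup>2 * y ^ 4"
        by (simp add: power_mult_distrib)
      have "(\<phi> (innov 1 \<omega>) (X 0 \<omega>))\<^sup>2 \<le> 2 * (lad_rem (innov 1 \<omega>) y)\<^sup>2 + 2 * (mean_rem y)\<^sup>2"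
        using zero_le_power2[of "lad_rem (innov 1 \<omega>) y + mean_rem y"]
        by (simp add: \<phi>_def y_def power2_sum power2_diff)
      also have "\<dots> \<le> 8 * y\<^sup>2 * of_bool (\<bar>innov 1 \<omega>\<bar> \<le> \<bar>y\<bar>) + 8 * C0\<^sup>2 * y ^ 4"
        using 1 2 by simp
      also have "\<dots> = P \<omega>"
        by (simp add: P_def y_def abs_mult power_mult_distrib mult_ac)
      finally show ?thesis .
    qed
    have \<phi>_sq: "integrable M (\<lambda>\<omega>. (\<phi> (innov 1 \<omega>) (X 0 \<omega>))\<^sup>2)"
    proof (rule Bochner_Integration.integrable_bound[OF P_int])
      show "AE \<omega> in M. norm ((\<phi> (innov 1 \<omega>) (X 0 \<omega>))\<^sup>2) \<le> norm (P \<omega>)"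
        using \<phi>_le by (intro AE_I2) (simp add: order.trans[OF _ abs_ge_self])
    qed measurable
    have "expectation (\<lambda>\<omega>. (\<phi> (innov 1 \<omega>) (X 0 \<omega>))\<^sup>2) \<le> expectation P"
      by (intro integral_mono \<phi>_sq P_int \<phi>_le)
    also have "\<dots> = 8 * \<delta>\<^sup>2 * expectation (\<lambda>\<omega>. (X 0 \<omega>)\<^sup>2 * of_bool (\<bar>innov 1 \<omega>\<bar> \<le> \<bar>\<delta>\<bar> * \<bar>X 0 \<omega>\<bar>)) + 8 * C0\<^sup>2 * \<delta> ^ 4 * q4"
      unfolding P_def using P_int0 X_moment4 by (simp add: q4_def)
    also have "\<dots> \<le> 8 * \<delta>\<^sup>2 * (C0 * \<bar>\<delta>\<bar> * q3) + 8 * C0\<^sup>2 * \<delta> ^ 4 * q4"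
      using lag_square_small_innov[OF C0(2), of "\<bar>\<delta>\<bar>"] by (intro add_right_mono mult_left_mono) (auto simp: q3_def)
    also have "\<dots> = 8 * C0 * q3 * \<bar>\<delta>\<bar> ^ 3 + 8 * C0\<^sup>2 * q4 * \<delta> ^ 4"
    proof -
      have "\<delta>\<^sup>2 * \<bar>\<delta>\<bar> = \<bar>\<delta>\<bar> ^ 3"
        unfolding power2_abs[of \<delta>, symmetric] by (simp only: power3_eq_cube power2_eq_square)
      then show ?thesis
        by (simp add: mult_ac)
    qed
    also have "\<dots> \<le> A * \<bar>\<delta>\<bar> ^ 3 + A * \<delta> ^ 4"
      using A by (intro add_mono mult_right_mono) auto
    finally have \<phi>_E: "expectation (\<lambda>\<omega>. (\<phi> (innov 1 \<omega>) (X 0 \<omega>))\<^sup>2) \<le> A * (\<bar>\<delta>\<bar> ^ 3 + \<delta> ^ 4)"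
      by (simp add: distrib_left)
    define S1 where "S1 = (\<lambda>\<omega>. \<Sum>t=2..n. \<phi> (innov (int t) \<omega>) (X (int t - 1) \<omega>))"
    define S2 where "S2 = (\<lambda>\<omega>. \<Sum>t=2..n. \<bar>mean_rem (X (int t - 1) \<omega> * \<delta>) / \<delta>\<^sup>2 - f 0 * (X (int t - 1) \<omega>)\<^sup>2\<bar>)"
    define S3 where "S3 = (\<lambda>\<omega>. (\<Sum>t=2..n. (X (int t - 1) \<omega>)\<^sup>2) - (real n - 1) * v)"
    have S1: "integrable M S1" "expectation (\<lambda>\<omega>. \<bar>S1 \<omega>\<bar>) \<le> sqrt n * sqrt (A * (\<bar>\<delta>\<bar> ^ 3 + \<delta> ^ 4))"
    proof -
      show "integrable M S1"
        unfolding S1_def by (rule martingale_difference_abs(1)[OF \<phi>_meas centred \<phi>_sq])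
      have "expectation (\<lambda>\<omega>. \<bar>S1 \<omega>\<bar>) \<le> sqrt n * sqrt (expectation (\<lambda>\<omega>. (\<phi> (innov 1 \<omega>) (X 0 \<omega>))\<^sup>2))"
        unfolding S1_def by (rule martingale_difference_abs(2)[OF \<phi>_meas centred \<phi>_sq])
      also have "\<dots> \<le> sqrt n * sqrt (A * (\<bar>\<delta>\<bar> ^ 3 + \<delta> ^ 4))"
        using \<phi>_E by (intro mult_left_mono real_sqrt_le_mono) auto
      finally show "expectation (\<lambda>\<omega>. \<bar>S1 \<omega>\<bar>) \<le> sqrt n * sqrt (A * (\<bar>\<delta>\<bar> ^ 3 + \<delta> ^ 4))" .
    qed
    have term_meas [measurable]: "(\<lambda>x. \<bar>mean_rem (x * \<delta>) / \<delta>\<^sup>2 - f 0 * x\<^sup>2\<bar>) \<in> borel_measurable borel"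
      by measurable
    have term_int: "integrable M (\<lambda>\<omega>. \<bar>mean_rem (X t \<omega> * \<delta>) / \<delta>\<^sup>2 - f 0 * (X t \<omega>)\<^sup>2\<bar>)" for t
    proof -
      have "integrable M (\<lambda>\<omega>. mean_rem (X t \<omega> * \<delta>))"
      proof (rule Bochner_Integration.integrable_bound)
        show "integrable M (\<lambda>\<omega>. 2 * C0 * \<delta>\<^sup>2 * (X t \<omega>)\<^sup>2)"
          using X_moments by simp
        show "AE \<omega> in M. norm (mean_rem (X t \<omega> * \<delta>)) \<le> norm (2 * C0 * \<delta>\<^sup>2 * (X t \<omega>)\<^sup>2)"
        proof (rule AE_I2)
          fix \<omega>
          have "mean_rem (X t \<omega> * \<delta>) \<le> 2 * C0 * \<delta>\<^sup>2 * (X t \<omega>)\<^sup>2"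
            using mean_rem_le[OF C0(2), of "X t \<omega> * \<delta>"] by (simp add: power_mult_distrib mult_ac)
          then show "norm (mean_rem (X t \<omega> * \<delta>)) \<le> norm (2 * C0 * \<delta>\<^sup>2 * (X t \<omega>)\<^sup>2)"
            using mean_rem_nonneg[of "X t \<omega> * \<delta>"] by simp
        qed
      qed measurable
      then show ?thesis
        using X_moments by simp
    qed
    have term_E: "expectation (\<lambda>\<omega>. \<bar>mean_rem (X t \<omega> * \<delta>) / \<delta>\<^sup>2 - f 0 * (X t \<omega>)\<^sup>2\<bar>) = osc \<delta>" for t
      unfolding osc_def by (rule expectation_X[OF term_meas])
    have osc_nonneg: "osc \<delta> \<ge> 0"
      by (simp add: osc_def)
    have S2: "integrable M S2" "expectation S2 \<le> n * osc \<delta>"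
    proof -
      show "integrable M S2"
        unfolding S2_def by (intro Bochner_Integration.integrable_sum term_int)
      have "expectation S2 = (\<Sum>t=2..n. osc \<delta>)"
        unfolding S2_def by (subst Bochner_Integration.integral_sum) (simp_all add: term_int term_E)
      also have "\<dots> \<le> n * osc \<delta>"
        using osc_nonneg by (simp add: mult_right_mono)
      finally show "expectation S2 \<le> n * osc \<delta>" .
    qed
    have S3: "integrable M S3" "expectation (\<lambda>\<omega>. \<bar>S3 \<omega>\<bar>) \<le> C1 * sqrt n"
      using C1(2)[OF n] X_moments unfolding S3_def v_def by (auto intro!: Bochner_Integration.integrable_sum)
    have "\<bar>rem_sum n \<delta> \<omega> - f 0 * v * n * \<delta>\<^sup>2\<bar> \<le> \<bar>S1 \<omega>\<bar> + \<delta>\<^sup>2 * S2 \<omega> + f 0 * \<delta>\<^sup>2 * \<bar>S3 \<omega>\<bar> + f 0 * v * \<delta>\<^sup>2" for \<omega>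
    proof -
      define S2' where "S2' = (\<Sum>t=2..n. mean_rem (X (int t - 1) \<omega> * \<delta>) / \<delta>\<^sup>2 - f 0 * (X (int t - 1) \<omega>)\<^sup>2)"
      have "\<delta>\<^sup>2 * S2' = (\<Sum>t=2..n. mean_rem (X (int t - 1) \<omega> * \<delta>)) - f 0 * \<delta>\<^sup>2 * (\<Sum>t=2..n. (X (int t - 1) \<omega>)\<^sup>2)"
        using \<open>\<delta> \<noteq> 0\<close> by (simp add: S2'_def sum_distrib_left sum_subtractf[symmetric] right_diff_distrib mult_ac)
      moreover have "rem_sum n \<delta> \<omega> = S1 \<omega> + (\<Sum>t=2..n. mean_rem (X (int t - 1) \<omega> * \<delta>))"
        by (simp add: rem_sum_def S1_def \<phi>_def sum_subtractf)
      \<comment> \<open>The last term pays for centring \<open>n - 1\<close> squares against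
        \<open>n\<close> times their mean.\<close>
      ultimately have eq: "rem_sum n \<delta> \<omega> - f 0 * v * n * \<delta>\<^sup>2 = S1 \<omega> + \<delta>\<^sup>2 * S2' + f 0 * \<delta>\<^sup>2 * S3 \<omega> - f 0 * v * \<delta>\<^sup>2"
        by (simp add: S3_def algebra_simps)
      have 2: "\<bar>\<delta>\<^sup>2 * S2'\<bar> \<le> \<delta>\<^sup>2 * S2 \<omega>"
        unfolding S2'_def S2_def abs_mult by (simp add: mult_left_mono sum_abs)
      have 3: "\<bar>f 0 * \<delta>\<^sup>2 * S3 \<omega>\<bar> = f 0 * \<delta>\<^sup>2 * \<bar>S3 \<omega>\<bar>" "f 0 * v * \<delta>\<^sup>2 \<ge> 0"
        using f_pos q by (simp_all add: abs_mult)
      have gen: "\<bar>a + b + c - d\<bar> \<le> \<bar>a\<bar> + b' + c' + d" if "\<bar>b\<bar> \<le> b'" "\<bar>c\<bar> = c'" "d \<ge> 0" for a b b' c c' d :: real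
        using that by linarith
      show ?thesis
        unfolding eq by (rule gen[OF 2 3])
    qed
    then have "expectation (\<lambda>\<omega>. \<bar>rem_sum n \<delta> \<omega> - f 0 * v * n * \<delta>\<^sup>2\<bar>) \<le>
        expectation (\<lambda>\<omega>. \<bar>S1 \<omega>\<bar> + \<delta>\<^sup>2 * S2 \<omega> + f 0 * \<delta>\<^sup>2 * \<bar>S3 \<omega>\<bar> + f 0 * v * \<delta>\<^sup>2)"
      using S1 S2 S3 rem_sum_int by (intro integral_mono) auto
    also have "\<dots> = expectation (\<lambda>\<omega>. \<bar>S1 \<omega>\<bar>) + \<delta>\<^sup>2 * expectation S2 + f 0 * \<delta>\<^sup>2 * expectation (\<lambda>\<omega>. \<bar>S3 \<omega>\<bar>) + f 0 * v * \<delta>\<^sup>2"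
      using S1 S2 S3 by (simp add: prob_space)
    also have "\<dots> \<le> sqrt n * sqrt (A * (\<bar>\<delta>\<bar> ^ 3 + \<delta> ^ 4)) + \<delta>\<^sup>2 * (n * osc \<delta>) + f 0 * \<delta>\<^sup>2 * (C1 * sqrt n) + f 0 * v * \<delta>\<^sup>2"
      using S1 S2 S3 f_pos q by (intro add_mono mult_left_mono) auto
    also have "\<dots> \<le> sqrt n * sqrt (A * (\<bar>\<delta>\<bar> ^ 3 + \<delta> ^ 4)) + n * \<delta>\<^sup>2 * osc \<delta> + A * sqrt n * \<delta>\<^sup>2"
    proof -
      have "f 0 * \<delta>\<^sup>2 * (C1 * sqrt n) + f 0 * v * \<delta>\<^sup>2 * 1 \<le> f 0 * \<delta>\<^sup>2 * (C1 * sqrt n) + f 0 * v * \<delta>\<^sup>2 * sqrt n"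
        using n f_pos q by (intro add_left_mono mult_left_mono) auto
      also have "\<dots> = f 0 * (C1 + v) * (sqrt n * \<delta>\<^sup>2)"
        by (simp add: algebra_simps)
      also have "\<dots> \<le> A * (sqrt n * \<delta>\<^sup>2)"
        using A by (intro mult_right_mono) auto
      finally show ?thesis
        by (simp add: mult_ac)
    qed
    finally show ?thesis .
  qed
  show thesis
    by (rule that[OF A(4) _ rem_sum_int]) (use main in \<open>simp add: v_def\<close>)
qed

end

text \<open>\<open>s n\<close> stands for the standard deviation of the weights in row
  \<open>n\<close>: bounded away from 0 and of smaller order than \<open>sqrt n\<close>, so that the
  scale \<open>s n / sqrt n\<close> of the bootstrap estimator tends to 0.\<close>

locale bootstrap_scale = bootstrap_lad M X Z \<theta> f W G
  for M :: "'a measure" and X Z :: "int \<Rightarrow> 'a \<Rightarrow> real" and \<theta> :: real and f :: "real \<Rightarrow> real"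
    and W :: "nat \<Rightarrow> nat \<Rightarrow> 'a \<Rightarrow> real" and G :: real +
  fixes s :: "nat \<Rightarrow> real" and s0 :: real
  assumes s0: "0 < s0" "\<And>n. 1 \<le> n \<Longrightarrow> s0 \<le> s n"
    and s_small: "(\<lambda>n. s n / sqrt n) \<longlonglongrightarrow> 0"
begin

definition \<mu> :: real where
  "\<mu> = f 0 * expectation (\<lambda>\<omega>. (X 0 \<omega>)\<^sup>2)"

lemma \<mu>_pos: "\<mu> > 0"
  using f_pos variance_X_pos by (simp add: \<mu>_def)

lemma inverse_real_tendsto: "(\<lambda>n. 1 / real n) \<longlonglongrightarrow> 0"
  using lim_1_over_n by (simp add: inverse_eq_divide)

text \<open>At \<open>\<delta> = u * s n / sqrt n\<close> one has
  \<open>n * \<delta>\<^sup>2 = u\<^sup>2 * (s n)\<^sup>2\<close>, so division by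
  \<open>(s n)\<^sup>2\<close> leaves the parabola. The leading martingale error becomes the root of
  a multiple of \<open>1 / (s n * sqrt n)\<close>, which vanishes since \<open>s n \<ge> s0\<close>;
  the error of the law of large numbers is of order \<open>1 / sqrt n\<close>.\<close>

lemma rem_sum_limit:
  "(\<lambda>n. expectation (\<lambda>\<omega>. \<bar>rem_sum n (u * s n / sqrt n) \<omega> / (s n)\<^sup>2 - \<mu> * u\<^sup>2\<bar>)) \<longlonglongrightarrow> 0"
proof (cases "u = 0")
  case False
  obtain A where A: "A \<ge> 0" "\<And>n (\<delta> :: real). 1 \<le> n \<Longrightarrow> \<delta> \<noteq> 0 \<Longrightarrow>
    expectation (\<lambda>\<omega>. \<bar>rem_sum n \<delta> \<omega> - f 0 * expectation (\<lambda>\<omega>. (X 0 \<omega>)\<^sup>2) * n * \<delta>\<^sup>2\<bar>) \<le>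
      sqrt n * sqrt (A * (\<bar>\<delta>\<bar> ^ 3 + \<delta> ^ 4)) + n * \<delta>\<^sup>2 * osc \<delta> + A * sqrt n * \<delta>\<^sup>2"
    by (rule rem_sum_bound) (rule that)
  define \<delta> where "\<delta> = (\<lambda>n. u * s n / sqrt (real n))"
  have \<delta>: "\<delta> \<longlonglongrightarrow> 0"
    using tendsto_mult_right_zero[OF s_small, of u] by (simp add: \<delta>_def)
  have ev: "\<forall>\<^sub>F n in sequentially. 1 \<le> n"
    by (rule eventually_ge_at_top)
  have \<delta>0: "\<forall>\<^sub>F n in sequentially. \<delta> n \<noteq> 0"
    using ev by eventually_elim (use False s0 in \<open>force simp: \<delta>_def\<close>)
  have osc: "(\<lambda>n. osc (\<delta> n)) \<longlonglongrightarrow> 0"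
    using \<delta> \<delta>0 by (rule osc_tendsto_0)
  have inv_sqrt: "(\<lambda>n. 1 / sqrt (real n)) \<longlonglongrightarrow> 0"
    using tendsto_real_sqrt[OF inverse_real_tendsto] by (simp add: real_sqrt_divide)
  show ?thesis
  proof (rule Lim_null_comparison)
    show "\<forall>\<^sub>F n in sequentially. norm (expectation (\<lambda>\<omega>. \<bar>rem_sum n (u * s n / sqrt n) \<omega> / (s n)\<^sup>2 - \<mu> * u\<^sup>2\<bar>)) \<le>
        sqrt (A * (\<bar>u\<bar> ^ 3 / s0 * (1 / sqrt n) + u ^ 4 * (1 / n))) + u\<^sup>2 * osc (\<delta> n) + A * u\<^sup>2 * (1 / sqrt n)"
      using ev \<delta>0
    proof eventually_elim
      case (elim n)
      have s: "s n > 0" "s0 \<le> s n"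
        using s0 elim(1) by force+
      have n: "real n > 0"
        using elim(1) by simp
      have nn: "sqrt n * sqrt n = n"
        by simp
      have \<delta>_sq: "n * (\<delta> n)\<^sup>2 = u\<^sup>2 * (s n)\<^sup>2"
        using n by (simp add: \<delta>_def power_divide power_mult_distrib)
      have \<delta>_4: "n * (\<delta> n) ^ 4 = u ^ 4 * (s n) ^ 4 * (1 / n)"
      proof -
        have "(sqrt n) ^ 4 = (sqrt n * sqrt n) * (sqrt n * sqrt n)"
          by (simp only: power4_eq_xxxx mult.assoc)
        also have "\<dots> = (real n)\<^sup>2"
          unfolding nn power2_eq_square ..
        finally show ?thesis
          using n by (simp add: \<delta>_def power_divide power_mult_distrib power2_eq_square)
      qed
      have \<delta>_3: "n * \<bar>\<delta> n\<bar> ^ 3 = \<bar>u\<bar> ^ 3 * (s n) ^ 3 * (1 / sqrt n)"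
      proof -
        have "(sqrt n) ^ 3 = n * sqrt n"
          unfolding power3_eq_cube nn ..
        then show ?thesis
          using n s by (simp add: \<delta>_def power_divide power_mult_distrib abs_mult)
      qed
      have s4: "(s n)\<^sup>2 * (s n)\<^sup>2 = (s n) ^ 4"
        by (simp flip: power_add)
      have "expectation (\<lambda>\<omega>. \<bar>rem_sum n (\<delta> n) \<omega> / (s n)\<^sup>2 - \<mu> * u\<^sup>2\<bar>) =
          expectation (\<lambda>\<omega>. \<bar>rem_sum n (\<delta> n) \<omega> - f 0 * expectation (\<lambda>\<omega>. (X 0 \<omega>)\<^sup>2) * n * (\<delta> n)\<^sup>2\<bar> / (s n)\<^sup>2)"
      proof (rule Bochner_Integration.integral_cong[OF refl])
        fix \<omega>
        have "f 0 * expectation (\<lambda>\<omega>. (X 0 \<omega>)\<^sup>2) * n * (\<delta> n)\<^sup>2 = \<mu> * u\<^sup>2 * (s n)\<^sup>2"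
          unfolding \<mu>_def mult.assoc \<delta>_sq ..
        then have "rem_sum n (\<delta> n) \<omega> / (s n)\<^sup>2 - \<mu> * u\<^sup>2 =
            (rem_sum n (\<delta> n) \<omega> - f 0 * expectation (\<lambda>\<omega>. (X 0 \<omega>)\<^sup>2) * n * (\<delta> n)\<^sup>2) / (s n)\<^sup>2"
          using s by (simp add: diff_divide_distrib)
        then show "\<bar>rem_sum n (\<delta> n) \<omega> / (s n)\<^sup>2 - \<mu> * u\<^sup>2\<bar> =
            \<bar>rem_sum n (\<delta> n) \<omega> - f 0 * expectation (\<lambda>\<omega>. (X 0 \<omega>)\<^sup>2) * n * (\<delta> n)\<^sup>2\<bar> / (s n)\<^sup>2"
          by (simp add: abs_divide)
      qed
      also have "\<dots> = expectation (\<lambda>\<omega>. \<bar>rem_sum n (\<delta> n) \<omega> - f 0 * expectation (\<lambda>\<omega>. (X 0 \<omega>)\<^sup>2) * n * (\<delta> n)\<^sup>2\<bar>) / (s n)\<^sup>2"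
        by simp
      also have "\<dots> \<le> (sqrt n * sqrt (A * (\<bar>\<delta> n\<bar> ^ 3 + (\<delta> n) ^ 4)) + n * (\<delta> n)\<^sup>2 * osc (\<delta> n) + A * sqrt n * (\<delta> n)\<^sup>2) / (s n)\<^sup>2"
        using A(2)[OF elim] by (intro divide_right_mono) auto
      also have "\<dots> = sqrt n * sqrt (A * (\<bar>\<delta> n\<bar> ^ 3 + (\<delta> n) ^ 4)) / (s n)\<^sup>2 + n * (\<delta> n)\<^sup>2 * osc (\<delta> n) / (s n)\<^sup>2 + A * sqrt n * (\<delta> n)\<^sup>2 / (s n)\<^sup>2"
        by (simp only: add_divide_distrib)
      also have "n * (\<delta> n)\<^sup>2 * osc (\<delta> n) / (s n)\<^sup>2 = u\<^sup>2 * osc (\<delta> n)"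
        unfolding \<delta>_sq using s by simp
      also have "A * sqrt n * (\<delta> n)\<^sup>2 / (s n)\<^sup>2 = A * u\<^sup>2 * (1 / sqrt n)"
      proof -
        have "sqrt n * (\<delta> n)\<^sup>2 = (real n / sqrt n) * (\<delta> n)\<^sup>2"
          by (simp only: real_div_sqrt[OF of_nat_0_le_iff])
        also have "\<dots> = n * (\<delta> n)\<^sup>2 * (1 / sqrt n)"
          by simp
        also have "\<dots> = u\<^sup>2 * (s n)\<^sup>2 * (1 / sqrt n)"
          unfolding \<delta>_sq ..
        finally show ?thesis
          unfolding mult.assoc[of A] using s by simp
      qed
      also have "sqrt n * sqrt (A * (\<bar>\<delta> n\<bar> ^ 3 + (\<delta> n) ^ 4)) / (s n)\<^sup>2 \<le>
          sqrt (A * (\<bar>u\<bar> ^ 3 / s0 * (1 / sqrt n) + u ^ 4 * (1 / n)))"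
      proof -
        have "sqrt n * sqrt (A * (\<bar>\<delta> n\<bar> ^ 3 + (\<delta> n) ^ 4)) / (s n)\<^sup>2 =
            sqrt (A * (n * \<bar>\<delta> n\<bar> ^ 3 + n * (\<delta> n) ^ 4) / (s n) ^ 4)"
        proof -
          have "(s n)\<^sup>2 = sqrt ((s n) ^ 4)"
            by (rule real_sqrt_unique[symmetric]) auto
          then have "sqrt n * sqrt (A * (\<bar>\<delta> n\<bar> ^ 3 + (\<delta> n) ^ 4)) / (s n)\<^sup>2 =
              sqrt (n * (A * (\<bar>\<delta> n\<bar> ^ 3 + (\<delta> n) ^ 4)) / (s n) ^ 4)"
            by (simp only: real_sqrt_mult real_sqrt_divide)
          then show ?thesis
            by (simp add: algebra_simps)
        qed
        also have "\<dots> \<le> sqrt (A * (\<bar>u\<bar> ^ 3 / s0 * (1 / sqrt n) + u ^ 4 * (1 / n)))"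
        proof (rule real_sqrt_le_mono)
          have 3: "\<bar>u\<bar> ^ 3 * (s n) ^ 3 * (1 / sqrt n) / (s n) ^ 4 \<le> \<bar>u\<bar> ^ 3 / s0 * (1 / sqrt n)"
          proof -
            have "(s n) ^ 4 = (s n) ^ 3 * s n"
              by (simp add: power3_eq_cube numeral_eq_Suc)
            then have "\<bar>u\<bar> ^ 3 * (s n) ^ 3 * (1 / sqrt n) / (s n) ^ 4 = \<bar>u\<bar> ^ 3 / s n * (1 / sqrt n)"
              using s by simp
            also have "\<dots> \<le> \<bar>u\<bar> ^ 3 / s0 * (1 / sqrt n)"
              using s s0 by (intro mult_right_mono divide_left_mono) auto
            finally show ?thesis .
          qed
          have "A * (n * \<bar>\<delta> n\<bar> ^ 3 + n * (\<delta> n) ^ 4) / (s n) ^ 4 =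
              A * (\<bar>u\<bar> ^ 3 * (s n) ^ 3 * (1 / sqrt n) / (s n) ^ 4 + u ^ 4 * (1 / n))"
            unfolding \<delta>_3 \<delta>_4 using s by (simp add: add_divide_distrib distrib_left)
          also have "\<dots> \<le> A * (\<bar>u\<bar> ^ 3 / s0 * (1 / sqrt n) + u ^ 4 * (1 / n))"
            using A(1) 3 by (intro mult_left_mono add_right_mono)
          finally show "A * (n * \<bar>\<delta> n\<bar> ^ 3 + n * (\<delta> n) ^ 4) / (s n) ^ 4 \<le>
              A * (\<bar>u\<bar> ^ 3 / s0 * (1 / sqrt n) + u ^ 4 * (1 / n))" .
        qed
        finally show ?thesis .
      qed
      finally show ?case
        by (simp add: \<delta>_def)
    qed
    have "(\<lambda>n. sqrt (A * (\<bar>u\<bar> ^ 3 / s0 * (1 / sqrt (real n)) + u ^ 4 * (1 / real n))) + u\<^sup>2 * osc (\<delta> n) + A * u\<^sup>2 * (1 / sqrt (real n)))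
      \<longlonglongrightarrow> sqrt (A * (\<bar>u\<bar> ^ 3 / s0 * 0 + u ^ 4 * 0)) + u\<^sup>2 * 0 + A * u\<^sup>2 * 0"
      by (intro tendsto_intros inv_sqrt inverse_real_tendsto osc)
    then show "(\<lambda>n. sqrt (A * (\<bar>u\<bar> ^ 3 / s0 * (1 / sqrt (real n)) + u ^ 4 * (1 / real n))) + u\<^sup>2 * osc (\<delta> n) + A * u\<^sup>2 * (1 / sqrt (real n))) \<longlonglongrightarrow> 0"
      by simp
  qed
qed (simp add: rem_sum_def)

end

lemma (in lad_ar1) rem_sum_mono_ray:
  assumes "0 \<le> u" "u \<le> v"
  shows "rem_sum n (u * d) \<omega> \<le> rem_sum n (v * d) \<omega>"
proof (cases "v = 0")
  case False
  then have "0 \<le> u / v" "u / v \<le> 1"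
    using assms by auto
  from lad_rem_mono[OF this] have "lad_rem z (u / v * (x * (v * d))) \<le> lad_rem z (x * (v * d))" for z x
    by blast
  moreover have "u / v * (x * (v * d)) = x * (u * d)" for x
    using False by simp
  ultimately show ?thesis
    unfolding rem_sum_def by (intro sum_mono) simp
qed (use assms in simp)

section \<open>Scores and linearization of the minimizers\<close>

context bootstrap_scale
begin

text \<open>\<open>b = 0\<close> gives the score of the estimator without weights,
  \<open>b = s n\<close> that of its bootstrap version.\<close>

definition score :: "nat \<Rightarrow> real \<Rightarrow> 'a \<Rightarrow> real" where
  "score n b \<omega> = (\<Sum>t=2..n. (1 + b * W n t \<omega>) * (X (int t - 1) \<omega> * sgn (innov (int t) \<omega>)))"

lemma score_measurable [measurable]: "score n b \<in> borel_measurable M"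
proof -
  have [measurable]: "W n t \<in> borel_measurable M" if "t \<in> {2..n}" for t
    using that by (intro entry_measurable) auto
  show ?thesis
    unfolding score_def by measurable
qed

lemma lag_sgn_square:
  "integrable M (\<lambda>\<omega>. (X 0 \<omega> * sgn (innov 1 \<omega>))\<^sup>2)"
  "expectation (\<lambda>\<omega>. (X 0 \<omega> * sgn (innov 1 \<omega>))\<^sup>2) \<le> expectation (\<lambda>\<omega>. (X 0 \<omega>)\<^sup>2)"
proof -
  have le: "(x * sgn z)\<^sup>2 \<le> x\<^sup>2" for x z :: real
    by (auto simp: sgn_if)
  show int: "integrable M (\<lambda>\<omega>. (X 0 \<omega> * sgn (innov 1 \<omega>))\<^sup>2)"
    using X_moments(1)[of 0] by (rule Bochner_Integration.integrable_bound) (use le in auto)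
  show "expectation (\<lambda>\<omega>. (X 0 \<omega> * sgn (innov 1 \<omega>))\<^sup>2) \<le> expectation (\<lambda>\<omega>. (X 0 \<omega>)\<^sup>2)"
    using int X_moments(1)[of 0] le by (intro integral_mono) auto
qed

lemma lag_sgn_centred: "expectation (\<lambda>\<omega>. x * sgn (innov 1 \<omega>)) = 0"
  by (simp add: expectation_sgn_innov)

text \<open>The part without weights is a martingale sum since the signs have mean 0; the other part
  is a weighted sum. For \<open>b \<le> s n\<close> the score is hence of order
  \<open>s n * sqrt n\<close> in mean.\<close>

lemma score_bound:
  obtains K where "K \<ge> 0" "\<And>n b. linear_bound n \<Longrightarrow> 0 \<le> b \<Longrightarrow> integrable M (score n b)"
    "\<And>n b. linear_bound n \<Longrightarrow> 0 \<le> b \<Longrightarrow> expectation (\<lambda>\<omega>. \<bar>score n b \<omega>\<bar>) \<le> sqrt n * (K + b * K)"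
proof -
  define v where "v = expectation (\<lambda>\<omega>. (X 0 \<omega>)\<^sup>2)"
  have "v \<ge> 0"
    by (simp add: v_def)
  define \<phi> :: "real \<Rightarrow> real \<Rightarrow> real" where "\<phi> = (\<lambda>z x. x * sgn z)"
  have \<phi>: "case_prod \<phi> \<in> borel_measurable (borel \<Otimes>\<^sub>M borel)"
    "\<And>x. expectation (\<lambda>\<omega>. \<phi> (innov 1 \<omega>) x) = 0"
    "integrable M (\<lambda>\<omega>. (\<phi> (innov 1 \<omega>) (X 0 \<omega>))\<^sup>2)"
    "expectation (\<lambda>\<omega>. (\<phi> (innov 1 \<omega>) (X 0 \<omega>))\<^sup>2) \<le> v"
    using lag_sgn_square lag_sgn_centred by (simp_all add: \<phi>_def v_def)
  define K where "K = sqrt v + sqrt (G * v)"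
  have K: "sqrt v \<le> K" "sqrt (G * v) \<le> K" "K \<ge> 0"
    using \<open>v \<ge> 0\<close> G_nonneg by (auto simp: K_def)
  have eq: "score n b = (\<lambda>\<omega>. (\<Sum>t=2..n. \<phi> (innov (int t) \<omega>) (X (int t - 1) \<omega>)) +
      b * (\<Sum>t=2..n. W n t \<omega> * \<phi> (innov (int t) \<omega>) (X (int t - 1) \<omega>)))" for n b
    by (simp add: fun_eq_iff score_def \<phi>_def distrib_right sum.distrib sum_distrib_left mult.assoc)
  show thesis
  proof (rule that[OF K(3)])
    fix n and b :: real
    assume n: "linear_bound n" and b: "0 \<le> b"
    note m = martingale_difference_abs[OF \<phi>(1,2,3), of n] and w = weighted_sum_abs(2,3)[OF n \<phi>(1,3,4)]
    show "integrable M (score n b)"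
      unfolding eq using m w by (intro Bochner_Integration.integrable_add integrable_mult_right)
    have "expectation (\<lambda>\<omega>. \<bar>score n b \<omega>\<bar>) \<le>
        expectation (\<lambda>\<omega>. \<bar>\<Sum>t=2..n. \<phi> (innov (int t) \<omega>) (X (int t - 1) \<omega>)\<bar> +
          b * \<bar>\<Sum>t=2..n. W n t \<omega> * \<phi> (innov (int t) \<omega>) (X (int t - 1) \<omega>)\<bar>)"
      unfolding eq
    proof (rule integral_mono)
      fix \<omega>
      have "\<bar>x + b * y\<bar> \<le> \<bar>x\<bar> + b * \<bar>y\<bar>" for x y
        using abs_triangle_ineq[of x "b * y"] b by (simp add: abs_mult)
      then show "\<bar>(\<Sum>t=2..n. \<phi> (innov (int t) \<omega>) (X (int t - 1) \<omega>)) +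
          b * (\<Sum>t=2..n. W n t \<omega> * \<phi> (innov (int t) \<omega>) (X (int t - 1) \<omega>))\<bar> \<le>
        \<bar>\<Sum>t=2..n. \<phi> (innov (int t) \<omega>) (X (int t - 1) \<omega>)\<bar> +
          b * \<bar>\<Sum>t=2..n. W n t \<omega> * \<phi> (innov (int t) \<omega>) (X (int t - 1) \<omega>)\<bar>" .
    qed (use m w in \<open>auto intro!: Bochner_Integration.integrable_add integrable_mult_right integrable_abs\<close>)
    also have "\<dots> = expectation (\<lambda>\<omega>. \<bar>\<Sum>t=2..n. \<phi> (innov (int t) \<omega>) (X (int t - 1) \<omega>)\<bar>) +
        b * expectation (\<lambda>\<omega>. \<bar>\<Sum>t=2..n. W n t \<omega> * \<phi> (innov (int t) \<omega>) (X (int t - 1) \<omega>)\<bar>)"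
      using m(1) w(1) by (subst Bochner_Integration.integral_add) (auto intro: integrable_abs)
    also have "\<dots> \<le> sqrt n * K + b * (sqrt n * K)"
    proof (intro add_mono mult_left_mono b)
      have "sqrt (expectation (\<lambda>\<omega>. (\<phi> (innov 1 \<omega>) (X 0 \<omega>))\<^sup>2)) \<le> sqrt v"
        using \<phi>(4) by simp
      then have "sqrt n * sqrt (expectation (\<lambda>\<omega>. (\<phi> (innov 1 \<omega>) (X 0 \<omega>))\<^sup>2)) \<le> sqrt n * K"
        using K(1) by (intro mult_left_mono order.trans[OF _ K(1)]) auto
      with m(2) show "expectation (\<lambda>\<omega>. \<bar>\<Sum>t=2..n. \<phi> (innov (int t) \<omega>) (X (int t - 1) \<omega>)\<bar>) \<le> sqrt n * K"
        by (rule order.trans)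
      have "sqrt n * sqrt (G * v) \<le> sqrt n * K"
        using K by (intro mult_left_mono) auto
      with w(2) show "expectation (\<lambda>\<omega>. \<bar>\<Sum>t=2..n. W n t \<omega> * \<phi> (innov (int t) \<omega>) (X (int t - 1) \<omega>)\<bar>) \<le> sqrt n * K"
        by (rule order.trans)
    qed
    also have "\<dots> = sqrt n * (K + b * K)"
      by (simp add: algebra_simps)
    finally show "expectation (\<lambda>\<omega>. \<bar>score n b \<omega>\<bar>) \<le> sqrt n * (K + b * K)" .
  qed
qed

text \<open>The premises describe a good sample point by finitely many inequalities. The halves are
  deliberate: \<open>weighted_lad_rem_le\<close> doubles the masses, and on each ray the error
  \<open>\<epsilon> / 2\<close> at the grid points is joined by at most
  \<open>\<epsilon> / 2\<close> between them.\<close>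

lemma minimizer_close:
  assumes n: "1 \<le> n" and z: "\<And>t. innov (int t) \<omega> \<noteq> 0"
    and b: "0 \<le> b" "b \<le> s n" and pos: "C > 0" "B \<ge> 0" "\<epsilon> > 0" "m > 0"
    and C: "\<mu> * C\<^sup>2 - \<epsilon> > 2 * B * C" "B / (2 * \<mu>) \<le> C" and m: "2 * \<mu> * C\<^sup>2 / real m \<le> \<epsilon> / 2"
    and min: "\<And>\<delta>. (\<Sum>t=2..n. (1 + b * W n t \<omega>) * \<bar>innov (int t) \<omega> - \<delta>\<^sub>0 * X (int t - 1) \<omega>\<bar>) \<le>
      (\<Sum>t=2..n. (1 + b * W n t \<omega>) * \<bar>innov (int t) \<omega> - \<delta> * X (int t - 1) \<omega>\<bar>)"
    and score: "\<bar>score n b \<omega>\<bar> \<le> B * (s n * sqrt n)"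
    and mass1: "mass n UNIV \<omega> \<le> ennreal (sqrt n * (B / 2))"
    and mass2: "mass n {..C * s n / sqrt n} \<omega> \<le> ennreal (sqrt n * (\<epsilon> / 2))"
    and grid: "\<And>i e. i \<le> m \<Longrightarrow> e = 1 \<or> e = - 1 \<Longrightarrow>
      \<bar>rem_sum n ((e * (real i * C / real m)) * s n / sqrt n) \<omega> / (s n)\<^sup>2 - \<mu> * (e * (real i * C / real m))\<^sup>2\<bar> \<le> \<epsilon> / 2"
  shows "\<mu> * (sqrt n / s n * \<delta>\<^sub>0 - score n b \<omega> / (2 * \<mu> * (s n * sqrt n)))\<^sup>2 \<le> 2 * (\<epsilon> + C * \<epsilon>)"
proof -
  have s: "s n > 0" and N: "sqrt (real n) > 0"
    using s0 n by (force, simp)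
  have R_ray: "\<bar>rem_sum n ((e * u) * s n / sqrt n) \<omega> / (s n)\<^sup>2 - \<mu> * u\<^sup>2\<bar> \<le> \<epsilon>"
    if e: "e = 1 \<or> e = - 1" and u: "0 \<le> u" "u \<le> C" for e u
  proof -
    define \<phi> where "\<phi> = (\<lambda>u. rem_sum n (u * (e * s n / sqrt n)) \<omega> / (s n)\<^sup>2)"
    have \<phi>_eq: "rem_sum n ((e * u) * s n / sqrt n) \<omega> / (s n)\<^sup>2 = \<phi> u" for u
      by (simp add: \<phi>_def mult_ac)
    have e_sq: "(e * y)\<^sup>2 = y\<^sup>2" for y
      using e by auto
    have "\<bar>\<phi> u - \<mu> * u\<^sup>2\<bar> \<le> \<epsilon> / 2 + 2 * \<mu> * C\<^sup>2 / real m"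
    proof (rule mono_near_parabola)
      show "\<phi> x \<le> \<phi> y" if "0 \<le> x" "x \<le> y" for x y
        unfolding \<phi>_def by (rule divide_right_mono[OF rem_sum_mono_ray[OF that]]) simp
      show "\<bar>\<phi> (real i * C / real m) - \<mu> * (real i * C / real m)\<^sup>2\<bar> \<le> \<epsilon> / 2" if "i \<le> m" for i
        using grid[OF that e] unfolding \<phi>_eq e_sq .
    qed (use pos \<mu>_pos u in auto)
    then show ?thesis
      unfolding \<phi>_eq using m by linarith
  qed
  have rem: "\<bar>\<Sum>t=2..n. W n t \<omega> * lad_rem (innov (int t) \<omega>) (X (int t - 1) \<omega> * \<delta>)\<bar> \<le> 2 * \<bar>\<delta>\<bar> * K"
    if "mass n A \<omega> \<le> ennreal K" "K \<ge> 0" "{..\<bar>\<delta>\<bar>} \<subseteq> A" for A K \<delta>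
    using that z unfolding mass_def by (intro weighted_lad_rem_le[where A = A]) auto
  show ?thesis
    unfolding score_def
  proof (rule argmin_near_linear_statistic[where I = "{2..n}" and W = "\<lambda>t. W n t \<omega>" and b = b and B = B])
    show "0 < s n" "0 < sqrt (real n)" "0 < \<mu>" "0 < C" "0 \<le> B" "0 \<le> b" "b \<le> s n"
      using s N \<mu>_pos pos b by auto
    show "2 * B * C < \<mu> * C\<^sup>2 - \<epsilon>" "B / (2 * \<mu>) \<le> C"
      using C by auto
    show "(\<Sum>t=2..n. (1 + b * W n t \<omega>) * (\<bar>innov (int t) \<omega> - \<delta>\<^sub>0 * X (int t - 1) \<omega>\<bar> - \<bar>innov (int t) \<omega>\<bar>)) \<le>
      (\<Sum>t=2..n. (1 + b * W n t \<omega>) * (\<bar>innov (int t) \<omega> - \<delta> * X (int t - 1) \<omega>\<bar> - \<bar>innov (int t) \<omega>\<bar>))" for \<delta>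
      using min[of \<delta>] by (simp add: right_diff_distrib sum_subtractf)
    show "\<bar>\<Sum>t=2..n. (1 + b * W n t \<omega>) * (X (int t - 1) \<omega> * sgn (innov (int t) \<omega>))\<bar> \<le> B * (s n * sqrt n)"
      using score by (simp only: score_def)
    show "\<bar>\<Sum>t=2..n. W n t \<omega> * lad_rem (innov (int t) \<omega>) (X (int t - 1) \<omega> * \<delta>)\<bar> \<le> \<bar>\<delta>\<bar> * (sqrt n * B)" for \<delta>
      using rem[OF mass1, of \<delta>] pos by simp
    show "\<bar>(\<Sum>t=2..n. lad_rem (innov (int t) \<omega>) (X (int t - 1) \<omega> * (u * s n / sqrt n))) / (s n)\<^sup>2 - \<mu> * u\<^sup>2\<bar> \<le> \<epsilon>"
      if "\<bar>u\<bar> \<le> C" for u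
      using R_ray[of 1 u] R_ray[of "- 1" "- u"] that unfolding rem_sum_def by (cases "0 \<le> u") auto
    show "\<bar>\<Sum>t=2..n. W n t \<omega> * lad_rem (innov (int t) \<omega>) (X (int t - 1) \<omega> * \<delta>)\<bar> \<le> \<bar>\<delta>\<bar> * (sqrt n * \<epsilon>)"
      if "\<bar>\<delta>\<bar> \<le> C * s n / sqrt n" for \<delta>
      using rem[OF mass2, of \<delta>] pos that by simp
  qed
qed

text \<open>The constants are chosen in the order \<open>B\<close>, \<open>C\<close>,
  \<open>\<epsilon>\<close>, \<open>m\<close>: first a bound for score and global mass that holds
  with high probability, then a radius at which the parabola dominates it, then a precision that
  forces the target distance, then a grid fine enough. The remaining events concern fixed constants
  and become unlikely as \<open>n\<close> grows.\<close>

lemma estimator_expansion: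
  fixes b :: "nat \<Rightarrow> real" and est :: "nat \<Rightarrow> 'a \<Rightarrow> real"
  assumes b: "\<And>n. 1 \<le> n \<Longrightarrow> 0 \<le> b n \<and> b n \<le> s n"
    and min: "\<And>n. 1 \<le> n \<Longrightarrow> AE \<omega> in M. \<forall>\<delta>.
      (\<Sum>t=2..n. (1 + b n * W n t \<omega>) * \<bar>innov (int t) \<omega> - est n \<omega> * X (int t - 1) \<omega>\<bar>) \<le>
      (\<Sum>t=2..n. (1 + b n * W n t \<omega>) * \<bar>innov (int t) \<omega> - \<delta> * X (int t - 1) \<omega>\<bar>)"
  shows "conv_in_prob M (\<lambda>n \<omega>. sqrt n / s n * est n \<omega> - score n (b n) \<omega> / (2 * \<mu> * (s n * sqrt n))) 0"
  unfolding conv_in_prob_def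
proof (intro allI impI, rule tendstoI)
  fix e \<tau> :: real
  assume "e > 0" "\<tau> > 0"
  define Y where "Y = (\<lambda>n \<omega>. sqrt (real n) / s n * est n \<omega> - score n (b n) \<omega> / (2 * \<mu> * (s n * sqrt n)))"
  obtain K1 where K1: "K1 \<ge> 0" "\<And>n b. linear_bound n \<Longrightarrow> 0 \<le> b \<Longrightarrow> integrable M (score n b)"
    "\<And>n b. linear_bound n \<Longrightarrow> 0 \<le> b \<Longrightarrow> expectation (\<lambda>\<omega>. \<bar>score n b \<omega>\<bar>) \<le> sqrt n * (K1 + b * K1)"
    by (rule score_bound) (rule that)
  obtain K2 where K2: "K2 \<ge> 0"
    "\<And>n. linear_bound n \<Longrightarrow> (\<integral>\<^sup>+\<omega>. mass n UNIV \<omega> \<partial>M) \<le> ennreal (sqrt n * K2)"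
    "\<And>n a. linear_bound n \<Longrightarrow> 0 \<le> a \<Longrightarrow> a \<le> 1 \<Longrightarrow> (\<integral>\<^sup>+\<omega>. mass n {..a} \<omega> \<partial>M) \<le> ennreal (sqrt n * K2 * sqrt a)"
    by (rule mass_bound) (rule that)
  \<comment> \<open>Four exceptional events of probability at most \<open>\<tau>'\<close> each; a
    fifth share keeps the inequality strict.\<close>
  define \<tau>' where "\<tau>' = \<tau> / 5"
  have \<tau>': "\<tau>' > 0"
    using \<open>\<tau> > 0\<close> by (simp add: \<tau>'_def)
  \<comment> \<open>\<open>L\<close> collects the numerators of the Markov bounds for score and
    global mass; for the latter the threshold \<open>B / 2\<close> accounts for the factor
    2.\<close>
  define L where "L = K1 / s0 + K1 + 2 * K2"
  have L: "K1 / s0 + K1 \<le> L" "2 * K2 \<le> L" "L \<ge> 0"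
    using K1(1) K2(1) s0(1) by (auto simp: L_def)
  define B where "B = 1 + L / \<tau>'"
  have B: "B > 0" "L / B \<le> \<tau>'"
  proof -
    show "B > 0"
      using L \<tau>' by (simp add: B_def add_pos_nonneg)
    have "L = \<tau>' * (L / \<tau>')"
      using \<tau>' by simp
    also have "\<dots> \<le> \<tau>' * B"
      using \<tau>' by (intro mult_left_mono) (auto simp: B_def)
    finally show "L / B \<le> \<tau>'"
      using \<open>B > 0\<close> by (simp add: divide_le_eq)
  qed
  \<comment> \<open>This gives \<open>\<mu> * C = 2 * B + 2 + \<mu>\<close>, hence
    \<open>\<mu> * C\<^sup>2 - 2 * B * C = 2 * C + \<mu> * C\<close>, which exceeds 2 and leaves
    room for any \<open>\<epsilon> \<le> 1\<close>.\<close>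
  define C where "C = (2 * B + 2) / \<mu> + 1"
  have C1: "C \<ge> 1"
    using B \<mu>_pos by (simp add: C_def)
  \<comment> \<open>The second entry makes the final error \<open>2 * (1 + C) * \<epsilon>\<close>
    at most \<open>\<mu> * e\<^sup>2\<close>.\<close>
  define \<epsilon> where "\<epsilon> = min 1 (\<mu> * e\<^sup>2 / (2 * (1 + C)))"
  have \<epsilon>: "\<epsilon> > 0" "\<epsilon> \<le> 1" "2 * (\<epsilon> + C * \<epsilon>) \<le> \<mu> * e\<^sup>2"
  proof -
    show "\<epsilon> > 0" "\<epsilon> \<le> 1"
      using \<mu>_pos \<open>e > 0\<close> C1 by (auto simp: \<epsilon>_def)
    have "\<epsilon> * (2 * (1 + C)) \<le> \<mu> * e\<^sup>2 / (2 * (1 + C)) * (2 * (1 + C))"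
      using C1 by (intro mult_right_mono) (auto simp: \<epsilon>_def)
    also have "\<dots> = \<mu> * e\<^sup>2"
    proof -
      have "a / b * b = a" if "b \<noteq> 0" for a b :: real
        using that by simp
      moreover have "2 * (1 + C) \<noteq> 0"
        using C1 by simp
      ultimately show ?thesis
        by blast
    qed
    finally show "2 * (\<epsilon> + C * \<epsilon>) \<le> \<mu> * e\<^sup>2"
      by (simp add: algebra_simps)
  qed
  have C2: "\<mu> * C\<^sup>2 - \<epsilon> > 2 * B * C" "B / (2 * \<mu>) \<le> C"
  proof -
    have "\<mu> * C = 2 * B + 2 + \<mu>"
    proof -
      have "\<mu> * (a / \<mu> + 1) = a + \<mu>" for a
        using \<mu>_pos by (simp add: distrib_left)
      then show ?thesis
        unfolding C_def .
    qed
    then have "\<mu> * C\<^sup>2 = 2 * B * C + 2 * C + \<mu> * C"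
      by (simp add: power2_eq_square mult.assoc[symmetric] distrib_right)
    moreover have "\<mu> * C > 0"
      using \<mu>_pos C1 by simp
    ultimately show "\<mu> * C\<^sup>2 - \<epsilon> > 2 * B * C"
      using C1 \<epsilon> by linarith
    have "B / (2 * \<mu>) \<le> (2 * B + 2) / \<mu>"
      using B \<mu>_pos by (simp add: field_simps)
    then show "B / (2 * \<mu>) \<le> C"
      by (simp add: C_def)
  qed
  obtain m :: nat where m: "m > 0" "2 * \<mu> * C\<^sup>2 / real m \<le> \<epsilon> / 2"
  proof -
    obtain m :: nat where *: "real m > 4 * \<mu> * C\<^sup>2 / \<epsilon>"
      using reals_Archimedean2 by blast
    have "4 * \<mu> * C\<^sup>2 / \<epsilon> \<ge> 0"
      using \<mu>_pos \<epsilon> by simp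
    with * have "real m > 0"
      by linarith
    then have "m > 0" "4 * \<mu> * C\<^sup>2 \<le> real m * \<epsilon>"
      using * \<epsilon>(1) by (auto simp: divide_less_eq)
    then show thesis
      by (intro that[of m]) (simp_all add: divide_le_eq mult_ac)
  qed
  define u where "u = (\<lambda>e i. e * (real i * C / real m))"
  define D where "D = (\<lambda>n e i. expectation (\<lambda>\<omega>. \<bar>rem_sum n (u e i * s n / sqrt n) \<omega> / (s n)\<^sup>2 - \<mu> * (u e i)\<^sup>2\<bar>))"
  define E1 where "E1 = (\<lambda>n. {\<omega> \<in> space M. \<bar>score n (b n) \<omega>\<bar> \<ge> B * (s n * sqrt n)})"
  define E2 where "E2 = (\<lambda>n. {\<omega> \<in> space M. mass n UNIV \<omega> > ennreal (sqrt n * (B / 2))})"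
  define E3 where "E3 = (\<lambda>n e i. {\<omega> \<in> space M. \<bar>rem_sum n (u e i * s n / sqrt n) \<omega> / (s n)\<^sup>2 - \<mu> * (u e i)\<^sup>2\<bar> \<ge> \<epsilon> / 2})"
  define E4 where "E4 = (\<lambda>n. {\<omega> \<in> space M. mass n {..C * s n / sqrt n} \<omega> > ennreal (sqrt n * (\<epsilon> / 2))})"
  have meas [measurable]: "E1 n \<in> sets M" "E2 n \<in> sets M" "E3 n e i \<in> sets M" "E4 n \<in> sets M" for n e i
    unfolding E1_def E2_def E3_def E4_def by measurable
  have D_lim: "(\<lambda>n. \<Sum>i\<le>m. D n 1 i / (\<epsilon> / 2) + D n (- 1) i / (\<epsilon> / 2)) \<longlonglongrightarrow> 0"
  proof -
    have "(\<lambda>n. \<Sum>i\<le>m. D n 1 i / (\<epsilon> / 2) + D n (- 1) i / (\<epsilon> / 2)) \<longlonglongrightarrow> (\<Sum>i\<le>m. 0 / (\<epsilon> / 2) + 0 / (\<epsilon> / 2))"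
      unfolding D_def using \<epsilon>(1) by (intro tendsto_sum tendsto_add tendsto_divide tendsto_const rem_sum_limit) auto
    then show ?thesis
      by simp
  qed
  have mass_lim: "(\<lambda>n. 2 * K2 * sqrt (C * (s n / sqrt n)) / \<epsilon>) \<longlonglongrightarrow> 0"
  proof -
    have "(\<lambda>n. 2 * K2 * sqrt (C * (s n / sqrt n)) / \<epsilon>) \<longlonglongrightarrow> 2 * K2 * sqrt (C * 0) / \<epsilon>"
      using \<epsilon>(1) by (intro tendsto_intros s_small) auto
    then show ?thesis
      by simp
  qed
  have small: "\<forall>\<^sub>F n in sequentially. C * (s n / sqrt n) < 1"
    using tendsto_mult_right_zero[OF s_small, of C] by (rule order_tendstoD(2)) simp
  show "\<forall>\<^sub>F n in sequentially. dist (prob {\<omega> \<in> space M. \<bar>sqrt n / s n * est n \<omega> - score n (b n) \<omega> / (2 * \<mu> * (s n * sqrt n)) - 0\<bar> > e}) 0 < \<tau>"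
    using eventually_linear_bound eventually_ge_at_top[of 1] small
      order_tendstoD(2)[OF D_lim \<tau>'] order_tendstoD(2)[OF mass_lim \<tau>']
  proof eventually_elim
    case (elim n)
    note lin = elim(1) and n = elim(2)
    have s: "s n > 0" "s0 \<le> s n" and N: "sqrt (real n) > 0"
      using s0 n by (force, force, simp)
    have bn: "0 \<le> b n" "b n \<le> s n"
      using b[OF n] by auto
    have P1: "prob (E1 n) \<le> \<tau>'"
    proof -
      have "prob (E1 n) \<le> expectation (\<lambda>\<omega>. \<bar>score n (b n) \<omega>\<bar>) / (B * (s n * sqrt n))"
        unfolding E1_def using B s N K1(2)[OF lin bn(1)] by (intro prob_abs_ge_le) auto
      also have "\<dots> \<le> sqrt n * (K1 + b n * K1) / (B * (s n * sqrt n))"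
        using B s N K1(3)[OF lin bn(1)] by (intro divide_right_mono) auto
      also have "\<dots> = (K1 / s n + b n / s n * K1) / B"
      proof -
        have "r * y / (B * (z * r)) = y / z / B" if "r \<noteq> 0" for r y z :: real
          using that mult_divide_mult_cancel_left[of r y "B * z"] by (simp add: mult_ac)
        from this[of "sqrt n" "K1 + b n * K1" "s n"] N show ?thesis
          by (simp add: add_divide_distrib)
      qed
      also have "\<dots> \<le> (K1 / s0 + 1 * K1) / B"
        using s s0 K1(1) bn B by (intro divide_right_mono add_mono mult_right_mono divide_left_mono) auto
      also have "\<dots> \<le> L / B"
        using L B by (intro divide_right_mono) auto
      finally show ?thesis
        using B by simp
    qed
    have P2: "prob (E2 n) \<le> \<tau>'"
    proof -
      have "prob (E2 n) \<le> sqrt n * K2 / (sqrt n * (B / 2))"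
        unfolding E2_def using K2 B N by (intro prob_gt_le_nn_integral K2(2)[OF lin]) auto
      also have "\<dots> = 2 * K2 / B"
        using N by simp
      also have "\<dots> \<le> L / B"
        using L B by (intro divide_right_mono) auto
      finally show ?thesis
        using B by simp
    qed
    have P4: "prob (E4 n) \<le> \<tau>'"
    proof -
      have a: "0 \<le> C * s n / sqrt n" "C * s n / sqrt n \<le> 1"
        using elim(3) C1 s N by auto
      have "prob (E4 n) \<le> sqrt n * K2 * sqrt (C * s n / sqrt n) / (sqrt n * (\<epsilon> / 2))"
        unfolding E4_def using K2 \<epsilon> N a by (intro prob_gt_le_nn_integral K2(3)[OF lin a]) auto
      also have "\<dots> = 2 * K2 * sqrt (C * (s n / sqrt n)) / \<epsilon>"
        using N by simp
      finally show ?thesis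
        using elim(5) by simp
    qed
    have P3: "prob (\<Union>i\<le>m. E3 n 1 i \<union> E3 n (- 1) i) \<le> \<tau>'"
    proof -
      obtain A where "\<And>n \<delta>. integrable M (rem_sum n \<delta>)"
        by (rule rem_sum_bound) (rule that)
      then have one: "prob (E3 n e i) \<le> D n e i / (\<epsilon> / 2)" for e i
        unfolding E3_def D_def using \<epsilon> by (intro prob_abs_ge_le) auto
      have "prob (\<Union>i\<le>m. E3 n 1 i \<union> E3 n (- 1) i) \<le> (\<Sum>i\<le>m. prob (E3 n 1 i \<union> E3 n (- 1) i))"
        by (intro finite_measure_subadditive_finite) auto
      also have "\<dots> \<le> (\<Sum>i\<le>m. D n 1 i / (\<epsilon> / 2) + D n (- 1) i / (\<epsilon> / 2))"
        by (intro sum_mono order.trans[OF measure_Un_le] add_mono one meas)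
      finally show ?thesis
        using elim(4) by simp
    qed
    have "AE \<omega> in M. \<omega> \<in> {\<omega> \<in> space M. \<bar>Y n \<omega> - 0\<bar> > e} \<longrightarrow>
        \<omega> \<in> E1 n \<union> E2 n \<union> E4 n \<union> (\<Union>i\<le>m. E3 n 1 i \<union> E3 n (- 1) i)"
    proof -
      have "AE \<omega> in M. \<forall>t. innov (int t) \<omega> \<noteq> 0"
        using innov_neq by (simp add: AE_all_countable)
      then show ?thesis
        using min[OF n]
      proof eventually_elim
        case (elim \<omega>)
        show ?case
        proof (rule impI, rule ccontr)
          assume \<omega>: "\<omega> \<in> {\<omega> \<in> space M. \<bar>Y n \<omega> - 0\<bar> > e}"
            and not: "\<omega> \<notin> E1 n \<union> E2 n \<union> E4 n \<union> (\<Union>i\<le>m. E3 n 1 i \<union> E3 n (- 1) i)"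
          have "\<mu> * (sqrt n / s n * est n \<omega> - score n (b n) \<omega> / (2 * \<mu> * (s n * sqrt n)))\<^sup>2 \<le> 2 * (\<epsilon> + C * \<epsilon>)"
          proof (rule minimizer_close[OF n _ bn _ _ \<epsilon>(1) m(1) C2 m(2)])
            show "innov (int t) \<omega> \<noteq> 0" for t
              using elim(1) by blast
            show "(\<Sum>t=2..n. (1 + b n * W n t \<omega>) * \<bar>innov (int t) \<omega> - est n \<omega> * X (int t - 1) \<omega>\<bar>) \<le>
              (\<Sum>t=2..n. (1 + b n * W n t \<omega>) * \<bar>innov (int t) \<omega> - \<delta> * X (int t - 1) \<omega>\<bar>)" for \<delta>
              using elim(2) by blast
            show "\<bar>score n (b n) \<omega>\<bar> \<le> B * (s n * sqrt n)"
              using \<omega> not by (auto simp: E1_def)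
            show "mass n UNIV \<omega> \<le> ennreal (sqrt n * (B / 2))"
              using \<omega> not by (auto simp: E2_def)
            show "mass n {..C * s n / sqrt n} \<omega> \<le> ennreal (sqrt n * (\<epsilon> / 2))"
              using \<omega> not by (auto simp: E4_def)
            show "\<bar>rem_sum n ((e * (real i * C / real m)) * s n / sqrt n) \<omega> / (s n)\<^sup>2 - \<mu> * (e * (real i * C / real m))\<^sup>2\<bar> \<le> \<epsilon> / 2"
              if "i \<le> m" "e = 1 \<or> e = - 1" for i e
            proof -
              have "\<omega> \<notin> E3 n e i" "\<omega> \<in> space M"
                using not that \<omega> by auto
              then show ?thesis
                by (simp add: E3_def u_def)
            qed
          qed (use C1 B in auto)
          then have "\<mu> * (Y n \<omega>)\<^sup>2 \<le> \<mu> * e\<^sup>2"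
            unfolding Y_def using \<epsilon>(3) by linarith
          then have "(Y n \<omega>)\<^sup>2 \<le> e\<^sup>2"
            using \<mu>_pos by simp
          then have "\<bar>Y n \<omega>\<bar> \<le> e"
            using \<open>e > 0\<close> by (simp add: abs_le_square_iff[symmetric])
          then show False
            using \<omega> by simp
        qed
      qed
    qed
    then have "prob {\<omega> \<in> space M. \<bar>Y n \<omega> - 0\<bar> > e} \<le> prob (E1 n \<union> E2 n \<union> E4 n \<union> (\<Union>i\<le>m. E3 n 1 i \<union> E3 n (- 1) i))"
      by (rule finite_measure_mono_AE) measurable
    also have "\<dots> \<le> prob (E1 n \<union> E2 n \<union> E4 n) + prob (\<Union>i\<le>m. E3 n 1 i \<union> E3 n (- 1) i)"
      by (rule measure_Un_le) measurable
    also have "\<dots> \<le> prob (E1 n \<union> E2 n) + prob (E4 n) + prob (\<Union>i\<le>m. E3 n 1 i \<union> E3 n (- 1) i)"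
      by (intro add_right_mono measure_Un_le) measurable
    also have "\<dots> \<le> prob (E1 n) + prob (E2 n) + prob (E4 n) + prob (\<Union>i\<le>m. E3 n 1 i \<union> E3 n (- 1) i)"
      by (intro add_right_mono measure_Un_le) measurable
    also have "\<dots> \<le> 4 * \<tau>'"
      using P1 P2 P3 P4 by linarith
    also have "\<dots> < \<tau>"
      using \<open>\<tau> > 0\<close> by (simp add: \<tau>'_def)
    finally show ?case
      by (simp add: Y_def)
  qed
qed

end

section \<open>Conditional laws\<close>

lemma (in prob_space) conv_in_prob_diff:
  assumes [measurable]: "\<And>n. Y n \<in> borel_measurable M" "\<And>n. V n \<in> borel_measurable M"
    and "conv_in_prob M Y 0" "conv_in_prob M V 0"
  shows "conv_in_prob M (\<lambda>n \<omega>. Y n \<omega> - V n \<omega>) 0"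
  unfolding conv_in_prob_def
proof (intro allI impI)
  fix e :: real
  assume "e > 0"
  then have e: "e / 2 > 0"
    by simp
  show "(\<lambda>n. prob {\<omega> \<in> space M. \<bar>Y n \<omega> - V n \<omega> - 0\<bar> > e}) \<longlonglongrightarrow> 0"
  proof (rule Lim_null_comparison)
    show "(\<lambda>n. prob {\<omega> \<in> space M. \<bar>Y n \<omega> - 0\<bar> > e / 2} + prob {\<omega> \<in> space M. \<bar>V n \<omega> - 0\<bar> > e / 2}) \<longlonglongrightarrow> 0"
      using assms(3,4) e unfolding conv_in_prob_def by (intro tendsto_add_zero) blast+
    have "prob {\<omega> \<in> space M. \<bar>Y n \<omega> - V n \<omega> - 0\<bar> > e} \<le>
        prob ({\<omega> \<in> space M. \<bar>Y n \<omega> - 0\<bar> > e / 2} \<union> {\<omega> \<in> space M. \<bar>V n \<omega> - 0\<bar> > e / 2})" for n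
      by (intro finite_measure_mono) auto
    also have "\<dots> n \<le> prob {\<omega> \<in> space M. \<bar>Y n \<omega> - 0\<bar> > e / 2} + prob {\<omega> \<in> space M. \<bar>V n \<omega> - 0\<bar> > e / 2}" for n
      by (intro measure_Un_le) measurable
    finally show "\<forall>\<^sub>F n in sequentially. norm (prob {\<omega> \<in> space M. \<bar>Y n \<omega> - V n \<omega> - 0\<bar> > e}) \<le>
        prob {\<omega> \<in> space M. \<bar>Y n \<omega> - 0\<bar> > e / 2} + prob {\<omega> \<in> space M. \<bar>V n \<omega> - 0\<bar> > e / 2}"
      by (intro always_eventually allI) simp
  qed
qed

text \<open>Polya's theorem in finite form. A continuous distribution function attains every level
  strictly between 0 and 1, so quantiles at multiples of \<open>e\<close> form a grid for all
  monotone \<open>F\<close> at once; that the grid depends only on \<open>e\<close> allows random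
  \<open>F\<close>. Grid error and level spacing add up to at most \<open>3 * e\<close>.\<close>

lemma (in real_distribution) cdf_uniform_grid:
  assumes cont: "\<And>x. isCont (cdf M) x" and "e > 0"
  obtains S where "finite S" "\<And>F x. mono F \<Longrightarrow> (\<And>x. 0 \<le> F x) \<Longrightarrow> (\<And>x. F x \<le> 1) \<Longrightarrow>
    (\<And>x. x \<in> S \<Longrightarrow> \<bar>F x - cdf M x\<bar> \<le> e) \<Longrightarrow> \<bar>F x - cdf M x\<bar> \<le> 3 * e"
proof -
  have cdf_less: "a \<le> b" if "cdf M a < cdf M b" for a b
  proof (rule ccontr)
    assume "\<not> a \<le> b"
    then have "cdf M b \<le> cdf M a"
      by (intro cdf_nondecreasing) simp
    then show False
      using that by simp
  qed
  have quantile: "\<exists>x. cdf M x = p" if "0 < p" "p < 1" for p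
  proof -
    have "\<forall>\<^sub>F x in at_bot. cdf M x < p"
      using cdf_lim_at_bot that(1) by (rule order_tendstoD(2))
    then obtain a where a: "cdf M a < p"
      by (auto simp: eventually_at_bot_linorder)
    have "\<forall>\<^sub>F x in at_top. p < cdf M x"
      using cdf_lim_at_top_prob that(2) by (rule order_tendstoD(1))
    then obtain b where b: "p < cdf M b"
      by (auto simp: eventually_at_top_linorder)
    have "a \<le> b"
      using a b by (intro cdf_less) linarith
    then show ?thesis
      using IVT[of "cdf M" a p b] a b cont by auto
  qed
  define q where "q = (\<lambda>p. SOME x. cdf M x = p)"
  have q: "cdf M (q p) = p" if "0 < p" "p < 1" for p
    unfolding q_def using quantile[OF that] by (rule someI_ex)
  define S where "S = (\<lambda>i. q (real i * e)) ` {i. real i * e < 1}"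
  have "finite S"
  proof -
    have "{i. real i * e < 1} \<subseteq> {..nat \<lceil>1 / e\<rceil>}"
    proof
      fix i
      assume "i \<in> {i. real i * e < 1}"
      then have "real i < 1 / e"
        using \<open>e > 0\<close> by (simp add: less_divide_eq)
      then show "i \<in> {..nat \<lceil>1 / e\<rceil>}"
        by simp linarith
    qed
    then show ?thesis
      unfolding S_def using finite_subset by blast
  qed
  moreover have "\<bar>F x - cdf M x\<bar> \<le> 3 * e"
    if F: "mono F" "\<And>x. 0 \<le> F x" "\<And>x. F x \<le> 1" and S: "\<And>x. x \<in> S \<Longrightarrow> \<bar>F x - cdf M x\<bar> \<le> e" for F x
  proof -
    have near: "\<bar>F (q (real i * e)) - real i * e\<bar> \<le> e" "cdf M (q (real i * e)) = real i * e"
      if "0 < i" "real i * e < 1" for i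
    proof -
      show "cdf M (q (real i * e)) = real i * e"
        using that \<open>e > 0\<close> by (intro q) auto
      then show "\<bar>F (q (real i * e)) - real i * e\<bar> \<le> e"
        using S[of "q (real i * e)"] that by (auto simp: S_def)
    qed
    define i where "i = nat \<lfloor>cdf M x / e\<rfloor>"
    have "0 \<le> cdf M x / e"
      using \<open>e > 0\<close> cdf_nonneg by simp
    then have "real i \<le> cdf M x / e" "cdf M x / e < real i + 1"
      unfolding i_def by (simp_all add: of_nat_nat)
    then have i: "real i * e \<le> cdf M x" "cdf M x < (real i + 1) * e"
      using \<open>e > 0\<close> by (simp_all add: le_divide_eq divide_less_eq)
    have upper: "F x - cdf M x \<le> 3 * e"
    proof (cases "real (Suc i) * e < 1")
      case True
      have "x \<le> q (real (Suc i) * e)"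
        using near(2)[of "Suc i"] True i by (intro cdf_less) (simp add: algebra_simps)
      then have "F x \<le> F (q (real (Suc i) * e))"
        using F(1) by (rule monoD[rotated])
      then show ?thesis
        using near(1)[of "Suc i"] True i \<open>e > 0\<close> by (simp add: algebra_simps abs_le_iff)
    next
      case False
      then show ?thesis
        using F(3)[of x] i \<open>e > 0\<close> by (simp add: algebra_simps)
    qed
    have lower: "cdf M x - F x \<le> 3 * e"
    \<comment> \<open>The level below \<open>real i * e\<close> is used, since its quantile lies to
      the left of \<open>x\<close> by a strict inequality of levels. For \<open>i \<le> 1\<close>
      that level is not positive, but then \<open>cdf M x\<close> is itself below
      \<open>2 * e\<close>.\<close>
    proof (cases "i \<le> 1")
      case True
      then have "(real i + 1) * e \<le> 2 * e"
        using \<open>e > 0\<close> by (intro mult_right_mono) auto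
      then have "cdf M x < 2 * e"
        using i by linarith
      then show ?thesis
        using F(2)[of x] \<open>e > 0\<close> by linarith
    next
      case False
      then obtain j where j: "i = Suc j" "0 < j"
        by (cases i) auto
      have "real j * e < real i * e"
        using j \<open>e > 0\<close> by simp
      then have "real j * e < cdf M x"
        using i by linarith
      moreover have "cdf M x \<le> 1"
        by (rule cdf_bounded_prob)
      ultimately have j1: "real j * e < 1"
        by linarith
      have "q (real j * e) \<le> x"
        using near(2)[OF j(2) j1] \<open>real j * e < cdf M x\<close> by (intro cdf_less) simp
      then have "F (q (real j * e)) \<le> F x"
        using F(1) by (rule monoD[rotated])
      then show ?thesis
        using near(1)[OF j(2) j1] i j by (simp add: algebra_simps abs_le_iff)
    qed
    show ?thesis
      using upper lower by (simp add: abs_le_iff)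
  qed
  ultimately show thesis
    by (rule that)
qed

section \<open>The linear statistic given the observations\<close>

context bootstrap_scale
begin

definition obs :: "nat \<Rightarrow> 'a \<Rightarrow> int \<Rightarrow> real" where
  "obs n \<omega> = (\<lambda>t\<in>{1..int n}. X t \<omega>)"

text \<open>The weight \<open>W n 1\<close> does not enter the sums from 2 to \<open>n\<close>, so it gets coefficient 0.\<close>

definition coef :: "nat \<Rightarrow> (int \<Rightarrow> real) \<Rightarrow> nat \<Rightarrow> real" where
  "coef n x j = (if j = 1 then 0 else
    x (int j - 1) * sgn (x (int j) - \<theta> * x (int j - 1)) / (2 * \<mu> * sqrt n))"

definition lin_stat :: "nat \<Rightarrow> 'a \<Rightarrow> real" where
  "lin_stat n \<omega> = (\<Sum>j=1..n. coef n (obs n \<omega>) j * W n j \<omega>)"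

text \<open>The data are frozen at \<open>x\<close> and only the weights are random; composed with
  \<open>obs n\<close> this becomes a version of the conditional distribution function that is
  explicit at every sample point.\<close>

definition cond_cdf :: "nat \<Rightarrow> real \<Rightarrow> (int \<Rightarrow> real) \<Rightarrow> real" where
  "cond_cdf n y x = prob {\<omega> \<in> space M. (\<Sum>j=1..n. coef n x j * W n j \<omega>) \<le> y}"

definition V :: real where
  "V = 1 / (4 * (f 0)\<^sup>2 * expectation (\<lambda>\<omega>. (X 0 \<omega>)\<^sup>2))"

definition limit_cdf :: "real \<Rightarrow> real" where
  "limit_cdf = cdf (density lborel (normal_density 0 (sqrt V)))"

lemma V_pos: "V > 0"
  using f_pos variance_X_pos by (simp add: V_def)

text \<open>In this form \<open>V\<close> arises as the limit of the sum of squared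
  coefficients.\<close>

lemma V_eq: "V = expectation (\<lambda>\<omega>. (X 0 \<omega>)\<^sup>2) / (4 * \<mu>\<^sup>2)"
  using f_pos variance_X_pos by (simp add: V_def \<mu>_def power2_eq_square)

lemma obs_measurable [measurable]: "obs n \<in> M \<rightarrow>\<^sub>M Pi\<^sub>M {1..int n} (\<lambda>_. borel)"
  unfolding obs_def by measurable

lemma coef_obs:
  assumes "j \<in> {1..n}"
  shows "coef n (obs n \<omega>) j = (if j = 1 then 0 else X (int j - 1) \<omega> * sgn (innov (int j) \<omega>) / (2 * \<mu> * sqrt n))"
  using assms by (auto simp: coef_def obs_def innov_def)

lemma coef_measurable [measurable]:
  assumes "j \<in> {1..n}"
  shows "(\<lambda>x. coef n x j) \<in> borel_measurable (Pi\<^sub>M {1..int n} (\<lambda>_. borel))"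
proof (cases "j = 1")
  case False
  then have [measurable]: "(\<lambda>x. x (int j)) \<in> borel_measurable (Pi\<^sub>M {1..int n} (\<lambda>_. borel))"
    "(\<lambda>x. x (int j - 1)) \<in> borel_measurable (Pi\<^sub>M {1..int n} (\<lambda>_. borel))"
    using assms by (auto intro!: measurable_component_singleton)
  show ?thesis
    unfolding coef_def using False by simp
qed (simp add: coef_def)

lemma lin_stat_measurable [measurable]: "lin_stat n \<in> borel_measurable M"
proof -
  note [measurable] = entry_measurable
  have [measurable]: "(\<lambda>\<omega>. coef n (obs n \<omega>) j) \<in> borel_measurable M" if "j \<in> {1..n}" for j
    by (rule measurable_compose[OF obs_measurable coef_measurable[OF that]])
  show ?thesis
    unfolding lin_stat_def by measurable
qed

text \<open>The score is affine in \<open>b\<close>, so its part without weights cancels between the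
  two expansions and a pure linear form in the weights is left.\<close>

lemma lin_stat_eq_score:
  assumes "2 \<le> n"
  shows "score n b \<omega> - score n 0 \<omega> = b * (2 * \<mu> * sqrt n) * lin_stat n \<omega>"
proof -
  define k where "k = 2 * \<mu> * sqrt n"
  have "k > 0"
    using \<mu>_pos assms by (simp add: k_def)
  have "lin_stat n \<omega> = (\<Sum>j=1..n. (if j = 1 then 0 else X (int j - 1) \<omega> * sgn (innov (int j) \<omega>) / k) * W n j \<omega>)"
    unfolding lin_stat_def k_def by (intro sum.cong refl) (simp only: coef_obs)
  also have "\<dots> = (\<Sum>t=2..n. W n t \<omega> * (X (int t - 1) \<omega> * sgn (innov (int t) \<omega>) / k))"
    by (rule sum_from_2[OF assms])
  finally have "k * lin_stat n \<omega> = (\<Sum>t=2..n. W n t \<omega> * (X (int t - 1) \<omega> * sgn (innov (int t) \<omega>)))"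
    using \<open>k > 0\<close> by (simp add: sum_distrib_left)
  then have "b * (k * lin_stat n \<omega>) = score n b \<omega> - score n 0 \<omega>"
    by (simp add: score_def sum_subtractf[symmetric] sum_distrib_left distrib_right mult.assoc)
  then show ?thesis
    by (simp add: k_def mult.assoc)
qed

definition ind_fun :: "nat \<Rightarrow> real \<Rightarrow> (int \<Rightarrow> real) \<times> (nat \<Rightarrow> real) \<Rightarrow> real" where
  "ind_fun n y = (\<lambda>(x, w). of_bool ((\<Sum>j=1..n. coef n x j * w j) \<le> y))"

lemma ind_fun_measurable [measurable]:
  "ind_fun n y \<in> borel_measurable (Pi\<^sub>M {1..int n} (\<lambda>_. borel) \<Otimes>\<^sub>M Pi\<^sub>M {1..n} (\<lambda>_. borel))"
  unfolding ind_fun_def by measurable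

lemma ind_fun_row: "ind_fun n y (x, \<lambda>j\<in>{1..n}. W n j \<omega>) = of_bool ((\<Sum>j=1..n. coef n x j * W n j \<omega>) \<le> y)"
proof -
  have "(\<Sum>j=1..n. coef n x j * (\<lambda>j\<in>{1..n}. W n j \<omega>) j) = (\<Sum>j=1..n. coef n x j * W n j \<omega>)"
    by (intro sum.cong) auto
  then show ?thesis
    by (simp add: ind_fun_def)
qed

lemma row_vector_measurable [measurable]: "(\<lambda>\<omega>. \<lambda>j\<in>{1..n}. W n j \<omega>) \<in> M \<rightarrow>\<^sub>M Pi\<^sub>M {1..n} (\<lambda>_. borel)"
  using entry_measurable by (intro measurable_restrict)

lemma cond_cdf_eq: "cond_cdf n y x = expectation (\<lambda>\<omega>. ind_fun n y (x, \<lambda>j\<in>{1..n}. W n j \<omega>))"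
proof -
  note [measurable] = entry_measurable
  have "expectation (\<lambda>\<omega>. ind_fun n y (x, \<lambda>j\<in>{1..n}. W n j \<omega>)) =
      expectation (indicator {\<omega> \<in> space M. (\<Sum>j=1..n. coef n x j * W n j \<omega>) \<le> y})"
    unfolding ind_fun_row by (intro Bochner_Integration.integral_cong) (auto simp: indicator_def)
  then show ?thesis
    by (simp add: cond_cdf_def)
qed

lemma cond_cdf_measurable [measurable]: "cond_cdf n y \<in> borel_measurable (Pi\<^sub>M {1..int n} (\<lambda>_. borel))"
proof -
  have "(\<lambda>(x, \<omega>). ind_fun n y (x, \<lambda>j\<in>{1..n}. W n j \<omega>)) \<in> borel_measurable (Pi\<^sub>M {1..int n} (\<lambda>_. borel) \<Otimes>\<^sub>M M)"
    by measurable
  then have "(\<lambda>x. expectation (\<lambda>\<omega>. ind_fun n y (x, \<lambda>j\<in>{1..n}. W n j \<omega>))) \<in> borel_measurable (Pi\<^sub>M {1..int n} (\<lambda>_. borel))"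
    using borel_measurable_lebesgue_integral[where f = "\<lambda>x \<omega>. ind_fun n y (x, \<lambda>j\<in>{1..n}. W n j \<omega>)"] by simp
  then show ?thesis
    by (simp add: cond_cdf_eq[abs_def])
qed

lemma obs_space: "obs n \<in> space M \<rightarrow> space (Pi\<^sub>M {1..int n} (\<lambda>_. borel))"
  by (auto simp: obs_def space_PiM)

lemma obs_algebra_eq: "obs_algebra M X n = vimage_algebra (space M) (obs n) (Pi\<^sub>M {1..int n} (\<lambda>_. borel))"
  unfolding obs_algebra_def obs_def ..

lemma obs_subalgebra: "subalgebra M (obs_algebra M X n)"
  unfolding subalgebra_def obs_algebra_eq
proof
  show "sets (vimage_algebra (space M) (obs n) (Pi\<^sub>M {1..int n} (\<lambda>_. borel))) \<subseteq> sets M"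
    unfolding sets_vimage_algebra2[OF obs_space] using measurable_sets[OF obs_measurable] by auto
qed simp

text \<open>An event of the observed algebra is a preimage under \<open>obs n\<close>, so its
  indicator may be frozen together with the coefficients; independence of data and weights then
  gives the defining identity of conditional expectation.\<close>

lemma cond_exp_lin_stat:
  "AE \<omega> in M. real_cond_exp M (obs_algebra M X n) (indicator {\<omega> \<in> space M. lin_stat n \<omega> \<le> y}) \<omega> =
    cond_cdf n y (obs n \<omega>)"
proof -
  interpret finite_measure_subalgebra M "obs_algebra M X n"
    by unfold_locales (rule obs_subalgebra)
  have H_meas: "(\<lambda>\<omega>. cond_cdf n y (obs n \<omega>)) \<in> borel_measurable M"
    by measurable
  show ?thesis
  proof (rule real_cond_exp_charact)
    show "integrable M (indicat_real {\<omega> \<in> space M. lin_stat n \<omega> \<le> y})"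
      by (rule integrable_real_indicator) (auto simp: emeasure_eq_measure)
    show "integrable M (\<lambda>\<omega>. cond_cdf n y (obs n \<omega>))"
      using H_meas by (intro integrable_const_bound[where B = 1]) (auto simp: cond_cdf_def)
    have "obs n \<in> obs_algebra M X n \<rightarrow>\<^sub>M Pi\<^sub>M {1..int n} (\<lambda>_. borel)"
      unfolding obs_algebra_eq by (rule measurable_vimage_algebra1[OF obs_space])
    then show "(\<lambda>\<omega>. cond_cdf n y (obs n \<omega>)) \<in> borel_measurable (obs_algebra M X n)"
      by (rule measurable_compose) measurable
    fix A
    assume "A \<in> sets (obs_algebra M X n)"
    then obtain B where B: "B \<in> sets (Pi\<^sub>M {1..int n} (\<lambda>_. borel))" "A = obs n -` B \<inter> space M"
      unfolding obs_algebra_eq sets_vimage_algebra2[OF obs_space] by blast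
    define g where "g = (\<lambda>(x, w). indicator B x * ind_fun n y (x, w))"
    have g: "g \<in> borel_measurable (Pi\<^sub>M {1..int n} (\<lambda>_. borel) \<Otimes>\<^sub>M Pi\<^sub>M {1..n} (\<lambda>_. borel))"
      unfolding g_def using B(1) by measurable
    have int: "integrable M (\<lambda>\<omega>. g (obs n \<omega>, \<lambda>j\<in>{1..n}. W n j \<omega>))"
    proof (rule integrable_const_bound[where B = 1])
      show "AE \<omega> in M. norm (g (obs n \<omega>, \<lambda>j\<in>{1..n}. W n j \<omega>)) \<le> 1"
        by (auto simp: g_def ind_fun_def indicator_def)
      show "(\<lambda>\<omega>. g (obs n \<omega>, \<lambda>j\<in>{1..n}. W n j \<omega>)) \<in> borel_measurable M"
        using g by measurable
    qed
    have pair: "indep_pair (Pi\<^sub>M {1..int n} (\<lambda>_. borel)) (obs n) (Pi\<^sub>M {1..n} (\<lambda>_. borel)) (\<lambda>\<omega>. \<lambda>j\<in>{1..n}. W n j \<omega>)"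
      using indep[of n] by (simp only: obs_def[abs_def])
    have "(LINT \<omega>:A|M. indicator {\<omega> \<in> space M. lin_stat n \<omega> \<le> y} \<omega>) = expectation (\<lambda>\<omega>. g (obs n \<omega>, \<lambda>j\<in>{1..n}. W n j \<omega>))"
      unfolding set_lebesgue_integral_def
    proof (rule Bochner_Integration.integral_cong[OF refl])
      fix \<omega>
      assume "\<omega> \<in> space M"
      moreover have "g (obs n \<omega>, \<lambda>j\<in>{1..n}. W n j \<omega>) = indicator B (obs n \<omega>) * of_bool (lin_stat n \<omega> \<le> y)"
        by (simp only: g_def prod.case ind_fun_row lin_stat_def)
      ultimately show "indicat_real A \<omega> *\<^sub>R indicator {\<omega> \<in> space M. lin_stat n \<omega> \<le> y} \<omega> = g (obs n \<omega>, \<lambda>j\<in>{1..n}. W n j \<omega>)"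
        by (simp add: B(2) indicator_def)
    qed
    also have "\<dots> = expectation (\<lambda>\<omega>. expectation (\<lambda>\<omega>'. g (obs n \<omega>, \<lambda>j\<in>{1..n}. W n j \<omega>')))"
      by (rule expectation_indep_pair[OF pair g int])
    also have "\<dots> = (LINT \<omega>:A|M. cond_cdf n y (obs n \<omega>))"
      unfolding set_lebesgue_integral_def cond_cdf_eq
      by (intro Bochner_Integration.integral_cong) (auto simp: g_def B(2) indicator_def)
    finally show "(LINT \<omega>:A|M. indicator {\<omega> \<in> space M. lin_stat n \<omega> \<le> y} \<omega>) = (LINT \<omega>:A|M. cond_cdf n y (obs n \<omega>))" .
  qed
qed

lemma limit_cdf_isCont: "isCont limit_cdf x"
  unfolding limit_cdf_def using V_pos by (intro cdf_normal_density_isCont) simp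

text \<open>Off three unlikely events the random coefficients meet the conditions of
  \<open>cdf_uniform_limit\<close>: their sum is bounded because the score is of order
  \<open>sqrt n\<close>, their squares sum to nearly \<open>V\<close> by the law of large numbers,
  and the largest is small by \<open>max_X\<close>.\<close>

lemma cond_cdf_limit:
  assumes max_X: "conv_in_prob M (\<lambda>n \<omega>. s n / sqrt (real n) * (MAX t\<in>{1..int n}. \<bar>X t \<omega>\<bar>)) 0"
  shows "conv_in_prob M (\<lambda>n \<omega>. cond_cdf n y (obs n \<omega>)) (limit_cdf y)"
  unfolding conv_in_prob_def
proof (intro allI impI, rule tendstoI)
  fix e r :: real
  assume "e > 0" "r > 0"
  define r' where "r' = r / 4"
  have r': "r' > 0"
    using \<open>r > 0\<close> by (simp add: r'_def)
  define v where "v = expectation (\<lambda>\<omega>. (X 0 \<omega>)\<^sup>2)"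
  obtain K1 where K1: "K1 \<ge> 0" "\<And>n b. linear_bound n \<Longrightarrow> 0 \<le> b \<Longrightarrow> integrable M (score n b)"
    "\<And>n b. linear_bound n \<Longrightarrow> 0 \<le> b \<Longrightarrow> expectation (\<lambda>\<omega>. \<bar>score n b \<omega>\<bar>) \<le> sqrt n * (K1 + b * K1)"
    by (rule score_bound) (rule that)
  obtain C2 where C2: "C2 \<ge> 0" "\<And>n. 1 \<le> n \<Longrightarrow>
    expectation (\<lambda>\<omega>. \<bar>(\<Sum>t=2..n. (X (int t - 1) \<omega>)\<^sup>2) - (real n - 1) * expectation (\<lambda>\<omega>. (X 0 \<omega>)\<^sup>2)\<bar>) \<le> C2 * sqrt n"
    by (rule X_square_average) (rule that)
  \<comment> \<open>Chosen so that Markov's inequality bounds the probability of a large score by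
    \<open>r'\<close>.\<close>
  define C where "C = 1 + K1 / (2 * \<mu> * r')"
  have C: "C > 0" "K1 / (2 * \<mu> * C) \<le> r'"
  proof -
    show "C > 0"
      using K1(1) \<mu>_pos r' by (simp add: C_def add_pos_nonneg)
    have "K1 = r' * (2 * \<mu>) * (K1 / (2 * \<mu> * r'))"
      using r' \<mu>_pos by simp
    also have "\<dots> \<le> r' * (2 * \<mu>) * C"
      using r' \<mu>_pos by (intro mult_left_mono) (auto simp: C_def)
    finally show "K1 / (2 * \<mu> * C) \<le> r'"
      using \<mu>_pos \<open>C > 0\<close> by (simp add: divide_le_eq mult_ac)
  qed
  obtain \<eta> N where \<eta>: "\<eta> > 0" and unif: "\<And>n c. N \<le> n \<Longrightarrow> (\<forall>j\<in>{1..n}. \<bar>c j\<bar> \<le> \<eta>) \<Longrightarrow>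
      \<bar>(\<Sum>j=1..n. (c j)\<^sup>2) - V\<bar> \<le> \<eta> \<Longrightarrow> \<bar>\<Sum>j=1..n. c j\<bar> \<le> C \<Longrightarrow>
      \<bar>prob {\<omega> \<in> space M. (\<Sum>j=1..n. c j * W n j \<omega>) \<le> y} - limit_cdf y\<bar> < e"
    using cdf_uniform_limit[OF V_pos \<open>e > 0\<close>, of C y] unfolding limit_cdf_def by blast
  \<comment> \<open>Coefficients carry the factor \<open>1 / (2 * \<mu> * sqrt n)\<close>. An error
    \<open>2 * a * n\<close> in the sum of the squares thus becomes \<open>\<eta>\<close>, and
    \<open>d\<close> becomes a bound \<open>\<eta>\<close> for single coefficients once
    \<open>s n\<close> is replaced by its lower bound \<open>s0\<close>.\<close>
  define a where "a = 2 * \<mu>\<^sup>2 * \<eta>"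
  define d where "d = 2 * \<mu> * s0 * \<eta>"
  have ad: "a > 0" "d > 0"
    using \<mu>_pos s0 \<eta> by (simp_all add: a_def d_def)
  define E1 where "E1 = (\<lambda>n. {\<omega> \<in> space M. \<bar>score n 0 \<omega>\<bar> \<ge> C * (2 * \<mu> * sqrt n)})"
  define E2 where "E2 = (\<lambda>n. {\<omega> \<in> space M. \<bar>(\<Sum>t=2..n. (X (int t - 1) \<omega>)\<^sup>2) - (real n - 1) * v\<bar> \<ge> a * n})"
  define E3 where "E3 = (\<lambda>n. \<Union>t\<in>{1..int n}. {\<omega> \<in> space M. s n / sqrt n * \<bar>X t \<omega>\<bar> > d})"
  have meas [measurable]: "E1 n \<in> sets M" "E2 n \<in> sets M" "E3 n \<in> sets M" for n
    unfolding E1_def E2_def E3_def by measurable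
  have inv_sqrt: "(\<lambda>n. 1 / sqrt (real n)) \<longlonglongrightarrow> 0"
    using tendsto_real_sqrt[OF inverse_real_tendsto] by (simp add: real_sqrt_divide)
  have lim2: "\<forall>\<^sub>F n in sequentially. C2 / a * (1 / sqrt (real n)) < r'"
    using tendsto_mult_right_zero[OF inv_sqrt] r' by (rule order_tendstoD(2))
  have lim2': "\<forall>\<^sub>F n in sequentially. v * (1 / real n) < a"
    using tendsto_mult_right_zero[OF inverse_real_tendsto] ad(1) by (rule order_tendstoD(2))
  have "(\<lambda>n. prob {\<omega> \<in> space M. \<bar>s n / sqrt (real n) * (MAX t\<in>{1..int n}. \<bar>X t \<omega>\<bar>) - 0\<bar> > d}) \<longlonglongrightarrow> 0"
    using max_X ad(2) unfolding conv_in_prob_def by blast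
  then have lim3: "\<forall>\<^sub>F n in sequentially. prob {\<omega> \<in> space M. \<bar>s n / sqrt (real n) * (MAX t\<in>{1..int n}. \<bar>X t \<omega>\<bar>) - 0\<bar> > d} < r'"
    using r' by (rule order_tendstoD(2))
  show "\<forall>\<^sub>F n in sequentially. dist (prob {\<omega> \<in> space M. \<bar>cond_cdf n y (obs n \<omega>) - limit_cdf y\<bar> > e}) 0 < r"
    using eventually_linear_bound eventually_ge_at_top[of "max 2 N"] lim2 lim2' lim3
  proof eventually_elim
    case (elim n)
    have n: "2 \<le> n" "N \<le> n" "1 \<le> n"
      using elim(2) by auto
    have N: "sqrt (real n) > 0" "real n > 0"
      using n by simp_all
    have s: "s0 \<le> s n" "s n > 0"
      using s0(1) s0(2)[OF n(3)] by simp_all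
    have P1: "prob (E1 n) \<le> r'"
    proof -
      have "prob (E1 n) \<le> expectation (\<lambda>\<omega>. \<bar>score n 0 \<omega>\<bar>) / (C * (2 * \<mu> * sqrt n))"
        unfolding E1_def using C \<mu>_pos N by (intro prob_abs_ge_le K1(2)[OF elim(1)]) auto
      also have "\<dots> \<le> sqrt n * K1 / (C * (2 * \<mu> * sqrt n))"
        using K1(3)[OF elim(1), of 0] C \<mu>_pos N by (intro divide_right_mono) auto
      also have "\<dots> = K1 / (2 * \<mu> * C)"
        using N by simp
      finally show ?thesis
        using C by simp
    qed
    have P2: "prob (E2 n) \<le> r'"
    proof -
      have "prob (E2 n) \<le> expectation (\<lambda>\<omega>. \<bar>(\<Sum>t=2..n. (X (int t - 1) \<omega>)\<^sup>2) - (real n - 1) * v\<bar>) / (a * n)"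
        unfolding E2_def using ad N X_moments(1)
        by (intro prob_abs_ge_le Bochner_Integration.integrable_diff Bochner_Integration.integrable_sum) auto
      also have "\<dots> \<le> C2 * sqrt n / (a * n)"
        using C2(2)[OF n(3)] ad N unfolding v_def by (intro divide_right_mono) auto
      also have "\<dots> = C2 / a * (1 / sqrt n)"
      proof -
        have "sqrt n / n = 1 / sqrt n"
          using sqrt_divide_self_eq[of "real n"] by (simp add: inverse_eq_divide)
        moreover have "C2 * sqrt n / (a * n) = C2 / a * (sqrt n / n)"
          by simp
        ultimately show ?thesis
          by simp
      qed
      finally show ?thesis
        using elim(3) by simp
    qed
    have P3: "prob (E3 n) \<le> r'"
    proof -
      have "E3 n = {\<omega> \<in> space M. \<bar>s n / sqrt (real n) * (MAX t\<in>{1..int n}. \<bar>X t \<omega>\<bar>) - 0\<bar> > d}"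
      proof -
        have "(\<exists>t\<in>{1..int n}. s n / sqrt n * \<bar>X t \<omega>\<bar> > d) \<longleftrightarrow> \<bar>s n / sqrt (real n) * (MAX t\<in>{1..int n}. \<bar>X t \<omega>\<bar>) - 0\<bar> > d" for \<omega>
        proof -
          define m where "m = (MAX t\<in>{1..int n}. \<bar>X t \<omega>\<bar>)"
          have ge: "\<bar>X t \<omega>\<bar> \<le> m" if "t \<in> {1..int n}" for t
            unfolding m_def using that by (intro Max_ge) auto
          have "m \<in> (\<lambda>t. \<bar>X t \<omega>\<bar>) ` {1..int n}"
            unfolding m_def using n by (intro Max_in) auto
          then obtain t where t: "t \<in> {1..int n}" "m = \<bar>X t \<omega>\<bar>"
            by blast
          have eq: "\<bar>s n / sqrt n * m - 0\<bar> = s n / sqrt n * m"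
            using t s N by simp
          have le: "s n / sqrt n * \<bar>X t \<omega>\<bar> \<le> s n / sqrt n * m" if "t \<in> {1..int n}" for t
            using ge[OF that] s N by (intro mult_left_mono) auto
          show ?thesis
            unfolding m_def[symmetric] eq
          proof
            assume "\<exists>t\<in>{1..int n}. s n / sqrt n * \<bar>X t \<omega>\<bar> > d"
            then show "s n / sqrt n * m > d"
              using le by (blast intro: less_le_trans)
          next
            assume "s n / sqrt n * m > d"
            then show "\<exists>t\<in>{1..int n}. s n / sqrt n * \<bar>X t \<omega>\<bar> > d"
              using t by (intro bexI[of _ t]) simp_all
          qed
        qed
        then show ?thesis
          unfolding E3_def by blast
      qed
      then show ?thesis
        using elim(5) by simp
    qed
    have "AE \<omega> in M. \<omega> \<in> {\<omega> \<in> space M. \<bar>cond_cdf n y (obs n \<omega>) - limit_cdf y\<bar> > e} \<longrightarrow> \<omega> \<in> E1 n \<union> E2 n \<union> E3 n"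
    proof -
      have "AE \<omega> in M. \<forall>t. innov (int t) \<omega> \<noteq> 0"
        using innov_neq by (simp add: AE_all_countable)
      then show ?thesis
      proof eventually_elim
        case (elim \<omega>)
        show ?case
        proof (rule impI, rule ccontr)
          assume \<omega>: "\<omega> \<in> {\<omega> \<in> space M. \<bar>cond_cdf n y (obs n \<omega>) - limit_cdf y\<bar> > e}"
            and not: "\<omega> \<notin> E1 n \<union> E2 n \<union> E3 n"
          define k where "k = 2 * \<mu> * sqrt n"
          have k: "k > 0"
            using \<mu>_pos N by (simp add: k_def)
          define c where "c = coef n (obs n \<omega>)"
          have c: "c j = (if j = 1 then 0 else X (int j - 1) \<omega> * sgn (innov (int j) \<omega>) / k)" if "j \<in> {1..n}" for j
            unfolding c_def k_def by (rule coef_obs[OF that])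
          have c_max: "\<forall>j\<in>{1..n}. \<bar>c j\<bar> \<le> \<eta>"
          proof
            fix j
            assume j: "j \<in> {1..n}"
            show "\<bar>c j\<bar> \<le> \<eta>"
            proof (cases "j = 1")
              case False
              then have "int j - 1 \<in> {1..int n}"
                using j by auto
              then have "\<omega> \<notin> {\<omega> \<in> space M. s n / sqrt n * \<bar>X (int j - 1) \<omega>\<bar> > d}"
                using not unfolding E3_def by blast
              then have "s n / sqrt n * \<bar>X (int j - 1) \<omega>\<bar> \<le> d"
                using \<omega> by simp
              then have "s n * \<bar>X (int j - 1) \<omega>\<bar> \<le> d * sqrt n"
                using N by (simp add: divide_le_eq)
              moreover have "s0 * \<bar>X (int j - 1) \<omega>\<bar> \<le> s n * \<bar>X (int j - 1) \<omega>\<bar>"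
                using s by (intro mult_right_mono) auto
              ultimately have "s0 * \<bar>X (int j - 1) \<omega>\<bar> \<le> s0 * (\<eta> * k)"
                by (simp add: d_def k_def mult_ac)
              then have X_le: "\<bar>X (int j - 1) \<omega>\<bar> \<le> \<eta> * k"
                using s0(1) by simp
              have "\<bar>c j\<bar> = \<bar>X (int j - 1) \<omega>\<bar> * \<bar>sgn (innov (int j) \<omega>)\<bar> / k"
                using c[OF j] False k by (simp add: abs_mult)
              also have "\<dots> = \<bar>X (int j - 1) \<omega>\<bar> / k"
                using elim by (simp add: abs_sgn_eq)
              also have "\<dots> \<le> \<eta>"
                using X_le k by (simp add: divide_le_eq)
              finally show ?thesis .
            qed (use c[OF j] \<eta> in simp)
          qed
          have c_sum: "(\<Sum>j=1..n. c j) = score n 0 \<omega> / k"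
          proof -
            have "(\<Sum>j=1..n. c j) = (\<Sum>j=1..n. (if j = 1 then 0 else X (int j - 1) \<omega> * sgn (innov (int j) \<omega>) / k) * 1)"
              using c by (intro sum.cong) auto
            also have "\<dots> = (\<Sum>t=2..n. 1 * (X (int t - 1) \<omega> * sgn (innov (int t) \<omega>) / k))"
              by (rule sum_from_2[OF n(1)])
            finally show ?thesis
              by (simp add: score_def sum_divide_distrib)
          qed
          have "\<bar>score n 0 \<omega>\<bar> \<le> C * k"
            using not \<omega> by (auto simp: E1_def k_def)
          then have c_sum_le: "\<bar>\<Sum>j=1..n. c j\<bar> \<le> C"
            unfolding c_sum using k by (simp add: divide_le_eq)
          define Q where "Q = (\<Sum>t=2..n. (X (int t - 1) \<omega>)\<^sup>2)"
          have c_sq: "(\<Sum>j=1..n. (c j)\<^sup>2) = Q / k\<^sup>2"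
          proof -
            have sgn_sq: "(sgn (innov (int t) \<omega>))\<^sup>2 = 1" for t
              using elim by (simp add: sgn_if)
            have "(\<Sum>j=1..n. (c j)\<^sup>2) = (\<Sum>j=1..n. (if j = 1 then 0 else (X (int j - 1) \<omega>)\<^sup>2 / k\<^sup>2) * 1)"
              using c sgn_sq by (intro sum.cong) (auto simp: power_divide power_mult_distrib)
            also have "\<dots> = (\<Sum>t=2..n. 1 * ((X (int t - 1) \<omega>)\<^sup>2 / k\<^sup>2))"
              by (rule sum_from_2[OF n(1)])
            finally show ?thesis
              by (simp add: Q_def sum_divide_distrib)
          qed
          have k_sq: "k\<^sup>2 = 4 * \<mu>\<^sup>2 * n"
            by (simp add: k_def power_mult_distrib)
          have "\<bar>Q - (real n - 1) * v\<bar> \<le> a * n"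
            using not \<omega> by (auto simp: E2_def Q_def)
          moreover have "0 \<le> v"
            by (simp add: v_def)
          moreover have "v \<le> a * n"
            using \<open>v * (1 / real n) < a\<close> N by (simp add: divide_less_eq)
          \<comment> \<open>One \<open>a * n\<close> comes from the law of large numbers, the other
            from centring at \<open>n * v\<close> in place of \<open>(n - 1) * v\<close>.\<close>
          ultimately have "\<bar>Q - n * v\<bar> \<le> 2 * (a * n)"
            by (simp add: abs_le_iff algebra_simps)
          then have "\<bar>Q - n * v\<bar> / k\<^sup>2 \<le> \<eta>"
            using N \<mu>_pos by (simp add: k_sq a_def divide_le_eq mult_ac)
          moreover have "Q / k\<^sup>2 - V = (Q - n * v) / k\<^sup>2"
            using N \<mu>_pos by (simp add: V_eq v_def[symmetric] k_sq diff_divide_distrib)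
          ultimately have c_sq_near: "\<bar>(\<Sum>j=1..n. (c j)\<^sup>2) - V\<bar> \<le> \<eta>"
            unfolding c_sq by (simp add: abs_divide)
          have "\<bar>cond_cdf n y (obs n \<omega>) - limit_cdf y\<bar> < e"
            using unif[OF n(2) c_max c_sq_near c_sum_le] by (simp add: cond_cdf_def c_def)
          then show False
            using \<omega> by simp
        qed
      qed
    qed
    then have "prob {\<omega> \<in> space M. \<bar>cond_cdf n y (obs n \<omega>) - limit_cdf y\<bar> > e} \<le> prob (E1 n \<union> E2 n \<union> E3 n)"
      by (rule finite_measure_mono_AE) measurable
    also have "\<dots> \<le> prob (E1 n \<union> E2 n) + prob (E3 n)"
      by (rule measure_Un_le) measurable
    also have "\<dots> \<le> prob (E1 n) + prob (E2 n) + prob (E3 n)"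
      by (intro add_right_mono measure_Un_le) measurable
    also have "\<dots> \<le> 3 * r'"
      using P1 P2 P3 by linarith
    also have "\<dots> < r"
      using \<open>r > 0\<close> by (simp add: r'_def)
    finally show ?case
      by simp
  qed
qed

end

lemma abs_greater_sets:
  fixes g :: "'a \<Rightarrow> real"
  assumes [measurable]: "g \<in> borel_measurable M"
  shows "{\<omega> \<in> space M. \<bar>g \<omega>\<bar> > c} \<in> sets M"
  by measurable

section \<open>From the linear statistic to the bootstrap statistic\<close>

context bootstrap_scale
begin

text \<open>A conditional Slutsky argument: off the event \<open>A n\<close> that the statistics
  differ by more than \<open>\<delta>\<close>, \<open>T n \<le> x\<close> lies between
  \<open>lin_stat n \<le> x - \<delta>\<close> and \<open>lin_stat n \<le> x + \<delta>\<close>.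
  Continuity of the limit absorbs the shift. The conditional probability of \<open>A n\<close> is
  small in probability because its mean is \<open>prob (A n)\<close>.\<close>

lemma cond_law_limit:
  fixes T :: "nat \<Rightarrow> 'a \<Rightarrow> real" and \<kappa> :: "nat \<Rightarrow> 'a \<Rightarrow> real measure"
  assumes max_X: "conv_in_prob M (\<lambda>n \<omega>. s n / sqrt (real n) * (MAX t\<in>{1..int n}. \<bar>X t \<omega>\<bar>)) 0"
    and T_measurable [measurable]: "\<And>n. T n \<in> borel_measurable M"
    and T: "conv_in_prob M (\<lambda>n \<omega>. T n \<omega> - lin_stat n \<omega>) 0"
    and \<kappa>: "\<And>n. regular_cond_distr M (obs_algebra M X n) (T n) (\<kappa> n)"
  shows "conv_in_prob M (\<lambda>n \<omega>. measure (\<kappa> n \<omega>) {..x}) (limit_cdf x)"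
  unfolding conv_in_prob_def
proof (intro allI impI)
  fix e :: real
  assume "e > 0"
  then have e3: "e / 3 > 0"
    by simp
  have "(limit_cdf \<longlongrightarrow> limit_cdf x) (at x)"
    using limit_cdf_isCont by (simp add: isCont_def)
  then have "\<forall>\<^sub>F y in at x. dist (limit_cdf y) (limit_cdf x) < e / 3"
    using e3 by (rule tendstoD)
  then obtain d where d: "d > 0" "\<And>y. y \<noteq> x \<Longrightarrow> dist y x < d \<Longrightarrow> dist (limit_cdf y) (limit_cdf x) < e / 3"
    unfolding eventually_at by auto
  define \<delta> where "\<delta> = d / 2"
  have \<delta>: "\<delta> > 0" "\<bar>limit_cdf (x + \<delta>) - limit_cdf x\<bar> < e / 3" "\<bar>limit_cdf (x - \<delta>) - limit_cdf x\<bar> < e / 3"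
    using d(1) d(2)[of "x + \<delta>"] d(2)[of "x - \<delta>"] by (auto simp: \<delta>_def dist_real_def)
  define A where "A = (\<lambda>n. {\<omega> \<in> space M. \<bar>T n \<omega> - lin_stat n \<omega> - 0\<bar> > \<delta>})"
  have A_sets [measurable]: "A n \<in> sets M" for n
    unfolding A_def by (intro abs_greater_sets borel_measurable_diff T_measurable lin_stat_measurable) simp
  define B where "B = (\<lambda>n. real_cond_exp M (obs_algebra M X n) (indicat_real (A n)))"
  define P where "P = (\<lambda>n y. prob {\<omega> \<in> space M. \<bar>cond_cdf n y (obs n \<omega>) - limit_cdf y\<bar> > e / 3})"
  have P_lim: "(\<lambda>n. P n y) \<longlonglongrightarrow> 0" for y
    using cond_cdf_limit[OF max_X, of y] e3 unfolding conv_in_prob_def P_def by blast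
  have A_lim: "(\<lambda>n. prob (A n)) \<longlonglongrightarrow> 0"
    using T \<delta>(1) unfolding conv_in_prob_def A_def by blast
  have le: "prob {\<omega> \<in> space M. \<bar>measure (\<kappa> n \<omega>) {..x} - limit_cdf x\<bar> > e} \<le>
      P n (x + \<delta>) + P n (x - \<delta>) + prob (A n) / (e / 3)" for n
  proof -
    interpret finite_measure_subalgebra M "obs_algebra M X n"
      by unfold_locales (rule obs_subalgebra)
    define L where "L = (\<lambda>y. {\<omega> \<in> space M. lin_stat n \<omega> \<le> y})"
    have L_sets [measurable]: "L y \<in> sets M" for y
      unfolding L_def by measurable
    define S where "S = {\<omega> \<in> space M. T n \<omega> \<le> x}"
    have S_sets [measurable]: "S \<in> sets M"
      unfolding S_def by measurable
    have int: "integrable M (indicat_real D)" if "D \<in> sets M" for D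
      using that by (intro integrable_real_indicator) (auto simp: emeasure_eq_measure)
    have S_eq: "T n -` {..x} \<inter> space M = S"
      by (auto simp: S_def)
    have \<kappa>_eq: "AE \<omega> in M. measure (\<kappa> n \<omega>) {..x} = real_cond_exp M (obs_algebra M X n) (indicator S) \<omega>"
      using \<kappa>[of n] unfolding regular_cond_distr_def S_eq[symmetric] by auto
    have H: "AE \<omega> in M. real_cond_exp M (obs_algebra M X n) (indicator (L y)) \<omega> = cond_cdf n y (obs n \<omega>)" for y
      unfolding L_def by (rule cond_exp_lin_stat)
    have upper: "AE \<omega> in M. real_cond_exp M (obs_algebra M X n) (indicator S) \<omega> \<le>
        real_cond_exp M (obs_algebra M X n) (\<lambda>\<omega>. indicator (L (x + \<delta>)) \<omega> + indicator (A n) \<omega>) \<omega>"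
      by (intro real_cond_exp_mono AE_I2 Bochner_Integration.integrable_add int S_sets L_sets A_sets)
        (auto simp: S_def L_def A_def indicator_def)
    have upper': "AE \<omega> in M. real_cond_exp M (obs_algebra M X n) (\<lambda>\<omega>. indicator (L (x + \<delta>)) \<omega> + indicator (A n) \<omega>) \<omega> =
        real_cond_exp M (obs_algebra M X n) (indicator (L (x + \<delta>))) \<omega> + B n \<omega>"
      unfolding B_def by (intro real_cond_exp_add int L_sets A_sets)
    have lower: "AE \<omega> in M. real_cond_exp M (obs_algebra M X n) (indicator (L (x - \<delta>))) \<omega> \<le>
        real_cond_exp M (obs_algebra M X n) (\<lambda>\<omega>. indicator S \<omega> + indicator (A n) \<omega>) \<omega>"
      by (intro real_cond_exp_mono AE_I2 Bochner_Integration.integrable_add int S_sets L_sets A_sets)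
        (auto simp: S_def L_def A_def indicator_def)
    have lower': "AE \<omega> in M. real_cond_exp M (obs_algebra M X n) (\<lambda>\<omega>. indicator S \<omega> + indicator (A n) \<omega>) \<omega> =
        real_cond_exp M (obs_algebra M X n) (indicator S) \<omega> + B n \<omega>"
      unfolding B_def by (intro real_cond_exp_add int S_sets A_sets)
    have B_int: "integrable M (B n)" "expectation (B n) = prob (A n)"
      unfolding B_def using real_cond_exp_int[OF int[OF A_sets[of n]]] by simp_all
    have B_nonneg: "AE \<omega> in M. 0 \<le> B n \<omega>"
      unfolding B_def by (rule real_cond_exp_pos) auto
    have B_meas [measurable]: "B n \<in> borel_measurable M"
      using B_int(1) by auto
    define E where "E = (\<lambda>y. {\<omega> \<in> space M. \<bar>cond_cdf n y (obs n \<omega>) - limit_cdf y\<bar> > e / 3})"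
    define EB where "EB = {\<omega> \<in> space M. \<bar>B n \<omega>\<bar> \<ge> e / 3}"
    have E_sets [measurable]: "E y \<in> sets M" "EB \<in> sets M" for y
      unfolding E_def EB_def by measurable
    have "AE \<omega> in M. \<omega> \<in> {\<omega> \<in> space M. \<bar>measure (\<kappa> n \<omega>) {..x} - limit_cdf x\<bar> > e} \<longrightarrow> \<omega> \<in> E (x + \<delta>) \<union> E (x - \<delta>) \<union> EB"
      using \<kappa>_eq H[of "x + \<delta>"] H[of "x - \<delta>"] upper upper' lower lower'
    proof eventually_elim
      case (elim \<omega>)
      show ?case
      proof (rule impI, rule ccontr)
        assume \<omega>: "\<omega> \<in> {\<omega> \<in> space M. \<bar>measure (\<kappa> n \<omega>) {..x} - limit_cdf x\<bar> > e}"
          and not: "\<omega> \<notin> E (x + \<delta>) \<union> E (x - \<delta>) \<union> EB"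
        have close: "\<bar>cond_cdf n (x + \<delta>) (obs n \<omega>) - limit_cdf (x + \<delta>)\<bar> \<le> e / 3"
          "\<bar>cond_cdf n (x - \<delta>) (obs n \<omega>) - limit_cdf (x - \<delta>)\<bar> \<le> e / 3" "\<bar>B n \<omega>\<bar> < e / 3"
          using not \<omega> by (auto simp: E_def EB_def)
        have "measure (\<kappa> n \<omega>) {..x} \<le> cond_cdf n (x + \<delta>) (obs n \<omega>) + B n \<omega>"
          using elim by simp
        moreover have "cond_cdf n (x - \<delta>) (obs n \<omega>) \<le> measure (\<kappa> n \<omega>) {..x} + B n \<omega>"
          using elim by simp
        ultimately have "\<bar>measure (\<kappa> n \<omega>) {..x} - limit_cdf x\<bar> \<le> e"
          using close \<delta>(2,3) by argo
        then show False
          using \<omega> by simp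
      qed
    qed
    then have "prob {\<omega> \<in> space M. \<bar>measure (\<kappa> n \<omega>) {..x} - limit_cdf x\<bar> > e} \<le> prob (E (x + \<delta>) \<union> E (x - \<delta>) \<union> EB)"
      by (rule finite_measure_mono_AE) measurable
    also have "\<dots> \<le> prob (E (x + \<delta>) \<union> E (x - \<delta>)) + prob EB"
      by (rule measure_Un_le) measurable
    also have "\<dots> \<le> prob (E (x + \<delta>)) + prob (E (x - \<delta>)) + prob EB"
      by (intro add_right_mono measure_Un_le) measurable
    \<comment> \<open>Markov's inequality for the conditional probability of \<open>A n\<close>; its
      almost sure nonnegativity turns the absolute mean into the mean.\<close>
    also have "prob EB \<le> prob (A n) / (e / 3)"
    proof -
      have "prob EB \<le> expectation (\<lambda>\<omega>. \<bar>B n \<omega>\<bar>) / (e / 3)"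
        unfolding EB_def using B_int(1) e3 by (rule prob_abs_ge_le)
      also have "expectation (\<lambda>\<omega>. \<bar>B n \<omega>\<bar>) = expectation (B n)"
        using B_nonneg by (intro integral_cong_AE) auto
      finally show ?thesis
        using B_int(2) by simp
    qed
    finally show ?thesis
      by (simp add: P_def E_def)
  qed
  show "(\<lambda>n. prob {\<omega> \<in> space M. \<bar>measure (\<kappa> n \<omega>) {..x} - limit_cdf x\<bar> > e}) \<longlonglongrightarrow> 0"
  proof (rule Lim_null_comparison)
    show "\<forall>\<^sub>F n in sequentially. norm (prob {\<omega> \<in> space M. \<bar>measure (\<kappa> n \<omega>) {..x} - limit_cdf x\<bar> > e}) \<le>
        P n (x + \<delta>) + P n (x - \<delta>) + prob (A n) / (e / 3)"
      using le by (intro always_eventually allI) simp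
    have "(\<lambda>n. P n (x + \<delta>) + P n (x - \<delta>) + prob (A n) / (e / 3)) \<longlonglongrightarrow> 0 + 0 + 0 / (e / 3)"
      using e3 by (intro tendsto_intros P_lim A_lim) simp
    then show "(\<lambda>n. P n (x + \<delta>) + P n (x - \<delta>) + prob (A n) / (e / 3)) \<longlonglongrightarrow> 0"
      by simp
  qed
qed

text \<open>The kernel takes values in probability measures at every sample point, so its
  distribution functions are monotone there without exceptional sets. The deterministic finite grid
  then reduces the supremum to finitely many pointwise limits.\<close>

lemma cond_law_uniform_limit:
  fixes T :: "nat \<Rightarrow> 'a \<Rightarrow> real" and \<kappa> :: "nat \<Rightarrow> 'a \<Rightarrow> real measure"
  assumes max_X: "conv_in_prob M (\<lambda>n \<omega>. s n / sqrt (real n) * (MAX t\<in>{1..int n}. \<bar>X t \<omega>\<bar>)) 0"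
    and T_measurable: "\<And>n. T n \<in> borel_measurable M"
    and T: "conv_in_prob M (\<lambda>n \<omega>. T n \<omega> - lin_stat n \<omega>) 0"
    and \<kappa>: "\<And>n. regular_cond_distr M (obs_algebra M X n) (T n) (\<kappa> n)"
  shows "conv_in_prob M (\<lambda>n \<omega>. SUP x. \<bar>measure (\<kappa> n \<omega>) {..x} - limit_cdf x\<bar>) 0"
  unfolding conv_in_prob_def
proof (intro allI impI)
  fix e :: real
  assume "e > 0"
  define \<nu> where "\<nu> = density lborel (normal_density 0 (sqrt V))"
  have "prob_space \<nu>"
    unfolding \<nu>_def using V_pos by (intro prob_space_normal_density) simp
  then interpret \<nu>: real_distribution \<nu>
    unfolding real_distribution_def real_distribution_axioms_def by (simp add: \<nu>_def)
  have limit_\<nu>: "limit_cdf = cdf \<nu>"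
    by (simp add: limit_cdf_def \<nu>_def)
  have e3: "e / 3 > 0"
    using \<open>e > 0\<close> by simp
  obtain S where S: "finite S" "\<And>F x. mono F \<Longrightarrow> (\<And>x. 0 \<le> F x) \<Longrightarrow> (\<And>x. F x \<le> 1) \<Longrightarrow>
    (\<And>x. x \<in> S \<Longrightarrow> \<bar>F x - cdf \<nu> x\<bar> \<le> e / 3) \<Longrightarrow> \<bar>F x - cdf \<nu> x\<bar> \<le> 3 * (e / 3)"
  proof (rule \<nu>.cdf_uniform_grid)
    show "isCont (cdf \<nu>) x" for x
      using limit_cdf_isCont[unfolded limit_\<nu>] .
    show "e / 3 > 0"
      by (rule e3)
    fix S
    assume *: "finite S" "\<And>F x. mono F \<Longrightarrow> (\<And>x. 0 \<le> F x) \<Longrightarrow> (\<And>x. F x \<le> 1) \<Longrightarrow>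
      (\<And>x. x \<in> S \<Longrightarrow> \<bar>F x - cdf \<nu> x\<bar> \<le> e / 3) \<Longrightarrow> \<bar>F x - cdf \<nu> x\<bar> \<le> 3 * (e / 3)"
    show thesis
      by (rule that[OF *(1)]) (rule *(2))
  qed
  define E where "E = (\<lambda>n x. {\<omega> \<in> space M. \<bar>measure (\<kappa> n \<omega>) {..x} - limit_cdf x\<bar> > e / 3})"
  have \<kappa>_prob: "\<kappa> n \<in> M \<rightarrow>\<^sub>M prob_algebra borel" for n
    using \<kappa>[of n] measurable_from_subalg[OF obs_subalgebra] unfolding regular_cond_distr_def by blast
  have [measurable]: "(\<lambda>\<omega>. measure (\<kappa> n \<omega>) {..x}) \<in> borel_measurable M" for n x
    by (rule measurable_compose[OF measurable_prob_algebraD[OF \<kappa>_prob] measurable_measure_subprob_algebra]) simp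
  have E_sets [measurable]: "E n x \<in> sets M" for n x
    unfolding E_def by measurable
  have E_lim: "(\<lambda>n. \<Sum>x\<in>S. prob (E n x)) \<longlonglongrightarrow> 0"
    using cond_law_limit[OF assms] e3 unfolding conv_in_prob_def E_def by (intro tendsto_null_sum) blast
  have le: "prob {\<omega> \<in> space M. \<bar>(SUP x. \<bar>measure (\<kappa> n \<omega>) {..x} - limit_cdf x\<bar>) - 0\<bar> > e} \<le> (\<Sum>x\<in>S. prob (E n x))" for n
  proof -
    have "{\<omega> \<in> space M. \<bar>(SUP x. \<bar>measure (\<kappa> n \<omega>) {..x} - limit_cdf x\<bar>) - 0\<bar> > e} \<subseteq> (\<Union>x\<in>S. E n x)"
    proof (rule subsetI, rule ccontr)
      fix \<omega>
      assume \<omega>: "\<omega> \<in> {\<omega> \<in> space M. \<bar>(SUP x. \<bar>measure (\<kappa> n \<omega>) {..x} - limit_cdf x\<bar>) - 0\<bar> > e}"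
        and not: "\<omega> \<notin> (\<Union>x\<in>S. E n x)"
      have "\<kappa> n \<omega> \<in> space (prob_algebra borel)"
        using \<omega> by (intro measurable_space[OF \<kappa>_prob]) simp
      then have \<kappa>_\<omega>: "prob_space (\<kappa> n \<omega>)" "sets (\<kappa> n \<omega>) = sets borel"
        by (simp_all add: space_prob_algebra)
      interpret \<kappa>: prob_space "\<kappa> n \<omega>"
        by (rule \<kappa>_\<omega>(1))
      have mono: "mono (\<lambda>x. measure (\<kappa> n \<omega>) {..x})"
        by (intro monoI \<kappa>.finite_measure_mono) (auto simp: \<kappa>_\<omega>(2))
      have grid: "\<bar>measure (\<kappa> n \<omega>) {..x} - cdf \<nu> x\<bar> \<le> e / 3" if "x \<in> S" for x
        using not \<omega> that unfolding E_def limit_\<nu> by (auto simp: not_less)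
      have bound: "\<bar>measure (\<kappa> n \<omega>) {..x} - limit_cdf x\<bar> \<le> e" for x
        using S(2)[OF mono _ _ grid, of x] by (simp add: limit_\<nu>)
      have "(SUP x. \<bar>measure (\<kappa> n \<omega>) {..x} - limit_cdf x\<bar>) \<le> e"
        using bound by (intro cSUP_least) auto
      \<comment> \<open>A real supremum carries information only for a bounded family; the uniform
        bound on the good event supplies this.\<close>
      moreover have "0 \<le> (SUP x. \<bar>measure (\<kappa> n \<omega>) {..x} - limit_cdf x\<bar>)"
      proof (rule cSUP_upper2)
        show "bdd_above (range (\<lambda>x. \<bar>measure (\<kappa> n \<omega>) {..x} - limit_cdf x\<bar>))"
          using bound by (rule bdd_aboveI2)
        show "0 \<le> \<bar>measure (\<kappa> n \<omega>) {..0} - limit_cdf 0\<bar>"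
          by simp
      qed simp
      ultimately show False
        using \<omega> by simp
    qed
    then have "prob {\<omega> \<in> space M. \<bar>(SUP x. \<bar>measure (\<kappa> n \<omega>) {..x} - limit_cdf x\<bar>) - 0\<bar> > e} \<le> prob (\<Union>x\<in>S. E n x)"
      using S(1) by (intro finite_measure_mono) auto
    also have "\<dots> \<le> (\<Sum>x\<in>S. prob (E n x))"
      using S(1) by (intro finite_measure_subadditive_finite) auto
    finally show ?thesis .
  qed
  show "(\<lambda>n. prob {\<omega> \<in> space M. \<bar>(SUP x. \<bar>measure (\<kappa> n \<omega>) {..x} - limit_cdf x\<bar>) - 0\<bar> > e}) \<longlonglongrightarrow> 0"
    by (rule Lim_null_comparison[OF _ E_lim]) (use le in \<open>auto intro!: always_eventually\<close>)
qed

end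

section \<open>The weight array\<close>

text \<open>Scheffe's argument: \<open>\<bar>V - 1\<bar>\<close> equals \<open>V - 1\<close> plus
  twice the negative part of \<open>V - 1\<close>. The first has mean 0, and the second is bounded
  by 2 because \<open>V \<ge> 0\<close>, so convergence in probability suffices for it.\<close>

lemma (in prob_space) conv_in_prob_imp_L1:
  fixes V :: "nat \<Rightarrow> 'a \<Rightarrow> real"
  assumes nonneg: "\<And>n \<omega>. 0 \<le> V n \<omega>" and int: "\<And>n. 1 \<le> n \<Longrightarrow> integrable M (V n)"
    and mean: "\<And>n. 1 \<le> n \<Longrightarrow> expectation (V n) = 1" and conv: "conv_in_prob M V 1"
  shows "(\<lambda>n. expectation (\<lambda>\<omega>. \<bar>V n \<omega> - 1\<bar>)) \<longlonglongrightarrow> 0"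
proof (rule tendstoI)
  fix e :: real
  assume "e > 0"
  then have "e / 4 > 0"
    by simp
  then have "(\<lambda>n. prob {\<omega> \<in> space M. \<bar>V n \<omega> - 1\<bar> > e / 4}) \<longlonglongrightarrow> 0"
    using conv unfolding conv_in_prob_def by blast
  then have "\<forall>\<^sub>F n in sequentially. prob {\<omega> \<in> space M. \<bar>V n \<omega> - 1\<bar> > e / 4} < e / 4"
    using \<open>e / 4 > 0\<close> by (rule order_tendstoD(2))
  with eventually_ge_at_top[of 1] show "\<forall>\<^sub>F n in sequentially. dist (expectation (\<lambda>\<omega>. \<bar>V n \<omega> - 1\<bar>)) 0 < e"
  proof eventually_elim
    case (elim n)
    define A where "A = {\<omega> \<in> space M. \<bar>V n \<omega> - 1\<bar> > e / 4}"
    have [measurable]: "V n \<in> borel_measurable M"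
      using int[OF elim(1)] by auto
    have A [measurable]: "A \<in> sets M"
      unfolding A_def by measurable
    have A_int: "integrable M (indicat_real A)"
      using A by (intro integrable_real_indicator) (auto simp: emeasure_eq_measure)
    have "expectation (\<lambda>\<omega>. \<bar>V n \<omega> - 1\<bar>) \<le> expectation (\<lambda>\<omega>. (V n \<omega> - 1) + 2 * (e / 4 + indicator A \<omega>))"
    proof (rule integral_mono)
      fix \<omega>
      assume "\<omega> \<in> space M"
      then show "\<bar>V n \<omega> - 1\<bar> \<le> (V n \<omega> - 1) + 2 * (e / 4 + indicator A \<omega>)"
        using nonneg[of n \<omega>] \<open>e > 0\<close> by (auto simp: A_def indicator_def abs_if)
    qed (use int[OF elim(1)] A_int in simp_all)
    also have "\<dots> = 2 * (e / 4 + prob A)"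
      using int[OF elim(1)] mean[OF elim(1)] A_int by (simp add: prob_space)
    also have "\<dots> < e"
      using elim(2) \<open>e > 0\<close> by (simp add: A_def)
    finally show ?case
      by (simp add: integral_nonneg_AE)
  qed
qed

lemma (in prob_space) array_indep_imp_indep_pair:
  fixes w :: "nat \<Rightarrow> nat \<Rightarrow> 'a \<Rightarrow> real" and X :: "int \<Rightarrow> 'a \<Rightarrow> real"
  assumes w_measurable: "\<And>n t. 1 \<le> t \<Longrightarrow> t \<le> n \<Longrightarrow> w n t \<in> borel_measurable M"
    and X_measurable [measurable]: "\<And>t. X t \<in> borel_measurable M"
    and indep: "array_indep_of_process M w X"
  shows "indep_pair (Pi\<^sub>M UNIV (\<lambda>_. borel)) (\<lambda>\<omega> t. X t \<omega>)
    (Pi\<^sub>M triangle (\<lambda>_. borel)) (\<lambda>\<omega>. \<lambda>(n, t)\<in>triangle. w n t \<omega>)"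
  unfolding indep_pair_def
proof (intro conjI ballI)
  show X: "(\<lambda>\<omega> t. X t \<omega>) \<in> M \<rightarrow>\<^sub>M Pi\<^sub>M UNIV (\<lambda>_. borel)"
    using measurable_restrict[of UNIV X M "\<lambda>_. borel", OF X_measurable] by (simp only: restrict_UNIV)
  show w: "(\<lambda>\<omega>. \<lambda>(n, t)\<in>triangle. w n t \<omega>) \<in> M \<rightarrow>\<^sub>M Pi\<^sub>M triangle (\<lambda>_. borel)"
    by (rule measurable_restrict) (auto simp: triangle_def intro: w_measurable)
  fix U :: "(int \<Rightarrow> real) set" and V :: "(nat \<times> nat \<Rightarrow> real) set"
  assume U: "U \<in> sets (Pi\<^sub>M UNIV (\<lambda>_. borel))" and V: "V \<in> sets (Pi\<^sub>M triangle (\<lambda>_. borel))"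
  have "{\<omega> \<in> space M. (\<lambda>(n, t)\<in>triangle. w n t \<omega>) \<in> V} \<in>
      sets (vimage_algebra (space M) (\<lambda>\<omega>. \<lambda>(n, t)\<in>triangle. w n t \<omega>) (Pi\<^sub>M triangle (\<lambda>_. borel)))"
    using in_vimage_algebra[OF V, of "\<lambda>\<omega>. \<lambda>(n, t)\<in>triangle. w n t \<omega>" "space M"]
    by (simp add: vimage_def Int_def conj_commute)
  moreover have "{\<omega> \<in> space M. (\<lambda>t. X t \<omega>) \<in> U} \<in>
      sets (vimage_algebra (space M) (\<lambda>\<omega> t. X t \<omega>) (Pi\<^sub>M UNIV (\<lambda>_. borel)))"
    using in_vimage_algebra[OF U, of "\<lambda>\<omega> t. X t \<omega>" "space M"]
    by (simp add: vimage_def Int_def conj_commute)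
  ultimately have "prob ({\<omega> \<in> space M. (\<lambda>(n, t)\<in>triangle. w n t \<omega>) \<in> V} \<inter> {\<omega> \<in> space M. (\<lambda>t. X t \<omega>) \<in> U}) =
      prob {\<omega> \<in> space M. (\<lambda>(n, t)\<in>triangle. w n t \<omega>) \<in> V} * prob {\<omega> \<in> space M. (\<lambda>t. X t \<omega>) \<in> U}"
    using indep unfolding array_indep_of_process_def by (intro indep_setD)
  moreover have "{\<omega> \<in> space M. (\<lambda>t. X t \<omega>) \<in> U \<and> (\<lambda>(n, t)\<in>triangle. w n t \<omega>) \<in> V} =
      {\<omega> \<in> space M. (\<lambda>(n, t)\<in>triangle. w n t \<omega>) \<in> V} \<inter> {\<omega> \<in> space M. (\<lambda>t. X t \<omega>) \<in> U}"
    by blast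
  ultimately show "prob {\<omega> \<in> space M. (\<lambda>t. X t \<omega>) \<in> U \<and> (\<lambda>(n, t)\<in>triangle. w n t \<omega>) \<in> V} =
      prob {\<omega> \<in> space M. (\<lambda>t. X t \<omega>) \<in> U} * prob {\<omega> \<in> space M. (\<lambda>(n, t)\<in>triangle. w n t \<omega>) \<in> V}"
    by (simp add: mult.commute)
qed

text \<open>Standardization acts in the same way on every coordinate and so commutes with
  permutations of the row.\<close>

lemma (in prob_space) exchangeable_row_affine:
  assumes exch: "row_exchangeable M w" and n: "2 \<le> n"
    and w_measurable: "\<And>t. t \<in> {1..n} \<Longrightarrow> w n t \<in> borel_measurable M"
  shows "exchangeable_row M n (\<lambda>t \<omega>. (w n t \<omega> - a) / b)"
proof
  show "2 \<le> n"
    by (rule n)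
  show "(\<lambda>\<omega>. (w n j \<omega> - a) / b) \<in> borel_measurable M" if "j \<in> {1..n}" for j
    using w_measurable[OF that] by measurable
  fix p
  assume p: "p permutes {1..n}"
  define g where "g = (\<lambda>x :: nat \<Rightarrow> real. \<lambda>t\<in>{1..n}. (x t - a) / b)"
  have g: "g \<in> Pi\<^sub>M {1..n} (\<lambda>_. borel) \<rightarrow>\<^sub>M Pi\<^sub>M {1..n} (\<lambda>_. borel)"
    unfolding g_def by measurable
  have distr_g: "distr M (Pi\<^sub>M {1..n} (\<lambda>_. borel)) (\<lambda>\<omega>. \<lambda>t\<in>{1..n}. (w n (q t) \<omega> - a) / b) =
      distr (distr M (Pi\<^sub>M {1..n} (\<lambda>_. borel)) (\<lambda>\<omega>. \<lambda>t\<in>{1..n}. w n (q t) \<omega>)) (Pi\<^sub>M {1..n} (\<lambda>_. borel)) g"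
    if q: "q permutes {1..n}" for q
  proof -
    have "(\<lambda>\<omega>. \<lambda>t\<in>{1..n}. w n (q t) \<omega>) \<in> M \<rightarrow>\<^sub>M Pi\<^sub>M {1..n} (\<lambda>_. borel)"
      using q by (intro measurable_restrict w_measurable) (simp only: permutes_in_image)
    then have "distr (distr M (Pi\<^sub>M {1..n} (\<lambda>_. borel)) (\<lambda>\<omega>. \<lambda>t\<in>{1..n}. w n (q t) \<omega>)) (Pi\<^sub>M {1..n} (\<lambda>_. borel)) g =
        distr M (Pi\<^sub>M {1..n} (\<lambda>_. borel)) (g \<circ> (\<lambda>\<omega>. \<lambda>t\<in>{1..n}. w n (q t) \<omega>))"
      by (rule distr_distr[OF g])
    moreover have "g \<circ> (\<lambda>\<omega>. \<lambda>t\<in>{1..n}. w n (q t) \<omega>) = (\<lambda>\<omega>. \<lambda>t\<in>{1..n}. (w n (q t) \<omega> - a) / b)"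
      by (auto simp: g_def fun_eq_iff)
    ultimately show ?thesis
      by simp
  qed
  have "distr M (Pi\<^sub>M {1..n} (\<lambda>_. borel)) (\<lambda>\<omega>. \<lambda>t\<in>{1..n}. w n (p t) \<omega>) =
      distr M (Pi\<^sub>M {1..n} (\<lambda>_. borel)) (\<lambda>\<omega>. \<lambda>t\<in>{1..n}. w n t \<omega>)"
    using exch p unfolding row_exchangeable_def by blast
  then show "distr M (Pi\<^sub>M {1..n} (\<lambda>_. borel)) (\<lambda>\<omega>. \<lambda>t\<in>{1..n}. (w n (p t) \<omega> - a) / b) =
      distr M (Pi\<^sub>M {1..n} (\<lambda>_. borel)) (\<lambda>\<omega>. \<lambda>t\<in>{1..n}. (w n t \<omega> - a) / b)"
    using distr_g[OF p] distr_g[OF permutes_id] by simp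
qed

theorem theorem3:
  fixes M :: "'a measure"
    and X Z :: "int \<Rightarrow> 'a \<Rightarrow> real"
    and \<theta>\<^sub>0 \<sigma> k :: real
    and f :: "real \<Rightarrow> real"
    and w :: "nat \<Rightarrow> nat \<Rightarrow> 'a \<Rightarrow> real"
    and \<theta>hat \<theta>star :: "nat \<Rightarrow> 'a \<Rightarrow> real"
    and \<kappa> :: "nat \<Rightarrow> 'a \<Rightarrow> real measure"
  assumes "prob_space M"
    \<comment> \<open>the AR(1) model\<close>
    and X_meas: "\<And>t. X t \<in> borel_measurable M"
    and X_stationary: "strictly_stationary M X"
    and AR1: "\<And>t. AE \<omega> in M. X t \<omega> = \<theta>\<^sub>0 * X (t - 1) \<omega> + Z t \<omega>"
    and \<theta>\<^sub>0: "\<bar>\<theta>\<^sub>0\<bar> < 1"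
    and Z_iid: "iid M Z"
    and Z_median: "\<And>t. is_median M (Z t) 0"
    and Z_variance: "\<And>t. prob_space.variance M (Z t) = \<sigma>\<^sup>2"
    and Z_moment4: "\<And>t. integrable M (\<lambda>\<omega>. (Z t \<omega>) ^ 4)"
    \<comment> \<open>\<open>f\<close> is the density of \<open>Z t\<close>; its value at \<open>0\<close> is the derivative of the distribution function\<close>
    and f_nonneg: "\<And>x. 0 \<le> f x"
    and Z_density: "\<And>t. distributed M lborel (Z t) (\<lambda>x. ennreal (f x))"
    and f_at_0: "\<And>t. (cdf (distr M borel (Z t)) has_real_derivative f 0) (at 0)"
    and f_pos: "f 0 > 0"
    \<comment> \<open>the bootstrap weights\<close>
    and w_meas: "\<And>n t. 1 \<le> t \<Longrightarrow> t \<le> n \<Longrightarrow> w n t \<in> borel_measurable M"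
    and w_exch: "row_exchangeable M w"
    and w_indep: "array_indep_of_process M w X"
    and A1: "\<And>n. n \<ge> 1 \<Longrightarrow> prob_space.expectation M (w n 1) = 1"
    and A2: "0 < k" "\<And>n. n \<ge> 1 \<Longrightarrow> k < (weight_sd M w n)\<^sup>2"
            "(\<lambda>n. (weight_sd M w n)\<^sup>2) \<in> o(\<lambda>n. real n)"
    and A3: "(\<lambda>n. covariance M (w n 1) (w n 2)) \<in> O(\<lambda>n. 1 / real n)"
    and A4: "\<And>n j. 1 \<le> j \<Longrightarrow> j \<le> n \<Longrightarrow> prob_space.expectation M (std_weight M w n j) = 0"
            "\<And>n j. 1 \<le> j \<Longrightarrow> j \<le> n \<Longrightarrow>
               prob_space.expectation M (\<lambda>\<omega>. (std_weight M w n j \<omega>)\<^sup>2) = 1"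
            "conv_in_prob M (\<lambda>n \<omega>. (1 / real n) * (\<Sum>j=1..n. (std_weight M w n j \<omega>)\<^sup>2)) 1"
            "\<And>j. 1 \<le> j \<Longrightarrow>
               ((\<lambda>K::real. limsup (\<lambda>n. ereal (sqrt (prob_space.expectation M
                   (\<lambda>\<omega>. (std_weight M w n j \<omega>)\<^sup>2 * indicator {\<omega>. \<bar>std_weight M w n j \<omega>\<bar> > K} \<omega>)))))
                 \<longlongrightarrow> 0) at_top"
    and max_X: "conv_in_prob M
                  (\<lambda>n \<omega>. weight_sd M w n / sqrt (real n) * (MAX t\<in>{1..int n}. \<bar>X t \<omega>\<bar>)) 0"
    \<comment> \<open>the estimators\<close>
    and \<theta>hat_meas: "\<And>n. \<theta>hat n \<in> borel_measurable M"
    and \<theta>hat: "\<And>n. AE \<omega> in M.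
          is_arg_min (\<lambda>\<theta>. (1 / real n) * (\<Sum>t=2..n. \<bar>X (int t) \<omega> - \<theta> * X (int t - 1) \<omega>\<bar>))
            (\<lambda>_. True) (\<theta>hat n \<omega>)"
    and \<theta>star_meas: "\<And>n. \<theta>star n \<in> borel_measurable M"
    and \<theta>star: "\<And>n. AE \<omega> in M.
          is_arg_min (\<lambda>\<theta>. \<Sum>t=2..n. w n t \<omega> * \<bar>X (int t) \<omega> - \<theta> * X (int t - 1) \<omega>\<bar>)
            (\<lambda>_. True) (\<theta>star n \<omega>)"
    \<comment> \<open>\<open>\<kappa> n\<close> is the conditional law of the bootstrap statistic given \<open>X\<^sub>1, \<dots>, X\<^sub>n\<close>\<close>
    and \<kappa>: "\<And>n. regular_cond_distr M (obs_algebra M X n)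
          (\<lambda>\<omega>. sqrt (real n) / weight_sd M w n * (\<theta>star n \<omega> - \<theta>hat n \<omega>)) (\<kappa> n)"
  shows "conv_in_prob M
           (\<lambda>n \<omega>. SUP x::real. \<bar>measure (\<kappa> n \<omega>) {..x}
              - cdf (density lborel (normal_density 0
                  (sqrt (1 / (4 * (f 0)\<^sup>2 * prob_space.expectation M (\<lambda>\<omega>. (X 0 \<omega>)\<^sup>2)))))) x\<bar>) 0"
proof -
  interpret prob_space M
    by fact
  interpret lad_ar1 M X Z \<theta>\<^sub>0 f
    by unfold_locales (use assms in auto)
  define sd where "sd = weight_sd M w"
  define W where "W = std_weight M w"
  have k: "k < (sd n)\<^sup>2" "sd n > 0" "sqrt k < sd n" if "1 \<le> n" for n
  proof -
    show "k < (sd n)\<^sup>2"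
      using A2(2)[OF that] by (simp add: sd_def)
    moreover have "sd n \<ge> 0"
      by (simp add: sd_def weight_sd_def)
    ultimately show "sqrt k < sd n"
      using \<open>0 < k\<close> by (intro real_less_lsqrt) auto
    then show "sd n > 0"
      using \<open>0 < k\<close> real_sqrt_gt_zero[of k] by linarith
  qed
  have W_eq: "W n t \<omega> = (w n t \<omega> - 1) / sd n" for n t \<omega>
    by (simp add: W_def std_weight_def sd_def)
  have w_eq: "w n t \<omega> = 1 + sd n * W n t \<omega>" if "1 \<le> n" for n t \<omega>
    using k[OF that] by (simp add: W_eq)
  have W_meas: "W n j \<in> borel_measurable M" if "j \<in> {1..n}" for n j
    unfolding W_eq[abs_def] using w_meas[of j n] that by simp
  have W_sq: "expectation (\<lambda>\<omega>. (W n j \<omega>)\<^sup>2) = 1" "integrable M (\<lambda>\<omega>. (W n j \<omega>)\<^sup>2)" if "j \<in> {1..n}" for n j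
  proof -
    show "expectation (\<lambda>\<omega>. (W n j \<omega>)\<^sup>2) = 1"
      using A4(2)[of j n] that by (simp add: W_def)
    \<comment> \<open>A non-integrable square would have integral 0 by convention, not 1.\<close>
    then show "integrable M (\<lambda>\<omega>. (W n j \<omega>)\<^sup>2)"
      using not_integrable_integral_eq by fastforce
  qed
  have W_row: "exchangeable_row M n (W n)" if "2 \<le> n" for n
  proof -
    have "W n = (\<lambda>t \<omega>. (w n t \<omega> - 1) / sd n)"
      by (simp add: fun_eq_iff W_eq)
    then show ?thesis
      using exchangeable_row_affine[OF w_exch that, of 1 "sd n"] w_meas by simp
  qed
  \<comment> \<open>The averages are nonnegative with mean 1, so their convergence in probability
    improves to convergence in mean, the form needed for \<open>\<eta>\<close> in the Gaussian
    approximation.\<close>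
  have row_average: "(\<lambda>n. expectation (\<lambda>\<omega>. \<bar>(1 / real n) * (\<Sum>j=1..n. (W n j \<omega>)\<^sup>2) - 1\<bar>)) \<longlonglongrightarrow> 0"
  proof (rule conv_in_prob_imp_L1)
    show "conv_in_prob M (\<lambda>n \<omega>. (1 / real n) * (\<Sum>j=1..n. (W n j \<omega>)\<^sup>2)) 1"
      unfolding W_def by (rule A4(3))
    fix n :: nat
    assume n: "1 \<le> n"
    show "integrable M (\<lambda>\<omega>. (1 / real n) * (\<Sum>j=1..n. (W n j \<omega>)\<^sup>2))"
      by (intro integrable_mult_right Bochner_Integration.integrable_sum W_sq)
    have "expectation (\<lambda>\<omega>. \<Sum>j=1..n. (W n j \<omega>)\<^sup>2) = (\<Sum>j=1..n. 1)"
      by (subst Bochner_Integration.integral_sum) (auto intro!: sum.cong simp: W_sq)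
    then show "expectation (\<lambda>\<omega>. (1 / real n) * (\<Sum>j=1..n. (W n j \<omega>)\<^sup>2)) = 1"
      using n by simp
  qed (simp add: sum_nonneg)
  have row_tail: "\<exists>K\<ge>0. \<forall>\<^sub>F n in sequentially. expectation (\<lambda>\<omega>. (W n 1 \<omega>)\<^sup>2 * of_bool (\<bar>W n 1 \<omega>\<bar> > K)) \<le> \<epsilon>"
    if "\<epsilon> > 0" for \<epsilon>
  proof -
    \<comment> \<open>The tail condition concerns square roots; comparison with
      \<open>sqrt \<epsilon>\<close> yields one level \<open>K\<close> that works for all large
      rows.\<close>
    have "ereal (sqrt \<epsilon>) > 0"
      using that by simp
    then have "\<forall>\<^sub>F K in at_top. limsup (\<lambda>n. ereal (sqrt (expectation
        (\<lambda>\<omega>. (std_weight M w n 1 \<omega>)\<^sup>2 * indicator {\<omega>. \<bar>std_weight M w n 1 \<omega>\<bar> > K} \<omega>)))) < ereal (sqrt \<epsilon>)"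
      by (intro order_tendstoD(2)[OF A4(4)]) simp_all
    then have "\<forall>\<^sub>F K in at_top. K \<ge> 0 \<and> limsup (\<lambda>n. ereal (sqrt (expectation
        (\<lambda>\<omega>. (std_weight M w n 1 \<omega>)\<^sup>2 * indicator {\<omega>. \<bar>std_weight M w n 1 \<omega>\<bar> > K} \<omega>)))) < ereal (sqrt \<epsilon>)"
      using eventually_ge_at_top[of "0::real"] by eventually_elim simp
    then obtain K where K: "K \<ge> 0" "limsup (\<lambda>n. ereal (sqrt (expectation
        (\<lambda>\<omega>. (std_weight M w n 1 \<omega>)\<^sup>2 * indicator {\<omega>. \<bar>std_weight M w n 1 \<omega>\<bar> > K} \<omega>)))) < ereal (sqrt \<epsilon>)"
      by (auto simp: eventually_at_top_linorder)
    have "\<forall>\<^sub>F n in sequentially. ereal (sqrt (expectation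
        (\<lambda>\<omega>. (std_weight M w n 1 \<omega>)\<^sup>2 * indicator {\<omega>. \<bar>std_weight M w n 1 \<omega>\<bar> > K} \<omega>))) < ereal (sqrt \<epsilon>)"
      using Limsup_lessD[OF K(2)] .
    then have "\<forall>\<^sub>F n in sequentially. expectation (\<lambda>\<omega>. (W n 1 \<omega>)\<^sup>2 * of_bool (\<bar>W n 1 \<omega>\<bar> > K)) \<le> \<epsilon>"
      by eventually_elim (simp add: W_def indicator_def)
    then show ?thesis
      using K(1) by blast
  qed
  obtain c where c: "c > 0" "\<forall>\<^sub>F n in sequentially. norm (covariance M (w n 1) (w n 2)) \<le> c * norm (1 / real n)"
    using A3 by (rule landau_o.bigE)
  \<comment> \<open>The second moment of a linear form is at most
    \<open>1 + \<bar>\<gamma>\<bar> + n * \<bar>\<gamma>\<bar>\<close> times the sum of squares, and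
    \<open>c / k\<close> bounds both \<open>\<bar>\<gamma>\<bar>\<close> and
    \<open>n * \<bar>\<gamma>\<bar>\<close>.\<close>
  define G where "G = 1 + 2 * c / k"
  have row_linear: "\<forall>\<^sub>F n in sequentially. \<forall>e. expectation (\<lambda>\<omega>. (\<Sum>j=1..n. e j * W n j \<omega>)\<^sup>2) \<le> G * (\<Sum>j=1..n. (e j)\<^sup>2)"
    using c(2) eventually_ge_at_top[of 2]
  proof eventually_elim
    case (elim n)
    have n: "1 \<le> n" "real n \<ge> 1"
      using elim(2) by simp_all
    interpret exchangeable_row M n "W n"
      by (rule W_row[OF elim(2)])
    define \<gamma> where "\<gamma> = expectation (\<lambda>\<omega>. W n 1 \<omega> * W n 2 \<omega>)"
    have mean: "expectation (w n j) = 1" if "j \<in> {1..n}" for j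
    proof -
      have "integrable M (W n j)"
        by (rule integrable_of_square[OF W_meas[OF that] W_sq(2)[OF that]])
      moreover have "expectation (W n j) = 0"
        using A4(1)[of j n] that by (simp add: W_def)
      moreover have "w n j = (\<lambda>\<omega>. 1 + sd n * W n j \<omega>)"
        using w_eq[OF n(1)] by (simp add: fun_eq_iff)
      ultimately show ?thesis
        by (simp add: prob_space)
    qed
    have cov: "covariance M (w n 1) (w n 2) = (sd n)\<^sup>2 * \<gamma>"
    proof -
      have "covariance M (w n 1) (w n 2) = expectation (\<lambda>\<omega>. (sd n)\<^sup>2 * (W n 1 \<omega> * W n 2 \<omega>))"
        unfolding covariance_def using mean[of 1] mean[of 2] elim(2) w_eq[OF n(1)]
        by (intro Bochner_Integration.integral_cong) (auto simp: power2_eq_square)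
      then show ?thesis
        by (simp add: \<gamma>_def)
    qed
    \<comment> \<open>The covariance bound is for the raw weights; the lower bound \<open>k\<close>
      on their variance transfers it to the standardized ones.\<close>
    have "k * \<bar>\<gamma>\<bar> \<le> (sd n)\<^sup>2 * \<bar>\<gamma>\<bar>"
      using k(1)[OF n(1)] by (intro mult_right_mono) auto
    also have "\<dots> \<le> c * (1 / n)"
      using elim(1)[unfolded cov] by (simp add: abs_mult)
    finally have \<gamma>: "real n * \<bar>\<gamma>\<bar> \<le> c / k"
      using n \<open>0 < k\<close> by (simp add: field_simps)
    then have \<gamma>1: "\<bar>\<gamma>\<bar> \<le> c / k"
      using n(2) mult_right_mono[of 1 "real n" "\<bar>\<gamma>\<bar>"] by simp
    show ?case
    proof
      fix e :: "nat \<Rightarrow> real"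
      define Q where "Q = (\<Sum>j=1..n. (e j)\<^sup>2)"
      have "Q \<ge> 0"
        by (simp add: Q_def sum_nonneg)
      have cs: "(\<Sum>j=1..n. e j)\<^sup>2 \<le> n * Q"
        using Cauchy_Schwarz_ineq_sum[of "\<lambda>_. 1" e "{1..n}"] by (simp add: Q_def)
      have "expectation (\<lambda>\<omega>. (\<Sum>j=1..n. e j * W n j \<omega>)\<^sup>2) = (1 - \<gamma>) * Q + \<gamma> * (\<Sum>j=1..n. e j)\<^sup>2"
        using expectation_linear_square[of "\<lambda>x. x" e] W_sq[of 1 n] elim(2) by (simp add: \<gamma>_def Q_def)
      also have "\<dots> \<le> (1 + \<bar>\<gamma>\<bar>) * Q + \<bar>\<gamma>\<bar> * (n * Q)"
        using cs \<open>Q \<ge> 0\<close> by (intro add_mono mult_right_mono mult_mono) auto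
      also have "\<dots> = (1 + \<bar>\<gamma>\<bar> + n * \<bar>\<gamma>\<bar>) * Q"
        by (simp add: algebra_simps)
      also have "\<dots> \<le> G * Q"
        using \<gamma> \<gamma>1 \<open>Q \<ge> 0\<close> by (intro mult_right_mono) (auto simp: G_def)
      finally show "expectation (\<lambda>\<omega>. (\<Sum>j=1..n. e j * W n j \<omega>)\<^sup>2) \<le> G * (\<Sum>j=1..n. (e j)\<^sup>2)"
        by (simp add: Q_def)
    qed
  qed
  have indep: "indep_pair (Pi\<^sub>M {1..int n} (\<lambda>_. borel)) (\<lambda>\<omega>. \<lambda>t\<in>{1..int n}. X t \<omega>)
      (Pi\<^sub>M {1..n} (\<lambda>_. borel)) (\<lambda>\<omega>. \<lambda>j\<in>{1..n}. W n j \<omega>)" for n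
  proof -
    \<comment> \<open>The standardized row as a measurable function of the whole array, so that
      independence of the array passes to it.\<close>
    define g where "g = (\<lambda>y :: nat \<times> nat \<Rightarrow> real. \<lambda>j\<in>{1..n}. (y (n, j) - 1) / sd n)"
    have g: "g \<in> Pi\<^sub>M triangle (\<lambda>_. borel) \<rightarrow>\<^sub>M Pi\<^sub>M {1..n} (\<lambda>_. borel)"
      unfolding g_def
    proof (rule measurable_restrict)
      fix j
      assume "j \<in> {1..n}"
      then have "(n, j) \<in> triangle"
        by (simp add: triangle_def)
      then have [measurable]: "(\<lambda>y. y (n, j)) \<in> borel_measurable (Pi\<^sub>M triangle (\<lambda>_. borel))"
        by (rule measurable_component_singleton)
      show "(\<lambda>y. (y (n, j) - 1) / sd n) \<in> borel_measurable (Pi\<^sub>M triangle (\<lambda>_. borel))"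
        by measurable
    qed
    have "(\<lambda>x. restrict x {1..int n}) \<in> Pi\<^sub>M UNIV (\<lambda>_. borel) \<rightarrow>\<^sub>M Pi\<^sub>M {1..int n} (\<lambda>_. borel)"
      by (rule measurable_restrict_subset) simp
    from indep_pair_compose[OF array_indep_imp_indep_pair[OF w_meas X_meas w_indep] this g]
    have "indep_pair (Pi\<^sub>M {1..int n} (\<lambda>_. borel)) (\<lambda>\<omega>. restrict (\<lambda>t. X t \<omega>) {1..int n})
      (Pi\<^sub>M {1..n} (\<lambda>_. borel)) (\<lambda>\<omega>. g (\<lambda>(n, t)\<in>triangle. w n t \<omega>))" .
    moreover have "g (\<lambda>(n, t)\<in>triangle. w n t \<omega>) = (\<lambda>j\<in>{1..n}. W n j \<omega>)" for \<omega>
      by (auto simp: g_def W_eq triangle_def fun_eq_iff)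
    ultimately show ?thesis
      by simp
  qed
  have sd_small: "(\<lambda>n. sd n / sqrt n) \<longlonglongrightarrow> 0"
  proof -
    have "(\<lambda>n. (sd n)\<^sup>2 / real n) \<longlonglongrightarrow> 0"
      using A2(3) by (simp add: sd_def smalloD_tendsto)
    then have "(\<lambda>n. sqrt ((sd n)\<^sup>2 / real n)) \<longlonglongrightarrow> sqrt 0"
      by (rule tendsto_real_sqrt)
    moreover have "sqrt ((sd n)\<^sup>2 / real n) = sd n / sqrt n" for n
      by (simp add: real_sqrt_divide sd_def weight_sd_def)
    ultimately show ?thesis
      by simp
  qed
  interpret exchangeable_array M W G
  proof (intro exchangeable_array.intro exchangeable_array_axioms.intro)
    show "prob_space M"
      by fact
    show "exchangeable_row M n (W n)" if "2 \<le> n" for n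
      by (rule W_row[OF that])
    show "W n j \<in> borel_measurable M" if "j \<in> {1..n}" for n j
      by (rule W_meas[OF that])
    show "expectation (\<lambda>\<omega>. (W n 1 \<omega>)\<^sup>2) = 1" if "2 \<le> n" for n
      by (rule W_sq(1)) (use that in simp)
  qed (fact row_average row_tail row_linear)+
  interpret bootstrap_scale M X Z \<theta>\<^sub>0 f W G sd "sqrt k"
  proof unfold_locales
    show "0 < sqrt k"
      using \<open>0 < k\<close> by simp
    show "sqrt k \<le> sd n" if "1 \<le> n" for n
      using k(3)[OF that] by simp
  qed (fact indep sd_small)+

  define T where "T = (\<lambda>n \<omega>. sqrt (real n) / sd n * (\<theta>star n \<omega> - \<theta>hat n \<omega>))"
  have arg_min_le: "g a \<le> g b" if "is_arg_min g (\<lambda>_. True) a" for g :: "real \<Rightarrow> real" and a b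
    using that by (auto simp: is_arg_min_def not_less)
  \<comment> \<open>Recentring at the true parameter: \<open>\<theta> - \<theta>\<^sub>0\<close>
    plays the part of the shift \<open>\<delta>\<close>.\<close>
  have resid: "X (int t) \<omega> - \<theta> * X (int t - 1) \<omega> = innov (int t) \<omega> - (\<theta> - \<theta>\<^sub>0) * X (int t - 1) \<omega>" for t \<theta> \<omega>
    by (simp add: innov_def algebra_simps)
  \<comment> \<open>The case \<open>b = 0\<close>. The factor \<open>sqrt n / sd n\<close> is the
    normalization of the bootstrap statistic, so this expansion can be subtracted from the next one
    term by term.\<close>
  have hat: "conv_in_prob M (\<lambda>n \<omega>. sqrt n / sd n * (\<theta>hat n \<omega> - \<theta>\<^sub>0) - score n 0 \<omega> / (2 * \<mu> * (sd n * sqrt n))) 0"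
  proof (rule estimator_expansion)
    show "0 \<le> (0::real) \<and> 0 \<le> sd n" if "1 \<le> n" for n
      using k(2)[OF that] by simp
    fix n :: nat
    assume n: "1 \<le> n"
    show "AE \<omega> in M. \<forall>\<delta>. (\<Sum>t=2..n. (1 + 0 * W n t \<omega>) * \<bar>innov (int t) \<omega> - (\<theta>hat n \<omega> - \<theta>\<^sub>0) * X (int t - 1) \<omega>\<bar>) \<le>
      (\<Sum>t=2..n. (1 + 0 * W n t \<omega>) * \<bar>innov (int t) \<omega> - \<delta> * X (int t - 1) \<omega>\<bar>)"
      using \<theta>hat[of n]
    proof eventually_elim
      case (elim \<omega>)
      show ?case
      proof
        fix \<delta>
        have "(1 / real n) * (\<Sum>t=2..n. \<bar>X (int t) \<omega> - \<theta>hat n \<omega> * X (int t - 1) \<omega>\<bar>) \<le>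
            (1 / real n) * (\<Sum>t=2..n. \<bar>X (int t) \<omega> - (\<theta>\<^sub>0 + \<delta>) * X (int t - 1) \<omega>\<bar>)"
          using arg_min_le[OF elim, of "\<theta>\<^sub>0 + \<delta>"] .
        then have "(\<Sum>t=2..n. \<bar>X (int t) \<omega> - \<theta>hat n \<omega> * X (int t - 1) \<omega>\<bar>) \<le>
            (\<Sum>t=2..n. \<bar>X (int t) \<omega> - (\<theta>\<^sub>0 + \<delta>) * X (int t - 1) \<omega>\<bar>)"
          using n by (simp add: divide_le_cancel)
        then show "(\<Sum>t=2..n. (1 + 0 * W n t \<omega>) * \<bar>innov (int t) \<omega> - (\<theta>hat n \<omega> - \<theta>\<^sub>0) * X (int t - 1) \<omega>\<bar>) \<le>
          (\<Sum>t=2..n. (1 + 0 * W n t \<omega>) * \<bar>innov (int t) \<omega> - \<delta> * X (int t - 1) \<omega>\<bar>)"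
          unfolding resid by simp
      qed
    qed
  qed
  \<comment> \<open>The case \<open>b = sd n\<close>, where \<open>1 + sd n * W n t\<close> is the
    original weight.\<close>
  have star: "conv_in_prob M (\<lambda>n \<omega>. sqrt n / sd n * (\<theta>star n \<omega> - \<theta>\<^sub>0) - score n (sd n) \<omega> / (2 * \<mu> * (sd n * sqrt n))) 0"
  proof (rule estimator_expansion)
    show "0 \<le> sd n \<and> sd n \<le> sd n" if "1 \<le> n" for n
      using k(2)[OF that] by simp
    fix n :: nat
    assume n: "1 \<le> n"
    show "AE \<omega> in M. \<forall>\<delta>. (\<Sum>t=2..n. (1 + sd n * W n t \<omega>) * \<bar>innov (int t) \<omega> - (\<theta>star n \<omega> - \<theta>\<^sub>0) * X (int t - 1) \<omega>\<bar>) \<le>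
      (\<Sum>t=2..n. (1 + sd n * W n t \<omega>) * \<bar>innov (int t) \<omega> - \<delta> * X (int t - 1) \<omega>\<bar>)"
      using \<theta>star[of n]
    proof eventually_elim
      case (elim \<omega>)
      show ?case
      proof
        fix \<delta>
        have "(\<Sum>t=2..n. w n t \<omega> * \<bar>X (int t) \<omega> - \<theta>star n \<omega> * X (int t - 1) \<omega>\<bar>) \<le>
            (\<Sum>t=2..n. w n t \<omega> * \<bar>X (int t) \<omega> - (\<theta>\<^sub>0 + \<delta>) * X (int t - 1) \<omega>\<bar>)"
          using arg_min_le[OF elim, of "\<theta>\<^sub>0 + \<delta>"] .
        then show "(\<Sum>t=2..n. (1 + sd n * W n t \<omega>) * \<bar>innov (int t) \<omega> - (\<theta>star n \<omega> - \<theta>\<^sub>0) * X (int t - 1) \<omega>\<bar>) \<le>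
          (\<Sum>t=2..n. (1 + sd n * W n t \<omega>) * \<bar>innov (int t) \<omega> - \<delta> * X (int t - 1) \<omega>\<bar>)"
          unfolding resid w_eq[OF n] by simp
      qed
    qed
  qed
  have diff: "conv_in_prob M (\<lambda>n \<omega>. (sqrt n / sd n * (\<theta>star n \<omega> - \<theta>\<^sub>0) - score n (sd n) \<omega> / (2 * \<mu> * (sd n * sqrt n))) -
      (sqrt n / sd n * (\<theta>hat n \<omega> - \<theta>\<^sub>0) - score n 0 \<omega> / (2 * \<mu> * (sd n * sqrt n)))) 0"
    by (intro conv_in_prob_diff[OF _ _ star hat] borel_measurable_diff borel_measurable_times borel_measurable_divide
        borel_measurable_const score_measurable \<theta>hat_meas \<theta>star_meas)
  have T: "conv_in_prob M (\<lambda>n \<omega>. T n \<omega> - lin_stat n \<omega>) 0"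
    unfolding conv_in_prob_def
  proof (intro allI impI)
    fix e :: real
    assume "e > 0"
    have eq: "T n \<omega> - lin_stat n \<omega> =
        (sqrt n / sd n * (\<theta>star n \<omega> - \<theta>\<^sub>0) - score n (sd n) \<omega> / (2 * \<mu> * (sd n * sqrt n))) -
        (sqrt n / sd n * (\<theta>hat n \<omega> - \<theta>\<^sub>0) - score n 0 \<omega> / (2 * \<mu> * (sd n * sqrt n)))" if n: "2 \<le> n" for n \<omega>
    proof -
      define d where "d = 2 * \<mu> * (sd n * sqrt n)"
      have "d \<noteq> 0"
        using \<mu>_pos k(2)[of n] n by (simp add: d_def)
      have "score n (sd n) \<omega> - score n 0 \<omega> = d * lin_stat n \<omega>"
        using lin_stat_eq_score[OF n, of "sd n" \<omega>] by (simp add: d_def mult_ac)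
      then have "lin_stat n \<omega> = score n (sd n) \<omega> / d - score n 0 \<omega> / d"
        using \<open>d \<noteq> 0\<close> by (simp add: diff_divide_distrib[symmetric])
      moreover have "T n \<omega> = sqrt n / sd n * (\<theta>star n \<omega> - \<theta>\<^sub>0) - sqrt n / sd n * (\<theta>hat n \<omega> - \<theta>\<^sub>0)"
        unfolding T_def right_diff_distrib[symmetric] by simp
      ultimately show ?thesis
        unfolding d_def[symmetric] by simp
    qed
    have "(\<lambda>n. prob {\<omega> \<in> space M. \<bar>(sqrt n / sd n * (\<theta>star n \<omega> - \<theta>\<^sub>0) - score n (sd n) \<omega> / (2 * \<mu> * (sd n * sqrt n))) -
        (sqrt n / sd n * (\<theta>hat n \<omega> - \<theta>\<^sub>0) - score n 0 \<omega> / (2 * \<mu> * (sd n * sqrt n))) - 0\<bar> > e}) \<longlonglongrightarrow> 0"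
      using diff \<open>e > 0\<close> unfolding conv_in_prob_def by blast
    moreover have "\<forall>\<^sub>F n in sequentially. prob {\<omega> \<in> space M. \<bar>(sqrt n / sd n * (\<theta>star n \<omega> - \<theta>\<^sub>0) - score n (sd n) \<omega> / (2 * \<mu> * (sd n * sqrt n))) -
        (sqrt n / sd n * (\<theta>hat n \<omega> - \<theta>\<^sub>0) - score n 0 \<omega> / (2 * \<mu> * (sd n * sqrt n))) - 0\<bar> > e} =
        prob {\<omega> \<in> space M. \<bar>T n \<omega> - lin_stat n \<omega> - 0\<bar> > e}"
      using eventually_ge_at_top[of 2] by eventually_elim (simp only: eq)
    ultimately show "(\<lambda>n. prob {\<omega> \<in> space M. \<bar>T n \<omega> - lin_stat n \<omega> - 0\<bar> > e}) \<longlonglongrightarrow> 0"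
      by (rule Lim_transform_eventually)
  qed
  have "conv_in_prob M (\<lambda>n \<omega>. SUP x. \<bar>measure (\<kappa> n \<omega>) {..x} - limit_cdf x\<bar>) 0"
  proof (rule cond_law_uniform_limit[OF _ _ T])
    show "conv_in_prob M (\<lambda>n \<omega>. sd n / sqrt (real n) * (MAX t\<in>{1..int n}. \<bar>X t \<omega>\<bar>)) 0"
      unfolding sd_def by (rule max_X)
    show "T n \<in> borel_measurable M" for n
      unfolding T_def using \<theta>hat_meas[of n] \<theta>star_meas[of n] by measurable
    show "regular_cond_distr M (obs_algebra M X n) (T n) (\<kappa> n)" for n
      unfolding T_def sd_def by (rule \<kappa>)
  qed
  then show ?thesis
    unfolding limit_cdf_def V_def .
qed

end
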